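(* For any $\lambda>0$, the hierarchical $\Phi^4_3$ measure and the (three-dimensional) hierarchical GFF measure are mutually singular: $$\mathbb P^{\Phi^4_3}_\lambda\perp\mathbb P^{GFF}.$$
   Context: Fix an integer $L\ge2$, dimension $d=3$. Let $\Lambda_n=\{x\in\mathbb Z^3:0\le x_i<L^n\}$, $[\cdot]$ the componentwise integer part. $\Omega$ is the product space of families $(z^{(n)}_x)_{n\ge0,x\in\Lambda_n}$ of reals; $\mathcal F_n$ is generated by $(z^{(k)}_x)_{0\le k\le n,\,x\in\Lambda_k}$. $\mathbb P^{GFF}$ is the probability measure on $\Omega$ under which the fields $z^{(n)}$, $n\ge 0$, are independent centred Gaussian, $z^{(0)}_0\sim\mathcal N(0,1)$, and for $n\ge1$, $\mathbb E[z^{(n)}_xz^{(n)}_y]=\delta_{xy}-L^{-3}\delta_{[x/L],[y/L]}$. The (infrared) field is $\phi^n(x)=\sum_{m=0}^nL^{-m/2}z^{(n-m)}_{[x/L^m]}$, $x\in\Lambda_n$. Wick powers: let $G_{00}=(1-L^{-1})^{-1}(1-L^{-3})$ and $:\!\phi^m\!:\;=\frac{d^m}{dt^m}\big|_{t=0}e^{t\phi-\frac{t^2}2G_{00}}$. For $x,y\in\Lambda_1$ put $G_{xy}=L^{-1}G_{00}+\delta_{xy}-L^{-3}$, and let $\alpha_3=-48\sum_{y\in\Lambda_1,\,y\ne0}G_{0y}^3$; this is $L^{-2}$ times the coefficient of $:\!\phi'^2\!:$ in $-\frac12\mathrm{Var}_z\big(\sum_{x\in\Lambda_1}:\!(L^{-1/2}\phi'+z_x)^4\!:\big)$,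 where $(z_x)_{x\in\Lambda_1}$ is centred Gaussian with covariance $\delta_{xy}-L^{-3}$. Set $r(s)=\alpha_3s^2\log_Ls$ for $s>0$, $\lambda_N=L^{-N}\lambda$. $\mathbb P^{\Phi^4_3}_\lambda$ is the probability measure on $\Omega$ which is the limit in law as $N\to\infty$ (for the topology induced by finite-depth layers: for each fixed $n$, the law on $\mathcal F_n$ converges) of $$\frac1{Z^{(N)}}\exp\Big(-\sum_{x\in\Lambda_N}\big(\lambda_N:\!\phi^N(x)^4\!:+\,r(\lambda_N):\!\phi^N(x)^2\!:\big)\Big)d\mathbb P^{GFF}.$$ (Existence of this limit is part of the paper's construction.) *)

theory Defs
  imports "HOL-Probability.Probability"
begin

section \<open>The hierarchical lattice and the configuration space\<close>

type_synonym site = "int ^ 3"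

definition Lam :: "nat \<Rightarrow> nat \<Rightarrow> site set" where
  "Lam L n = {x. \<forall>i. 0 \<le> x $ i \<and> x $ i < int (L ^ n)}"

definition ipart :: "site \<Rightarrow> nat \<Rightarrow> site" where
  "ipart x k = (\<chi> i. x $ i div int k)"

type_synonym config = "nat \<times> site \<Rightarrow> real"

definition indices :: "nat \<Rightarrow> (nat \<times> site) set" where
  "indices L = (SIGMA n:UNIV. Lam L n)"

definition layers :: "nat \<Rightarrow> nat \<Rightarrow> (nat \<times> site) set" where
  "layers L n = (SIGMA k:{..n}. Lam L k)"

definition Omega :: "nat \<Rightarrow> config measure" where
  "Omega L = PiM (indices L) (\<lambda>_. borel)"

definition layer_field :: "nat \<Rightarrow> nat \<Rightarrow> config \<Rightarrow> site \<Rightarrow> real" where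
  "layer_field L n \<omega> = (\<lambda>x\<in>Lam L n. \<omega> (n, x))"

section \<open>The hierarchical Gaussian free field\<close>

text \<open>
  A centred Gaussian family indexed by \<open>A\<close> with (possibly degenerate) covariance \<open>C\<close>: every linear
  combination is a centred normal variable. The law \<open>N(0, \<sigma>\<^sup>2)\<close> is the image of the standard normal
  law under multiplication by \<open>\<sigma>\<close>, so that \<open>\<sigma> = 0\<close> gives the point mass at 0; this case occurs
  for the layers \<open>n \<ge> 1\<close>, which sum to zero over each block.
\<close>

definition centred_gaussian_family ::
  "'w measure \<Rightarrow> 'i set \<Rightarrow> ('i \<Rightarrow> 'w \<Rightarrow> real) \<Rightarrow> ('i \<Rightarrow> 'i \<Rightarrow> real) \<Rightarrow> bool" where
  "centred_gaussian_family M A X C \<longleftrightarrow>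
     (\<forall>x\<in>A. X x \<in> borel_measurable M) \<and>
     (\<forall>B c. finite B \<longrightarrow> B \<subseteq> A \<longrightarrow>
        (\<exists>\<sigma>. distr M borel (\<lambda>\<omega>. \<Sum>x\<in>B. c x * X x \<omega>)
             = distr std_normal_distribution borel (\<lambda>u. \<sigma> * u))) \<and>
     (\<forall>x\<in>A. \<forall>y\<in>A. (\<integral>\<omega>. X x \<omega> * X y \<omega> \<partial>M) = C x y)"

definition is_GFF :: "nat \<Rightarrow> config measure \<Rightarrow> bool" where
  "is_GFF L P \<longleftrightarrow>
     prob_space P \<and> sets P = sets (Omega L) \<and>
     prob_space.indep_vars P (\<lambda>n. PiM (Lam L n) (\<lambda>_. borel)) (layer_field L) UNIV \<and>
     distributed P lborel (\<lambda>\<omega>. \<omega> (0, 0)) std_normal_density \<and>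
     (\<forall>n\<ge>1. centred_gaussian_family P (Lam L n) (\<lambda>x \<omega>. \<omega> (n, x))
        (\<lambda>x y. of_bool (x = y) - of_bool (ipart x L = ipart y L) / real L ^ 3))"

definition phi :: "nat \<Rightarrow> nat \<Rightarrow> site \<Rightarrow> config \<Rightarrow> real" where
  "phi L n x \<omega> = (\<Sum>m\<le>n. real L powr (- real m / 2) * \<omega> (n - m, ipart x (L ^ m)))"

section \<open>Wick powers and the renormalised interaction\<close>

text \<open>
  \<open>G00\<close> is the limiting variance of \<open>phi\<close> at a point; it is used for Wick ordering at every scale.
\<close>

definition G00 :: "nat \<Rightarrow> real" where
  "G00 L = inverse (1 - 1 / real L) * (1 - 1 / real L ^ 3)"

definition wick :: "nat \<Rightarrow> nat \<Rightarrow> real \<Rightarrow> real" where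
  "wick L m u = (deriv ^^ m) (\<lambda>t. exp (t * u - t\<^sup>2 / 2 * G00 L)) 0"

definition Gcov :: "nat \<Rightarrow> site \<Rightarrow> site \<Rightarrow> real" where
  "Gcov L x y = G00 L / real L + of_bool (x = y) - 1 / real L ^ 3"

text \<open>
  \<open>alpha3 L\<close> is \<open>L\<close> to the power -2 times the coefficient of the second Wick power in
  \<open>- Var / 2\<close> of the block sum of fourth Wick powers, the variance being over one layer. The term
  \<open>y = 0\<close> drops out because the squared mean is subtracted.
\<close>

definition alpha3 :: "nat \<Rightarrow> real" where
  "alpha3 L = - 48 * (\<Sum>y\<in>Lam L 1 - {0}. Gcov L 0 y ^ 3)"

definition mass_ct :: "nat \<Rightarrow> real \<Rightarrow> real" where
  "mass_ct L s = alpha3 L * s\<^sup>2 * log (real L) s"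

definition lam_scaled :: "nat \<Rightarrow> real \<Rightarrow> nat \<Rightarrow> real" where
  "lam_scaled L lam N = lam / real L ^ N"

definition interaction :: "nat \<Rightarrow> real \<Rightarrow> nat \<Rightarrow> config \<Rightarrow> real" where
  "interaction L lam N \<omega> =
     (\<Sum>x\<in>Lam L N. lam_scaled L lam N * wick L 4 (phi L N x \<omega>)
                  + mass_ct L (lam_scaled L lam N) * wick L 2 (phi L N x \<omega>))"

definition partition_function :: "nat \<Rightarrow> real \<Rightarrow> config measure \<Rightarrow> nat \<Rightarrow> real" where
  "partition_function L lam P N = (\<integral>\<omega>. exp (- interaction L lam N \<omega>) \<partial>P)"

definition Phi43_cutoff :: "nat \<Rightarrow> real \<Rightarrow> config measure \<Rightarrow> nat \<Rightarrow> config measure" where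
  "Phi43_cutoff L lam P N =
     density P (\<lambda>\<omega>. ennreal (exp (- interaction L lam N \<omega>) / partition_function L lam P N))"

section \<open>The limit measure and mutual singularity\<close>

text \<open>
  Restriction to the sigma-algebra generated by the layers up to \<open>n\<close>, realised as the law of these
  finitely many real coordinates.
\<close>

definition layer_law :: "nat \<Rightarrow> nat \<Rightarrow> config measure \<Rightarrow> config measure" where
  "layer_law L n M = distr M (PiM (layers L n) (\<lambda>_. borel)) (\<lambda>\<omega>. restrict \<omega> (layers L n))"

text \<open>
  Weak convergence of measures on \<open>\<real>\<^sup>I\<close> (\<open>I\<close> finite), the carrier being the extensional functions
  on \<open>I\<close> with the product topology.
\<close>

definition weak_conv_fin ::
  "'i set \<Rightarrow> (nat \<Rightarrow> ('i \<Rightarrow> real) measure) \<Rightarrow> ('i \<Rightarrow> real) measure \<Rightarrow> bool" where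
  "weak_conv_fin I M M' \<longleftrightarrow>
     (\<forall>f. continuous_map (product_topology (\<lambda>_. euclideanreal) I) euclideanreal f \<longrightarrow>
          bounded (f ` (\<Pi>\<^sub>E i\<in>I. UNIV)) \<longrightarrow>
          (\<lambda>N. \<integral>\<omega>. f \<omega> \<partial>M N) \<longlonglongrightarrow> (\<integral>\<omega>. f \<omega> \<partial>M'))"

definition is_Phi43 :: "nat \<Rightarrow> real \<Rightarrow> config measure \<Rightarrow> config measure \<Rightarrow> bool" where
  "is_Phi43 L lam P Q \<longleftrightarrow>
     prob_space Q \<and> sets Q = sets (Omega L) \<and>
     (\<forall>n. weak_conv_fin (layers L n)
            (\<lambda>N. layer_law L n (Phi43_cutoff L lam P N)) (layer_law L n Q))"

definition mutually_singular :: "'a measure \<Rightarrow> 'a measure \<Rightarrow> bool" where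
  "mutually_singular M N \<longleftrightarrow>
     sets M = sets N \<and> (\<exists>A\<in>sets M. emeasure M A = 0 \<and> emeasure N (space N - A) = 0)"

end

theory Submission
  imports Defs
begin

text \<open>
  Let \<open>s = \<lambda> L\<^sup>-\<^sup>n\<close> be the effective coupling of scale \<open>n\<close>. Under the GFF the
  increments of the field inside different blocks of one layer are independent, so integrating out
  the finest layer turns a product of single site weights into a product of single site weights.
  A weight \<open>g\<close> is followed through this map by means of \<open>u = - (ln g)'\<close>: up to an error
  \<open>O(s\<^sup>3)\<close> that contracts under rescaling, \<open>u\<close> stays the derivative of
  \<open>\<lambda>\<^sub>n :\<phi>\<^sup>4: + r\<^sub>n :\<phi>\<^sup>2:\<close> with \<open>\<lambda>\<^sub>n = s + O(s\<^sup>2)\<close>, and the counterterm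
  \<open>\<alpha>\<^sub>3 s\<^sup>2 log s\<close> keeps \<open>r\<^sub>n\<close> of order \<open>s\<^sup>2 log s\<close>. Both bounds are uniform in the cutoff.

  In the layer \<open>n + 1\<close>, the centred quartic \<open>F\<close> of the increments in one block has mean zero under
  the GFF, whereas under the \<open>\<Phi>\<^sup>4\<close> measure its conditional mean is \<open>- c s + O(s\<^sup>2)\<close> with \<open>c > 0\<close>,
  as long as the coarse field satisfies \<open>s \<phi>\<^sup>2 \<le> 1\<close>. Summed over the \<open>L\<^sup>3\<^sup>n\<close> blocks this is a
  drift of order \<open>s L\<^sup>3\<^sup>n\<close>, that is \<open>L\<^sup>2\<^sup>n\<close>, against fluctuations of order \<open>L\<^sup>3\<^sup>n\<^sup>/\<^sup>2\<close>.
  By Chebyshev's inequality a continuous test function of the layers up to \<open>n + 1\<close> separates the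
  two measures up to \<open>O(L\<^sup>-\<^sup>n)\<close>, and Borel--Cantelli gives singularity.
\<close>

section \<open>Gaussian families: characteristic functions, moments, independence\<close>

text \<open>Perturbation theory is available only while \<open>s * \<psi>\<^sup>2\<close> is
  bounded, yet integrating out a layer averages the weights over all field values. For large fields
  it is replaced by a quartic lower bound on the interaction and a correlation inequality, at the
  price of a weaker error. The scales explain which errors contract. With w = sqrt L a block has w^6
  sites and the rescaling of the argument contributes 1/w, so an error of \<open>u\<close> is
  multiplied by about w^5, while it is measured in units that grow by w^6 (the constant part) or at
  least w^7 (the field dependent part). The mass is multiplied by L^2 per step, exactly as s^2 is,
  so a source of order s^2 accumulates a logarithm; the function \<open>mass_ct\<close> solves this
  second order recursion exactly, and a deviation of order s^(5/2) is controlled because its unit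
  gains an extra factor sqrt L. The flow starts at the cutoff, where the weight has no error at all,
  and runs towards coarse scales; this is where uniformity in the cutoff comes from. The size of the
  drift comes from \<open>lh \<ge> s / 2\<close>.\<close>

lemma weighted_char_unique:
  fixes h Y :: "'a \<Rightarrow> real" and h' Y' :: "'b \<Rightarrow> real"
  assumes "prob_space M" "prob_space M'"
    and [measurable]: "h \<in> borel_measurable M" "Y \<in> borel_measurable M"
      "h' \<in> borel_measurable M'" "Y' \<in> borel_measurable M'"
    and h: "\<And>\<omega>. 0 \<le> h \<omega> \<and> h \<omega> \<le> 2" and h': "\<And>\<omega>. 0 \<le> h' \<omega> \<and> h' \<omega> \<le> 2"
    and eq: "\<And>u. (CLINT \<omega>|M. of_real (h \<omega>) * iexp (u * Y \<omega>))
               = (CLINT \<omega>|M'. of_real (h' \<omega>) * iexp (u * Y' \<omega>))"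
    and [measurable]: "A \<in> sets borel"
  shows "(\<integral>\<omega>. h \<omega> * indicator A (Y \<omega>) \<partial>M) = (\<integral>\<omega>. h' \<omega> * indicator A (Y' \<omega>) \<partial>M')"
proof -
  interpret M: prob_space M by fact
  interpret M': prob_space M' by fact
  have ih: "integrable M h" by (rule M.integrable_const_bound[of _ 2]) (use h in auto)
  have ih': "integrable M' h'" by (rule M'.integrable_const_bound[of _ 2]) (use h' in auto)
  have iA: "integrable M (\<lambda>\<omega>. h \<omega> * indicator A (Y \<omega>))"
    by (rule M.integrable_const_bound[of _ 2]) (use h in \<open>auto split: split_indicator\<close>)
  have iA': "integrable M' (\<lambda>\<omega>. h' \<omega> * indicator A (Y' \<omega>))"
    by (rule M'.integrable_const_bound[of _ 2]) (use h' in \<open>auto split: split_indicator\<close>)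
  define m where "m = integral\<^sup>L M h"
  \<comment> \<open>At u = 0 the hypothesis says that both weights have the same total mass.
    Dividing by it gives two probability laws on the line with equal characteristic functions; mass
    zero has to be treated apart.\<close>
  have m': "m = integral\<^sup>L M' h'"
    using eq[of 0] by (simp add: m_def)
  have m0: "m \<ge> 0" unfolding m_def by (rule Bochner_Integration.integral_nonneg) (use h in auto)
  show ?thesis
  proof (cases "m = 0")
    case True
    have "(\<integral>\<omega>. h \<omega> * indicator A (Y \<omega>) \<partial>M) \<le> m" unfolding m_def
      by (rule Bochner_Integration.integral_mono[OF iA ih]) (use h in \<open>auto split: split_indicator\<close>)
    moreover have "(\<integral>\<omega>. h \<omega> * indicator A (Y \<omega>) \<partial>M) \<ge> 0"
      by (rule Bochner_Integration.integral_nonneg) (use h in auto)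
    moreover have "(\<integral>\<omega>. h' \<omega> * indicator A (Y' \<omega>) \<partial>M') \<le> m" unfolding m'
      by (rule Bochner_Integration.integral_mono[OF iA' ih']) (use h' in \<open>auto split: split_indicator\<close>)
    moreover have "(\<integral>\<omega>. h' \<omega> * indicator A (Y' \<omega>) \<partial>M') \<ge> 0"
      by (rule Bochner_Integration.integral_nonneg) (use h' in auto)
    ultimately show ?thesis using True by linarith
  next
    case False
    with m0 have mp: "m > 0" by simp
    define N where "N = distr (density M (\<lambda>\<omega>. ennreal (h \<omega> / m))) borel Y"
    define N' where "N' = distr (density M' (\<lambda>\<omega>. ennreal (h' \<omega> / m))) borel Y'"
    have pd: "prob_space (density M (\<lambda>\<omega>. ennreal (h \<omega> / m)))"
      by (rule prob_spaceI, subst emeasure_density)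
         (use ih h mp in \<open>auto simp: nn_integral_eq_integral[OF integrable_divide] m_def[symmetric]\<close>)
    have pd': "prob_space (density M' (\<lambda>\<omega>. ennreal (h' \<omega> / m)))"
      by (rule prob_spaceI, subst emeasure_density)
         (use ih' h' mp in \<open>auto simp: nn_integral_eq_integral[OF integrable_divide] m'[symmetric]\<close>)
    have rd: "real_distribution N" unfolding N_def
      by (rule prob_space.real_distribution_distr[OF pd]) simp
    have rd': "real_distribution N'" unfolding N'_def
      by (rule prob_space.real_distribution_distr[OF pd']) simp
    have c: "char N u = (CLINT \<omega>|M. of_real (h \<omega>) * iexp (u * Y \<omega>)) / m" for u
    proof -
      have "char N u = (CLINT \<omega>|M. (h \<omega> / m) *\<^sub>R iexp (u * Y \<omega>))"
        unfolding char_def N_def by (subst integral_distr, simp, simp, subst integral_density) (use h mp in auto)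
      also have "\<dots> = (CLINT \<omega>|M. (of_real (h \<omega>) * iexp (u * Y \<omega>)) / of_real m)"
        by (intro Bochner_Integration.integral_cong) (auto simp: scaleR_conv_of_real)
      finally show ?thesis by simp
    qed
    have c': "char N' u = (CLINT \<omega>|M'. of_real (h' \<omega>) * iexp (u * Y' \<omega>)) / m" for u
    proof -
      have "char N' u = (CLINT \<omega>|M'. (h' \<omega> / m) *\<^sub>R iexp (u * Y' \<omega>))"
        unfolding char_def N'_def by (subst integral_distr, simp, simp, subst integral_density) (use h' mp in auto)
      also have "\<dots> = (CLINT \<omega>|M'. (of_real (h' \<omega>) * iexp (u * Y' \<omega>)) / of_real m)"
        by (intro Bochner_Integration.integral_cong) (auto simp: scaleR_conv_of_real)
      finally show ?thesis by simp
    qed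
    have "N = N'" by (rule Levy_uniqueness[OF rd rd'], rule ext) (simp only: c c' eq)
    then have "(\<integral>x. indicator A x \<partial>N) = (\<integral>x. indicator A x \<partial>N' :: real)" by simp
    moreover have "(\<integral>x. indicator A x \<partial>N :: real) = (\<integral>\<omega>. h \<omega> * indicator A (Y \<omega>) \<partial>M) / m"
      unfolding N_def by (subst integral_distr, simp, simp, subst integral_density) (use h mp in auto)
    moreover have "(\<integral>x. indicator A x \<partial>N' :: real) = (\<integral>\<omega>. h' \<omega> * indicator A (Y' \<omega>) \<partial>M') / m"
      unfolding N'_def by (subst integral_distr, simp, simp, subst integral_density) (use h' mp in auto)
    ultimately show ?thesis using mp by simp
  qed
qed

text \<open>
  One coordinate at a time, the factor \<open>iexp (t i * X i)\<close> is replaced by an arbitrary indicator; Levy's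
  uniqueness theorem is applied to \<open>X i\<close> under the measure weighted by the remaining factors, split
  into real and imaginary part and shifted to be nonnegative.
\<close>

lemma Cramer_Wold:
  fixes X :: "'i \<Rightarrow> 'a \<Rightarrow> real" and X' :: "'i \<Rightarrow> 'b \<Rightarrow> real"
  assumes M: "prob_space M" and M': "prob_space M'" and I: "finite I"
    and X: "\<And>i. i \<in> I \<Longrightarrow> X i \<in> borel_measurable M"
    and X': "\<And>i. i \<in> I \<Longrightarrow> X' i \<in> borel_measurable M'"
    and eq: "\<And>t. (CLINT \<omega>|M. iexp (\<Sum>i\<in>I. t i * X i \<omega>)) = (CLINT \<omega>|M'. iexp (\<Sum>i\<in>I. t i * X' i \<omega>))"
  shows "distr M (PiM I (\<lambda>_. borel)) (\<lambda>\<omega>. \<lambda>i\<in>I. X i \<omega>)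
       = distr M' (PiM I (\<lambda>_. borel)) (\<lambda>\<omega>. \<lambda>i\<in>I. X' i \<omega>)"
proof -
  interpret M: prob_space M by fact
  interpret M': prob_space M' by fact
  define ind where "ind J A \<omega> = (\<Prod>j\<in>J. indicator (A j) (X j \<omega>) :: real)" for J A \<omega>
  define ind' where "ind' J A \<omega> = (\<Prod>j\<in>J. indicator (A j) (X' j \<omega>) :: real)" for J A \<omega>
  have bnd: "0 \<le> ind J A \<omega> \<and> ind J A \<omega> \<le> 1" "0 \<le> ind' J A \<omega>' \<and> ind' J A \<omega>' \<le> 1" for J A \<omega> \<omega>'
    unfolding ind_def ind'_def by (auto intro!: prod_nonneg prod_le_1)
  have key: "(CLINT \<omega>|M. of_real (ind J A \<omega>) * iexp (\<Sum>i\<in>I-J. t i * X i \<omega>))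
     = (CLINT \<omega>|M'. of_real (ind' J A \<omega>) * iexp (\<Sum>i\<in>I-J. t i * X' i \<omega>))"
    if "J \<subseteq> I" "\<And>j. j \<in> J \<Longrightarrow> A j \<in> sets borel" for J A t
  proof -
    have "finite J" using that(1) I finite_subset by auto
    then show ?thesis using that
    proof (induction J arbitrary: t rule: finite_induct)
      case empty
      then show ?case using eq[of t] by (simp add: ind_def ind'_def)
    next
      case (insert k J)
      have k: "k \<in> I" and J: "J \<subseteq> I" using insert by auto
      have Ak[measurable]: "A k \<in> sets borel" using insert.prems by auto
      have m1[measurable]: "\<And>i. i \<in> I \<Longrightarrow> X i \<in> borel_measurable M" using X by auto
      have m2[measurable]: "\<And>i. i \<in> I \<Longrightarrow> X' i \<in> borel_measurable M'" using X' by auto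
      have [measurable]: "X k \<in> borel_measurable M" "X' k \<in> borel_measurable M'" using X X' k by auto
      have [measurable]: "ind J A \<in> borel_measurable M"
        unfolding ind_def using insert.prems J by (intro borel_measurable_prod) (auto intro!: measurable_compose[OF X])
      have [measurable]: "ind' J A \<in> borel_measurable M'"
        unfolding ind'_def using insert.prems J by (intro borel_measurable_prod) (auto intro!: measurable_compose[OF X'])
      define K where "K = I - insert k J"
      have IJ: "I - J = insert k K" "k \<notin> K" "finite K" "K \<subseteq> I"
        using k insert I by (auto simp: K_def)
      define S where "S t \<omega> = (\<Sum>i\<in>K. t i * X i \<omega>)" for t \<omega>
      define S' where "S' t \<omega> = (\<Sum>i\<in>K. t i * X' i \<omega>)" for t \<omega>
      have [measurable]: "S t \<in> borel_measurable M" for t unfolding S_def using IJ by (intro borel_measurable_sum) auto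
      have [measurable]: "S' t \<in> borel_measurable M'" for t unfolding S'_def using IJ by (intro borel_measurable_sum) auto
      \<comment> \<open>The coefficient of coordinate \<open>k\<close> is a free parameter u of the
        induction hypothesis, which thereby becomes an identity of characteristic functions of
        \<open>X k\<close> and \<open>X' k\<close>.\<close>
      have IH: "(CLINT \<omega>|M. of_real (ind J A \<omega>) * iexp (S t \<omega> + u * X k \<omega>))
              = (CLINT \<omega>|M'. of_real (ind' J A \<omega>) * iexp (S' t \<omega> + u * X' k \<omega>))" for t u
      proof -
        have e: "(\<Sum>i\<in>I - J. (t(k := u)) i * f i) = (\<Sum>i\<in>K. t i * f i) + u * f k" for f :: "'i \<Rightarrow> real"
        proof -
          have "(\<Sum>i\<in>K. (t(k := u)) i * f i) = (\<Sum>i\<in>K. t i * f i)"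
            by (rule sum.cong) (use IJ in auto)
          then show ?thesis using IJ by (simp add: add.commute)
        qed
        show ?thesis using insert.IH[of "t(k := u)"] J insert.prems(2)
          unfolding e S_def S'_def by auto
      qed
      have int: "complex_integrable M (\<lambda>\<omega>. of_real (ind J A \<omega>) * iexp (f \<omega>))"
        if "f \<in> borel_measurable M" for f
        using that bnd by (intro M.integrable_const_bound[of _ 1]) (auto simp: norm_mult)
      have int': "complex_integrable M' (\<lambda>\<omega>. of_real (ind' J A \<omega>) * iexp (f \<omega>))"
        if "f \<in> borel_measurable M'" for f
        using that bnd by (intro M'.integrable_const_bound[of _ 1]) (auto simp: norm_mult)
      have neg: "S (\<lambda>i. - t i) \<omega> = - S t \<omega>" "S' (\<lambda>i. - t i) \<omega>' = - S' t \<omega>'" for t \<omega> \<omega>'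
        by (auto simp: S_def S'_def sum_negf)
      have zero: "S (\<lambda>i. 0) \<omega> = 0" "S' (\<lambda>i. 0) \<omega>' = 0" for \<omega> \<omega>'
        by (auto simp: S_def S'_def)
      \<comment> \<open>Writing cosine and sine through exponentials reduces the nonnegative weights
        to the coefficient families 0, t and -t, for each of which the induction hypothesis is
        known.\<close>
      have cosid: "of_real (a * (1 + cos s)) * iexp x
          = of_real a * iexp (0 + x) + (of_real a * iexp (s + x) + of_real a * iexp (- s + x)) / 2"
        for a s x :: real
        by (simp add: cos_of_real[symmetric] cos_exp_eq exp_add distrib_left field_simps exp_minus flip: exp_of_real)
           (simp add: exp_add[symmetric] cos_exp_eq algebra_simps)
      have sinid: "of_real (a * (1 + sin s)) * iexp x
          = of_real a * iexp (0 + x) + (of_real a * iexp (s + x) - of_real a * iexp (- s + x)) / (2 * \<i>)"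
        for a s x :: real
      proof -
        have "complex_of_real (sin s) = (iexp s - iexp (- s)) / (2 * \<i>)"
          by (simp add: sin_of_real[symmetric] sin_exp_eq)
        moreover have "iexp (s + x) = iexp s * iexp x" "iexp (- s + x) = iexp (- s) * iexp x"
          by (simp_all add: exp_add[symmetric] algebra_simps)
        moreover have "a * (1 + (p - q) / (2 * \<i>)) * y = a * y + (a * (p * y) - a * (q * y)) / (2 * \<i>)"
          for a p q y :: complex by (simp add: field_simps)
        ultimately show ?thesis by (simp only: of_real_mult of_real_add of_real_1 add_0)
      qed
      have linc: "(CLINT \<omega>|N. f \<omega> + (g \<omega> + h \<omega>) / 2) = (CLINT \<omega>|N. f \<omega>) + ((CLINT \<omega>|N. g \<omega>) + (CLINT \<omega>|N. h \<omega>)) / 2"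
        if "complex_integrable N f" "complex_integrable N g" "complex_integrable N h" for N :: "'c measure" and f g h
        using that by simp
      have lins: "(CLINT \<omega>|N. f \<omega> + (g \<omega> - h \<omega>) / (2 * \<i>)) = (CLINT \<omega>|N. f \<omega>) + ((CLINT \<omega>|N. g \<omega>) - (CLINT \<omega>|N. h \<omega>)) / (2 * \<i>)"
        if "complex_integrable N f" "complex_integrable N g" "complex_integrable N h" for N :: "'c measure" and f g h
        using that by simp
      have wb: "0 \<le> a * (1 + c) \<and> a * (1 + c) \<le> 2" if "0 \<le> a \<and> a \<le> 1" "\<bar>c\<bar> \<le> 1" for a c :: real
        using that mult_mono[of a 1 "1 + c" 2] by (auto intro!: mult_nonneg_nonneg)
      have c: "(\<integral>\<omega>. (ind J A \<omega> * (1 + cos (S t \<omega>))) * indicator (A k) (X k \<omega>) \<partial>M)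
             = (\<integral>\<omega>. (ind' J A \<omega> * (1 + cos (S' t \<omega>))) * indicator (A k) (X' k \<omega>) \<partial>M')" for t
      proof (rule weighted_char_unique[OF M M'])
        show "0 \<le> ind J A \<omega> * (1 + cos (S t \<omega>)) \<and> ind J A \<omega> * (1 + cos (S t \<omega>)) \<le> 2" for \<omega>
          by (rule wb[OF bnd(1)]) simp
        show "0 \<le> ind' J A \<omega> * (1 + cos (S' t \<omega>)) \<and> ind' J A \<omega> * (1 + cos (S' t \<omega>)) \<le> 2" for \<omega>
          by (rule wb[OF bnd(2)]) simp
        fix u
        show "(CLINT \<omega>|M. of_real (ind J A \<omega> * (1 + cos (S t \<omega>))) * iexp (u * X k \<omega>))
            = (CLINT \<omega>|M'. of_real (ind' J A \<omega> * (1 + cos (S' t \<omega>))) * iexp (u * X' k \<omega>))"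
          unfolding cosid
          by (subst linc[OF int int int], measurable, subst linc[OF int' int' int'], measurable)
             (use IH[of "\<lambda>_. 0" u] IH[of t u] IH[of "\<lambda>i. - t i" u] in \<open>simp only: neg zero\<close>)
      qed measurable
      have s: "(\<integral>\<omega>. (ind J A \<omega> * (1 + sin (S t \<omega>))) * indicator (A k) (X k \<omega>) \<partial>M)
             = (\<integral>\<omega>. (ind' J A \<omega> * (1 + sin (S' t \<omega>))) * indicator (A k) (X' k \<omega>) \<partial>M')" for t
      proof (rule weighted_char_unique[OF M M'])
        show "0 \<le> ind J A \<omega> * (1 + sin (S t \<omega>)) \<and> ind J A \<omega> * (1 + sin (S t \<omega>)) \<le> 2" for \<omega>
          by (rule wb[OF bnd(1)]) simp
        show "0 \<le> ind' J A \<omega> * (1 + sin (S' t \<omega>)) \<and> ind' J A \<omega> * (1 + sin (S' t \<omega>)) \<le> 2" for \<omega>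
          by (rule wb[OF bnd(2)]) simp
        fix u
        show "(CLINT \<omega>|M. of_real (ind J A \<omega> * (1 + sin (S t \<omega>))) * iexp (u * X k \<omega>))
            = (CLINT \<omega>|M'. of_real (ind' J A \<omega> * (1 + sin (S' t \<omega>))) * iexp (u * X' k \<omega>))"
          unfolding sinid
          by (subst lins[OF int int int], measurable, subst lins[OF int' int' int'], measurable)
             (use IH[of "\<lambda>_. 0" u] IH[of t u] IH[of "\<lambda>i. - t i" u] in \<open>simp only: neg zero\<close>)
      qed measurable
      define a where "a \<omega> = ind J A \<omega> * indicator (A k) (X k \<omega>)" for \<omega>
      define a' where "a' \<omega> = ind' J A \<omega> * indicator (A k) (X' k \<omega>)" for \<omega>
      have [measurable]: "a \<in> borel_measurable M" "a' \<in> borel_measurable M'"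
        unfolding a_def a'_def by measurable
      have ab: "\<bar>a \<omega>\<bar> \<le> 1" "\<bar>a' \<omega>'\<bar> \<le> 1" for \<omega> \<omega>'
        using bnd[of J A] by (auto simp: a_def a'_def split: split_indicator)
      have ia: "integrable M (\<lambda>\<omega>. a \<omega> * f \<omega>)" if "f \<in> borel_measurable M" "\<And>\<omega>. \<bar>f \<omega>\<bar> \<le> 1" for f
        using that ab by (intro M.integrable_const_bound[of _ 1]) (auto simp: abs_mult intro!: mult_le_one)
      have ia': "integrable M' (\<lambda>\<omega>. a' \<omega> * f \<omega>)" if "f \<in> borel_measurable M'" "\<And>\<omega>. \<bar>f \<omega>\<bar> \<le> 1" for f
        using that ab by (intro M'.integrable_const_bound[of _ 1]) (auto simp: abs_mult intro!: mult_le_one)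
      have i1: "integrable M a" using ia[of "\<lambda>_. 1"] by simp
      have i1': "integrable M' a'" using ia'[of "\<lambda>_. 1"] by simp
      \<comment> \<open>At t = 0 the sine vanishes and the integral of \<open>a\<close> alone
        remains. Subtracting it undoes the shift by 1 that made the weights nonnegative.\<close>
      have e0: "(\<integral>\<omega>. a \<omega> \<partial>M) = (\<integral>\<omega>. a' \<omega> \<partial>M')"
        using s[of "\<lambda>_. 0"] by (simp add: zero a_def a'_def)
      have ec: "(\<integral>\<omega>. a \<omega> * cos (S t \<omega>) \<partial>M) = (\<integral>\<omega>. a' \<omega> * cos (S' t \<omega>) \<partial>M')"
      proof -
        have "(\<integral>\<omega>. a \<omega> + a \<omega> * cos (S t \<omega>) \<partial>M) = (\<integral>\<omega>. a' \<omega> + a' \<omega> * cos (S' t \<omega>) \<partial>M')"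
          using c[of t] by (simp add: a_def a'_def algebra_simps)
        then show ?thesis using e0 i1 i1' ia[of "\<lambda>\<omega>. cos (S t \<omega>)"] ia'[of "\<lambda>\<omega>. cos (S' t \<omega>)"]
          by (simp add: ia ia')
      qed
      have es: "(\<integral>\<omega>. a \<omega> * sin (S t \<omega>) \<partial>M) = (\<integral>\<omega>. a' \<omega> * sin (S' t \<omega>) \<partial>M')"
      proof -
        have "(\<integral>\<omega>. a \<omega> + a \<omega> * sin (S t \<omega>) \<partial>M) = (\<integral>\<omega>. a' \<omega> + a' \<omega> * sin (S' t \<omega>) \<partial>M')"
          using s[of t] by (simp add: a_def a'_def algebra_simps)
        then show ?thesis using e0 i1 i1' ia[of "\<lambda>\<omega>. sin (S t \<omega>)"] ia'[of "\<lambda>\<omega>. sin (S' t \<omega>)"]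
          by (simp add: ia ia')
      qed
      have "(CLINT \<omega>|M. of_real (a \<omega>) * iexp (S t \<omega>))
          = (CLINT \<omega>|M. of_real (a \<omega> * cos (S t \<omega>)) + \<i> * of_real (a \<omega> * sin (S t \<omega>)))"
        by (simp add: cos_of_real sin_of_real algebra_simps exp_Euler)
      also have "\<dots> = of_real (\<integral>\<omega>. a \<omega> * cos (S t \<omega>) \<partial>M) + \<i> * of_real (\<integral>\<omega>. a \<omega> * sin (S t \<omega>) \<partial>M)"
        using ia[of "\<lambda>\<omega>. cos (S t \<omega>)"] ia[of "\<lambda>\<omega>. sin (S t \<omega>)"] 
        by (subst Bochner_Integration.integral_add) (auto simp del: of_real_mult)
      also have "\<dots> = of_real (\<integral>\<omega>. a' \<omega> * cos (S' t \<omega>) \<partial>M') + \<i> * of_real (\<integral>\<omega>. a' \<omega> * sin (S' t \<omega>) \<partial>M')"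
        by (simp add: ec es)
      also have "\<dots> = (CLINT \<omega>|M'. of_real (a' \<omega> * cos (S' t \<omega>)) + \<i> * of_real (a' \<omega> * sin (S' t \<omega>)))"
        using ia'[of "\<lambda>\<omega>. cos (S' t \<omega>)"] ia'[of "\<lambda>\<omega>. sin (S' t \<omega>)"] 
        by (subst Bochner_Integration.integral_add) (auto simp del: of_real_mult)
      also have "\<dots> = (CLINT \<omega>|M'. of_real (a' \<omega>) * iexp (S' t \<omega>))"
        by (simp add: cos_of_real sin_of_real algebra_simps exp_Euler)
      finally show ?case using insert.hyps
        by (simp add: a_def a'_def ind_def ind'_def S_def S'_def K_def mult.commute)
    qed
  qed
  have mX: "(\<lambda>\<omega>. \<lambda>i\<in>I. X i \<omega>) \<in> measurable M (PiM I (\<lambda>_. borel))"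
    using X by (intro measurable_restrict) auto
  have mX': "(\<lambda>\<omega>. \<lambda>i\<in>I. X' i \<omega>) \<in> measurable M' (PiM I (\<lambda>_. borel))"
    using X' by (intro measurable_restrict) auto
  interpret D: prob_space "distr M (PiM I (\<lambda>_. borel)) (\<lambda>\<omega>. \<lambda>i\<in>I. X i \<omega>)"
    by (rule M.prob_space_distr[OF mX])
  show ?thesis
  proof (rule measure_eqI_PiM_finite[OF I])
    fix A assume A: "\<And>i. i \<in> I \<Longrightarrow> A i \<in> sets (borel :: real measure)"
    have P: "Pi\<^sub>E I A \<in> sets (PiM I (\<lambda>_. borel))" using A I by (intro sets_PiM_I_finite) auto
    have 1: "ind I A = indicator ((\<lambda>\<omega>. \<lambda>i\<in>I. X i \<omega>) -` (Pi\<^sub>E I A))"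
      by (auto simp: ind_def fun_eq_iff I indicator_def PiE_iff prod_zero_iff[OF I] intro!: prod.neutral)
    have 2: "ind' I A = indicator ((\<lambda>\<omega>. \<lambda>i\<in>I. X' i \<omega>) -` (Pi\<^sub>E I A))"
      by (auto simp: ind'_def fun_eq_iff I indicator_def PiE_iff prod_zero_iff[OF I] intro!: prod.neutral)
    have "(\<integral>\<omega>. ind I A \<omega> \<partial>M) = (\<integral>\<omega>. ind' I A \<omega> \<partial>M')"
      using key[of I A "\<lambda>_. 0"] A by simp
    then have "measure M ((\<lambda>\<omega>. \<lambda>i\<in>I. X i \<omega>) -` (Pi\<^sub>E I A) \<inter> space M)
       = measure M' ((\<lambda>\<omega>. \<lambda>i\<in>I. X' i \<omega>) -` (Pi\<^sub>E I A) \<inter> space M')"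
      unfolding 1 2 by (simp add: integral_indicator)
    then show "emeasure (distr M (PiM I (\<lambda>_. borel)) (\<lambda>\<omega>. \<lambda>i\<in>I. X i \<omega>)) (Pi\<^sub>E I A)
        = emeasure (distr M' (PiM I (\<lambda>_. borel)) (\<lambda>\<omega>. \<lambda>i\<in>I. X' i \<omega>)) (Pi\<^sub>E I A)"
      using P by (simp add: emeasure_distr[OF mX] emeasure_distr[OF mX'] M.emeasure_eq_measure M'.emeasure_eq_measure)
  next
    show "range (\<lambda>_::nat. Pi\<^sub>E I (\<lambda>_. UNIV)) \<subseteq> prod_algebra I (\<lambda>_. borel :: real measure)"
      using I by (auto simp: prod_algebra_eq_finite intro!: exI[of _ "\<lambda>_. UNIV"])
  qed (use D.emeasure_finite in \<open>auto simp: space_PiM\<close>)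
qed

section \<open>Moments of pairs from a centred Gaussian family\<close>

lemma gaussian_pair_combination:
  assumes "centred_gaussian_family M A X C" "x \<in> A" "y \<in> A"
  shows "\<exists>\<sigma>. distr M borel (\<lambda>\<omega>. a * X x \<omega> + b * X y \<omega>)
              = distr std_normal_distribution borel (\<lambda>u. \<sigma> * u)"
proof -
  have *: "\<exists>\<sigma>. distr M borel (\<lambda>\<omega>. \<Sum>x\<in>B. c x * X x \<omega>)
              = distr std_normal_distribution borel (\<lambda>u. \<sigma> * u)" if "finite B" "B \<subseteq> A" for B c
    using assms(1) that unfolding centred_gaussian_family_def by blast
  show ?thesis
  proof (cases "x = y")
    case True
    then show ?thesis using *[of "{x}" "\<lambda>_. a + b"] assms by (simp add: distrib_right)
  next
    case False
    then show ?thesis using *[of "{x, y}" "\<lambda>z. if z = x then a else b"] assms by simp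
  qed
qed

lemma scaled_normal_moments:
  fixes Y :: "'a \<Rightarrow> real"
  assumes [measurable]: "Y \<in> borel_measurable M"
    and eq: "distr M borel Y = distr std_normal_distribution borel (\<lambda>u. \<sigma> * u)"
  shows "integrable M (\<lambda>\<omega>. Y \<omega> ^ k)"
    and "(\<integral>\<omega>. Y \<omega> ^ k \<partial>M) = \<sigma> ^ k * (\<integral>u. u ^ k \<partial>std_normal_distribution)"
    and "(CLINT \<omega>|M. iexp (Y \<omega>)) = exp (- (\<sigma>\<^sup>2) / 2)"
proof -
  have "integrable (distr M borel Y) (\<lambda>y. y ^ k)"
    unfolding eq
    by (subst integrable_distr_eq) (auto simp: power_mult_distrib intro!: integrable_mult_right integrable_std_normal_distribution_moment)
  then show "integrable M (\<lambda>\<omega>. Y \<omega> ^ k)" by (subst (asm) integrable_distr_eq) auto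
  have "(\<integral>\<omega>. Y \<omega> ^ k \<partial>M) = (\<integral>y. y ^ k \<partial>distr M borel Y)" by (subst integral_distr) auto
  also have "\<dots> = (\<integral>u. (\<sigma> * u) ^ k \<partial>std_normal_distribution)" unfolding eq by (subst integral_distr) auto
  finally show "(\<integral>\<omega>. Y \<omega> ^ k \<partial>M) = \<sigma> ^ k * (\<integral>u. u ^ k \<partial>std_normal_distribution)"
    by (simp add: power_mult_distrib)
  have "(CLINT \<omega>|M. iexp (Y \<omega>)) = (CLINT y|distr M borel Y. iexp y)" by (subst integral_distr) auto
  also have "\<dots> = (CLINT u|std_normal_distribution. iexp (\<sigma> * u))" unfolding eq by (subst integral_distr) auto
  also have "\<dots> = char std_normal_distribution \<sigma>" by (simp add: char_def)
  finally show "(CLINT \<omega>|M. iexp (Y \<omega>)) = exp (- (\<sigma>\<^sup>2) / 2)"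
    by (simp add: char_std_normal_distribution exp_of_real flip: of_real_power)
qed

lemma gaussian_integrable_mono:
  assumes G: "centred_gaussian_family M A X C" "x \<in> A" "y \<in> A"
  shows "integrable M (\<lambda>\<omega>. X x \<omega> ^ i * X y \<omega> ^ j)"
proof -
  have [measurable]: "X x \<in> borel_measurable M" "X y \<in> borel_measurable M"
    using G unfolding centred_gaussian_family_def by auto
  have ix: "integrable M (\<lambda>\<omega>. X x \<omega> ^ (2 * i))"
    using gaussian_pair_combination[OF G, of 1 0] scaled_normal_moments(1)[of "X x" M _ "2 * i"] by auto
  have iy: "integrable M (\<lambda>\<omega>. X y \<omega> ^ (2 * j))"
    using gaussian_pair_combination[OF G, of 0 1] scaled_normal_moments(1)[of "X y" M _ "2 * j"] by auto
  show ?thesis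
  proof (rule Bochner_Integration.integrable_bound[OF Bochner_Integration.integrable_add[OF ix iy]], measurable, rule AE_I2)
    fix \<omega>
    have "0 \<le> (\<bar>X x \<omega> ^ i\<bar> - \<bar>X y \<omega> ^ j\<bar>)\<^sup>2" by simp
    then have "2 * (\<bar>X x \<omega> ^ i\<bar> * \<bar>X y \<omega> ^ j\<bar>) \<le> (X x \<omega> ^ i)\<^sup>2 + (X y \<omega> ^ j)\<^sup>2"
      by (simp add: power2_diff)
    moreover have "0 \<le> \<bar>X x \<omega> ^ i\<bar> * \<bar>X y \<omega> ^ j\<bar>" by simp
    ultimately show "norm (X x \<omega> ^ i * X y \<omega> ^ j) \<le> norm (X x \<omega> ^ (2 * i) + X y \<omega> ^ (2 * j))"
      by (simp add: abs_mult power_mult[symmetric] mult.commute power_even_eq)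
  qed
qed

lemma gaussian_var:
  assumes G: "centred_gaussian_family M A X C" and B: "finite B" "B \<subseteq> A"
  shows "(\<integral>\<omega>. (\<Sum>x\<in>B. c x * X x \<omega>)\<^sup>2 \<partial>M) = (\<Sum>x\<in>B. \<Sum>y\<in>B. c x * c y * C x y)"
proof -
  have i: "integrable M (\<lambda>\<omega>. X x \<omega> * X y \<omega>)" if "x \<in> B" "y \<in> B" for x y
    using gaussian_integrable_mono[OF G, of x y 1 1] that B by auto
  have "(\<integral>\<omega>. (\<Sum>x\<in>B. c x * X x \<omega>)\<^sup>2 \<partial>M) = (\<integral>\<omega>. (\<Sum>x\<in>B. \<Sum>y\<in>B. (c x * c y) * (X x \<omega> * X y \<omega>)) \<partial>M)"
    by (intro Bochner_Integration.integral_cong) (auto simp: power2_eq_square sum_product algebra_simps)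
  also have "\<dots> = (\<Sum>x\<in>B. \<Sum>y\<in>B. c x * c y * (\<integral>\<omega>. X x \<omega> * X y \<omega> \<partial>M))"
    using i by (simp add: Bochner_Integration.integral_sum)
  also have "\<dots> = (\<Sum>x\<in>B. \<Sum>y\<in>B. c x * c y * C x y)"
    using G B unfolding centred_gaussian_family_def by (intro sum.cong refl) (auto simp: subset_eq)
  finally show ?thesis .
qed

lemma std_normal_second_moment: "(\<integral>u. u ^ 2 \<partial>std_normal_distribution) = 1"
  using std_normal_distribution_even_moments(1)[of 1] by (simp add: fact_numeral)

lemma gaussian_char:
  assumes G: "centred_gaussian_family M A X C" and B: "finite B" "B \<subseteq> A"
  shows "(CLINT \<omega>|M. iexp (\<Sum>x\<in>B. c x * X x \<omega>))
       = of_real (exp (- (\<Sum>x\<in>B. \<Sum>y\<in>B. c x * c y * C x y) / 2))"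
proof -
  obtain \<sigma> where s: "distr M borel (\<lambda>\<omega>. \<Sum>x\<in>B. c x * X x \<omega>)
              = distr std_normal_distribution borel (\<lambda>u. \<sigma> * u)"
    using G B unfolding centred_gaussian_family_def by blast
  have m: "(\<lambda>\<omega>. \<Sum>x\<in>B. c x * X x \<omega>) \<in> borel_measurable M"
    using G B unfolding centred_gaussian_family_def by (intro borel_measurable_sum borel_measurable_times) auto
  have "\<sigma>\<^sup>2 = (\<Sum>x\<in>B. \<Sum>y\<in>B. c x * c y * C x y)"
    using scaled_normal_moments(2)[OF m s, of 2] gaussian_var[OF G B, of c] std_normal_second_moment by simp
  then show ?thesis using scaled_normal_moments(3)[OF m s] by simp
qed

text \<open>As functions of t these moments are a generating function: expanding the power on the
  left shows every mixed moment of the pair as a coefficient.\<close>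

lemma gaussian_pair_moments:
  assumes G: "centred_gaussian_family M A X C" "x \<in> A" "y \<in> A"
  shows "(\<integral>\<omega>. (X x \<omega> + t * X y \<omega>) ^ (2 * k) \<partial>M)
           = fact (2 * k) / (2 ^ k * fact k) * (C x x + 2 * C x y * t + C y y * t\<^sup>2) ^ k" (is ?even)
    and "odd n \<Longrightarrow> (\<integral>\<omega>. (X x \<omega> + t * X y \<omega>) ^ n \<partial>M) = 0"
proof -
  have [measurable]: "X x \<in> borel_measurable M" "X y \<in> borel_measurable M"
    using G unfolding centred_gaussian_family_def by auto
  have cov: "(\<integral>\<omega>. X u \<omega> * X v \<omega> \<partial>M) = C u v" if "u \<in> A" "v \<in> A" for u v
    using G that unfolding centred_gaussian_family_def by auto
  have i: "integrable M (\<lambda>\<omega>. X u \<omega> * X v \<omega>)" if "u \<in> A" "v \<in> A" for u v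
    using gaussian_integrable_mono[OF G(1) that, of 1 1] by simp
  obtain \<sigma> where s: "distr M borel (\<lambda>\<omega>. X x \<omega> + t * X y \<omega>)
              = distr std_normal_distribution borel (\<lambda>u. \<sigma> * u)"
    using gaussian_pair_combination[OF G, of 1 t] by auto
  have "\<sigma>\<^sup>2 = (\<integral>\<omega>. (X x \<omega> + t * X y \<omega>) ^ 2 \<partial>M)"
    using scaled_normal_moments(2)[OF _ s, of 2] std_normal_second_moment by simp
  also have "\<dots> = (\<integral>\<omega>. X x \<omega> * X x \<omega> + 2 * t * (X x \<omega> * X y \<omega>) + t\<^sup>2 * (X y \<omega> * X y \<omega>) \<partial>M)"
    by (intro Bochner_Integration.integral_cong) (auto simp: power2_eq_square algebra_simps)
  also have "\<dots> = C x x + 2 * C x y * t + C y y * t\<^sup>2"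
    using i G by (simp add: cov)
  finally have v: "\<sigma>\<^sup>2 = C x x + 2 * C x y * t + C y y * t\<^sup>2" .
  have mm: "(\<lambda>\<omega>. X x \<omega> + t * X y \<omega>) \<in> borel_measurable M" by measurable
  show ?even using scaled_normal_moments(2)[OF mm s, of "2 * k"] std_normal_distribution_even_moments(1)[of k]
    unfolding power_mult[of \<sigma>] v by (simp only: mult.commute)
  show "odd n \<Longrightarrow> (\<integral>\<omega>. (X x \<omega> + t * X y \<omega>) ^ n \<partial>M) = 0"
    using scaled_normal_moments(2)[OF _ s, of n] integral_std_normal_distribution_moment_odd[of n] by simp
qed

lemma gaussian_binomial_moments:
  assumes G: "centred_gaussian_family M A X C" "x \<in> A" "y \<in> A"
  shows "(\<integral>\<omega>. (X x \<omega> + t * X y \<omega>) ^ n \<partial>M)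
      = (\<Sum>j\<le>n. (of_nat (n choose j) * (\<integral>\<omega>. X x \<omega> ^ (n - j) * X y \<omega> ^ j \<partial>M)) * t ^ j)"
proof -
  have "(\<integral>\<omega>. (X x \<omega> + t * X y \<omega>) ^ n \<partial>M)
     = (\<integral>\<omega>. (\<Sum>j\<le>n. (of_nat (n choose j) * t ^ j) * (X x \<omega> ^ (n - j) * X y \<omega> ^ j)) \<partial>M)"
  proof (intro Bochner_Integration.integral_cong refl)
    fix \<omega>
    show "(X x \<omega> + t * X y \<omega>) ^ n = (\<Sum>j\<le>n. (of_nat (n choose j) * t ^ j) * (X x \<omega> ^ (n - j) * X y \<omega> ^ j))"
      using binomial_ring[of "t * X y \<omega>" "X x \<omega>" n] by (simp add: add.commute power_mult_distrib algebra_simps)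
  qed
  also have "\<dots> = (\<Sum>j\<le>n. (of_nat (n choose j) * t ^ j) * (\<integral>\<omega>. X x \<omega> ^ (n - j) * X y \<omega> ^ j \<partial>M))"
    using gaussian_integrable_mono[OF G] by (subst Bochner_Integration.integral_sum) auto
  finally show ?thesis by (simp add: algebra_simps)
qed

lemma gaussian_odd_moment:
  assumes G: "centred_gaussian_family M A X C" "x \<in> A" "y \<in> A" and n: "odd (i + j)"
  shows "(\<integral>\<omega>. X x \<omega> ^ i * X y \<omega> ^ j \<partial>M) = 0"
proof -
  define n where "n = i + j"
  have "\<forall>t. (\<Sum>j\<le>n. (of_nat (n choose j) * (\<integral>\<omega>. X x \<omega> ^ (n - j) * X y \<omega> ^ j \<partial>M)) * t ^ j) = (\<Sum>j\<le>n. 0 * t ^ j)"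
    using gaussian_binomial_moments[OF G, of _ n] gaussian_pair_moments(2)[OF G, of n] assms(4) by (simp add: n_def)
  from this[unfolded polyfun_eq_coeffs, rule_format, of j]
  show ?thesis by (auto simp: n_def)
qed

text \<open>Isserlis' formula by polarisation. The variance of X + t Y is a quadratic polynomial in
  t and the even moments are multiples of its powers, so that comparing coefficients in t gives the
  mixed moments, also for degenerate covariances.\<close>

lemma gaussian_moments:
  assumes G: "centred_gaussian_family M A X C" "x \<in> A" "y \<in> A"
  defines "E \<equiv> \<lambda>i j. (\<integral>\<omega>. X x \<omega> ^ i * X y \<omega> ^ j \<partial>M)"
  shows "E 2 0 = C x x" "E 4 0 = 3 * (C x x)\<^sup>2"
    and "E 2 2 = C x x * C y y + 2 * (C x y)\<^sup>2"
    and "E 2 4 = 3 * C x x * (C y y)\<^sup>2 + 12 * (C x y)\<^sup>2 * C y y"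
    and "E 3 3 = 9 * C x x * C y y * C x y + 6 * C x y ^ 3"
    and "E 4 4 = 9 * (C x x)\<^sup>2 * (C y y)\<^sup>2 + 72 * C x x * C y y * (C x y)\<^sup>2 + 24 * C x y ^ 4"
proof -
  define a b c where "a = C x x" and "b = C x y" and "c = C y y"
  have e: "(\<Sum>j\<le>2*k. (of_nat (2*k choose j) * E (2*k - j) j) * t ^ j)
     = fact (2 * k) / (2 ^ k * fact k) * (a + 2 * b * t + c * t\<^sup>2) ^ k" for k t
    using gaussian_binomial_moments[OF G, of t "2*k"] gaussian_pair_moments(1)[OF G, of t k]
    by (simp add: E_def a_def b_def c_def)
  have "E 2 0 = a" using e[where k=1 and t=0] by (simp add: numeral_2_eq_2)
  \<comment> \<open>The three lists below contain the coefficients of 3, 15 and 105 times the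
    second, third and fourth power of \<open>a + 2 * b * t + c * t\<^sup>2\<close>; the factors are
    the standard normal moments of order 4, 6 and 8.\<close>
  have 2: "\<forall>t. (\<Sum>j\<le>4. (of_nat (4 choose j) * E (4 - j) j) * t ^ j)
       = (\<Sum>j\<le>4. ([3*a^2, 12*a*b, 6*a*c+12*b^2, 12*b*c, 3*c^2] ! j) * t ^ j)"
  proof
    fix t
    have "(\<Sum>j\<le>4. (of_nat (4 choose j) * E (4 - j) j) * t ^ j) = 3 * (a + 2 * b * t + c * t\<^sup>2) ^ 2"
      using e[where k=2 and t=t] by (simp add: fact_numeral)
    also have "\<dots> = (\<Sum>j\<le>4. ([3*a^2, 12*a*b, 6*a*c+12*b^2, 12*b*c, 3*c^2] ! j) * t ^ j)"
      by (simp add: eval_nat_numeral atMost_Suc algebra_simps)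
    finally show "(\<Sum>j\<le>4. (of_nat (4 choose j) * E (4 - j) j) * t ^ j) = \<dots>" .
  qed
  have 3: "\<forall>t. (\<Sum>j\<le>6. (of_nat (6 choose j) * E (6 - j) j) * t ^ j)
       = (\<Sum>j\<le>6. ([15*a^3, 90*a^2*b, 45*a^2*c+180*a*b^2, 180*a*b*c+120*b^3, 45*a*c^2+180*b^2*c, 90*b*c^2, 15*c^3] ! j) * t ^ j)"
  proof
    fix t
    have "(\<Sum>j\<le>6. (of_nat (6 choose j) * E (6 - j) j) * t ^ j) = 15 * (a + 2 * b * t + c * t\<^sup>2) ^ 3"
      using e[where k=3 and t=t] by (simp add: fact_numeral)
    also have "\<dots> = (\<Sum>j\<le>6. ([15*a^3, 90*a^2*b, 45*a^2*c+180*a*b^2, 180*a*b*c+120*b^3, 45*a*c^2+180*b^2*c, 90*b*c^2, 15*c^3] ! j) * t ^ j)"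
      by (simp add: eval_nat_numeral atMost_Suc algebra_simps)
    finally show "(\<Sum>j\<le>6. (of_nat (6 choose j) * E (6 - j) j) * t ^ j) = \<dots>" .
  qed
  have 4: "\<forall>t. (\<Sum>j\<le>8. (of_nat (8 choose j) * E (8 - j) j) * t ^ j)
       = (\<Sum>j\<le>8. ([105*a^4, 840*a^3*b, 420*a^3*c+2520*a^2*b^2, 2520*a^2*b*c+3360*a*b^3,
           630*a^2*c^2+5040*a*b^2*c+1680*b^4, 2520*a*b*c^2+3360*b^3*c, 420*a*c^3+2520*b^2*c^2, 840*b*c^3, 105*c^4] ! j) * t ^ j)"
  proof
    fix t
    have "(\<Sum>j\<le>8. (of_nat (8 choose j) * E (8 - j) j) * t ^ j) = 105 * (a + 2 * b * t + c * t\<^sup>2) ^ 4"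
      using e[where k=4 and t=t] by (simp add: fact_numeral)
    also have "\<dots> = (\<Sum>j\<le>8. ([105*a^4, 840*a^3*b, 420*a^3*c+2520*a^2*b^2, 2520*a^2*b*c+3360*a*b^3,
           630*a^2*c^2+5040*a*b^2*c+1680*b^4, 2520*a*b*c^2+3360*b^3*c, 420*a*c^3+2520*b^2*c^2, 840*b*c^3, 105*c^4] ! j) * t ^ j)"
      by (simp add: eval_nat_numeral atMost_Suc algebra_simps)
    finally show "(\<Sum>j\<le>8. (of_nat (8 choose j) * E (8 - j) j) * t ^ j) = \<dots>" .
  qed
  have ch: "(4::nat) choose 2 = 6" "(6::nat) choose 4 = 15" "(6::nat) choose 3 = 20" "(8::nat) choose 4 = 70"
    by (simp_all add: eval_nat_numeral)
  note 2 = 2[unfolded polyfun_eq_coeffs, rule_format]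
  note 3 = 3[unfolded polyfun_eq_coeffs, rule_format]
  note 4 = 4[unfolded polyfun_eq_coeffs, rule_format]
  show "E 2 0 = C x x" using \<open>E 2 0 = a\<close> by (simp add: a_def)
  show "E 4 0 = 3 * (C x x)\<^sup>2" using 2[of 0] by (simp add: a_def)
  show "E 2 2 = C x x * C y y + 2 * (C x y)\<^sup>2" using 2[of 2] ch by (simp add: a_def b_def c_def numeral_2_eq_2)
  show "E 2 4 = 3 * C x x * (C y y)\<^sup>2 + 12 * (C x y)\<^sup>2 * C y y" using 3[of 4] ch by (simp add: a_def b_def c_def)
  show "E 3 3 = 9 * C x x * C y y * C x y + 6 * C x y ^ 3" using 3[of 3] ch by (simp add: a_def b_def c_def algebra_simps)
  show "E 4 4 = 9 * (C x x)\<^sup>2 * (C y y)\<^sup>2 + 72 * C x x * C y y * (C x y)\<^sup>2 + 24 * C x y ^ 4"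
    using 4[of 4] ch by (simp add: a_def b_def c_def algebra_simps)
qed

text \<open>The covariance may be singular, so densities are of no use. Instead the family is
  compared with one that has the same block laws and independent blocks: the quadratic form in the
  exponent splits along the blocks, the characteristic functions agree, and
  \<open>Cramer_Wold\<close> identifies the joint laws.\<close>

lemma gaussian_blocks_indep:
  fixes X :: "'i \<Rightarrow> 'a \<Rightarrow> real" and \<beta> :: "'i \<Rightarrow> 'j"
  assumes M: "prob_space M" and G: "centred_gaussian_family M A X C" and A: "finite A"
    and J: "finite J" "J \<noteq> {}" "\<And>x. x \<in> A \<Longrightarrow> \<beta> x \<in> J"
    and C0: "\<And>x y. x \<in> A \<Longrightarrow> y \<in> A \<Longrightarrow> \<beta> x \<noteq> \<beta> y \<Longrightarrow> C x y = 0"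
  shows "prob_space.indep_vars M (\<lambda>j. PiM {x\<in>A. \<beta> x = j} (\<lambda>_. borel))
           (\<lambda>j \<omega>. \<lambda>x\<in>{x\<in>A. \<beta> x = j}. X x \<omega>) J"
proof -
  interpret prob_space M by fact
  have C0': "\<And>x y. x \<in> A \<Longrightarrow> y \<in> A \<Longrightarrow> C x y \<noteq> 0 \<Longrightarrow> \<beta> y = \<beta> x" using C0 by metis
  define blk where "blk j = {x\<in>A. \<beta> x = j}" for j
  define N where "N j = (PiM (blk j) (\<lambda>_. borel) :: ('i \<Rightarrow> real) measure)" for j
  define V where "V j \<omega> = (\<lambda>x\<in>blk j. X x \<omega>)" for j \<omega>
  have X: "X x \<in> borel_measurable M" if "x \<in> A" for x
    using G that unfolding centred_gaussian_family_def by auto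
  have V[measurable]: "V j \<in> measurable M (N j)" for j
    unfolding V_def N_def by (intro measurable_restrict) (auto simp: blk_def X)
  define D where "D j = distr M (N j) (V j)" for j
  have D: "prob_space (D j)" for j unfolding D_def by (rule prob_space_distr) simp
  interpret PS: product_prob_space D J by (rule product_prob_spaceI) (rule D)
  have psP: "prob_space (PiM J D)" by (rule PS.prob_space_axioms)
  have sD: "sets (D j) = sets (N j)" for j by (simp add: D_def)
  \<comment> \<open>The comparison family lives on the product of the block laws; each site reads
    off its coordinate in the factor of its own block.\<close>
  define X' where "X' x \<xi> = (\<xi> (\<beta> x) x :: real)" for x and \<xi> :: "'j \<Rightarrow> 'i \<Rightarrow> real"
  have comp: "(\<lambda>\<xi>. \<xi> j) \<in> measurable (PiM J D) (N j)" if "j \<in> J" for j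
    using measurable_component_singleton[OF that, of D] by (simp cong: measurable_cong_sets add: sD)
  have X': "X' x \<in> borel_measurable (PiM J D)" if "x \<in> A" for x
    unfolding X'_def by (rule measurable_compose[OF comp[OF J(3)[OF that]]])
      (use that in \<open>auto simp: N_def blk_def intro!: measurable_component_singleton\<close>)
  have fin: "finite (blk j)" "blk j \<subseteq> A" for j using A by (auto simp: blk_def)
  have split: "(\<Sum>x\<in>A. f x) = (\<Sum>j\<in>J. \<Sum>x\<in>blk j. f x)" for f :: "'i \<Rightarrow> real"
    unfolding blk_def by (rule sum.group[symmetric]) (use A J in auto)
  have eq: "distr M (PiM A (\<lambda>_. borel)) (\<lambda>\<omega>. \<lambda>i\<in>A. X i \<omega>)
       = distr (PiM J D) (PiM A (\<lambda>_. borel)) (\<lambda>\<omega>. \<lambda>i\<in>A. X' i \<omega>)"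
  proof (rule Cramer_Wold[OF M psP A X X'])
    fix t :: "'i \<Rightarrow> real"
    have b: "(CLINT \<xi>|D j. iexp (\<Sum>x\<in>blk j. t x * \<xi> x)) = of_real (exp (- (\<Sum>x\<in>blk j. \<Sum>y\<in>blk j. t x * t y * C x y) / 2))" for j
    proof -
      have [measurable]: "(\<lambda>\<xi>. \<Sum>x\<in>blk j. t x * \<xi> x) \<in> borel_measurable (N j)"
        unfolding N_def by (intro borel_measurable_sum borel_measurable_times) (auto intro!: measurable_component_singleton)
      have "(CLINT \<xi>|D j. iexp (\<Sum>x\<in>blk j. t x * \<xi> x)) = (CLINT \<omega>|M. iexp (\<Sum>x\<in>blk j. t x * V j \<omega> x))"
        unfolding D_def by (subst integral_distr) (auto simp del: of_real_sum of_real_mult)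
      also have "\<dots> = (CLINT \<omega>|M. iexp (\<Sum>x\<in>blk j. t x * X x \<omega>))"
        by (intro Bochner_Integration.integral_cong refl arg_cong[where f=iexp] sum.cong) (auto simp: V_def)
      finally show ?thesis using gaussian_char[OF G fin] by simp
    qed
    have "(CLINT \<xi>|PiM J D. iexp (\<Sum>i\<in>A. t i * X' i \<xi>)) = (CLINT \<xi>|PiM J D. (\<Prod>j\<in>J. iexp (\<Sum>x\<in>blk j. t x * \<xi> j x)))"
    proof (intro Bochner_Integration.integral_cong refl)
      fix \<xi>
      have "(\<Sum>i\<in>A. t i * X' i \<xi>) = (\<Sum>j\<in>J. \<Sum>x\<in>blk j. t x * \<xi> j x)"
        unfolding split by (intro sum.cong refl) (auto simp: X'_def blk_def)
      then show "iexp (\<Sum>i\<in>A. t i * X' i \<xi>) = (\<Prod>j\<in>J. iexp (\<Sum>x\<in>blk j. t x * \<xi> j x))"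
        by (simp only: of_real_sum sum_distrib_left exp_sum[OF J(1)])
    qed
    also have "\<dots> = (\<Prod>j\<in>J. CLINT \<xi>|D j. iexp (\<Sum>x\<in>blk j. t x * \<xi> x))"
    proof (rule PS.product_integral_prod[OF J(1)])
      fix j
      have [measurable]: "(\<lambda>\<xi>. \<Sum>x\<in>blk j. t x * \<xi> x) \<in> borel_measurable (D j)"
        unfolding D_def measurable_distr_eq1 N_def
        by (intro borel_measurable_sum borel_measurable_times) (auto intro!: measurable_component_singleton)
      show "complex_integrable (D j) (\<lambda>\<xi>. iexp (\<Sum>x\<in>blk j. t x * \<xi> x))"
        by (rule finite_measure.integrable_const_bound[OF prob_space.finite_measure[OF D], where B = 1]) (auto simp del: of_real_sum of_real_mult)
    qed
    also have "\<dots> = of_real (exp (\<Sum>j\<in>J. - (\<Sum>x\<in>blk j. \<Sum>y\<in>blk j. t x * t y * C x y) / 2))"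
      unfolding b by (simp only: exp_sum[OF J(1)] of_real_prod)
    also have "(\<Sum>j\<in>J. - (\<Sum>x\<in>blk j. \<Sum>y\<in>blk j. t x * t y * C x y) / 2) = - (\<Sum>x\<in>A. \<Sum>y\<in>A. t x * t y * C x y) / 2"
    proof -
      have "(\<Sum>x\<in>A. \<Sum>y\<in>A. t x * t y * C x y) = (\<Sum>j\<in>J. \<Sum>x\<in>blk j. \<Sum>y\<in>blk j. t x * t y * C x y)"
        unfolding split[of "\<lambda>x. \<Sum>y\<in>A. t x * t y * C x y"]
      proof (rule sum.cong[OF refl], rule sum.cong[OF refl])
        fix j x assume "j \<in> J" "x \<in> blk j"
        then show "(\<Sum>y\<in>A. t x * t y * C x y) = (\<Sum>y\<in>blk j. t x * t y * C x y)"
          using A C0' by (intro sum.mono_neutral_right) (auto simp: blk_def)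
      qed
      then show ?thesis by (simp add: sum_negf sum_divide_distrib)
    qed
    finally show "(CLINT \<omega>|M. iexp (\<Sum>i\<in>A. t i * X i \<omega>)) = (CLINT \<xi>|PiM J D. iexp (\<Sum>i\<in>A. t i * X' i \<xi>))"
      using gaussian_char[OF G A subset_refl, of t] by simp
  qed
  \<comment> \<open>Grouping a flat family by blocks carries the equality of the two joint laws over
    to families of blocks, where it says that the joint law is the product law.\<close>
  define nest where "nest \<eta> = (\<lambda>j\<in>J. \<lambda>x\<in>blk j. \<eta> x :: real)" for \<eta>
  have nest[measurable]: "nest \<in> measurable (PiM A (\<lambda>_. borel)) (PiM J N)"
    unfolding nest_def N_def by (intro measurable_restrict measurable_component_singleton) (auto simp: blk_def)
  have mX: "(\<lambda>\<omega>. \<lambda>i\<in>A. X i \<omega>) \<in> measurable M (PiM A (\<lambda>_. borel))" by (intro measurable_restrict X)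
  have mX': "(\<lambda>\<omega>. \<lambda>i\<in>A. X' i \<omega>) \<in> measurable (PiM J D) (PiM A (\<lambda>_. borel))" by (intro measurable_restrict X')
  have "distr M (PiM J N) (\<lambda>\<omega>. \<lambda>j\<in>J. V j \<omega>) = distr M (PiM J N) (nest \<circ> (\<lambda>\<omega>. \<lambda>i\<in>A. X i \<omega>))"
    by (intro distr_cong refl) (auto simp: nest_def V_def blk_def fun_eq_iff)
  also have "\<dots> = distr (distr M (PiM A (\<lambda>_. borel)) (\<lambda>\<omega>. \<lambda>i\<in>A. X i \<omega>)) (PiM J N) nest"
    by (rule distr_distr[OF nest mX, symmetric])
  also have "\<dots> = distr (PiM J D) (PiM J N) (nest \<circ> (\<lambda>\<omega>. \<lambda>i\<in>A. X' i \<omega>))"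
    unfolding eq by (rule distr_distr[OF nest mX'])
  also have "\<dots> = distr (PiM J D) (PiM J N) (\<lambda>\<xi>. \<xi>)"
  proof (intro distr_cong refl)
    fix \<xi> assume "\<xi> \<in> space (PiM J D)"
    then have "\<xi> \<in> (\<Pi>\<^sub>E j\<in>J. space (N j))" by (simp add: space_PiM D_def)
    then have a: "\<And>j. j \<in> J \<Longrightarrow> \<xi> j \<in> (\<Pi>\<^sub>E x\<in>blk j. UNIV)" and b: "\<And>j. j \<notin> J \<Longrightarrow> \<xi> j = undefined"
      by (auto simp: N_def space_PiM PiE_iff extensional_def)
    show "(nest \<circ> (\<lambda>\<omega>. \<lambda>i\<in>A. X' i \<omega>)) \<xi> = \<xi>"
    proof
      fix j show "(nest \<circ> (\<lambda>\<omega>. \<lambda>i\<in>A. X' i \<omega>)) \<xi> j = \<xi> j"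
        using a[of j] b[of j] by (cases "j \<in> J") (auto simp: nest_def X'_def blk_def fun_eq_iff PiE_iff extensional_def)
    qed
  qed
  also have "\<dots> = PiM J D"
    by (rule distr_id2) (intro sets_PiM_cong refl, simp add: sD)
  finally have "indep_vars N V J"
    unfolding D_def by (subst indep_vars_iff_distr_eq_PiM'[OF J(2) V])
  then show ?thesis unfolding N_def V_def blk_def .
qed

section \<open>The Gaussian increments in one block\<close>

text \<open>Bound for the moment of order k of the weight \<open>\<rho>\<close> introduced below.
  The quotient of factorials is the standard normal moment of order 2 k. Only the block size enters,
  so constants built from it are the same for all blocks and all scales.\<close>

definition moment_bound :: "real \<Rightarrow> nat \<Rightarrow> real" where
  "moment_bound b k = (1 + b) ^ k * (1 + b * (fact (2 * k) / (2 ^ k * fact k)))"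

text \<open>The covariance is the orthogonal projection onto the fields with zero sum over the
  block, which is the law of the increments of one layer of the free field inside one block.\<close>

locale gaussian_block = prob_space M for M :: "'w measure" +
  fixes I :: "'i set" and Z :: "'i \<Rightarrow> 'w \<Rightarrow> real"
  assumes finite_I: "finite I" and card_I: "card I \<ge> 3"
    and gauss: "centred_gaussian_family M I Z (\<lambda>x y. of_bool (x = y) - 1 / real (card I))"
begin

abbreviation "b \<equiv> real (card I)"
definition "\<gamma> = 1 - 1 / b"
definition "Cv x y = of_bool (x = y) - 1 / b" for x y :: 'i
definition "Q k \<omega> = (\<Sum>y\<in>I. Z y \<omega> ^ k)" for k :: nat
text \<open>One weight that dominates all increments of the block at once. Being at least 1 it has
  monotone powers, so every polynomial bound can be stated with a single power of it.\<close>

definition "\<rho> \<omega> = 1 + Q 2 \<omega>"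

text \<open>
  The coefficients make \<open>F4\<close> centred and uncorrelated with \<open>Q 2\<close> and \<open>Q 3\<close>, so that the first
  order shift of its mean under the interaction does not depend on the background field.
\<close>

definition "F4 \<omega> = Q 4 \<omega> - 6 * \<gamma> * Q 2 \<omega> + 3 * b * \<gamma>\<^sup>2"
text \<open>\<open>S3\<close> and \<open>S4\<close> are the sums of the third and fourth powers of
  all entries of the covariance matrix \<open>Cv\<close> of the block.\<close>

definition "S3 = b * (\<gamma> ^ 3 - (b - 1) / b ^ 3)"
definition "S4 = b * (\<gamma> ^ 4 + (b - 1) / b ^ 4)"
abbreviation "Mom \<equiv> moment_bound b"

lemma b_ge: "b \<ge> 3" using card_I by simp
lemma \<gamma>_bounds: "0 < \<gamma>" "\<gamma> \<le> 1" using b_ge by (auto simp: \<gamma>_def field_simps)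

lemma gauss': "centred_gaussian_family M I Z Cv"
  using gauss by (simp add: Cv_def[abs_def])

lemma Z_meas[measurable]: "y \<in> I \<Longrightarrow> Z y \<in> borel_measurable M"
  using gauss unfolding centred_gaussian_family_def by auto

lemma Q_meas[measurable]: "Q k \<in> borel_measurable M"
  unfolding Q_def by (intro borel_measurable_sum borel_measurable_power) auto

lemma Cv_diag: "Cv x x = \<gamma>" by (simp add: Cv_def \<gamma>_def)

lemma Cv_sums:
  assumes "x \<in> I"
  shows "(\<Sum>y\<in>I. Cv x y) = 0" "(\<Sum>y\<in>I. (Cv x y)\<^sup>2) = \<gamma>"
    "(\<Sum>y\<in>I. Cv x y ^ 3) = \<gamma> ^ 3 - (b - 1) / b ^ 3" "(\<Sum>y\<in>I. Cv x y ^ 4) = \<gamma> ^ 4 + (b - 1) / b ^ 4"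
proof -
  have *: "(\<Sum>y\<in>I. Cv x y ^ k) = \<gamma> ^ k + (b - 1) * (- 1 / b) ^ k" for k
  proof -
    have "(\<Sum>y\<in>I. Cv x y ^ k) = Cv x x ^ k + (\<Sum>y\<in>I - {x}. Cv x y ^ k)"
      using assms finite_I by (simp add: sum.remove)
    also have "(\<Sum>y\<in>I - {x}. Cv x y ^ k) = (\<Sum>y\<in>I - {x}. (- 1 / b) ^ k)"
      by (rule sum.cong) (auto simp: Cv_def)
    also have "\<dots> = (b - 1) * (- 1 / b) ^ k"
      using assms finite_I card_I by (simp add: of_nat_diff)
    finally show ?thesis by (simp add: Cv_diag)
  qed
  show "(\<Sum>y\<in>I. Cv x y) = 0" "(\<Sum>y\<in>I. (Cv x y)\<^sup>2) = \<gamma>"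
  proof -
    have "\<gamma>\<^sup>2 + (b - 1) * (- 1 / b)\<^sup>2 = \<gamma>" "\<gamma> + (b - 1) * (- 1 / b) = 0"
      using b_ge by (simp_all add: \<gamma>_def power2_eq_square field_simps)
    then show "(\<Sum>y\<in>I. Cv x y) = 0" "(\<Sum>y\<in>I. (Cv x y)\<^sup>2) = \<gamma>" using *[of 1] *[of 2] by simp_all
  qed
  show "(\<Sum>y\<in>I. Cv x y ^ 3) = \<gamma> ^ 3 - (b - 1) / b ^ 3" "(\<Sum>y\<in>I. Cv x y ^ 4) = \<gamma> ^ 4 + (b - 1) / b ^ 4"
    using *[of 3] *[of 4] b_ge by (simp_all add: power_divide)
qed

text \<open>The variance of the block sum is the total of all entries of the covariance matrix, and
  each row of the projection sums to zero.\<close>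

lemma Q1_AE: "AE \<omega> in M. Q 1 \<omega> = 0"
proof -
  have i: "integrable M (\<lambda>\<omega>. (Q 1 \<omega>)\<^sup>2)"
  proof -
    have "(\<lambda>\<omega>. (Q 1 \<omega>)\<^sup>2) = (\<lambda>\<omega>. \<Sum>x\<in>I. \<Sum>y\<in>I. Z x \<omega> ^ 1 * Z y \<omega> ^ 1)"
      by (simp add: Q_def power2_eq_square sum_product fun_eq_iff)
    moreover have "integrable M (\<lambda>\<omega>. Z x \<omega> ^ 1 * Z y \<omega> ^ 1)" if "x \<in> I" "y \<in> I" for x y
      using gaussian_integrable_mono[OF gauss' that] .
    ultimately show ?thesis by simp
  qed
  have "(\<integral>\<omega>. (Q 1 \<omega>)\<^sup>2 \<partial>M) = (\<Sum>x\<in>I. \<Sum>y\<in>I. Cv x y)"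
    using gaussian_var[OF gauss' finite_I subset_refl, of "\<lambda>_. 1"] by (simp add: Q_def)
  also have "\<dots> = 0" using Cv_sums by simp
  finally have "AE \<omega> in M. (Q 1 \<omega>)\<^sup>2 = 0"
    using integral_nonneg_eq_0_iff_AE[OF i] by auto
  then show ?thesis by auto
qed

lemma Z_pow_bound: "y \<in> I \<Longrightarrow> (Z y \<omega>)\<^sup>2 \<le> Q 2 \<omega>"
  unfolding Q_def using member_le_sum[of y I "\<lambda>y. (Z y \<omega>)\<^sup>2"] finite_I by auto

lemma Q2_nonneg: "Q 2 \<omega> \<ge> 0" unfolding Q_def by (intro sum_nonneg) auto

lemma \<rho>_ge: "\<rho> \<omega> \<ge> 1" using Q2_nonneg by (simp add: \<rho>_def)

lemma \<rho>_abs [simp]: "\<bar>\<rho> \<omega>\<bar> = \<rho> \<omega>" "\<bar>\<rho> \<omega> ^ k\<bar> = \<rho> \<omega> ^ k"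
  using \<rho>_ge[of \<omega>] by auto

lemma \<rho>_power_ge: "1 \<le> \<rho> \<omega> ^ k" by (rule one_le_power[OF \<rho>_ge])

lemma Z_le_\<rho>: "y \<in> I \<Longrightarrow> 1 + (Z y \<omega>)\<^sup>2 \<le> \<rho> \<omega>"
  using Z_pow_bound[of y \<omega>] by (auto simp: \<rho>_def)

text \<open>Passing through the largest increment turns a power of a sum over the block into a power
  sum, whose mean is a one dimensional Gaussian moment.\<close>

lemma \<rho>_power_le: "\<rho> \<omega> ^ k \<le> (1 + b) ^ k * (1 + Q (2 * k) \<omega>)"
proof -
  have ne: "I \<noteq> {}" using card_I by auto
  define m where "m = Max ((\<lambda>y. (Z y \<omega>)\<^sup>2) ` I)"
  have "m \<in> (\<lambda>y. (Z y \<omega>)\<^sup>2) ` I" unfolding m_def using finite_I ne by (intro Max_in) auto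
  then obtain y where y: "y \<in> I" "m = (Z y \<omega>)\<^sup>2" by auto
  have "Q 2 \<omega> \<le> b * m"
    unfolding Q_def using sum_bounded_above[of I "\<lambda>y. (Z y \<omega>)\<^sup>2" m] finite_I by (auto simp: m_def)
  then have le: "\<rho> \<omega> \<le> (1 + b) * max 1 m" 
    using mult_left_mono[of m "max 1 m" b] by (auto simp: \<rho>_def distrib_right)
  have "\<rho> \<omega> ^ k \<le> (1 + b) ^ k * (max 1 m) ^ k"
    using power_mono[OF le, of k] \<rho>_ge[of \<omega>] by (simp add: power_mult_distrib)
  also have "(max 1 m) ^ k \<le> 1 + Q (2 * k) \<omega>"
  proof -
    have "m ^ k \<le> Q (2 * k) \<omega>"
      unfolding Q_def y(2) power_mult[symmetric]
      by (rule member_le_sum[OF y(1)]) (auto simp: finite_I)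
    moreover have "Q (2 * k) \<omega> \<ge> 0" unfolding Q_def by (intro sum_nonneg) auto
    ultimately show ?thesis by (auto simp: max_def)
  qed
  finally show ?thesis using b_ge by (auto simp: mult_left_mono)
qed

lemma Z_moment: "y \<in> I \<Longrightarrow> (\<integral>\<omega>. Z y \<omega> ^ (2 * k) \<partial>M) = fact (2 * k) / (2 ^ k * fact k) * \<gamma> ^ k"
  using gaussian_pair_moments(1)[OF gauss', of y y 0 k] by (simp add: Cv_diag)

lemma Q_int: "integrable M (Q k)"
  unfolding Q_def using gaussian_integrable_mono[OF gauss', of _ _ k 0] by (auto intro!: Bochner_Integration.integrable_sum)

lemma QQ_int: "integrable M (\<lambda>\<omega>. Q i \<omega> * Q j \<omega>)"
  unfolding Q_def sum_product using gaussian_integrable_mono[OF gauss'] by auto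

lemma \<rho>_meas[measurable]: "\<rho> \<in> borel_measurable M" unfolding \<rho>_def[abs_def] by measurable

lemma \<rho>_int: "integrable M (\<lambda>\<omega>. \<rho> \<omega> ^ k)"
proof (rule Bochner_Integration.integrable_bound[of _ "\<lambda>\<omega>. (1 + b) ^ k * (1 + Q (2 * k) \<omega>)"])
  show "AE \<omega> in M. norm (\<rho> \<omega> ^ k) \<le> norm ((1 + b) ^ k * (1 + Q (2 * k) \<omega>))"
  proof (rule AE_I2)
    fix \<omega>
    have "0 \<le> \<rho> \<omega> ^ k" using \<rho>_ge[of \<omega>] by simp
    then show "norm (\<rho> \<omega> ^ k) \<le> norm ((1 + b) ^ k * (1 + Q (2 * k) \<omega>))"
      using \<rho>_power_le[of \<omega> k] by simp
  qed
qed (use Q_int in auto)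

lemma \<rho>_mom: "(\<integral>\<omega>. \<rho> \<omega> ^ k \<partial>M) \<le> Mom k"
proof -
  have "(\<integral>\<omega>. \<rho> \<omega> ^ k \<partial>M) \<le> (\<integral>\<omega>. (1 + b) ^ k * (1 + Q (2 * k) \<omega>) \<partial>M)"
    by (intro Bochner_Integration.integral_mono \<rho>_int \<rho>_power_le) (use Q_int in auto)
  also have "\<dots> = (1 + b) ^ k * (1 + (\<integral>\<omega>. Q (2 * k) \<omega> \<partial>M))"
    using Q_int by (simp add: prob_space)
  also have "(\<integral>\<omega>. Q (2 * k) \<omega> \<partial>M) = b * (fact (2 * k) / (2 ^ k * fact k) * \<gamma> ^ k)"
    unfolding Q_def using gaussian_integrable_mono[OF gauss', of _ _ "2*k" 0]
    by (subst Bochner_Integration.integral_sum) (auto simp: Z_moment)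
  also have "(1 + b) ^ k * (1 + b * (fact (2 * k) / (2 ^ k * fact k) * \<gamma> ^ k)) \<le> Mom k"
    unfolding moment_bound_def using b_ge \<gamma>_bounds power_le_one[of \<gamma> k]
    by (intro mult_left_mono add_left_mono mult_right_le_one_le) auto
  finally show ?thesis .
qed

lemma Mom_ge_1: "Mom k \<ge> 1"
  using \<rho>_mom[of k] Bochner_Integration.integral_mono[of M "\<lambda>_. 1 :: real" "\<lambda>\<omega>. \<rho> \<omega> ^ k"] \<rho>_int[of k] \<rho>_power_ge[of _ k]
  by (simp add: prob_space)

lemma \<rho>_bounded_int:
  assumes [measurable]: "f \<in> borel_measurable M" and "AE \<omega> in M. \<bar>f \<omega>\<bar> \<le> K * \<rho> \<omega> ^ k"
  shows "integrable M f" "(\<integral>\<omega>. \<bar>f \<omega>\<bar> \<partial>M) \<le> \<bar>K\<bar> * Mom k"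
proof -
  have le: "AE \<omega> in M. \<bar>f \<omega>\<bar> \<le> \<bar>K\<bar> * \<rho> \<omega> ^ k"
    using assms(2)
  proof eventually_elim
    case (elim \<omega>)
    have "K * \<rho> \<omega> ^ k \<le> \<bar>K\<bar> * \<rho> \<omega> ^ k" using \<rho>_ge[of \<omega>] by (intro mult_right_mono) auto
    with elim show ?case by simp
  qed
  have i: "integrable M (\<lambda>\<omega>. \<bar>K\<bar> * \<rho> \<omega> ^ k)" using \<rho>_int by simp
  show "integrable M f"
    by (rule Bochner_Integration.integrable_bound[OF i]) (use le in \<open>auto elim!: eventually_mono simp: abs_mult\<close>)
  then have "(\<integral>\<omega>. \<bar>f \<omega>\<bar> \<partial>M) \<le> (\<integral>\<omega>. \<bar>K\<bar> * \<rho> \<omega> ^ k \<partial>M)"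
    using i le by (intro integral_mono_AE) auto
  also have "\<dots> \<le> \<bar>K\<bar> * Mom k" using \<rho>_mom[of k] by (simp add: mult_left_mono)
  finally show "(\<integral>\<omega>. \<bar>f \<omega>\<bar> \<partial>M) \<le> \<bar>K\<bar> * Mom k" .
qed

section \<open>Covariances of the power sums with the first order interaction of a block\<close>

lemma QQ: "(\<integral>\<omega>. Q i \<omega> * Q j \<omega> \<partial>M) = (\<Sum>x\<in>I. \<Sum>y\<in>I. (\<integral>\<omega>. Z x \<omega> ^ i * Z y \<omega> ^ j \<partial>M))"
  unfolding Q_def sum_product using gaussian_integrable_mono[OF gauss']
  by (subst Bochner_Integration.integral_sum; auto)+

lemma Q_expect: "(\<integral>\<omega>. Q 2 \<omega> \<partial>M) = b * \<gamma>" "(\<integral>\<omega>. Q 4 \<omega> \<partial>M) = 3 * b * \<gamma>\<^sup>2" "odd i \<Longrightarrow> (\<integral>\<omega>. Q i \<omega> \<partial>M) = 0"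
proof -
  have *: "(\<integral>\<omega>. Q k \<omega> \<partial>M) = (\<Sum>y\<in>I. \<integral>\<omega>. Z y \<omega> ^ k * Z y \<omega> ^ 0 \<partial>M)" for k
    unfolding Q_def using gaussian_integrable_mono[OF gauss', of _ _ k 0] by simp
  show "(\<integral>\<omega>. Q 2 \<omega> \<partial>M) = b * \<gamma>" "(\<integral>\<omega>. Q 4 \<omega> \<partial>M) = 3 * b * \<gamma>\<^sup>2"
    unfolding * using gaussian_moments(1,2)[OF gauss'] by (simp_all add: Cv_diag)
  show "odd i \<Longrightarrow> (\<integral>\<omega>. Q i \<omega> \<partial>M) = 0"
    unfolding * by (intro sum.neutral ballI gaussian_odd_moment[OF gauss']) auto
qed

lemma QQ_odd: "odd (i + j) \<Longrightarrow> (\<integral>\<omega>. Q i \<omega> * Q j \<omega> \<partial>M) = 0"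
  unfolding QQ by (intro sum.neutral ballI gaussian_odd_moment[OF gauss']) auto

lemma QQ_22: "(\<integral>\<omega>. Q 2 \<omega> * Q 2 \<omega> \<partial>M) = b\<^sup>2 * \<gamma>\<^sup>2 + 2 * b * \<gamma>"
proof -
  have "(\<integral>\<omega>. Q 2 \<omega> * Q 2 \<omega> \<partial>M) = (\<Sum>x\<in>I. \<Sum>y\<in>I. \<gamma>\<^sup>2 + 2 * (Cv x y)\<^sup>2)"
    unfolding QQ using gaussian_moments(3)[OF gauss'] by (simp add: Cv_diag power2_eq_square)
  also have "\<dots> = b\<^sup>2 * \<gamma>\<^sup>2 + 2 * b * \<gamma>"
    by (simp add: sum.distrib sum_distrib_left[symmetric] Cv_sums)
      (simp add: power2_eq_square power3_eq_cube algebra_simps)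
  finally show ?thesis .
qed

lemma QQ_24: "(\<integral>\<omega>. Q 2 \<omega> * Q 4 \<omega> \<partial>M) = 3 * b\<^sup>2 * \<gamma> ^ 3 + 12 * b * \<gamma>\<^sup>2"
proof -
  have "(\<integral>\<omega>. Q 2 \<omega> * Q 4 \<omega> \<partial>M) = (\<Sum>x\<in>I. \<Sum>y\<in>I. 3 * \<gamma> ^ 3 + 12 * \<gamma> * (Cv x y)\<^sup>2)"
    unfolding QQ using gaussian_moments(4)[OF gauss']
    by (simp add: Cv_diag power2_eq_square power3_eq_cube algebra_simps)
  also have "\<dots> = 3 * b\<^sup>2 * \<gamma> ^ 3 + 12 * b * \<gamma>\<^sup>2"
    by (simp add: sum.distrib sum_distrib_left[symmetric] Cv_sums)
      (simp add: power2_eq_square power3_eq_cube algebra_simps)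
  finally show ?thesis .
qed

lemma QQ_42: "(\<integral>\<omega>. Q 4 \<omega> * Q 2 \<omega> \<partial>M) = 3 * b\<^sup>2 * \<gamma> ^ 3 + 12 * b * \<gamma>\<^sup>2"
  using QQ_24 by (simp add: mult.commute)

lemma QQ_43: "(\<integral>\<omega>. Q 2 \<omega> * Q 3 \<omega> \<partial>M) = 0" "(\<integral>\<omega>. Q 4 \<omega> * Q 3 \<omega> \<partial>M) = 0"
  by (rule QQ_odd, simp)+

lemma QQ_33: "(\<integral>\<omega>. Q 3 \<omega> * Q 3 \<omega> \<partial>M) = 6 * S3"
proof -
  have "(\<integral>\<omega>. Q 3 \<omega> * Q 3 \<omega> \<partial>M) = (\<Sum>x\<in>I. \<Sum>y\<in>I. 9 * \<gamma>\<^sup>2 * Cv x y + 6 * Cv x y ^ 3)"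
    unfolding QQ using gaussian_moments(5)[OF gauss']
    by (simp add: Cv_diag power2_eq_square algebra_simps)
  also have "\<dots> = 6 * S3"
    by (simp add: sum.distrib sum_distrib_left[symmetric] Cv_sums S3_def)
  finally show ?thesis .
qed

lemma QQ_44: "(\<integral>\<omega>. Q 4 \<omega> * Q 4 \<omega> \<partial>M) = 9 * b\<^sup>2 * \<gamma> ^ 4 + 72 * b * \<gamma> ^ 3 + 24 * S4"
proof -
  have "(\<integral>\<omega>. Q 4 \<omega> * Q 4 \<omega> \<partial>M) = (\<Sum>x\<in>I. \<Sum>y\<in>I. 9 * \<gamma> ^ 4 + 72 * \<gamma>\<^sup>2 * (Cv x y)\<^sup>2 + 24 * Cv x y ^ 4)"
    unfolding QQ using gaussian_moments(6)[OF gauss']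
    by (simp add: Cv_diag eval_nat_numeral algebra_simps)
  also have "\<dots> = 9 * b\<^sup>2 * \<gamma> ^ 4 + 72 * b * \<gamma> ^ 3 + 24 * S4"
    by (simp add: sum.distrib sum_distrib_left[symmetric] Cv_sums)
      (simp add: S4_def eval_nat_numeral algebra_simps)
  finally show ?thesis .
qed

text \<open>
  The increment of \<open>lh :\<phi>\<^sup>4: + r :\<phi>\<^sup>2:\<close> over a block when \<open>\<psi>\<close> is replaced by \<open>\<psi> + Z\<close>. The terms
  linear in \<open>Z\<close> are absent since the increments of a block sum to zero almost surely.
\<close>

definition "X1 lh r G \<psi> \<omega> = lh * (6 * \<psi>\<^sup>2 * Q 2 \<omega> + 4 * \<psi> * Q 3 \<omega> + Q 4 \<omega> - 6 * G * Q 2 \<omega>) + r * Q 2 \<omega>"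

lemma X1_alt: "X1 lh r G \<psi> = (\<lambda>\<omega>. (lh * (6 * \<psi>\<^sup>2 - 6 * G) + r) * Q 2 \<omega> + 4 * lh * \<psi> * Q 3 \<omega> + lh * Q 4 \<omega>)"
  by (auto simp: X1_def fun_eq_iff algebra_simps)

lemma QX1: "(\<integral>\<omega>. Q i \<omega> * X1 lh r G \<psi> \<omega> \<partial>M) = (lh * (6 * \<psi>\<^sup>2 - 6 * G) + r) * (\<integral>\<omega>. Q i \<omega> * Q 2 \<omega> \<partial>M)
    + 4 * lh * \<psi> * (\<integral>\<omega>. Q i \<omega> * Q 3 \<omega> \<partial>M) + lh * (\<integral>\<omega>. Q i \<omega> * Q 4 \<omega> \<partial>M)"
proof -
  have "(\<integral>\<omega>. Q i \<omega> * X1 lh r G \<psi> \<omega> \<partial>M) = (\<integral>\<omega>. (lh * (6 * \<psi>\<^sup>2 - 6 * G) + r) * (Q i \<omega> * Q 2 \<omega>)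
     + 4 * lh * \<psi> * (Q i \<omega> * Q 3 \<omega>) + lh * (Q i \<omega> * Q 4 \<omega>) \<partial>M)"
    by (intro Bochner_Integration.integral_cong refl) (simp add: X1_alt algebra_simps)
  then show ?thesis using QQ_int by simp
qed

lemma X1_int: "integrable M (X1 lh r G \<psi>)" "integrable M (\<lambda>\<omega>. Q i \<omega> * X1 lh r G \<psi> \<omega>)"
proof -
  show "integrable M (X1 lh r G \<psi>)" unfolding X1_alt using Q_int by simp
  have "(\<lambda>\<omega>. Q i \<omega> * X1 lh r G \<psi> \<omega>) = (\<lambda>\<omega>. (lh * (6 * \<psi>\<^sup>2 - 6 * G) + r) * (Q i \<omega> * Q 2 \<omega>)
     + 4 * lh * \<psi> * (Q i \<omega> * Q 3 \<omega>) + lh * (Q i \<omega> * Q 4 \<omega>))"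
    by (simp add: X1_alt algebra_simps fun_eq_iff)
  then show "integrable M (\<lambda>\<omega>. Q i \<omega> * X1 lh r G \<psi> \<omega>)" using QQ_int by simp
qed

lemma X1_expect: "(\<integral>\<omega>. X1 lh r G \<psi> \<omega> \<partial>M) = (lh * (6 * \<psi>\<^sup>2 - 6 * G) + r) * (b * \<gamma>) + lh * (3 * b * \<gamma>\<^sup>2)"
  unfolding X1_alt using Q_int by (simp add: Q_expect)

text \<open>If G is the fixed point of G \<mapsto> G / L + \<gamma>, then
  \<open>\<psi>\<^sup>2 + \<gamma> - G\<close> is the second Wick power of \<psi> for the variance G
  / L of a rescaled coarse field.\<close>

lemma cov_Q2_X1: "(\<integral>\<omega>. (Q 2 \<omega> - b * \<gamma>) * X1 lh r G \<psi> \<omega> \<partial>M) = 12 * lh * b * \<gamma> * (\<psi>\<^sup>2 + \<gamma> - G) + 2 * b * \<gamma> * r"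
proof -
  have "(\<integral>\<omega>. (Q 2 \<omega> - b * \<gamma>) * X1 lh r G \<psi> \<omega> \<partial>M)
      = (\<integral>\<omega>. Q 2 \<omega> * X1 lh r G \<psi> \<omega> \<partial>M) - b * \<gamma> * (\<integral>\<omega>. X1 lh r G \<psi> \<omega> \<partial>M)"
    using X1_int by (simp add: left_diff_distrib)
  then show ?thesis
    unfolding QX1 X1_expect QQ_22 QQ_24 using QQ_odd[of 2 3]
    by (simp add: power2_eq_square power3_eq_cube algebra_simps)
qed

lemma cov_Q3_X1: "(\<integral>\<omega>. Q 3 \<omega> * X1 lh r G \<psi> \<omega> \<partial>M) = 24 * lh * \<psi> * S3"
  unfolding QX1 QQ_33 using QQ_odd[of 3 2] QQ_odd[of 3 4] by simp

text \<open>\<open>F4\<close> is the sum of the fourth Hermite polynomials of the increments for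
  their own variance \<gamma>. It is orthogonal to all polynomials of degree at most three in the
  Gaussian field, so only \<open>lh * Q 4\<close> contributes and neither \<psi> nor r is
  left.\<close>

lemma cov_F4_X1: "(\<integral>\<omega>. F4 \<omega> * X1 lh r G \<psi> \<omega> \<partial>M) = 24 * lh * S4"
proof -
  have "(\<integral>\<omega>. F4 \<omega> * X1 lh r G \<psi> \<omega> \<partial>M)
      = (\<integral>\<omega>. Q 4 \<omega> * X1 lh r G \<psi> \<omega> - 6 * \<gamma> * (Q 2 \<omega> * X1 lh r G \<psi> \<omega>) + 3 * b * \<gamma>\<^sup>2 * X1 lh r G \<psi> \<omega> \<partial>M)"
    by (intro Bochner_Integration.integral_cong refl) (simp add: F4_def algebra_simps)
  also have "\<dots> = (\<integral>\<omega>. Q 4 \<omega> * X1 lh r G \<psi> \<omega> \<partial>M) - 6 * \<gamma> * (\<integral>\<omega>. Q 2 \<omega> * X1 lh r G \<psi> \<omega> \<partial>M) + 3 * b * \<gamma>\<^sup>2 * (\<integral>\<omega>. X1 lh r G \<psi> \<omega> \<partial>M)"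
    using X1_int by simp
  finally show ?thesis
    unfolding QX1 X1_expect QQ_22 QQ_24 QQ_44 QQ_42 QQ_43
    by (simp add: power2_eq_square power3_eq_cube power4_eq_xxxx algebra_simps)
qed

lemma F4_expect: "(\<integral>\<omega>. F4 \<omega> \<partial>M) = 0" "integrable M F4"
  unfolding F4_def[abs_def] using Q_int by (simp_all add: Q_expect prob_space power2_eq_square)

end

section \<open>Tilted expectations and the class of site weights\<close>

context prob_space begin

text \<open>
  Chebyshev's association inequality: \<open>X\<close> and \<open>exp (- X)\<close> are oppositely ordered. It replaces
  perturbation theory where the field is large.
\<close>

lemma tilted_mean_le:
  fixes X :: "'a \<Rightarrow> real"
  assumes X: "integrable M X" and c: "AE \<omega> in M. X \<omega> \<ge> - c"
  shows "integrable M (\<lambda>\<omega>. exp (- X \<omega>))" "integrable M (\<lambda>\<omega>. X \<omega> * exp (- X \<omega>))"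
    and "exp (- expectation X) \<le> expectation (\<lambda>\<omega>. exp (- X \<omega>))"
    and "expectation (\<lambda>\<omega>. X \<omega> * exp (- X \<omega>)) \<le> expectation X * expectation (\<lambda>\<omega>. exp (- X \<omega>))"
proof -
  have [measurable]: "X \<in> borel_measurable M" using X by auto
  show i1: "integrable M (\<lambda>\<omega>. exp (- X \<omega>))"
    by (rule integrable_const_bound[of _ "exp c"]) (use c in \<open>auto elim!: eventually_mono\<close>)
  show i2: "integrable M (\<lambda>\<omega>. X \<omega> * exp (- X \<omega>))"
  proof (rule Bochner_Integration.integrable_bound[of _ "\<lambda>\<omega>. exp c * X \<omega>"])
    show "AE \<omega> in M. norm (X \<omega> * exp (- X \<omega>)) \<le> norm (exp c * X \<omega>)"
      using c
    proof eventually_elim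
      case (elim \<omega>)
      then have "\<bar>X \<omega>\<bar> * exp (- X \<omega>) \<le> \<bar>X \<omega>\<bar> * exp c" by (intro mult_left_mono) auto
      then show ?case by (simp add: abs_mult mult.commute)
    qed
  qed (use X in auto)
  define a where "a = expectation X"
  \<comment> \<open>The tangent to the exponential at the mean; integrating it is Jensen's
    inequality.\<close>
  have "exp (- a) * (1 + a - X \<omega>) \<le> exp (- X \<omega>)" for \<omega>
  proof -
    have "exp (- a) * (1 + (a - X \<omega>)) \<le> exp (- a) * exp (a - X \<omega>)"
      by (intro mult_left_mono exp_ge_add_one_self) auto
    then show ?thesis by (simp add: exp_diff exp_minus field_simps)
  qed
  then have "expectation (\<lambda>\<omega>. exp (- a) * (1 + a - X \<omega>)) \<le> expectation (\<lambda>\<omega>. exp (- X \<omega>))"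
    using X i1 by (intro Bochner_Integration.integral_mono) auto
  then show "exp (- expectation X) \<le> expectation (\<lambda>\<omega>. exp (- X \<omega>))"
    using X by (simp add: a_def prob_space)
  \<comment> \<open>Both factors change sign where X crosses its mean, in opposite
    directions.\<close>
  have "(X \<omega> - a) * (exp (- X \<omega>) - exp (- a)) \<le> 0" for \<omega>
    by (cases "X \<omega> \<le> a") (auto simp: mult_le_0_iff)
  then have "expectation (\<lambda>\<omega>. (X \<omega> - a) * (exp (- X \<omega>) - exp (- a))) \<le> expectation (\<lambda>\<omega>. 0)"
    using X i1 i2 by (intro Bochner_Integration.integral_mono) (auto simp: algebra_simps)
  moreover have "expectation (\<lambda>\<omega>. (X \<omega> - a) * (exp (- X \<omega>) - exp (- a)))
     = expectation (\<lambda>\<omega>. X \<omega> * exp (- X \<omega>)) - a * expectation (\<lambda>\<omega>. exp (- X \<omega>)) - exp (- a) * (expectation X - a)"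
    using X i1 i2 by (simp add: algebra_simps prob_space)
  ultimately show "expectation (\<lambda>\<omega>. X \<omega> * exp (- X \<omega>)) \<le> expectation X * expectation (\<lambda>\<omega>. exp (- X \<omega>))"
    by (simp add: a_def)
qed

end

text \<open>The interaction is bounded below but not above. The constant \<open>exp c\<close> uses
  only the lower bound and serves for arbitrarily large positive x.\<close>

lemma exp_taylor2:
  fixes x :: real assumes "x \<ge> - c" "c \<ge> 0"
  shows "\<bar>exp (- x) - 1\<bar> \<le> exp c * \<bar>x\<bar>" "\<bar>exp (- x) - 1 + x\<bar> \<le> exp c * x\<^sup>2"
proof -
  have e: "exp (- x) \<le> exp c" using assms by simp
  have ge1: "exp c \<ge> 1" using assms by simp
  have l: "1 - x \<le> exp (- x)" using exp_ge_add_one_self[of "- x"] by simp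
  have "1 + x \<le> exp x" by simp
  then have u: "exp (- x) * (1 + x) \<le> 1" by (simp add: exp_minus field_simps)
  show 1: "\<bar>exp (- x) - 1\<bar> \<le> exp c * \<bar>x\<bar>"
  proof (cases "x \<ge> 0")
    case True
    then have "exp (- x) \<le> 1" by simp
    moreover have "x \<le> exp c * x" using True ge1 by (simp add: mult_le_cancel_right1)
    ultimately show ?thesis using l True by auto
  next
    case False
    have "exp (- x) - 1 \<le> exp (- x) * (- x)" using u by (simp add: algebra_simps)
    also have "\<dots> \<le> exp c * (- x)" using e False by (intro mult_right_mono) auto
    finally show ?thesis using False by simp
  qed
  show "\<bar>exp (- x) - 1 + x\<bar> \<le> exp c * x\<^sup>2"
  proof -
    have "exp (- x) - 1 + x \<le> x - exp (- x) * x" using u by (simp add: algebra_simps)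
    also have "\<dots> = x * (1 - exp (- x))" by (simp add: algebra_simps)
    also have "\<dots> \<le> \<bar>x\<bar> * \<bar>exp (- x) - 1\<bar>" by (metis abs_ge_self abs_minus_commute abs_mult)
    also have "\<dots> \<le> \<bar>x\<bar> * (exp c * \<bar>x\<bar>)" using 1 by (intro mult_left_mono) auto
    finally show ?thesis using l by (simp add: power2_eq_square algebra_simps)
  qed
qed

section \<open>First order expansion of tilted means\<close>

context prob_space begin

text \<open>Y is the part of X of first order in D, p a random variable that dominates everything.
  For centred f the term of order zero vanishes, and then the normalisation only matters in second
  order: it differs from 1 by O(D) and multiplies a mean that is itself O(D).\<close>

lemma tilt_first_order:
  fixes X :: "'a \<Rightarrow> real"
  assumes [measurable]: "f \<in> borel_measurable M" "X \<in> borel_measurable M" "Y \<in> borel_measurable M" "p \<in> borel_measurable M"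
    and bnd: "AE \<omega> in M. \<bar>Y \<omega>\<bar> \<le> D * p \<omega> \<and> \<bar>X \<omega> - Y \<omega>\<bar> \<le> D\<^sup>2 * p \<omega> \<and> X \<omega> \<ge> - c \<and> p \<omega> \<ge> 1"
    and D: "0 \<le> D" "D \<le> 2" and c: "c \<ge> 0"
    and p: "integrable M p" "expectation p \<le> m"
    and fp: "integrable M (\<lambda>\<omega>. \<bar>f \<omega>\<bar> * (p \<omega>)\<^sup>2)" "expectation (\<lambda>\<omega>. \<bar>f \<omega>\<bar> * (p \<omega>)\<^sup>2) \<le> m'"
  shows "expectation f = 0 \<Longrightarrow> \<bar>expectation (\<lambda>\<omega>. f \<omega> * exp (- X \<omega>)) / expectation (\<lambda>\<omega>. exp (- X \<omega>)) + expectation (\<lambda>\<omega>. f \<omega> * Y \<omega>)\<bar>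
      \<le> exp (6 * m) * (10 * exp c * m' + 6 * exp c * m * m') * D\<^sup>2" (is "_ \<Longrightarrow> ?goal")
    and "expectation (\<lambda>\<omega>. \<bar>f \<omega>\<bar> * exp (- X \<omega>)) / expectation (\<lambda>\<omega>. exp (- X \<omega>)) \<le> exp (6 * m) * exp c * m'"
    and "integrable M (\<lambda>\<omega>. f \<omega> * exp (- X \<omega>))" "integrable M X"
proof -
  \<comment> \<open>From D at most 2 one gets \<open>D\<^sup>2 \<le> 2 * D\<close>, hence the factor
    3.\<close>
  have Xb: "AE \<omega> in M. \<bar>X \<omega>\<bar> \<le> 3 * D * p \<omega>"
    using bnd
  proof eventually_elim
    case (elim \<omega>)
    have "D\<^sup>2 * p \<omega> \<le> 2 * D * p \<omega>" using elim D by (intro mult_right_mono) (auto simp: power2_eq_square mult_right_mono)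
    then show ?case using elim by linarith
  qed
  have dom: "integrable M h" if "h \<in> borel_measurable M" "AE \<omega> in M. \<bar>h \<omega>\<bar> \<le> k * (\<bar>f \<omega>\<bar> * (p \<omega>)\<^sup>2)" for h k
    by (rule Bochner_Integration.integrable_bound[OF integrable_mult_right[OF fp(1), of k]])
       (use that in \<open>auto elim!: eventually_mono\<close>)
  show iX: "integrable M X"
    by (rule Bochner_Integration.integrable_bound[OF integrable_mult_right[OF p(1), of "3 * D"]])
       (use Xb in \<open>auto elim!: eventually_mono\<close>)
  have cA: "AE \<omega> in M. X \<omega> \<ge> - c" using bnd by auto
  note tm = tilted_mean_le[OF iX cA]
  define z where "z = expectation (\<lambda>\<omega>. exp (- X \<omega>))"
  have aX: "expectation (\<lambda>\<omega>. \<bar>X \<omega>\<bar>) \<le> 3 * D * m"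
  proof -
    have "expectation (\<lambda>\<omega>. \<bar>X \<omega>\<bar>) \<le> expectation (\<lambda>\<omega>. 3 * D * p \<omega>)"
      using iX p Xb by (intro integral_mono_AE) auto
    also have "\<dots> \<le> 3 * D * m" using p D by (simp add: mult_left_mono)
    finally show ?thesis .
  qed
  have m1: "m \<ge> 1"
  proof -
    have "expectation (\<lambda>\<omega>. 1) \<le> expectation p" using p bnd by (intro integral_mono_AE) auto
    then show ?thesis using p by (simp add: prob_space)
  qed
  \<comment> \<open>Through Jensen's inequality this bounds the normalisation from below by
    \<open>exp (- (6 * m))\<close>; the factor 6 is 3 D for the largest admissible D.\<close>
  have "expectation X \<le> 6 * m"
  proof -
    have "expectation X \<le> expectation (\<lambda>\<omega>. \<bar>X \<omega>\<bar>)" using iX by (intro Bochner_Integration.integral_mono) auto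
    also note aX
    also have "3 * D * m \<le> 6 * m" using D m1 by (intro mult_right_mono) auto
    finally show ?thesis .
  qed
  then have "exp (- (6 * m)) \<le> exp (- expectation X)" by simp
  also have "\<dots> \<le> z" using tm(3) by (simp add: z_def)
  finally have zl: "exp (- (6 * m)) \<le> z" .
  then have zp: "z > 0" using less_le_trans[OF exp_gt_zero] by blast
  have iz: "1 / z \<le> exp (6 * m)" using zl zp by (simp add: exp_minus field_simps)
  have m'0: "m' \<ge> 0" using order_trans[OF Bochner_Integration.integral_nonneg fp(2)] by simp
  have pp: "AE \<omega> in M. 1 \<le> p \<omega> \<and> p \<omega> \<le> (p \<omega>)\<^sup>2 \<and> 1 \<le> (p \<omega>)\<^sup>2"
    using bnd by eventually_elim (auto simp: power2_eq_square one_le_mult_iff mult_le_cancel_left1 intro: order_trans)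
  have f0: "integrable M f"
    by (rule dom[of _ 1]) (use pp in \<open>auto elim!: eventually_mono simp: mult_le_cancel_left1\<close>)
  have fe: "AE \<omega> in M. \<bar>f \<omega> * exp (- X \<omega>)\<bar> \<le> exp c * (\<bar>f \<omega>\<bar> * (p \<omega>)\<^sup>2)"
    using bnd pp
  proof eventually_elim
    case (elim \<omega>)
    have "\<bar>f \<omega>\<bar> * exp (- X \<omega>) \<le> (\<bar>f \<omega>\<bar> * (p \<omega>)\<^sup>2) * exp c"
      using elim by (intro mult_mono) (auto simp: mult_le_cancel_left1)
    then show ?case by (simp add: abs_mult mult.commute)
  qed
  show ife: "integrable M (\<lambda>\<omega>. f \<omega> * exp (- X \<omega>))" by (rule dom[OF _ fe]) measurable
  have fX: "AE \<omega> in M. \<bar>f \<omega> * Y \<omega>\<bar> \<le> D * (\<bar>f \<omega>\<bar> * (p \<omega>)\<^sup>2)"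
    using bnd pp
  proof eventually_elim
    case (elim \<omega>)
    have "\<bar>f \<omega>\<bar> * \<bar>Y \<omega>\<bar> \<le> \<bar>f \<omega>\<bar> * (D * (p \<omega>)\<^sup>2)"
      using elim D by (intro mult_left_mono) (auto intro: order_trans[OF _ mult_left_mono])
    then show ?case by (simp add: abs_mult algebra_simps)
  qed
  have ifY: "integrable M (\<lambda>\<omega>. f \<omega> * Y \<omega>)" by (rule dom[OF _ fX]) measurable
  define R where "R \<omega> = f \<omega> * (exp (- X \<omega>) - 1 + Y \<omega>)" for \<omega>
  have Rb: "AE \<omega> in M. \<bar>R \<omega>\<bar> \<le> 10 * exp c * D\<^sup>2 * (\<bar>f \<omega>\<bar> * (p \<omega>)\<^sup>2)"
    using bnd pp Xb
  proof eventually_elim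
    case (elim \<omega>)
    have e1: "exp c \<ge> 1" using c by simp
    have "\<bar>exp (- X \<omega>) - 1 + Y \<omega>\<bar> \<le> \<bar>exp (- X \<omega>) - 1 + X \<omega>\<bar> + \<bar>X \<omega> - Y \<omega>\<bar>" by linarith
    also have "\<dots> \<le> exp c * (X \<omega>)\<^sup>2 + D\<^sup>2 * p \<omega>" using exp_taylor2(2)[of c "X \<omega>"] c elim by (intro add_mono) auto
    also have "\<dots> \<le> exp c * (3 * D * p \<omega>)\<^sup>2 + exp c * (D\<^sup>2 * (p \<omega>)\<^sup>2)"
    proof (intro add_mono mult_left_mono)
      show "(X \<omega>)\<^sup>2 \<le> (3 * D * p \<omega>)\<^sup>2" using elim by (metis abs_ge_zero power2_abs power_mono)
      have "D\<^sup>2 * p \<omega> \<le> 1 * (D\<^sup>2 * (p \<omega>)\<^sup>2)" using elim by (simp add: mult_left_mono)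
      also have "\<dots> \<le> exp c * (D\<^sup>2 * (p \<omega>)\<^sup>2)" using e1 by (intro mult_right_mono) auto
      finally show "D\<^sup>2 * p \<omega> \<le> exp c * (D\<^sup>2 * (p \<omega>)\<^sup>2)" .
    qed auto
    also have "\<dots> = 10 * exp c * D\<^sup>2 * (p \<omega>)\<^sup>2" by (simp add: power_mult_distrib algebra_simps)
    finally have "\<bar>f \<omega>\<bar> * \<bar>exp (- X \<omega>) - 1 + Y \<omega>\<bar> \<le> \<bar>f \<omega>\<bar> * (10 * exp c * D\<^sup>2 * (p \<omega>)\<^sup>2)"
      by (intro mult_left_mono) auto
    then show ?case unfolding R_def abs_mult by (simp only: mult_ac)
  qed
  have iR: "integrable M R" by (rule dom[OF _ Rb]) (simp add: R_def[abs_def])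
  have ER: "\<bar>expectation R\<bar> \<le> 10 * exp c * D\<^sup>2 * m'"
  proof -
    have "\<bar>expectation R\<bar> \<le> expectation (\<lambda>\<omega>. \<bar>R \<omega>\<bar>)" by (rule integral_abs_bound)
    also have "\<dots> \<le> expectation (\<lambda>\<omega>. 10 * exp c * D\<^sup>2 * (\<bar>f \<omega>\<bar> * (p \<omega>)\<^sup>2))"
      using iR fp Rb by (intro integral_mono_AE) auto
    also have "\<dots> = 10 * exp c * D\<^sup>2 * expectation (\<lambda>\<omega>. \<bar>f \<omega>\<bar> * (p \<omega>)\<^sup>2)" by simp
    also have "\<dots> \<le> 10 * exp c * D\<^sup>2 * m'" using fp by (intro mult_left_mono) auto
    finally show ?thesis .
  qed
  have EY: "\<bar>expectation (\<lambda>\<omega>. f \<omega> * Y \<omega>)\<bar> \<le> D * m'"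
  proof -
    have "\<bar>expectation (\<lambda>\<omega>. f \<omega> * Y \<omega>)\<bar> \<le> expectation (\<lambda>\<omega>. \<bar>f \<omega> * Y \<omega>\<bar>)" by (rule integral_abs_bound)
    also have "\<dots> \<le> expectation (\<lambda>\<omega>. D * (\<bar>f \<omega>\<bar> * (p \<omega>)\<^sup>2))"
      using ifY fp fX by (intro integral_mono_AE) auto
    also have "\<dots> = D * expectation (\<lambda>\<omega>. \<bar>f \<omega>\<bar> * (p \<omega>)\<^sup>2)" by simp
    also have "\<dots> \<le> D * m'" using fp D by (intro mult_left_mono) auto
    finally show ?thesis .
  qed
  have z1: "\<bar>z - 1\<bar> \<le> exp c * (3 * D * m)"
  proof -
    have "z - 1 = expectation (\<lambda>\<omega>. exp (- X \<omega>) - 1)" using tm(1) by (simp add: z_def prob_space)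
    also have "\<bar>\<dots>\<bar> \<le> expectation (\<lambda>\<omega>. \<bar>exp (- X \<omega>) - 1\<bar>)" by (rule integral_abs_bound)
    also have "\<dots> \<le> expectation (\<lambda>\<omega>. exp c * \<bar>X \<omega>\<bar>)"
    proof (intro integral_mono_AE)
      show "AE \<omega> in M. \<bar>exp (- X \<omega>) - 1\<bar> \<le> exp c * \<bar>X \<omega>\<bar>"
        using cA by eventually_elim (rule exp_taylor2(1)[OF _ c])
    qed (use tm(1) iX in auto)
    also have "\<dots> \<le> exp c * (3 * D * m)" using aX by simp
    finally show ?thesis .
  qed
  show "expectation f = 0 \<Longrightarrow> ?goal"
  proof -
    assume Ef: "expectation f = 0"
    have "expectation R = expectation (\<lambda>\<omega>. f \<omega> * exp (- X \<omega>) - f \<omega> + f \<omega> * Y \<omega>)"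
      by (intro Bochner_Integration.integral_cong refl) (simp add: R_def algebra_simps)
    also have "\<dots> = expectation (\<lambda>\<omega>. f \<omega> * exp (- X \<omega>)) + expectation (\<lambda>\<omega>. f \<omega> * Y \<omega>)"
      using ife f0 ifY Ef by simp
    \<comment> \<open>Because f is centred, the difference of the two means is exactly the Taylor
      remainder plus a product of two quantities of order D.\<close>
    finally have "expectation (\<lambda>\<omega>. f \<omega> * exp (- X \<omega>)) / z + expectation (\<lambda>\<omega>. f \<omega> * Y \<omega>)
        = (1 / z) * (expectation R + (z - 1) * expectation (\<lambda>\<omega>. f \<omega> * Y \<omega>))"
      using zp by (simp add: field_simps)
    also have "\<bar>\<dots>\<bar> \<le> exp (6 * m) * ((10 * exp c * D\<^sup>2 * m') + (exp c * (3 * D * m)) * (D * m'))"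
      unfolding abs_mult
    proof (intro mult_mono)
      show "\<bar>expectation R + (z - 1) * expectation (\<lambda>\<omega>. f \<omega> * Y \<omega>)\<bar> \<le> 10 * exp c * D\<^sup>2 * m' + exp c * (3 * D * m) * (D * m')"
        by (rule order_trans[OF abs_triangle_ineq], unfold abs_mult, intro add_mono mult_mono)
           (use ER EY z1 D m1 in auto)
    qed (use iz zp in auto)
    also have "\<dots> = exp (6 * m) * (10 * exp c * m' + 3 * exp c * m * m') * D\<^sup>2"
      by (simp add: power2_eq_square algebra_simps)
    also have "\<dots> \<le> exp (6 * m) * (10 * exp c * m' + 6 * exp c * m * m') * D\<^sup>2"
      using m1 m'0 by (intro mult_right_mono mult_left_mono add_left_mono) auto
    finally show ?goal by (simp add: z_def)
  qed
  have "expectation (\<lambda>\<omega>. \<bar>f \<omega>\<bar> * exp (- X \<omega>)) \<le> expectation (\<lambda>\<omega>. exp c * (\<bar>f \<omega>\<bar> * (p \<omega>)\<^sup>2))"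
    using ife fe fp by (intro integral_mono_AE) (auto simp: abs_mult dest: integrable_abs)
  also have "\<dots> \<le> exp c * m'" using fp by simp
  finally have "expectation (\<lambda>\<omega>. \<bar>f \<omega>\<bar> * exp (- X \<omega>)) * (1 / z) \<le> (exp c * m') * exp (6 * m)"
    using iz zp m'0 by (intro mult_mono) auto
  then show "expectation (\<lambda>\<omega>. \<bar>f \<omega>\<bar> * exp (- X \<omega>)) / expectation (\<lambda>\<omega>. exp (- X \<omega>)) \<le> exp (6 * m) * exp c * m'"
    by (simp add: z_def algebra_simps)
qed

end

text \<open>
  The two branches cross at \<open>s * x\<^sup>2 = 1\<close>, the border between small and large fields. Under the
  rescaling \<open>x \<mapsto> w * x\<close>, \<open>s \<mapsto> w\<^sup>2 * s\<close> with \<open>w = sqrt L\<close> both grow at least by \<open>w\<^sup>7\<close>, while the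
  block sum in a renormalisation step only contributes \<open>w\<^sup>5\<close>.
\<close>

definition remainder :: "real \<Rightarrow> real \<Rightarrow> real" where
  "remainder s x = min (s ^ 3 * \<bar>x\<bar> ^ 5) (s\<^sup>2 * \<bar>x\<bar> ^ 3)"

text \<open>
  Only the logarithmic derivative of a weight is controlled, so multiplicative constants play no role;
  the leading part of \<open>u\<close> is the derivative of \<open>lh :\<phi>\<^sup>4: + r :\<phi>\<^sup>2:\<close>.
\<close>

definition rg_good where
  "rg_good G lh r A A' s g u \<longleftrightarrow> u \<in> borel_measurable borel \<and>
     (\<forall>x::real. 0 < g x \<and> (g has_real_derivative - (u x * g x)) (at x) \<and>
        \<bar>u x - (4 * lh * (x ^ 3 - 3 * G * x) + 2 * r * x)\<bar> \<le> A * s ^ 3 + A' * remainder s x)"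

definition quartic_incr :: "real \<Rightarrow> real \<Rightarrow> real \<Rightarrow> real \<Rightarrow> real \<Rightarrow> real" where
  "quartic_incr lh r G \<psi> z = lh * (6 * \<psi>\<^sup>2 * z\<^sup>2 + 4 * \<psi> * z ^ 3 + z ^ 4 - 6 * G * z\<^sup>2) + r * z\<^sup>2"

text \<open>The subtracted term is linear in z and adds up to zero over a block. It also vanishes at
  \<psi> = 0, where the function is the plain increment of \<open>- ln g\<close>.
  \<open>quartic_incr\<close> is its counterpart for the exact quartic weight.\<close>

definition site_incr :: "real \<Rightarrow> real \<Rightarrow> real \<Rightarrow> (real \<Rightarrow> real) \<Rightarrow> real \<Rightarrow> real \<Rightarrow> real" where
  "site_incr lh r G g \<psi> z = ln (g \<psi>) - ln (g (\<psi> + z)) - (4 * lh * (\<psi> ^ 3 - 3 * G * \<psi>) + 2 * r * \<psi>) * z"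

section \<open>Scaling and quasi-additivity of the remainder function\<close>

lemma remainder_nonneg: "s \<ge> 0 \<Longrightarrow> remainder s x \<ge> 0" by (simp add: remainder_def)

lemma remainder_le: "remainder s x \<le> s ^ 3 * \<bar>x\<bar> ^ 5" "remainder s x \<le> s\<^sup>2 * \<bar>x\<bar> ^ 3"
  by (simp_all add: remainder_def)

lemma remainder_mono: "s \<ge> 0 \<Longrightarrow> \<bar>x\<bar> \<le> \<bar>y\<bar> \<Longrightarrow> remainder s x \<le> remainder s y"
  unfolding remainder_def by (intro min.mono mult_left_mono power_mono) auto

lemma remainder_scale:
  assumes "s \<ge> 0" "k \<ge> 1" shows "remainder s (k * x) \<le> k ^ 5 * remainder s x"
proof -
  have k: "k ^ 3 \<le> k ^ 5" using assms by (intro power_increasing) auto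
  have "s\<^sup>2 * \<bar>k * x\<bar> ^ 3 = k ^ 3 * (s\<^sup>2 * \<bar>x\<bar> ^ 3)" using assms by (simp add: abs_mult power_mult_distrib)
  also have "\<dots> \<le> k ^ 5 * (s\<^sup>2 * \<bar>x\<bar> ^ 3)" using k assms by (intro mult_right_mono) auto
  finally have 1: "s\<^sup>2 * \<bar>k * x\<bar> ^ 3 \<le> k ^ 5 * (s\<^sup>2 * \<bar>x\<bar> ^ 3)" .
  have 2: "s ^ 3 * \<bar>k * x\<bar> ^ 5 = k ^ 5 * (s ^ 3 * \<bar>x\<bar> ^ 5)" using assms by (simp add: abs_mult power_mult_distrib)
  have e: "k ^ 5 * remainder s x = min (k ^ 5 * (s ^ 3 * \<bar>x\<bar> ^ 5)) (k ^ 5 * (s\<^sup>2 * \<bar>x\<bar> ^ 3))"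
    unfolding remainder_def using assms by (simp add: min_mult_distrib_left)
  show ?thesis unfolding e unfolding remainder_def by (intro min.mono) (use 1 2 in linarith)+
qed

text \<open>The factor of the first term must be close to 1: in a renormalisation step it multiplies
  w^5 and has to stay below w^7, which may be as small as 2 w^5. Splitting at
  \<open>\<bar>x\<bar> / 25\<close> works since (26/25)^5 is below 5/4; the second factor may be any
  constant.\<close>

lemma remainder_add:
  assumes s: "s \<ge> 0" shows "remainder s (x + z) \<le> 5 / 4 * remainder s x + 26 ^ 5 * remainder s z"
proof (cases "\<bar>z\<bar> \<le> \<bar>x\<bar> / 25")
  case True
  have "remainder s (x + z) \<le> remainder s (26 / 25 * x)" using True abs_triangle_ineq[of x z] by (intro remainder_mono s) (simp add: abs_mult)
  also have "\<dots> \<le> (26 / 25) ^ 5 * remainder s x" by (intro remainder_scale s) auto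
  also have "\<dots> \<le> 5 / 4 * remainder s x" by (intro mult_right_mono remainder_nonneg s) (auto simp: eval_nat_numeral)
  finally show ?thesis using remainder_nonneg[OF s, of z] by auto
next
  case False
  have "remainder s (x + z) \<le> remainder s (26 * z)" using False abs_triangle_ineq[of x z] by (intro remainder_mono s) (simp add: abs_mult)
  also have "\<dots> \<le> 26 ^ 5 * remainder s z" by (intro remainder_scale s) auto
  finally show ?thesis using remainder_nonneg[OF s, of x] by auto
qed

lemma remainder_small: "s > 0 \<Longrightarrow> s * x\<^sup>2 \<le> 1 \<Longrightarrow> remainder s x = s ^ 3 * \<bar>x\<bar> ^ 5"
proof -
  assume "s > 0" "s * x\<^sup>2 \<le> 1"
  then have "(s\<^sup>2 * \<bar>x\<bar> ^ 3) * (s * x\<^sup>2) \<le> (s\<^sup>2 * \<bar>x\<bar> ^ 3) * 1" by (intro mult_left_mono) auto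
  moreover have "(s\<^sup>2 * \<bar>x\<bar> ^ 3) * (s * x\<^sup>2) = s ^ 3 * \<bar>x\<bar> ^ 5"
    using power2_abs[of x, symmetric] by (simp only: power_add[symmetric]) (simp add: eval_nat_numeral)
  ultimately show ?thesis by (simp add: remainder_def)
qed

lemma remainder_large: "s > 0 \<Longrightarrow> s * x\<^sup>2 \<ge> 1 \<Longrightarrow> remainder s x = s\<^sup>2 * \<bar>x\<bar> ^ 3"
proof -
  assume "s > 0" "s * x\<^sup>2 \<ge> 1"
  then have "(s\<^sup>2 * \<bar>x\<bar> ^ 3) * 1 \<le> (s\<^sup>2 * \<bar>x\<bar> ^ 3) * (s * x\<^sup>2)" by (intro mult_left_mono) auto
  moreover have "(s\<^sup>2 * \<bar>x\<bar> ^ 3) * (s * x\<^sup>2) = s ^ 3 * \<bar>x\<bar> ^ 5"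
    using power2_abs[of x, symmetric] by (simp only: power_add[symmetric]) (simp add: eval_nat_numeral)
  ultimately show ?thesis by (simp add: remainder_def)
qed

lemma remainder_rescale:
  assumes "s \<ge> 0" "w \<ge> 1"
  shows "w ^ 7 * remainder s x \<le> remainder (w\<^sup>2 * s) (w * x)"
proof -
  have w: "w ^ 7 \<le> w ^ 11" using assms by (intro power_increasing) auto
  have "(w\<^sup>2 * s)\<^sup>2 * \<bar>w * x\<bar> ^ 3 = w ^ 7 * (s\<^sup>2 * \<bar>x\<bar> ^ 3)" using assms by (simp add: abs_mult eval_nat_numeral)
  moreover have "(w\<^sup>2 * s) ^ 3 * \<bar>w * x\<bar> ^ 5 = w ^ 11 * (s ^ 3 * \<bar>x\<bar> ^ 5)" using assms by (simp add: abs_mult eval_nat_numeral)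
  moreover have "w ^ 7 * (s ^ 3 * \<bar>x\<bar> ^ 5) \<le> w ^ 11 * (s ^ 3 * \<bar>x\<bar> ^ 5)" using w assms by (intro mult_right_mono) auto
  moreover have e: "w ^ 7 * remainder s x = min (w ^ 7 * (s ^ 3 * \<bar>x\<bar> ^ 5)) (w ^ 7 * (s\<^sup>2 * \<bar>x\<bar> ^ 3))"
    unfolding remainder_def using assms by (simp add: min_mult_distrib_left)
  ultimately show ?thesis unfolding e unfolding remainder_def by (intro min.mono) linarith+
qed

section \<open>Increments of a single site weight: expansion, stability and size\<close>

lemma add_cubed_le: "(p + q :: real) ^ 3 \<le> 4 * (p ^ 3 + q ^ 3)" if "p \<ge> 0" "q \<ge> 0"
proof -
  have "0 \<le> 3 * (p + q) * (p - q)\<^sup>2" using that by simp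
  then show ?thesis by (simp add: power2_eq_square power3_eq_cube algebra_simps)
qed

lemma add_fifth_le: "(p + q :: real) ^ 5 \<le> 32 * (p ^ 5 + q ^ 5)" if "p \<ge> 0" "q \<ge> 0"
proof -
  have "(p + q) ^ 5 \<le> (2 * max p q) ^ 5" using that by (intro power_mono) auto
  also have "\<dots> \<le> 32 * (p ^ 5 + q ^ 5)" using that by (auto simp: power_mult_distrib max_def)
  finally show ?thesis .
qed

text \<open>The smallness conditions make the errors cost only a fraction of the quartic part:
  \<open>A * s\<close> and \<open>A' * s\<close> turn the terms of the error that are large in z
  into at most s z^4 / 64 each, and \<open>A'\<^sup>2 * s\<close> allows the mixed term in \<psi>
  and z to be removed by completing a square.\<close>

locale rg_params =
  fixes A A' s lh r G :: real
  assumes A: "0 \<le> A" "0 \<le> A'" and s: "0 < s" "s \<le> 1" "A * s \<le> 1 / 64" "A' * s \<le> 1 / 256" "A'\<^sup>2 * s \<le> 1"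
    and lh: "s / 2 \<le> lh" "lh \<le> 2 * s" and r: "\<bar>r\<bar> \<le> s" and G: "0 \<le> G" "G \<le> 2"
begin

lemma s_sq: "s\<^sup>2 \<le> s"
  using s by (simp add: power2_eq_square mult_left_le)

lemma A_s_cubed: "A * s ^ 3 \<le> s\<^sup>2 / 64" "A' * s ^ 3 \<le> s\<^sup>2"
proof -
  have "(A * s) * s\<^sup>2 \<le> (1 / 64) * s\<^sup>2" using s by (intro mult_right_mono) auto
  then show "A * s ^ 3 \<le> s\<^sup>2 / 64" by (simp add: power2_eq_square power3_eq_cube)
  have "(A' * s) * s\<^sup>2 \<le> 1 * s\<^sup>2" using s by (intro mult_right_mono) auto
  then show "A' * s ^ 3 \<le> s\<^sup>2" by (simp add: power2_eq_square power3_eq_cube)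
qed

lemma abs_le_quartic: "\<bar>z\<bar> \<le> 1 + z ^ 4" for z :: real
proof -
  have "0 \<le> (\<bar>z\<bar> - 1)\<^sup>2" "0 \<le> (z\<^sup>2 - 1)\<^sup>2" by auto
  then have "2 * \<bar>z\<bar> \<le> z\<^sup>2 + 1" "2 * z\<^sup>2 \<le> z ^ 4 + 1" by (auto simp: power2_diff power_mult[symmetric])
  moreover have "0 \<le> z ^ 4" by simp
  ultimately show ?thesis by linarith
qed

text \<open>Mean value theorem for \<open>- ln g\<close> minus its leading polynomial. The
  derivative of the difference is exactly the error in \<open>u\<close>, and the error is monotone
  in the absolute value of the field.\<close>

lemma site_expansion:
  assumes g: "rg_good G lh r A A' s g u"
  shows "\<bar>site_incr lh r G g \<psi> z - quartic_incr lh r G \<psi> z\<bar> \<le> \<bar>z\<bar> * (A * s ^ 3 + A' * remainder s (\<bar>\<psi>\<bar> + \<bar>z\<bar>))"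
proof -
  define k where "k x = - ln (g x) - lh * (x ^ 4 - 6 * G * x\<^sup>2) - r * x\<^sup>2" for x
  define S where "S = {- (\<bar>\<psi>\<bar> + \<bar>z\<bar>)..\<bar>\<psi>\<bar> + \<bar>z\<bar>}"
  have gp: "g x > 0" and gd: "(g has_real_derivative - (u x * g x)) (at x)"
    and ge: "\<bar>u x - (4 * lh * (x ^ 3 - 3 * G * x) + 2 * r * x)\<bar> \<le> A * s ^ 3 + A' * remainder s x" for x
    using g by (auto simp: rg_good_def)
  have d: "(k has_real_derivative (u x - (4 * lh * (x ^ 3 - 3 * G * x) + 2 * r * x))) (at x within S)" for x
    unfolding k_def
    by (rule has_field_derivative_at_within)
       (auto intro!: derivative_eq_intros gd simp: gp less_imp_neq[OF gp, symmetric] field_simps power2_eq_square power3_eq_cube)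
  have "norm (k (\<psi> + z) - k \<psi>) \<le> (A * s ^ 3 + A' * remainder s (\<bar>\<psi>\<bar> + \<bar>z\<bar>)) * norm ((\<psi> + z) - \<psi>)"
  proof (rule field_differentiable_bound[of S k "\<lambda>x. u x - (4 * lh * (x ^ 3 - 3 * G * x) + 2 * r * x)", OF _ d])
    fix x assume "x \<in> S"
    then have "remainder s x \<le> remainder s (\<bar>\<psi>\<bar> + \<bar>z\<bar>)" using s by (intro remainder_mono) (auto simp: S_def)
    then show "norm (u x - (4 * lh * (x ^ 3 - 3 * G * x) + 2 * r * x)) \<le> A * s ^ 3 + A' * remainder s (\<bar>\<psi>\<bar> + \<bar>z\<bar>)"
      using ge[of x] mult_left_mono[of "remainder s x" "remainder s (\<bar>\<psi>\<bar> + \<bar>z\<bar>)" A'] A by simp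
  qed (auto simp: S_def)
  moreover have "k (\<psi> + z) - k \<psi> = site_incr lh r G g \<psi> z - quartic_incr lh r G \<psi> z"
    by (simp add: k_def site_incr_def quartic_incr_def eval_nat_numeral algebra_simps)
  ultimately show ?thesis by (simp add: mult.commute)
qed

text \<open>The cubic branch of \<open>remainder\<close> is the one that remains comparable with the
  quartic weight for large z: times z it is of degree four.\<close>

lemma remainder_cubic:
  "\<bar>z\<bar> * (A * s ^ 3 + A' * remainder s (\<bar>\<psi>\<bar> + \<bar>z\<bar>))
     \<le> \<bar>z\<bar> * (A * s ^ 3) + 4 * A' * s\<^sup>2 * \<bar>\<psi>\<bar> ^ 3 * \<bar>z\<bar> + s * z ^ 4 / 64"
proof -
  have "remainder s (\<bar>\<psi>\<bar> + \<bar>z\<bar>) \<le> s\<^sup>2 * (\<bar>\<psi>\<bar> + \<bar>z\<bar>) ^ 3"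
    using remainder_le(2)[of s "\<bar>\<psi>\<bar> + \<bar>z\<bar>"] by simp
  also have "\<dots> \<le> s\<^sup>2 * (4 * (\<bar>\<psi>\<bar> ^ 3 + \<bar>z\<bar> ^ 3))" by (intro mult_left_mono add_cubed_le) auto
  finally have "remainder s (\<bar>\<psi>\<bar> + \<bar>z\<bar>) \<le> s\<^sup>2 * (4 * (\<bar>\<psi>\<bar> ^ 3 + \<bar>z\<bar> ^ 3))" .
  then have "\<bar>z\<bar> * (A * s ^ 3 + A' * remainder s (\<bar>\<psi>\<bar> + \<bar>z\<bar>)) \<le> \<bar>z\<bar> * (A * s ^ 3 + A' * (s\<^sup>2 * (4 * (\<bar>\<psi>\<bar> ^ 3 + \<bar>z\<bar> ^ 3))))"
    using A by (intro mult_left_mono add_left_mono) auto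
  also have "\<dots> = \<bar>z\<bar> * (A * s ^ 3) + 4 * A' * s\<^sup>2 * \<bar>\<psi>\<bar> ^ 3 * \<bar>z\<bar> + (A' * s) * (4 * s * z ^ 4)"
  proof -
    have "\<bar>z\<bar> * \<bar>z\<bar> ^ 3 = z ^ 4" by (simp add: eval_nat_numeral abs_mult[symmetric])
    then have "A' * s\<^sup>2 * 4 * (\<bar>z\<bar> * \<bar>z\<bar> ^ 3) = (A' * s) * (4 * s * z ^ 4)" by (simp add: power2_eq_square)
    then show ?thesis by (simp add: algebra_simps)
  qed
  also have "(A' * s) * (4 * s * z ^ 4) \<le> (1 / 256) * (4 * s * z ^ 4)" using s by (intro mult_right_mono) auto
  finally show ?thesis by simp
qed

text \<open>Stability of the interaction. Out of the coercivity s/8 of the quartic form, the Wick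
  and mass terms and the error terms are paid, leaving s/32. The loss
  \<open>64 * s\<^sup>2 * \<psi> ^ 4\<close> is bounded for small fields, and for large fields it
  has the size of the upper bound for the mean interaction.\<close>

lemma site_lower:
  assumes g: "rg_good G lh r A A' s g u"
  shows "site_incr lh r G g \<psi> z \<ge> s / 32 * (\<psi>\<^sup>2 * z\<^sup>2 + z ^ 4) - 6000 * s - 64 * s\<^sup>2 * \<psi> ^ 4"
proof -
  have 1: "lh * (6 * \<psi>\<^sup>2 * z\<^sup>2 + 4 * \<psi> * z ^ 3 + z ^ 4) \<ge> s / 8 * (\<psi>\<^sup>2 * z\<^sup>2 + z ^ 4)"
  proof -
    \<comment> \<open>Completing the square in z; the form 6 \<psi>^2 + 4 \<psi> z + z^2 is positive
      definite with room for a quarter of \<psi>^2 + z^2.\<close>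
    have e: "6 * \<psi>\<^sup>2 * z\<^sup>2 + 4 * \<psi> * z ^ 3 + z ^ 4 - (\<psi>\<^sup>2 * z\<^sup>2 + z ^ 4) / 4
       = z\<^sup>2 * (3 / 4 * (z + 8 / 3 * \<psi>)\<^sup>2 + 5 / 12 * \<psi>\<^sup>2)"
      by (simp add: eval_nat_numeral field_simps)
    have "6 * \<psi>\<^sup>2 * z\<^sup>2 + 4 * \<psi> * z ^ 3 + z ^ 4 - (\<psi>\<^sup>2 * z\<^sup>2 + z ^ 4) / 4 \<ge> 0"
      unfolding e by (intro mult_nonneg_nonneg add_nonneg_nonneg) auto
    then have le: "6 * \<psi>\<^sup>2 * z\<^sup>2 + 4 * \<psi> * z ^ 3 + z ^ 4 \<ge> (\<psi>\<^sup>2 * z\<^sup>2 + z ^ 4) / 4" by simp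
    have "s / 2 * ((\<psi>\<^sup>2 * z\<^sup>2 + z ^ 4) / 4) \<le> lh * (6 * \<psi>\<^sup>2 * z\<^sup>2 + 4 * \<psi> * z ^ 3 + z ^ 4)"
      using lh s le by (intro mult_mono) auto
    then show ?thesis by simp
  qed
  \<comment> \<open>25 is 24 + 1: the Wick term has coefficient at most 6 * 2 s * 2, the mass at
    most s.\<close>
  have 2: "- 6 * lh * G * z\<^sup>2 + r * z\<^sup>2 \<ge> - 25 * s * z\<^sup>2"
  proof -
    have "lh * G \<le> (2 * s) * 2" using lh s G by (intro mult_mono) auto
    then have "6 * (lh * G) - r \<le> 25 * s" using r by auto
    then have "(6 * (lh * G) - r) * z\<^sup>2 \<le> 25 * s * z\<^sup>2" by (intro mult_right_mono) auto
    then show ?thesis by (simp add: algebra_simps)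
  qed
  have 3: "25 * z\<^sup>2 \<le> z ^ 4 / 32 + 5000"
    using zero_le_power2[of "z\<^sup>2 - 400"] by (simp add: power2_diff power_mult[symmetric])
  have h3: "25 * s * z\<^sup>2 \<le> s * z ^ 4 / 32 + 5000 * s"
    using mult_left_mono[OF 3, of s] s by (simp add: algebra_simps)
  have 4: "\<bar>z\<bar> * (A * s ^ 3) \<le> s * (1 + z ^ 4) / 64"
  proof -
    have "A * s ^ 3 \<le> s / 64" using A_s_cubed s_sq by linarith
    then have "\<bar>z\<bar> * (A * s ^ 3) \<le> (1 + z ^ 4) * (s / 64)"
      using A s abs_le_quartic[of z] by (intro mult_mono) auto
    then show ?thesis by (simp add: mult.commute)
  qed
  have 5: "4 * A' * s\<^sup>2 * \<bar>\<psi>\<bar> ^ 3 * \<bar>z\<bar> \<le> s / 16 * (\<psi>\<^sup>2 * z\<^sup>2) + 64 * s\<^sup>2 * \<psi> ^ 4"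
  proof -
    \<comment> \<open>The weight 32 in the square leaves half of the coercivity in \<psi>^2 z^2 and
      produces the constant 64, since 1024 / 16 = 64.\<close>
    have sq: "s * (p * q - 32 * a * s * p\<^sup>2)\<^sup>2 = s * (p * q)\<^sup>2 - 64 * (a * s\<^sup>2 * p ^ 3 * q) + 1024 * ((a\<^sup>2 * s) * (s\<^sup>2 * p ^ 4))"
      for p q a :: real
      by (simp add: power2_diff power_mult_distrib) (simp add: eval_nat_numeral algebra_simps)
    have "0 \<le> s * (\<bar>\<psi>\<bar> * \<bar>z\<bar> - 32 * A' * s * \<bar>\<psi>\<bar>\<^sup>2)\<^sup>2" using s by simp
    then have "64 * (A' * s\<^sup>2 * \<bar>\<psi>\<bar> ^ 3 * \<bar>z\<bar>) \<le> s * (\<psi>\<^sup>2 * z\<^sup>2) + 1024 * ((A'\<^sup>2 * s) * (s\<^sup>2 * \<psi> ^ 4))"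
      unfolding sq by (simp add: power_mult_distrib power_even_abs)
    then have "4 * A' * s\<^sup>2 * \<bar>\<psi>\<bar> ^ 3 * \<bar>z\<bar> \<le> s / 16 * (\<psi>\<^sup>2 * z\<^sup>2) + (A'\<^sup>2 * s) * (64 * s\<^sup>2 * \<psi> ^ 4)"
      by simp
    also have "(A'\<^sup>2 * s) * (64 * s\<^sup>2 * \<psi> ^ 4) \<le> 1 * (64 * s\<^sup>2 * \<psi> ^ 4)" using s by (intro mult_right_mono) auto
    finally show ?thesis by simp
  qed
  have "site_incr lh r G g \<psi> z \<ge> quartic_incr lh r G \<psi> z - \<bar>z\<bar> * (A * s ^ 3 + A' * remainder s (\<bar>\<psi>\<bar> + \<bar>z\<bar>))"
    using site_expansion[OF g, of \<psi> z] by linarith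
  moreover have "quartic_incr lh r G \<psi> z = lh * (6 * \<psi>\<^sup>2 * z\<^sup>2 + 4 * \<psi> * z ^ 3 + z ^ 4) + (- 6 * lh * G * z\<^sup>2 + r * z\<^sup>2)"
    by (simp add: quartic_incr_def algebra_simps)
  moreover define P R where "P = s * (\<psi>\<^sup>2 * z\<^sup>2)" and "R = s * z ^ 4"
  moreover have "0 \<le> P" "0 \<le> R" using s by (auto simp: P_def R_def)
  moreover have "s / 32 * (\<psi>\<^sup>2 * z\<^sup>2 + z ^ 4) = P / 32 + R / 32" "s / 8 * (\<psi>\<^sup>2 * z\<^sup>2 + z ^ 4) = P / 8 + R / 8"
    "s * (1 + z ^ 4) / 64 = s / 64 + R / 64" "s / 16 * (\<psi>\<^sup>2 * z\<^sup>2) = P / 16"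
    by (simp_all add: P_def R_def algebra_simps)
  ultimately show ?thesis using 1 2 h3 4 5 remainder_cubic[of z \<psi>] s by linarith
qed

lemma quartic_incr_abs: "\<bar>quartic_incr lh r G \<psi> z\<bar> \<le> 40 * s * (1 + \<psi>\<^sup>2) * (1 + z\<^sup>2)\<^sup>2"
proof -
  define t where "t = (1 + z\<^sup>2)\<^sup>2"
  have t: "z\<^sup>2 \<le> t" "z ^ 4 \<le> t" "t \<ge> 1" by (auto simp: t_def power2_sum power_mult[symmetric])
  have "\<bar>\<psi> * z ^ 3\<bar> \<le> (\<psi>\<^sup>2 * z\<^sup>2 + z ^ 4) / 2"
  proof -
    have "2 * (\<bar>\<psi>\<bar> * \<bar>z\<bar>) * z\<^sup>2 \<le> (\<bar>\<psi>\<bar> * \<bar>z\<bar>)\<^sup>2 + (z\<^sup>2)\<^sup>2" by (rule sum_squares_bound)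
    then show ?thesis by (simp add: abs_mult power_mult_distrib power_mult[symmetric] eval_nat_numeral algebra_simps)
  qed
  note a = this
  have "\<bar>6 * \<psi>\<^sup>2 * z\<^sup>2 + 4 * \<psi> * z ^ 3 + z ^ 4 - 6 * G * z\<^sup>2\<bar> \<le> 8 * (\<psi>\<^sup>2 * z\<^sup>2) + 3 * z ^ 4 + 6 * (G * z\<^sup>2)"
  proof -
    define P W V where "P = \<psi>\<^sup>2 * z\<^sup>2" and "W = \<psi> * z ^ 3" and "V = G * z\<^sup>2"
    have "0 \<le> V" "0 \<le> P" "0 \<le> z ^ 4" using G by (auto simp: P_def V_def)
    moreover have "W \<le> (P + z ^ 4) / 2" "- W \<le> (P + z ^ 4) / 2"
      using a unfolding P_def W_def by (auto simp only: abs_le_iff)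
    moreover have eq: "6 * \<psi>\<^sup>2 * z\<^sup>2 + 4 * \<psi> * z ^ 3 + z ^ 4 - 6 * G * z\<^sup>2 = 6 * P + 4 * W + z ^ 4 - 6 * V"
      by (simp add: P_def W_def V_def)
    ultimately show ?thesis unfolding eq P_def[symmetric] V_def[symmetric] by (simp add: abs_le_iff)
  qed
  also have "\<dots> \<le> 8 * (\<psi>\<^sup>2 * t) + 3 * t + 6 * (2 * t)"
    using t G by (intro add_mono mult_left_mono mult_mono) auto
  also have "\<dots> \<le> 16 * ((1 + \<psi>\<^sup>2) * t)"
  proof -
    have "0 \<le> \<psi>\<^sup>2 * t" using t by auto
    then show ?thesis using t by (simp add: algebra_simps)
  qed
  finally have "\<bar>lh\<bar> * \<bar>6 * \<psi>\<^sup>2 * z\<^sup>2 + 4 * \<psi> * z ^ 3 + z ^ 4 - 6 * G * z\<^sup>2\<bar> \<le> 2 * s * (16 * ((1 + \<psi>\<^sup>2) * t))"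
    using lh s by (intro mult_mono) auto
  moreover have "\<bar>r\<bar> * z\<^sup>2 \<le> s * ((1 + \<psi>\<^sup>2) * t)"
  proof (intro mult_mono r)
    have "0 \<le> \<psi>\<^sup>2 * t" using t by auto
    then show "z\<^sup>2 \<le> (1 + \<psi>\<^sup>2) * t" unfolding distrib_right using t by linarith
  qed (use s in auto)
  moreover have "0 \<le> s * ((1 + \<psi>\<^sup>2) * t)" using s t by auto
  moreover have "\<bar>lh * Y + r * z\<^sup>2\<bar> \<le> \<bar>lh\<bar> * \<bar>Y\<bar> + \<bar>r\<bar> * z\<^sup>2" for Y
    using abs_triangle_ineq[of "lh * Y" "r * z\<^sup>2"] by (simp only: abs_mult abs_power2)
  moreover have "2 * s * (16 * ((1 + \<psi>\<^sup>2) * t)) = 32 * (s * ((1 + \<psi>\<^sup>2) * t))"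
    "40 * s * (1 + \<psi>\<^sup>2) * t = 40 * (s * ((1 + \<psi>\<^sup>2) * t))" by simp_all
  ultimately show ?thesis unfolding quartic_incr_def t_def[symmetric]
    by (smt (verit))
qed

lemma site_abs:
  assumes g: "rg_good G lh r A A' s g u"
  shows "\<bar>site_incr lh r G g \<psi> z\<bar> \<le> 100 * (s + s * \<psi>\<^sup>2 + s\<^sup>2 * \<psi> ^ 4) * (1 + z\<^sup>2)\<^sup>2"
proof -
  define t where "t = (1 + z\<^sup>2)\<^sup>2"
  have t: "z\<^sup>2 \<le> t" "z ^ 4 \<le> t" "t \<ge> 1" by (auto simp: t_def power2_sum power_mult[symmetric])
  have zt: "\<bar>z\<bar> \<le> t"
  proof -
    have "2 * \<bar>z\<bar> \<le> z\<^sup>2 + 1" using zero_le_power2[of "\<bar>z\<bar> - 1"] by (simp add: power2_diff)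
    moreover have "t = 1 + 2 * z\<^sup>2 + z ^ 4" by (simp add: t_def power2_sum power_mult[symmetric])
    moreover have "0 \<le> z ^ 4" "0 \<le> z\<^sup>2" by simp_all
    ultimately show ?thesis by linarith
  qed
  have "\<bar>z\<bar> * (A * s ^ 3) \<le> t * s"
  proof (intro mult_mono zt)
    show "A * s ^ 3 \<le> s" using A_s_cubed s_sq zero_le_power2[of s] by linarith
  qed (use t A s in auto)
  moreover have "4 * A' * s\<^sup>2 * \<bar>\<psi>\<bar> ^ 3 * \<bar>z\<bar> \<le> 2 * (s * \<psi>\<^sup>2 + s\<^sup>2 * \<psi> ^ 4) * t"
  proof (rule mult_mono[OF _ zt])
    have "0 \<le> s * (\<bar>\<psi>\<bar> - A' * s * \<bar>\<psi>\<bar>\<^sup>2)\<^sup>2" using s by auto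
    also have "\<dots> = s * \<bar>\<psi>\<bar>\<^sup>2 + (A'\<^sup>2 * s) * (s\<^sup>2 * \<bar>\<psi>\<bar> ^ 4) - 2 * A' * s\<^sup>2 * \<bar>\<psi>\<bar> ^ 3"
      by (simp add: power2_diff power_mult_distrib) (simp add: eval_nat_numeral algebra_simps)
    finally have "2 * A' * s\<^sup>2 * \<bar>\<psi>\<bar> ^ 3 \<le> s * \<psi>\<^sup>2 + (A'\<^sup>2 * s) * (s\<^sup>2 * \<psi> ^ 4)" by (simp add: power_even_abs)
    also have "(A'\<^sup>2 * s) * (s\<^sup>2 * \<psi> ^ 4) \<le> 1 * (s\<^sup>2 * \<psi> ^ 4)" using s by (intro mult_right_mono) auto
    finally show "4 * A' * s\<^sup>2 * \<bar>\<psi>\<bar> ^ 3 \<le> 2 * (s * \<psi>\<^sup>2 + s\<^sup>2 * \<psi> ^ 4)" by simp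
  qed (use s in auto)
  moreover have "s * z ^ 4 / 64 \<le> s * t" using t s mult_left_mono[OF t(2), of s] by auto
  moreover have "\<bar>site_incr lh r G g \<psi> z\<bar> \<le> \<bar>quartic_incr lh r G \<psi> z\<bar> + \<bar>z\<bar> * (A * s ^ 3 + A' * remainder s (\<bar>\<psi>\<bar> + \<bar>z\<bar>))"
    using site_expansion[OF g, of \<psi> z] by linarith
  moreover define a b c where "a = s * t" and "b = s * \<psi>\<^sup>2 * t" and "c = s\<^sup>2 * \<psi> ^ 4 * t"
  moreover have "0 \<le> a" "0 \<le> b" "0 \<le> c" using s t by (auto simp: a_def b_def c_def)
  moreover have "t * s = a" "2 * (s * \<psi>\<^sup>2 + s\<^sup>2 * \<psi> ^ 4) * t = 2 * b + 2 * c"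
    "40 * s * (1 + \<psi>\<^sup>2) * t = 40 * a + 40 * b"
    "100 * (s + s * \<psi>\<^sup>2 + s\<^sup>2 * \<psi> ^ 4) * t = 100 * a + 100 * b + 100 * c"
    by (simp_all add: a_def b_def c_def algebra_simps)
  ultimately show ?thesis
    using quartic_incr_abs[of \<psi> z] remainder_cubic[of z \<psi>] unfolding t_def[symmetric]
    by linarith
qed

text \<open>For small fields the quintic branch is used. The bound
  \<open>A' * s * \<bar>\<psi>\<bar> \<le> 1\<close>, a consequence of
  \<open>A'\<^sup>2 * s \<le> 1\<close> and \<open>s * \<psi>\<^sup>2 \<le> 1\<close>, turns the
  third order term with \<psi>^5 into one of second order with \<psi>^4, without leaving A' in the
  constant.\<close>

lemma site_small:
  assumes g: "rg_good G lh r A A' s g u" and small: "s * \<psi>\<^sup>2 \<le> 1"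
  shows "\<bar>site_incr lh r G g \<psi> z - quartic_incr lh r G \<psi> z\<bar> \<le> 65 * (s * (1 + \<psi>\<^sup>2))\<^sup>2 * (1 + z\<^sup>2) ^ 4"
proof -
  define t where "t = 1 + z\<^sup>2"
  define D where "D = s * (1 + \<psi>\<^sup>2)"
  have t: "t \<ge> 1" by (simp add: t_def)
  have zt: "\<bar>z\<bar> \<le> t"
  proof -
    have "2 * \<bar>z\<bar> \<le> z\<^sup>2 + 1" using zero_le_power2[of "\<bar>z\<bar> - 1"] by (simp add: power2_diff)
    then show ?thesis using zero_le_power2[of z] unfolding t_def by linarith
  qed
  have sD: "s\<^sup>2 \<le> D\<^sup>2" "s\<^sup>2 * \<psi> ^ 4 \<le> D\<^sup>2"
    using s by (auto simp: D_def power_mult_distrib power2_sum power_mult[symmetric])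
  have 1: "A * s ^ 3 \<le> D\<^sup>2"
    using A_s_cubed sD zero_le_power2[of s] by linarith
  have 2: "A' * s ^ 3 * \<bar>\<psi>\<bar> ^ 5 \<le> D\<^sup>2"
  proof -
    have "(A' * s * \<bar>\<psi>\<bar>)\<^sup>2 = (A'\<^sup>2 * s) * (s * \<psi>\<^sup>2)" by (simp add: power_mult_distrib power2_eq_square)
    also have "\<dots> \<le> 1 * 1" using s small by (intro mult_mono) auto
    finally have "A' * s * \<bar>\<psi>\<bar> \<le> 1" using power2_le_imp_le[of "A' * s * \<bar>\<psi>\<bar>" 1] by auto
    then have "(A' * s * \<bar>\<psi>\<bar>) * (s\<^sup>2 * \<psi> ^ 4) \<le> 1 * (s\<^sup>2 * \<psi> ^ 4)" by (intro mult_right_mono) auto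
    moreover have "(A' * s * \<bar>\<psi>\<bar>) * (s\<^sup>2 * \<psi> ^ 4) = A' * s ^ 3 * \<bar>\<psi>\<bar> ^ 5"
      unfolding power_even_abs[of 4 \<psi>, symmetric, simplified] by (simp add: eval_nat_numeral)
    ultimately show ?thesis using sD by simp
  qed
  have 3: "A' * s ^ 3 * \<bar>z\<bar> ^ 5 \<le> D\<^sup>2 * t ^ 3"
  proof -
    have "A' * s ^ 3 \<le> D\<^sup>2" using A_s_cubed sD by linarith
    moreover have "\<bar>z\<bar> ^ 5 \<le> t ^ 3"
    proof -
      have "\<bar>z\<bar> * (z\<^sup>2)\<^sup>2 \<le> t * t\<^sup>2" using zt by (intro mult_mono power_mono) (auto simp: t_def)
      then show ?thesis unfolding power2_abs[of z, symmetric] by (simp add: eval_nat_numeral mult.assoc)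
    qed
    ultimately show ?thesis using A s by (intro mult_mono) auto
  qed
  have "remainder s (\<bar>\<psi>\<bar> + \<bar>z\<bar>) \<le> s ^ 3 * (\<bar>\<psi>\<bar> + \<bar>z\<bar>) ^ 5"
    using remainder_le(1)[of s "\<bar>\<psi>\<bar> + \<bar>z\<bar>"] by simp
  also have "\<dots> \<le> s ^ 3 * (32 * (\<bar>\<psi>\<bar> ^ 5 + \<bar>z\<bar> ^ 5))" using s by (intro mult_left_mono add_fifth_le) auto
  finally have "A' * remainder s (\<bar>\<psi>\<bar> + \<bar>z\<bar>) \<le> A' * (s ^ 3 * (32 * (\<bar>\<psi>\<bar> ^ 5 + \<bar>z\<bar> ^ 5)))"
    using A by (intro mult_left_mono) auto
  also have "\<dots> \<le> 32 * (D\<^sup>2 + D\<^sup>2 * t ^ 3)" using 2 3 by (simp add: algebra_simps)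
  finally have "A * s ^ 3 + A' * remainder s (\<bar>\<psi>\<bar> + \<bar>z\<bar>) \<le> D\<^sup>2 * (33 + 32 * t ^ 3)" using 1 by (simp add: algebra_simps)
  also have "\<dots> \<le> D\<^sup>2 * (65 * t ^ 3)" using one_le_power[OF t, of 3] by (intro mult_left_mono) auto
  finally have "\<bar>z\<bar> * (A * s ^ 3 + A' * remainder s (\<bar>\<psi>\<bar> + \<bar>z\<bar>)) \<le> t * (D\<^sup>2 * (65 * t ^ 3))"
    using zt A s remainder_nonneg[of s "\<bar>\<psi>\<bar> + \<bar>z\<bar>"] by (intro mult_mono) auto
  also have "\<dots> = 65 * D\<^sup>2 * t ^ 4" by (simp add: eval_nat_numeral)
  finally show ?thesis using site_expansion[OF g, of \<psi> z] by (simp add: t_def D_def)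
qed

end

text \<open>
  The error constants depend on the block size only. In \<open>rg_good\<close> first \<open>A'\<close> is chosen from
  \<open>lead_const\<close>, then \<open>A\<close> from \<open>A'\<close> and \<open>feed_const\<close>, and last the range of \<open>s\<close>.
\<close>

definition small_const :: "real \<Rightarrow> real" where
  "small_const b = (let m = 65 * b * moment_bound b 4; m' = (65 * b)\<^sup>2 * moment_bound b 12; c = 6064 * b
     in exp (6 * m) * (10 * exp c * m' + 6 * exp c * m * m') + exp (6 * m) * exp c * m')"

definition large_const :: "real \<Rightarrow> real" where
  "large_const b = 32 * b * (300 * moment_bound b 2 + 6064)"

definition lead_const :: "real \<Rightarrow> real" where
  "lead_const b = 128 * b * small_const b + 8 * (4 * large_const b + 273 * b)"

definition feed_const :: "real \<Rightarrow> real" where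
  "feed_const b = 26 ^ 5 * (b * small_const b + large_const b)"

text \<open>\<psi> is the rescaled coarse field that all sites of the block share. The weights may
  differ from site to site, which spares comparing the laws of different blocks; only the parameters
  of \<open>rg_good\<close> are common.\<close>

locale tilted_block = gaussian_block M I Z + rg_params A A' s lh r G
  for M :: "'w measure" and I :: "'i set" and Z A A' s lh r G +
  fixes g u :: "'i \<Rightarrow> real \<Rightarrow> real" and \<psi> :: real
  assumes good: "\<And>y. y \<in> I \<Longrightarrow> rg_good G lh r A A' s (g y) (u y)"
begin

lemma g_pos: "y \<in> I \<Longrightarrow> 0 < g y x" and g_deriv: "y \<in> I \<Longrightarrow> (g y has_real_derivative - (u y x * g y x)) (at x)"
  and u_err: "y \<in> I \<Longrightarrow> \<bar>u y x - (4 * lh * (x ^ 3 - 3 * G * x) + 2 * r * x)\<bar> \<le> A * s ^ 3 + A' * remainder s x"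
  and u_meas[measurable]: "y \<in> I \<Longrightarrow> u y \<in> borel_measurable borel"
  using good[of y] by (auto simp: rg_good_def)

lemma g_meas[measurable]: "y \<in> I \<Longrightarrow> g y \<in> borel_measurable borel"
  by (intro borel_measurable_continuous_onI continuous_at_imp_continuous_on ballI)
     (use g_deriv DERIV_isCont in blast)

definition "X \<omega> = (\<Sum>y\<in>I. ln (g y \<psi>) - ln (g y (\<psi> + Z y \<omega>)))"

lemma X_meas[measurable]: "X \<in> borel_measurable M"
  unfolding X_def by (intro borel_measurable_sum borel_measurable_diff borel_measurable_const borel_measurable_ln measurable_compose[OF _ g_meas]) auto

lemma exp_X: "(\<Prod>y\<in>I. g y (\<psi> + Z y \<omega>)) = (\<Prod>y\<in>I. g y \<psi>) * exp (- X \<omega>)"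
proof -
  have "exp (- X \<omega>) = exp (\<Sum>y\<in>I. ln (g y (\<psi> + Z y \<omega>)) - ln (g y \<psi>))"
    unfolding X_def by (simp add: sum_negf[symmetric])
  also have "\<dots> = (\<Prod>y\<in>I. g y (\<psi> + Z y \<omega>) / g y \<psi>)"
    unfolding exp_sum[OF finite_I] by (intro prod.cong refl) (simp add: exp_diff g_pos)
  finally show ?thesis using finite_I g_pos by (simp add: prod_dividef prod_zero_iff less_imp_neq[symmetric])
qed

lemma X_split: "Q 1 \<omega> = 0 \<Longrightarrow> X \<omega> = (\<Sum>y\<in>I. site_incr lh r G (g y) \<psi> (Z y \<omega>))"
  unfolding X_def site_incr_def by (simp add: sum_subtractf sum_distrib_left[symmetric] Q_def)

lemma X1_split: "X1 lh r G \<psi> \<omega> = (\<Sum>y\<in>I. quartic_incr lh r G \<psi> (Z y \<omega>))"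
  unfolding X1_def quartic_incr_def Q_def by (simp add: sum.distrib sum_subtractf sum_distrib_left algebra_simps)

lemma X_lower: "AE \<omega> in M. X \<omega> \<ge> s / 32 * (\<psi>\<^sup>2 * Q 2 \<omega> + Q 4 \<omega>) - b * (6000 * s + 64 * s\<^sup>2 * \<psi> ^ 4)"
  using Q1_AE
proof eventually_elim
  case (elim \<omega>)
  have "(\<Sum>y\<in>I. s / 32 * (\<psi>\<^sup>2 * (Z y \<omega>)\<^sup>2 + Z y \<omega> ^ 4) - 6000 * s - 64 * s\<^sup>2 * \<psi> ^ 4) \<le> X \<omega>"
    unfolding X_split[OF elim] by (intro sum_mono site_lower[OF good])
  moreover have "(\<Sum>y\<in>I. s / 32 * (\<psi>\<^sup>2 * (Z y \<omega>)\<^sup>2 + Z y \<omega> ^ 4) - 6000 * s - 64 * s\<^sup>2 * \<psi> ^ 4)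
     = s / 32 * (\<psi>\<^sup>2 * Q 2 \<omega> + Q 4 \<omega>) - b * (6000 * s + 64 * s\<^sup>2 * \<psi> ^ 4)"
    unfolding sum_subtractf sum_distrib_left[symmetric] sum.distrib Q_def by (simp add: algebra_simps)
  ultimately show ?case by simp
qed

lemma X_abs: "AE \<omega> in M. \<bar>X \<omega>\<bar> \<le> (100 * b * (s + s * \<psi>\<^sup>2 + s\<^sup>2 * \<psi> ^ 4)) * \<rho> \<omega> ^ 2"
  using Q1_AE
proof eventually_elim
  case (elim \<omega>)
  have "\<bar>X \<omega>\<bar> \<le> (\<Sum>y\<in>I. \<bar>site_incr lh r G (g y) \<psi> (Z y \<omega>)\<bar>)"
    unfolding X_split[OF elim] by (rule sum_abs)
  also have "\<dots> \<le> (\<Sum>y\<in>I. 100 * (s + s * \<psi>\<^sup>2 + s\<^sup>2 * \<psi> ^ 4) * \<rho> \<omega> ^ 2)"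
  proof (intro sum_mono)
    fix y assume y: "y \<in> I"
    show "\<bar>site_incr lh r G (g y) \<psi> (Z y \<omega>)\<bar> \<le> 100 * (s + s * \<psi>\<^sup>2 + s\<^sup>2 * \<psi> ^ 4) * \<rho> \<omega> ^ 2"
      by (rule order_trans[OF site_abs[OF good[OF y]]])
         (use s Z_le_\<rho>[OF y] in \<open>auto intro!: mult_left_mono power_mono\<close>)
  qed
  finally show ?case by (simp add: algebra_simps)
qed

lemma X_int: "integrable M X"
  and X_mean: "expectation X \<le> 100 * b * (s + s * \<psi>\<^sup>2 + s\<^sup>2 * \<psi> ^ 4) * Mom 2"
proof -
  show i: "integrable M X" by (rule \<rho>_bounded_int(1)[OF X_meas X_abs])
  have "expectation X \<le> expectation (\<lambda>\<omega>. \<bar>X \<omega>\<bar>)" using i by (intro Bochner_Integration.integral_mono) auto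
  also note \<rho>_bounded_int(2)[OF X_meas X_abs]
  finally show "expectation X \<le> 100 * b * (s + s * \<psi>\<^sup>2 + s\<^sup>2 * \<psi> ^ 4) * Mom 2"
    using s b_ge by (simp add: abs_of_nonneg)
qed

lemma Q_even_nonneg: "Q 2 \<omega> \<ge> 0" "Q 4 \<omega> \<ge> 0" unfolding Q_def by (auto intro!: sum_nonneg)

lemma X_ge: "AE \<omega> in M. X \<omega> \<ge> - (b * (6000 * s + 64 * s\<^sup>2 * \<psi> ^ 4))"
  using X_lower
proof eventually_elim
  case (elim \<omega>)
  have "0 \<le> s / 32 * (\<psi>\<^sup>2 * Q 2 \<omega> + Q 4 \<omega>)" using s Q_even_nonneg by auto
  then show ?case using elim by linarith
qed

definition "z0 = expectation (\<lambda>\<omega>. exp (- X \<omega>))"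
text \<open>The conditional mean of f under the interaction, given the coarse field. The common
  factor of the weights at \<psi> itself has been cancelled, so that X is small for small
  coupling.\<close>

definition "tilt f = expectation (\<lambda>\<omega>. f \<omega> * exp (- X \<omega>)) / z0"

lemma z0_pos: "z0 > 0"
  using tilted_mean_le(3)[OF X_int X_ge] less_le_trans[OF exp_gt_zero] unfolding z0_def by blast

lemma exp_X_int: "integrable M (\<lambda>\<omega>. exp (- X \<omega>))"
  by (rule tilted_mean_le(1)[OF X_int X_ge])

lemma tilt_int:
  assumes [measurable]: "f \<in> borel_measurable M" and f: "AE \<omega> in M. \<bar>f \<omega>\<bar> \<le> K * \<rho> \<omega> ^ k"
  shows "integrable M (\<lambda>\<omega>. f \<omega> * exp (- X \<omega>))"
proof -
  define c where "c = b * (6000 * s + 64 * s\<^sup>2 * \<psi> ^ 4)"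
  have X: "AE \<omega> in M. X \<omega> \<ge> - c" using X_ge by (simp add: c_def)
  have "AE \<omega> in M. \<bar>f \<omega> * exp (- X \<omega>)\<bar> \<le> (K * exp c) * \<rho> \<omega> ^ k"
    using f X
  proof eventually_elim
    case (elim \<omega>)
    have "\<bar>f \<omega>\<bar> * exp (- X \<omega>) \<le> (K * \<rho> \<omega> ^ k) * exp c"
      using elim by (intro mult_mono) (auto intro: order_trans[OF abs_ge_zero])
    then show ?case by (simp add: abs_mult algebra_simps)
  qed
  then show ?thesis by (intro \<rho>_bounded_int(1)) measurable
qed

lemma tilt_mono:
  assumes "integrable M (\<lambda>\<omega>. f \<omega> * exp (- X \<omega>))" "integrable M (\<lambda>\<omega>. h \<omega> * exp (- X \<omega>))"
    and "AE \<omega> in M. f \<omega> \<le> h \<omega>"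
  shows "tilt f \<le> tilt h"
  unfolding tilt_def using assms z0_pos
  by (intro divide_right_mono integral_mono_AE) (auto elim!: eventually_mono intro!: mult_right_mono)

lemma tilt_cong: "AE \<omega> in M. f \<omega> = h \<omega> \<Longrightarrow> f \<in> borel_measurable M \<Longrightarrow> h \<in> borel_measurable M \<Longrightarrow> tilt f = tilt h"
  unfolding tilt_def by (intro arg_cong2[where f = "(/)"] integral_cong_AE) (auto elim!: eventually_mono)

lemma tilt_const: "tilt (\<lambda>_. c) = c"
  using z0_pos by (simp add: tilt_def z0_def)

lemma tilt_cmult: "tilt (\<lambda>\<omega>. c * f \<omega>) = c * tilt f"
  by (simp add: tilt_def mult.assoc)

lemma tilt_add:
  assumes "integrable M (\<lambda>\<omega>. f \<omega> * exp (- X \<omega>))" "integrable M (\<lambda>\<omega>. h \<omega> * exp (- X \<omega>))"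
  shows "tilt (\<lambda>\<omega>. f \<omega> + h \<omega>) = tilt f + tilt h"
  using assms by (simp add: tilt_def distrib_right add_divide_distrib)

lemma tilt_abs: "\<bar>tilt f\<bar> \<le> tilt (\<lambda>\<omega>. \<bar>f \<omega>\<bar>)"
proof -
  have "\<bar>expectation (\<lambda>\<omega>. f \<omega> * exp (- X \<omega>))\<bar> \<le> expectation (\<lambda>\<omega>. \<bar>f \<omega> * exp (- X \<omega>)\<bar>)"
    by (rule integral_abs_bound)
  then show ?thesis using z0_pos by (simp add: tilt_def abs_mult divide_right_mono)
qed

lemma Q_abs_le: "\<bar>Q 2 \<omega>\<bar> \<le> 1 * \<rho> \<omega> ^ 4" "(\<Sum>y\<in>I. \<bar>Z y \<omega>\<bar> ^ 3) \<le> b * \<rho> \<omega> ^ 4" "\<bar>Q 4 \<omega>\<bar> \<le> b * \<rho> \<omega> ^ 4"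
  "(\<Sum>y\<in>I. \<bar>Z y \<omega>\<bar> ^ 5) \<le> b * \<rho> \<omega> ^ 4" "\<bar>Q 3 \<omega>\<bar> \<le> (\<Sum>y\<in>I. \<bar>Z y \<omega>\<bar> ^ 3)"
proof -
  have z: "\<bar>Z y \<omega>\<bar> ^ k \<le> \<rho> \<omega> ^ 4" if "y \<in> I" "k \<le> 8" for y k
  proof -
    define x where "x = max 1 \<bar>Z y \<omega>\<bar>"
    have "\<bar>Z y \<omega>\<bar> ^ k \<le> x ^ k" by (intro power_mono) (auto simp: x_def)
    also have "\<dots> \<le> x ^ 8" using that by (intro power_increasing) (auto simp: x_def)
    also have "\<dots> = (x\<^sup>2) ^ 4" by (simp add: power_mult[symmetric])
    also have "\<dots> \<le> \<rho> \<omega> ^ 4"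
    proof (intro power_mono)
      have "x\<^sup>2 \<le> 1 + (Z y \<omega>)\<^sup>2" by (auto simp: x_def max_def)
      then show "x\<^sup>2 \<le> \<rho> \<omega>" using Z_le_\<rho>[OF that(1), of \<omega>] by linarith
    qed simp
    finally show ?thesis .
  qed
  have s: "(\<Sum>y\<in>I. \<bar>Z y \<omega>\<bar> ^ k) \<le> b * \<rho> \<omega> ^ 4" if "k \<le> 8" for k
    using sum_bounded_above[of I "\<lambda>y. \<bar>Z y \<omega>\<bar> ^ k" "\<rho> \<omega> ^ 4"] z[OF _ that] by auto
  show "(\<Sum>y\<in>I. \<bar>Z y \<omega>\<bar> ^ 3) \<le> b * \<rho> \<omega> ^ 4" "(\<Sum>y\<in>I. \<bar>Z y \<omega>\<bar> ^ 5) \<le> b * \<rho> \<omega> ^ 4" using s by auto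
  show "\<bar>Q 3 \<omega>\<bar> \<le> (\<Sum>y\<in>I. \<bar>Z y \<omega>\<bar> ^ 3)" unfolding Q_def power_abs[symmetric] by (rule sum_abs)
  show "\<bar>Q 4 \<omega>\<bar> \<le> b * \<rho> \<omega> ^ 4" using s[of 4] Q_even_nonneg[of \<omega>] by (simp add: Q_def power_even_abs)
  have "Q 2 \<omega> \<le> \<rho> \<omega> ^ 1" by (simp add: \<rho>_def)
  also have "\<dots> \<le> \<rho> \<omega> ^ 4" using \<rho>_ge by (intro power_increasing) auto
  finally show "\<bar>Q 2 \<omega>\<bar> \<le> 1 * \<rho> \<omega> ^ 4" using Q_even_nonneg[of \<omega>] by simp
qed

lemma tilt_ints: "integrable M (\<lambda>\<omega>. Q 2 \<omega> * exp (- X \<omega>))" "integrable M (\<lambda>\<omega>. Q 3 \<omega> * exp (- X \<omega>))"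
  "integrable M (\<lambda>\<omega>. Q 4 \<omega> * exp (- X \<omega>))"
  "integrable M (\<lambda>\<omega>. (\<Sum>y\<in>I. \<bar>Z y \<omega>\<bar> ^ 3) * exp (- X \<omega>))" "integrable M (\<lambda>\<omega>. (\<Sum>y\<in>I. \<bar>Z y \<omega>\<bar> ^ 5) * exp (- X \<omega>))"
proof -
  show "integrable M (\<lambda>\<omega>. Q 2 \<omega> * exp (- X \<omega>))" by (rule tilt_int[OF _ AE_I2]) (measurable, rule Q_abs_le)
  show "integrable M (\<lambda>\<omega>. Q 4 \<omega> * exp (- X \<omega>))" by (rule tilt_int[OF _ AE_I2]) (measurable, rule Q_abs_le)
  show "integrable M (\<lambda>\<omega>. Q 3 \<omega> * exp (- X \<omega>))"
    by (rule tilt_int[OF _ AE_I2]) (measurable, rule order_trans[OF Q_abs_le(5) Q_abs_le(2)])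
  have a: "\<bar>(\<Sum>y\<in>I. \<bar>Z y \<omega>\<bar> ^ k)\<bar> = (\<Sum>y\<in>I. \<bar>Z y \<omega>\<bar> ^ k)" for k \<omega>
    by (intro abs_of_nonneg sum_nonneg) auto
  show "integrable M (\<lambda>\<omega>. (\<Sum>y\<in>I. \<bar>Z y \<omega>\<bar> ^ 3) * exp (- X \<omega>))"
    by (rule tilt_int[OF _ AE_I2]) (measurable, unfold a, rule Q_abs_le)
  show "integrable M (\<lambda>\<omega>. (\<Sum>y\<in>I. \<bar>Z y \<omega>\<bar> ^ 5) * exp (- X \<omega>))"
    by (rule tilt_int[OF _ AE_I2]) (measurable, unfold a, rule Q_abs_le)
qed

section \<open>Tilted block means for small and for large background fields\<close>

lemma small_const_parts:
  defines "m \<equiv> 65 * b * Mom 4" and "m' \<equiv> (65 * b)\<^sup>2 * Mom 12" and "c \<equiv> 6064 * b"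
  shows "exp (6 * m) * (10 * exp c * m' + 6 * exp c * m * m') \<le> small_const b" "exp (6 * m) * exp c * m' \<le> small_const b"
    and "small_const b \<ge> 0"
proof -
  have "m \<ge> 0" "m' \<ge> 0" using Mom_ge_1[of 4] Mom_ge_1[of 12] b_ge by (auto simp: m_def m'_def)
  then have p: "exp (6 * m) * (10 * exp c * m' + 6 * exp c * m * m') \<ge> 0" "exp (6 * m) * exp c * m' \<ge> 0" by auto
  have e: "small_const b = exp (6 * m) * (10 * exp c * m' + 6 * exp c * m * m') + exp (6 * m) * exp c * m'"
    by (simp add: small_const_def Let_def m_def m'_def c_def)
  show "exp (6 * m) * (10 * exp c * m' + 6 * exp c * m * m') \<le> small_const b" "exp (6 * m) * exp c * m' \<le> small_const b" "small_const b \<ge> 0"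
    unfolding e using p by linarith+
qed

text \<open>The expansion parameter is D = s (1 + \<psi>^2), the size of the interaction in the
  block; in the small field region it is at most 2.\<close>

lemma small_field:
  assumes small: "s * \<psi>\<^sup>2 \<le> 1" and [measurable]: "f \<in> borel_measurable M" and f: "\<And>\<omega>. \<bar>f \<omega>\<bar> \<le> K * \<rho> \<omega> ^ 4"
  shows "expectation f = 0 \<Longrightarrow> \<bar>tilt f + expectation (\<lambda>\<omega>. f \<omega> * X1 lh r G \<psi> \<omega>)\<bar> \<le> K * small_const b * (s * (1 + \<psi>\<^sup>2))\<^sup>2"
    and "tilt (\<lambda>\<omega>. \<bar>f \<omega>\<bar>) \<le> K * small_const b"
proof -
  define D where "D = s * (1 + \<psi>\<^sup>2)"
  \<comment> \<open>65 is the constant of \<open>site_small\<close>. With f of size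
    \<open>\<rho> \<omega> ^ 4\<close> the product of f and the square of p has size
    \<open>\<rho> \<omega> ^ 12\<close>, hence the twelfth moment. The constant 6064 is 6000 + 64,
    the lower bound on X when s and \<open>s * \<psi>\<^sup>2\<close> are at most 1.\<close>
  define p where "p \<omega> = 65 * b * \<rho> \<omega> ^ 4" for \<omega>
  define m where "m = 65 * b * Mom 4"
  define m' where "m' = (65 * b)\<^sup>2 * Mom 12"
  define c where "c = 6064 * b"
  have K: "K \<ge> 0"
  proof -
    have "0 \<le> K * \<rho> undefined ^ 4" using f[of undefined] by linarith
    moreover have "0 < \<rho> undefined ^ 4" using \<rho>_power_ge[of undefined 4] by linarith
    ultimately show ?thesis by (metis zero_le_mult_iff not_less)
  qed
  have D: "0 \<le> D" "D \<le> 2" using s small by (auto simp: D_def distrib_left)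
  have [measurable]: "p \<in> borel_measurable M" "X1 lh r G \<psi> \<in> borel_measurable M"
    unfolding p_def[abs_def] X1_def[abs_def] by measurable
  have bnd: "AE \<omega> in M. \<bar>X1 lh r G \<psi> \<omega>\<bar> \<le> D * p \<omega> \<and> \<bar>X \<omega> - X1 lh r G \<psi> \<omega>\<bar> \<le> D\<^sup>2 * p \<omega> \<and> X \<omega> \<ge> - c \<and> p \<omega> \<ge> 1"
    using Q1_AE X_ge
  proof eventually_elim
    case (elim \<omega>)
    have "\<bar>X1 lh r G \<psi> \<omega>\<bar> \<le> (\<Sum>y\<in>I. \<bar>quartic_incr lh r G \<psi> (Z y \<omega>)\<bar>)" unfolding X1_split by (rule sum_abs)
    also have "\<dots> \<le> (\<Sum>y\<in>I. 65 * D * \<rho> \<omega> ^ 4)"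
    proof (intro sum_mono)
      fix y assume y: "y \<in> I"
      have "40 * s * (1 + \<psi>\<^sup>2) * (1 + (Z y \<omega>)\<^sup>2)\<^sup>2 \<le> 65 * D * \<rho> \<omega> ^ 4"
      proof (rule mult_mono)
        have "40 * s * (1 + \<psi>\<^sup>2) = 40 * D" by (simp add: D_def)
        then show "40 * s * (1 + \<psi>\<^sup>2) \<le> 65 * D" using D by simp
        have "(1 + (Z y \<omega>)\<^sup>2)\<^sup>2 \<le> \<rho> \<omega> ^ 2" using Z_le_\<rho>[OF y] by (intro power_mono) auto
        also have "\<dots> \<le> \<rho> \<omega> ^ 4" using \<rho>_ge by (intro power_increasing) auto
        finally show "(1 + (Z y \<omega>)\<^sup>2)\<^sup>2 \<le> \<rho> \<omega> ^ 4" .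
      qed (use D s in \<open>auto simp: D_def\<close>)
      then show "\<bar>quartic_incr lh r G \<psi> (Z y \<omega>)\<bar> \<le> 65 * D * \<rho> \<omega> ^ 4" using quartic_incr_abs[of \<psi> "Z y \<omega>"] by linarith
    qed
    finally have 1: "\<bar>X1 lh r G \<psi> \<omega>\<bar> \<le> D * p \<omega>" by (simp add: p_def algebra_simps)
    have "\<bar>X \<omega> - X1 lh r G \<psi> \<omega>\<bar> \<le> (\<Sum>y\<in>I. \<bar>site_incr lh r G (g y) \<psi> (Z y \<omega>) - quartic_incr lh r G \<psi> (Z y \<omega>)\<bar>)"
      unfolding X1_split X_split[OF elim(1)] sum_subtractf[symmetric] by (rule sum_abs)
    also have "\<dots> \<le> (\<Sum>y\<in>I. 65 * D\<^sup>2 * \<rho> \<omega> ^ 4)"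
    proof (intro sum_mono)
      fix y assume y: "y \<in> I"
      show "\<bar>site_incr lh r G (g y) \<psi> (Z y \<omega>) - quartic_incr lh r G \<psi> (Z y \<omega>)\<bar> \<le> 65 * D\<^sup>2 * \<rho> \<omega> ^ 4"
        by (rule order_trans[OF site_small[OF good[OF y] small]], unfold D_def)
           (use Z_le_\<rho>[OF y] in \<open>auto intro!: mult_left_mono power_mono\<close>)
    qed
    finally have 2: "\<bar>X \<omega> - X1 lh r G \<psi> \<omega>\<bar> \<le> D\<^sup>2 * p \<omega>" by (simp add: p_def algebra_simps)
    have "s\<^sup>2 * \<psi> ^ 4 = (s * \<psi>\<^sup>2)\<^sup>2" by (simp add: power_mult_distrib power_mult[symmetric])
    also have "\<dots> \<le> 1" using small s by (simp add: power_le_one)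
    finally have "b * (6000 * s + 64 * s\<^sup>2 * \<psi> ^ 4) \<le> b * 6064" using s by (intro mult_left_mono) auto
    then have 3: "X \<omega> \<ge> - c" using elim(2) by (simp add: c_def)
    have "1 * 1 \<le> 65 * b * \<rho> \<omega> ^ 4" using b_ge \<rho>_power_ge[of \<omega> 4] by (intro mult_mono) auto
    then show ?case using 1 2 3 by (simp add: p_def)
  qed
  have p: "integrable M p" "expectation p \<le> m"
    unfolding p_def m_def using \<rho>_int[of 4] \<rho>_mom[of 4] b_ge by (auto simp: mult_left_mono)
  have le: "AE \<omega> in M. \<bar>\<bar>f \<omega>\<bar> * (p \<omega>)\<^sup>2\<bar> \<le> (K * (65 * b)\<^sup>2) * \<rho> \<omega> ^ 12"
  proof (rule AE_I2)
    fix \<omega>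
    have "\<bar>f \<omega>\<bar> * (p \<omega>)\<^sup>2 \<le> (K * \<rho> \<omega> ^ 4) * (p \<omega>)\<^sup>2" using f[of \<omega>] by (intro mult_right_mono) auto
    also have "\<dots> = (K * (65 * b)\<^sup>2) * \<rho> \<omega> ^ 12" by (simp add: p_def power_mult_distrib power_mult[symmetric] power_add[symmetric])
    finally show "\<bar>\<bar>f \<omega>\<bar> * (p \<omega>)\<^sup>2\<bar> \<le> (K * (65 * b)\<^sup>2) * \<rho> \<omega> ^ 12" by simp
  qed
  have m1: "(\<lambda>\<omega>. \<bar>f \<omega>\<bar> * (p \<omega>)\<^sup>2) \<in> borel_measurable M" by measurable
  have fp: "integrable M (\<lambda>\<omega>. \<bar>f \<omega>\<bar> * (p \<omega>)\<^sup>2)" "expectation (\<lambda>\<omega>. \<bar>f \<omega>\<bar> * (p \<omega>)\<^sup>2) \<le> K * m'"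
    using \<rho>_bounded_int[OF m1 le] K by (auto simp: m'_def)
  have c0: "c \<ge> 0" using b_ge by (simp add: c_def)
  note T = tilt_first_order[OF _ _ _ _ bnd D c0 p fp]
  note C = small_const_parts[folded m_def m'_def c_def]
  show "tilt (\<lambda>\<omega>. \<bar>f \<omega>\<bar>) \<le> K * small_const b"
    using T(2) mult_left_mono[OF C(2) K] by (simp add: tilt_def z0_def algebra_simps)
  assume "expectation f = 0"
  then have "\<bar>tilt f + expectation (\<lambda>\<omega>. f \<omega> * X1 lh r G \<psi> \<omega>)\<bar> \<le> exp (6 * m) * (10 * exp c * (K * m') + 6 * exp c * m * (K * m')) * D\<^sup>2"
    using T(1) by (simp add: tilt_def z0_def)
  also have "\<dots> = (K * D\<^sup>2) * (exp (6 * m) * (10 * exp c * m' + 6 * exp c * m * m'))" by (simp add: algebra_simps)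
  also have "\<dots> \<le> (K * D\<^sup>2) * small_const b" using C(1) K by (intro mult_left_mono) auto
  finally show "\<bar>tilt f + expectation (\<lambda>\<omega>. f \<omega> * X1 lh r G \<psi> \<omega>)\<bar> \<le> K * small_const b * (s * (1 + \<psi>\<^sup>2))\<^sup>2"
    by (simp add: D_def algebra_simps)
qed

text \<open>Nothing is expanded here. By the association inequality the tilted mean of X is at most
  its Gaussian mean, of order s^2 \<psi>^4, while X controls s (\<psi>^2 \<open>Q 2\<close> +
  \<open>Q 4\<close>) from above up to a loss of the same order. Dividing by s \<psi>^2 bounds
  \<open>Q 2\<close>, and 2 \<psi> z^3 \<le> \<psi>^2 z^2 + z^4 bounds the cubes.\<close>

lemma large_field:
  assumes large: "s * \<psi>\<^sup>2 \<ge> 1"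
  shows "tilt (Q 2) \<le> large_const b * (s * \<psi>\<^sup>2)" "tilt (\<lambda>\<omega>. \<Sum>y\<in>I. \<bar>Z y \<omega>\<bar> ^ 3) \<le> large_const b * (s * \<bar>\<psi>\<bar> ^ 3)"
proof -
  define F where "F \<omega> = \<psi>\<^sup>2 * Q 2 \<omega> + Q 4 \<omega>" for \<omega>
  define k where "k = b * (6000 * s + 64 * s\<^sup>2 * \<psi> ^ 4)"
  have ps: "\<psi>\<^sup>2 \<ge> 1"
  proof -
    have "s * \<psi>\<^sup>2 \<le> 1 * \<psi>\<^sup>2" using s by (intro mult_right_mono) auto
    then show ?thesis using large by linarith
  qed
  then have psn: "\<bar>\<psi>\<bar> > 0" by auto
  have s1: "s \<le> s\<^sup>2 * \<psi> ^ 4" and s2: "s * \<psi>\<^sup>2 \<le> s\<^sup>2 * \<psi> ^ 4"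
  proof -
    have e: "s\<^sup>2 * \<psi> ^ 4 = (s * \<psi>\<^sup>2) * (s * \<psi>\<^sup>2)" by (simp add: power2_eq_square eval_nat_numeral)
    have "1 * (s * \<psi>\<^sup>2) \<le> (s * \<psi>\<^sup>2) * (s * \<psi>\<^sup>2)" using large s by (intro mult_right_mono) auto
    then show s2: "s * \<psi>\<^sup>2 \<le> s\<^sup>2 * \<psi> ^ 4" using e by simp
    have "s * 1 \<le> s * \<psi>\<^sup>2" using ps s by (intro mult_left_mono) auto
    then show "s \<le> s\<^sup>2 * \<psi> ^ 4" using s2 by linarith
  qed
  have iF: "integrable M (\<lambda>\<omega>. F \<omega> * exp (- X \<omega>))"
    unfolding F_def distrib_right mult.assoc using tilt_ints by simp
  have iX: "integrable M (\<lambda>\<omega>. X \<omega> * exp (- X \<omega>))" by (rule tilted_mean_le(2)[OF X_int X_ge])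
  have ik: "integrable M (\<lambda>\<omega>. (X \<omega> + k) * exp (- X \<omega>))" using iX exp_X_int by (simp add: distrib_right)
  have "tilt (\<lambda>\<omega>. s / 32 * F \<omega>) \<le> tilt (\<lambda>\<omega>. X \<omega> + k)"
  proof (intro tilt_mono ik)
    show "AE \<omega> in M. s / 32 * F \<omega> \<le> X \<omega> + k"
      using X_lower by eventually_elim (simp add: F_def k_def)
  qed (use iF in \<open>auto simp: mult.assoc\<close>)
  moreover have "tilt (\<lambda>\<omega>. X \<omega> + k) = tilt X + k" using iX exp_X_int tilt_add[of X "\<lambda>_. k"] by (simp add: tilt_const)
  moreover have "tilt X \<le> expectation X"
    using tilted_mean_le(4)[OF X_int X_ge] z0_pos by (simp add: tilt_def z0_def[symmetric] divide_le_eq)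
  ultimately have "s / 32 * tilt F \<le> 100 * b * (s + s * \<psi>\<^sup>2 + s\<^sup>2 * \<psi> ^ 4) * Mom 2 + k"
    using X_mean unfolding tilt_cmult by linarith
  \<comment> \<open>In the large field region s and \<open>s * \<psi>\<^sup>2\<close> are at most
    \<open>s\<^sup>2 * \<psi> ^ 4\<close>; the three terms give the 300 in
    \<open>large_const\<close>, and its factor 32 undoes the s/32.\<close>
  also have "\<dots> \<le> 100 * b * (3 * (s\<^sup>2 * \<psi> ^ 4)) * Mom 2 + b * (6064 * (s\<^sup>2 * \<psi> ^ 4))"
    unfolding k_def using s1 s2 b_ge Mom_ge_1[of 2] by (intro add_mono mult_right_mono mult_left_mono) auto
  also have "\<dots> = s / 32 * (large_const b * (s * \<psi> ^ 4))"
    by (simp add: large_const_def power2_eq_square algebra_simps)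
  finally have F: "tilt F \<le> large_const b * (s * \<psi> ^ 4)" using s by simp
  have "\<psi>\<^sup>2 * tilt (Q 2) \<le> tilt F"
    unfolding tilt_cmult[symmetric] using tilt_ints iF Q_even_nonneg by (intro tilt_mono) (auto simp: mult.assoc F_def)
  also note F
  also have "large_const b * (s * \<psi> ^ 4) = \<psi>\<^sup>2 * (large_const b * (s * \<psi>\<^sup>2))" by (simp add: eval_nat_numeral)
  finally show "tilt (Q 2) \<le> large_const b * (s * \<psi>\<^sup>2)" using psn by (simp add: mult_le_cancel_left)
  have L0: "large_const b \<ge> 0" using b_ge Mom_ge_1[of 2] by (simp add: large_const_def)
  have "(2 * \<bar>\<psi>\<bar>) * tilt (\<lambda>\<omega>. \<Sum>y\<in>I. \<bar>Z y \<omega>\<bar> ^ 3) \<le> tilt F"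
    unfolding tilt_cmult[symmetric]
  proof (intro tilt_mono iF AE_I2)
    fix \<omega>
    have "2 * \<bar>\<psi>\<bar> * (\<Sum>y\<in>I. \<bar>Z y \<omega>\<bar> ^ 3) \<le> (\<Sum>y\<in>I. \<psi>\<^sup>2 * Z y \<omega> ^ 2 + Z y \<omega> ^ 4)"
      unfolding sum_distrib_left
    proof (intro sum_mono)
      fix y
      have cube: "\<bar>x\<bar> ^ 3 = \<bar>x\<bar> * x\<^sup>2" for x :: real
        by (simp only: power2_abs[symmetric, of x]) (simp add: power2_eq_square power3_eq_cube)
      have "2 * (\<bar>\<psi>\<bar> * \<bar>Z y \<omega>\<bar>) * \<bar>Z y \<omega>\<bar>\<^sup>2 \<le> (\<bar>\<psi>\<bar> * \<bar>Z y \<omega>\<bar>)\<^sup>2 + (\<bar>Z y \<omega>\<bar>\<^sup>2)\<^sup>2" by (rule sum_squares_bound)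
      then show "2 * \<bar>\<psi>\<bar> * \<bar>Z y \<omega>\<bar> ^ 3 \<le> \<psi>\<^sup>2 * Z y \<omega> ^ 2 + Z y \<omega> ^ 4"
        by (simp add: power_mult_distrib power_mult[symmetric] cube mult.assoc)
    qed
    then show "2 * \<bar>\<psi>\<bar> * (\<Sum>y\<in>I. \<bar>Z y \<omega>\<bar> ^ 3) \<le> F \<omega>"
      by (simp add: F_def Q_def sum.distrib sum_distrib_left)
  qed (use tilt_ints in \<open>auto simp: mult.assoc\<close>)
  also note F
  also have "large_const b * (s * \<psi> ^ 4) = \<bar>\<psi>\<bar> * (large_const b * (s * \<bar>\<psi>\<bar> ^ 3))"
  proof -
    have "\<psi> ^ 4 = \<bar>\<psi>\<bar> * \<bar>\<psi>\<bar> ^ 3" by (simp add: power_Suc[symmetric] power_even_abs del: power_Suc)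
    then show ?thesis by simp
  qed
  also have "\<dots> \<le> (2 * \<bar>\<psi>\<bar>) * (large_const b * (s * \<bar>\<psi>\<bar> ^ 3))" using L0 s by (intro mult_right_mono) auto
  finally show "tilt (\<lambda>\<omega>. \<Sum>y\<in>I. \<bar>Z y \<omega>\<bar> ^ 3) \<le> large_const b * (s * \<bar>\<psi>\<bar> ^ 3)" using psn by (simp add: mult_le_cancel_left)
qed

end

section \<open>Differentiation under the expectation\<close>

context prob_space begin

lemma has_derivative_expectation:
  fixes F F' :: "real \<Rightarrow> 'a \<Rightarrow> real"
  assumes [measurable]: "\<And>x. F x \<in> borel_measurable M" "\<And>x. F' x \<in> borel_measurable M"
    and d: "\<And>x \<omega>. ((\<lambda>x. F x \<omega>) has_real_derivative F' x \<omega>) (at x)"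
    and K: "\<And>x \<omega>. \<bar>F x \<omega>\<bar> \<le> K" "\<And>x \<omega>. \<bar>F' x \<omega>\<bar> \<le> K"
  shows "((\<lambda>x. expectation (F x)) has_real_derivative expectation (F' x)) (at x)"
proof -
  have i: "integrable M (F x)" for x by (rule integrable_const_bound[of _ K]) (use K in auto)
  have lip: "\<bar>F b \<omega> - F a \<omega>\<bar> \<le> K * \<bar>b - a\<bar>" for a b \<omega>
    using field_differentiable_bound[of UNIV "\<lambda>x. F x \<omega>" "\<lambda>x. F' x \<omega>" K b a] d K by auto
  show ?thesis
    unfolding has_field_derivative_iff tendsto_at_iff_sequentially
  proof (intro allI impI)
    fix X :: "nat \<Rightarrow> real" assume X: "\<forall>i. X i \<in> UNIV - {x}" "X \<longlonglongrightarrow> x"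
    have "(\<lambda>n. expectation (\<lambda>\<omega>. (F (X n) \<omega> - F x \<omega>) / (X n - x))) \<longlonglongrightarrow> expectation (F' x)"
    proof (rule integral_dominated_convergence[of _ _ _ "\<lambda>_. K"])
      show "AE \<omega> in M. (\<lambda>n. (F (X n) \<omega> - F x \<omega>) / (X n - x)) \<longlonglongrightarrow> F' x \<omega>"
      proof (rule AE_I2)
        fix \<omega>
        show "(\<lambda>n. (F (X n) \<omega> - F x \<omega>) / (X n - x)) \<longlonglongrightarrow> F' x \<omega>"
          using d[of \<omega> x] X unfolding has_field_derivative_iff tendsto_at_iff_sequentially by (auto simp: o_def)
      qed
      show "AE \<omega> in M. norm ((F (X n) \<omega> - F x \<omega>) / (X n - x)) \<le> K" for n
      proof (rule AE_I2)
        fix \<omega>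
        have "\<bar>X n - x\<bar> > 0" using X by auto
        then show "norm ((F (X n) \<omega> - F x \<omega>) / (X n - x)) \<le> K"
          using lip[of "X n" \<omega> x] by (simp add: field_simps)
      qed
    qed auto
    then show "((\<lambda>y. (expectation (F y) - expectation (F x)) / (y - x)) \<circ> X) \<longlonglongrightarrow> expectation (F' x)"
      using i by (simp add: o_def)
  qed
qed

end

context rg_params begin

text \<open>The stability bound at \<psi> = 0 gives decay like exp(- s x^4 / 32), whereas u grows
  polynomially. This provides the domination for differentiating the block map and the integrability
  of all products of weights.\<close>

lemma site_bounded:
  assumes g: "rg_good G lh r A A' s g u"
  shows "\<exists>K. \<forall>x. 0 < g x \<and> g x \<le> K \<and> \<bar>u x\<bar> * g x \<le> K"
    and "g x \<le> g 0 * exp (6000 * s) * exp (- (s / 32 * x ^ 4))"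
proof -
  have gp: "g x > 0" for x using g by (auto simp: rg_good_def)
  have dec: "g x \<le> g 0 * exp (6000 * s) * exp (- (s / 32 * x ^ 4))" for x
  proof -
    have "s / 32 * x ^ 4 - 6000 * s \<le> ln (g 0) - ln (g x)"
      using site_lower[OF g, of 0 x] by (simp add: site_incr_def)
    then have "ln (g x) \<le> ln (g 0) + 6000 * s + - (s / 32 * x ^ 4)" by linarith
    then have "exp (ln (g x)) \<le> exp (ln (g 0) + 6000 * s + - (s / 32 * x ^ 4))" by simp
    then show ?thesis by (simp only: exp_add exp_ln[OF gp])
  qed
  then show "g x \<le> g 0 * exp (6000 * s) * exp (- (s / 32 * x ^ 4))" .
  define k where "k = g 0 * exp (6000 * s)"
  define c where "c = 80 + A + A'"
  have k: "k > 0" using gp by (simp add: k_def)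
  have c: "c \<ge> 1" using A by (simp add: c_def)
  have ub: "\<bar>u x\<bar> \<le> c * (1 + x ^ 4)" for x
  proof -
    have a: "\<bar>x\<bar> ^ j \<le> 1 + x ^ 4" if "j \<le> 4" for j
    proof (cases "\<bar>x\<bar> \<le> 1")
      case True
      moreover have "0 \<le> x ^ 4" by simp
      ultimately show ?thesis using power_le_one[of "\<bar>x\<bar>" j] by linarith
    next
      case False
      then have "1 \<le> \<bar>x\<bar>" by simp
      from power_increasing[OF that this] show ?thesis by (simp add: power_even_abs)
    qed
    have "\<bar>u x\<bar> \<le> \<bar>4 * lh * (x ^ 3 - 3 * G * x) + 2 * r * x\<bar> + (A * s ^ 3 + A' * remainder s x)"
      using g unfolding rg_good_def by (smt (verit))
    also have "\<bar>4 * lh * (x ^ 3 - 3 * G * x) + 2 * r * x\<bar> \<le> 4 * lh * (\<bar>x\<bar> ^ 3 + 3 * G * \<bar>x\<bar>) + 2 * \<bar>r\<bar> * \<bar>x\<bar>"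
      by (rule order_trans[OF abs_triangle_ineq]) 
         (use lh s G in \<open>auto simp: abs_mult power_abs intro!: add_mono mult_left_mono order_trans[OF abs_triangle_ineq4]\<close>)
    also have "\<dots> \<le> 4 * 2 * ((1 + x ^ 4) + 3 * 2 * (1 + x ^ 4)) + 2 * 1 * (1 + x ^ 4)"
      using lh s G r a[of 3] a[of 1] by (intro add_mono mult_mono) auto
    also have "A * s ^ 3 + A' * remainder s x \<le> A * 1 + A' * (1 + x ^ 4)"
    proof (intro add_mono mult_left_mono A)
      show "s ^ 3 \<le> 1" using s by (simp add: power_le_one)
      have "remainder s x \<le> s\<^sup>2 * \<bar>x\<bar> ^ 3" by (rule remainder_le)
      also have "\<dots> \<le> 1 * (1 + x ^ 4)" using s a[of 3] by (intro mult_mono) (auto simp: power_le_one)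
      finally show "remainder s x \<le> 1 + x ^ 4" by simp
    qed
    finally have "\<bar>u x\<bar> \<le> 58 * (1 + x ^ 4) + (A + A' * (1 + x ^ 4))" by (simp add: algebra_simps)
    also have "\<dots> \<le> 58 * (1 + x ^ 4) + (A * (1 + x ^ 4) + A' * (1 + x ^ 4))"
      using mult_left_mono[OF _ A(1), of 1 "1 + x ^ 4"] by simp
    also have "\<dots> = (58 + A + A') * (1 + x ^ 4)" by (simp add: algebra_simps)
    also have "\<dots> \<le> c * (1 + x ^ 4)" unfolding c_def by (intro mult_right_mono) auto
    finally show ?thesis .
  qed
  have xe: "(1 + x ^ 4) * exp (- (s / 32 * x ^ 4)) \<le> 1 + 32 / s" for x :: real
  proof -
    have "1 + s / 32 * x ^ 4 \<le> exp (s / 32 * x ^ 4)" by (rule exp_ge_add_one_self)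
    then have "s / 32 * x ^ 4 \<le> exp (s / 32 * x ^ 4)" by linarith
    then have "x ^ 4 \<le> 32 / s * exp (s / 32 * x ^ 4)" using s by (simp add: field_simps)
    moreover have "1 \<le> exp (s / 32 * x ^ 4)" using s by simp
    ultimately have "1 + x ^ 4 \<le> (1 + 32 / s) * exp (s / 32 * x ^ 4)" unfolding distrib_right by linarith
    then show ?thesis by (simp add: exp_minus field_simps)
  qed
  show "\<exists>K. \<forall>x. 0 < g x \<and> g x \<le> K \<and> \<bar>u x\<bar> * g x \<le> K"
  proof (intro exI[of _ "c * k * (1 + 32 / s)"] allI conjI gp)
    fix x
    have gk: "g x \<le> k * exp (- (s / 32 * x ^ 4))" using dec[of x] by (simp add: k_def)
    have "g x \<le> k * 1"
      by (rule order_trans[OF gk]) (use k s in \<open>auto intro!: mult_left_mono\<close>)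
    also have "k * 1 \<le> (c * k) * (1 + 32 / s)"
      using k c s by (intro mult_mono) (auto simp: mult_le_cancel_right1)
    finally show "g x \<le> c * k * (1 + 32 / s)" .
    have "\<bar>u x\<bar> * g x \<le> (c * (1 + x ^ 4)) * (k * exp (- (s / 32 * x ^ 4)))"
      using ub[of x] gk gp[of x] c by (intro mult_mono) (auto simp: less_imp_le)
    also have "\<dots> = (c * k) * ((1 + x ^ 4) * exp (- (s / 32 * x ^ 4)))" by simp
    also have "\<dots> \<le> (c * k) * (1 + 32 / s)" using xe k c by (intro mult_left_mono) auto
    finally show "\<bar>u x\<bar> * g x \<le> c * k * (1 + 32 / s)" .
  qed
qed

end

section \<open>The tilted mean of the logarithmic derivative over a block\<close>

context tilted_block begin

definition "U \<omega> = (\<Sum>y\<in>I. u y (\<psi> + Z y \<omega>))"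

text \<open>First order shifts of the tilted means of \<open>Q 2\<close> and \<open>Q 3\<close>, up to sign.\<close>

definition "lead2 = 12 * lh * b * \<gamma> * (\<psi>\<^sup>2 + \<gamma> - G) + 2 * b * \<gamma> * r"
definition "lead3 = 24 * lh * \<psi> * S3"

lemma const_nonneg: "large_const b \<ge> 0" "small_const b \<ge> 0"
  using b_ge Mom_ge_1[of 2] small_const_parts(3) by (auto simp: large_const_def)

lemma S3_abs: "\<bar>S3\<bar> \<le> b"
proof -
  have "\<gamma> ^ 3 \<le> 1" "0 \<le> \<gamma> ^ 3" using \<gamma>_bounds by (auto simp: power_le_one)
  moreover have "(b - 1) / b ^ 3 \<le> 1" "0 \<le> (b - 1) / b ^ 3"
  proof -
    have "b * 1 \<le> b * b ^ 2" using b_ge by (intro mult_left_mono one_le_power) auto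
    then have "b - 1 \<le> b ^ 3" by (simp add: power2_eq_square power3_eq_cube)
    then show "(b - 1) / b ^ 3 \<le> 1" "0 \<le> (b - 1) / b ^ 3" using b_ge by (auto simp: divide_le_eq)
  qed
  ultimately have "\<bar>\<gamma> ^ 3 - (b - 1) / b ^ 3\<bar> \<le> 1" by linarith
  then show ?thesis using b_ge by (simp add: S3_def abs_mult mult_left_le)
qed

text \<open>The tilted means of \<open>Q 2\<close> and \<open>Q 3\<close> are known up to O(D^2)
  with D = s (1 + \<psi>^2). The coefficients contribute s (1 + \<open>\<bar>\<psi>\<bar>\<close>),
  and the resulting polynomial of degree five times s^3 is the small field branch of
  \<open>remainder\<close> plus a constant.\<close>

lemma leading_small:
  assumes small: "s * \<psi>\<^sup>2 \<le> 1"
  shows "\<bar>4 * lh * (3 * \<psi> * (tilt (Q 2) - b * \<gamma> + lead2) + (tilt (Q 3) + lead3))\<bar> \<le> lead_const b * (s ^ 3 + remainder s \<psi>)"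
proof -
  define D where "D = s * (1 + \<psi>\<^sup>2)"
  define C where "C = b * small_const b * D\<^sup>2"
  have b2: "\<bar>Q 2 \<omega> - b * \<gamma>\<bar> \<le> b * \<rho> \<omega> ^ 4" for \<omega>
  proof -
    have "Q 2 \<omega> \<le> 1 * \<rho> \<omega> ^ 4" using Q_abs_le(1)[of \<omega>] by linarith
    also have "\<dots> \<le> b * \<rho> \<omega> ^ 4" using b_ge \<rho>_power_ge[of \<omega> 4] by (intro mult_right_mono) auto
    finally have 1: "Q 2 \<omega> \<le> b * \<rho> \<omega> ^ 4" .
    have "b * \<gamma> \<le> b * \<rho> \<omega> ^ 4" using b_ge \<gamma>_bounds \<rho>_power_ge[of \<omega> 4] by (intro mult_left_mono) auto
    moreover have "0 \<le> b * \<gamma>" using b_ge \<gamma>_bounds by auto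
    ultimately show ?thesis using 1 Q_even_nonneg(1)[of \<omega>] by linarith
  qed
  have m: "(\<lambda>\<omega>. Q 2 \<omega> - b * \<gamma>) \<in> borel_measurable M" by measurable
  have e: "expectation (\<lambda>\<omega>. Q 2 \<omega> - b * \<gamma>) = 0" using Q_int by (simp add: Q_expect prob_space)
  have t2: "tilt (\<lambda>\<omega>. Q 2 \<omega> - b * \<gamma>) = tilt (Q 2) - b * \<gamma>"
    using tilt_add[of "Q 2" "\<lambda>_. - b * \<gamma>"] tilt_ints exp_X_int tilt_const[of "- b * \<gamma>"] by simp
  have 2: "\<bar>tilt (Q 2) - b * \<gamma> + lead2\<bar> \<le> C"
    using small_field(1)[OF small m b2 e] unfolding t2 cov_Q2_X1 by (simp add: lead2_def C_def D_def)
  have 3: "\<bar>tilt (Q 3) + lead3\<bar> \<le> C"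
    using small_field(1)[OF small Q_meas order_trans[OF Q_abs_le(5) Q_abs_le(2)]] unfolding cov_Q3_X1
    by (simp add: lead3_def C_def D_def Q_expect)
  have "\<bar>3 * \<psi> * (tilt (Q 2) - b * \<gamma> + lead2) + (tilt (Q 3) + lead3)\<bar> \<le> 3 * \<bar>\<psi>\<bar> * C + C"
    by (rule order_trans[OF abs_triangle_ineq]) (use 2 3 in \<open>auto simp: abs_mult intro!: add_mono mult_left_mono\<close>)
  then have "\<bar>4 * lh\<bar> * \<bar>3 * \<psi> * (tilt (Q 2) - b * \<gamma> + lead2) + (tilt (Q 3) + lead3)\<bar> \<le> (8 * s) * (3 * \<bar>\<psi>\<bar> * C + C)"
    using lh s by (intro mult_mono) auto
  also have "\<dots> = 8 * b * small_const b * s ^ 3 * ((3 * \<bar>\<psi>\<bar> + 1) * (1 + \<psi>\<^sup>2)\<^sup>2)"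
  proof -
    define T where "T = (1 + \<psi>\<^sup>2)\<^sup>2"
    have "C = b * small_const b * (s * s * T)" by (simp add: C_def D_def T_def power2_eq_square)
    then show ?thesis unfolding T_def[symmetric] by (simp add: power3_eq_cube algebra_simps)
  qed
  \<comment> \<open>16 is the sum of the coefficients of the product expanded below, each power
    being at most 1 + \<open>\<bar>\<psi>\<bar> ^ 5\<close>.\<close>
  also have "\<dots> \<le> 8 * b * small_const b * s ^ 3 * (16 * (1 + \<bar>\<psi>\<bar> ^ 5))"
  proof (intro mult_left_mono)
    define x where "x = \<bar>\<psi>\<bar>"
    have x: "x \<ge> 0" by (simp add: x_def)
    have p: "x ^ j \<le> 1 + x ^ 5" if "j \<le> 5" for j
    proof (cases "x \<le> 1")
      case True then show ?thesis using power_le_one[OF x, of j] zero_le_power[OF x, of 5] by linarith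
    next
      case False
      then have "1 \<le> x" by simp
      from power_increasing[OF that this] show ?thesis by linarith
    qed
    have "(3 * x + 1) * (1 + x\<^sup>2)\<^sup>2 = 1 + 3 * x ^ 1 + 2 * x ^ 2 + 6 * x ^ 3 + x ^ 4 + 3 * x ^ 5"
      by (simp add: eval_nat_numeral algebra_simps)
    also have "\<dots> \<le> 16 * (1 + x ^ 5)" using p[of 1] p[of 2] p[of 3] p[of 4] p[of 0] zero_le_power[OF x, of 5] by simp
    finally show "(3 * \<bar>\<psi>\<bar> + 1) * (1 + \<psi>\<^sup>2)\<^sup>2 \<le> 16 * (1 + \<bar>\<psi>\<bar> ^ 5)" by (simp add: x_def)
  qed (use const_nonneg b_ge s in auto)
  also have "\<dots> = 128 * b * small_const b * (s ^ 3 + remainder s \<psi>)"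
    using remainder_small[OF s(1) small] by (simp add: algebra_simps)
  also have "\<dots> \<le> lead_const b * (s ^ 3 + remainder s \<psi>)"
    unfolding lead_const_def using const_nonneg b_ge s remainder_nonneg[of s \<psi>] by (intro mult_right_mono) auto
  finally show ?thesis by (simp add: abs_mult)
qed

text \<open>No cancellation between the tilted means and their first order shifts is used: each term
  is O(s \<psi>^2), or O(s \<open>\<bar>\<psi>\<bar> ^ 3\<close>) for the cubic ones, and the
  coefficients lift both to the large field branch.\<close>

lemma leading_large:
  assumes large: "s * \<psi>\<^sup>2 \<ge> 1"
  shows "\<bar>4 * lh * (3 * \<psi> * (tilt (Q 2) - b * \<gamma> + lead2) + (tilt (Q 3) + lead3))\<bar> \<le> lead_const b * (s ^ 3 + remainder s \<psi>)"
proof -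
  define P where "P = s * \<psi>\<^sup>2"
  define C where "C = large_const b"
  have P1: "P \<ge> 1" using large by (simp add: P_def)
  have "P \<le> 1 * \<psi>\<^sup>2" unfolding P_def using s by (intro mult_right_mono) auto
  then have ps2: "\<psi>\<^sup>2 \<ge> 1" using P1 by linarith
  then have ps: "\<bar>\<psi>\<bar> \<ge> 1" using power2_le_imp_le[of 1 "\<bar>\<psi>\<bar>"] by simp
  have sP: "s \<le> P" using mult_left_mono[OF ps2, of s] s by (simp add: P_def)
  have t0: "0 \<le> tilt (Q 2)"
    using tilt_mono[of "\<lambda>_. 0" "Q 2"] tilt_ints Q_even_nonneg tilt_const[of 0] by simp
  have t2: "tilt (Q 2) \<le> C * P" using large_field(1)[OF large] by (simp add: C_def P_def)
  have t3: "\<bar>tilt (Q 3)\<bar> \<le> C * (s * \<bar>\<psi>\<bar> ^ 3)"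
  proof -
    have "\<bar>tilt (Q 3)\<bar> \<le> tilt (\<lambda>\<omega>. \<bar>Q 3 \<omega>\<bar>)" by (rule tilt_abs)
    also have "\<dots> \<le> tilt (\<lambda>\<omega>. \<Sum>y\<in>I. \<bar>Z y \<omega>\<bar> ^ 3)"
      using tilt_ints Q_abs_le(5) integrable_abs[OF tilt_ints(2)] by (intro tilt_mono) (auto simp: abs_mult)
    also note large_field(2)[OF large]
    finally show ?thesis by (simp add: C_def)
  qed
  have C0: "C \<ge> 0" using const_nonneg by (simp add: C_def)
  have bg: "0 \<le> b * \<gamma>" "b * \<gamma> \<le> b" using b_ge \<gamma>_bounds by (auto simp: mult_left_le)
  have l2: "\<bar>lead2\<bar> \<le> 74 * b * P"
  proof -
    have "\<bar>\<psi>\<^sup>2 + \<gamma> - G\<bar> \<le> \<psi>\<^sup>2 + 2" using G \<gamma>_bounds zero_le_power2[of \<psi>] by linarith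
    then have "\<bar>12 * lh\<bar> * \<bar>b * \<gamma>\<bar> * \<bar>\<psi>\<^sup>2 + \<gamma> - G\<bar> \<le> (24 * s) * b * (\<psi>\<^sup>2 + 2)"
      using lh s bg by (intro mult_mono) auto
    also have "\<dots> = 24 * b * P + 48 * b * s" by (simp add: P_def algebra_simps)
    also have "\<dots> \<le> 72 * b * P" using mult_left_mono[OF sP, of b] b_ge by simp
    finally have 1: "\<bar>12 * lh * b * \<gamma> * (\<psi>\<^sup>2 + \<gamma> - G)\<bar> \<le> 72 * b * P" by (simp add: abs_mult mult.assoc)
    have "2 * \<bar>b * \<gamma>\<bar> * \<bar>r\<bar> \<le> 2 * b * P" using bg r sP by (intro mult_mono) auto
    then have "\<bar>2 * b * \<gamma> * r\<bar> \<le> 2 * b * P" by (simp add: abs_mult mult.assoc)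
    then show ?thesis using 1 unfolding lead2_def by linarith
  qed
  have "b \<le> b * P" using P1 b_ge by (simp add: mult_le_cancel_left1)
  then have 2: "\<bar>tilt (Q 2) - b * \<gamma> + lead2\<bar> \<le> (C + 75 * b) * P"
    using t2 t0 l2 bg by (simp add: distrib_right)
  have 3: "\<bar>tilt (Q 3) + lead3\<bar> \<le> (C + 48 * b) * (s * \<bar>\<psi>\<bar> ^ 3)"
  proof -
    have "\<bar>24 * lh\<bar> * \<bar>\<psi>\<bar> * \<bar>S3\<bar> \<le> (48 * s) * \<bar>\<psi>\<bar> ^ 3 * b"
      using lh s S3_abs self_le_power[OF ps, of 3] b_ge by (intro mult_mono) auto
    then have "\<bar>lead3\<bar> \<le> 48 * b * (s * \<bar>\<psi>\<bar> ^ 3)" by (simp add: lead3_def abs_mult algebra_simps)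
    then show ?thesis using t3 by (simp add: distrib_right)
  qed
  have "\<bar>3 * \<psi> * (tilt (Q 2) - b * \<gamma> + lead2) + (tilt (Q 3) + lead3)\<bar> \<le> 3 * \<bar>\<psi>\<bar> * ((C + 75 * b) * P) + (C + 48 * b) * (s * \<bar>\<psi>\<bar> ^ 3)"
    by (rule order_trans[OF abs_triangle_ineq]) (use 2 3 in \<open>auto simp: abs_mult intro!: add_mono mult_left_mono\<close>)
  also have "\<dots> = (4 * C + 273 * b) * (s * \<bar>\<psi>\<bar> ^ 3)"
  proof -
    have "\<bar>\<psi>\<bar> * P = s * \<bar>\<psi>\<bar> ^ 3"
      unfolding P_def power2_abs[of \<psi>, symmetric] by (simp add: power2_eq_square power3_eq_cube)
    moreover have "3 * \<bar>\<psi>\<bar> * ((C + 75 * b) * P) = 3 * (C + 75 * b) * (\<bar>\<psi>\<bar> * P)" by (simp only: mult_ac)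
    ultimately have "3 * \<bar>\<psi>\<bar> * ((C + 75 * b) * P) = 3 * (C + 75 * b) * (s * \<bar>\<psi>\<bar> ^ 3)" by simp
    then show ?thesis by (simp add: algebra_simps)
  qed
  finally have "\<bar>4 * lh\<bar> * \<bar>3 * \<psi> * (tilt (Q 2) - b * \<gamma> + lead2) + (tilt (Q 3) + lead3)\<bar> \<le> (8 * s) * ((4 * C + 273 * b) * (s * \<bar>\<psi>\<bar> ^ 3))"
    using lh s by (intro mult_mono) auto
  also have "\<dots> = 8 * (4 * C + 273 * b) * remainder s \<psi>"
    using remainder_large[OF s(1) large] by (simp add: power2_eq_square)
  also have "\<dots> \<le> lead_const b * (s ^ 3 + remainder s \<psi>)"
    unfolding lead_const_def C_def[symmetric] using const_nonneg C0 b_ge s remainder_nonneg[of s \<psi>]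
    by (intro mult_mono) auto
  finally show ?thesis by (simp add: abs_mult)
qed

text \<open>The error at the increments, as opposed to the background field, must not reproduce
  \<open>remainder s \<psi>\<close> at full size. For large fields the cubic branch together with
  the third tilted moment yields an extra factor s; for small fields fifth moments are bounded and
  only s^3 is left.\<close>

lemma feed_down: "tilt (\<lambda>\<omega>. \<Sum>y\<in>I. remainder s (Z y \<omega>)) \<le> (b * small_const b + large_const b) * (s ^ 3 + s * remainder s \<psi>)"
  and feed_int: "integrable M (\<lambda>\<omega>. (\<Sum>y\<in>I. remainder s (Z y \<omega>)) * exp (- X \<omega>))"
proof -
  have qm[measurable]: "remainder s \<in> borel_measurable borel" unfolding remainder_def[abs_def] by measurable
  have [measurable]: "(\<lambda>\<omega>. \<Sum>y\<in>I. remainder s (Z y \<omega>)) \<in> borel_measurable M"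
    by (intro borel_measurable_sum measurable_compose[OF _ qm]) auto
  have le5: "(\<Sum>y\<in>I. remainder s (Z y \<omega>)) \<le> s ^ 3 * (\<Sum>y\<in>I. \<bar>Z y \<omega>\<bar> ^ 5)" for \<omega>
    unfolding sum_distrib_left by (intro sum_mono remainder_le)
  have le3: "(\<Sum>y\<in>I. remainder s (Z y \<omega>)) \<le> s\<^sup>2 * (\<Sum>y\<in>I. \<bar>Z y \<omega>\<bar> ^ 3)" for \<omega>
    unfolding sum_distrib_left by (intro sum_mono remainder_le)
  have nn: "0 \<le> (\<Sum>y\<in>I. remainder s (Z y \<omega>))" for \<omega> using s by (intro sum_nonneg remainder_nonneg) auto
  show i: "integrable M (\<lambda>\<omega>. (\<Sum>y\<in>I. remainder s (Z y \<omega>)) * exp (- X \<omega>))"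
  proof (rule tilt_int[OF _ AE_I2])
    fix \<omega>
    have "s ^ 3 * (\<Sum>y\<in>I. \<bar>Z y \<omega>\<bar> ^ 5) \<le> s ^ 3 * (b * \<rho> \<omega> ^ 4)" using s Q_abs_le(4) by (intro mult_left_mono) auto
    then show "\<bar>\<Sum>y\<in>I. remainder s (Z y \<omega>)\<bar> \<le> (s ^ 3 * b) * \<rho> \<omega> ^ 4" using le5[of \<omega>] nn[of \<omega>] by (simp add: mult.assoc)
  qed measurable
  have q0: "remainder s \<psi> \<ge> 0" using s remainder_nonneg by simp
  show "tilt (\<lambda>\<omega>. \<Sum>y\<in>I. remainder s (Z y \<omega>)) \<le> (b * small_const b + large_const b) * (s ^ 3 + s * remainder s \<psi>)"
  proof (cases "s * \<psi>\<^sup>2 \<le> 1")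
    case True
    have a: "\<bar>(\<Sum>y\<in>I. \<bar>Z y \<omega>\<bar> ^ k)\<bar> = (\<Sum>y\<in>I. \<bar>Z y \<omega>\<bar> ^ k)" for k \<omega>
      by (intro abs_of_nonneg sum_nonneg) auto
    have "tilt (\<lambda>\<omega>. \<Sum>y\<in>I. remainder s (Z y \<omega>)) \<le> tilt (\<lambda>\<omega>. s ^ 3 * (\<Sum>y\<in>I. \<bar>Z y \<omega>\<bar> ^ 5))"
      using i tilt_ints le5 by (intro tilt_mono) (auto simp: mult.assoc)
    also have "\<dots> = s ^ 3 * tilt (\<lambda>\<omega>. \<Sum>y\<in>I. \<bar>Z y \<omega>\<bar> ^ 5)" by (rule tilt_cmult)
    also have "tilt (\<lambda>\<omega>. \<Sum>y\<in>I. \<bar>Z y \<omega>\<bar> ^ 5) \<le> b * small_const b"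
      using small_field(2)[OF True, of "\<lambda>\<omega>. \<Sum>y\<in>I. \<bar>Z y \<omega>\<bar> ^ 5" b] Q_abs_le(4) unfolding a by simp
    then have "s ^ 3 * tilt (\<lambda>\<omega>. \<Sum>y\<in>I. \<bar>Z y \<omega>\<bar> ^ 5) \<le> s ^ 3 * (b * small_const b)" using s by (intro mult_left_mono) auto
    also have "\<dots> \<le> (s ^ 3 + s * remainder s \<psi>) * (b * small_const b + large_const b)"
      using s q0 const_nonneg b_ge by (intro mult_mono) auto
    finally show ?thesis by (simp add: mult.commute)
  next
    case False
    then have large: "s * \<psi>\<^sup>2 \<ge> 1" by simp
    have "tilt (\<lambda>\<omega>. \<Sum>y\<in>I. remainder s (Z y \<omega>)) \<le> tilt (\<lambda>\<omega>. s\<^sup>2 * (\<Sum>y\<in>I. \<bar>Z y \<omega>\<bar> ^ 3))"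
      using i tilt_ints le3 by (intro tilt_mono) (auto simp: mult.assoc)
    also have "\<dots> = s\<^sup>2 * tilt (\<lambda>\<omega>. \<Sum>y\<in>I. \<bar>Z y \<omega>\<bar> ^ 3)" by (rule tilt_cmult)
    also have "\<dots> \<le> s\<^sup>2 * (large_const b * (s * \<bar>\<psi>\<bar> ^ 3))" by (intro mult_left_mono large_field[OF large]) auto
    also have "\<dots> = (s * remainder s \<psi>) * large_const b" using remainder_large[OF s(1) large] by (simp add: power2_eq_square)
    also have "\<dots> \<le> (s ^ 3 + s * remainder s \<psi>) * (b * small_const b + large_const b)"
      using s q0 const_nonneg b_ge by (intro mult_mono) auto
    finally show ?thesis by (simp add: mult.commute)
  qed
qed

text \<open>The cubic in \<psi> + Z expands with vanishing linear sum, and \<open>Q 2\<close>,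
  \<open>Q 3\<close> are replaced by their means and first order shifts. The terms of the bound are,
  in order: the error of that replacement, the constant error of the weights, their error at the
  background field (with the 5/4 of \<open>remainder_add\<close>), and their error at the
  increments.\<close>

lemma tilt_U: "\<bar>tilt U - (4 * lh * (b * (\<psi> ^ 3 - 3 * G * \<psi>) + 3 * b * \<gamma> * \<psi>) + 2 * r * b * \<psi> - 4 * lh * (3 * \<psi> * lead2 + lead3))\<bar>
    \<le> lead_const b * (s ^ 3 + remainder s \<psi>) + b * A * s ^ 3 + 5 / 4 * b * A' * remainder s \<psi>
      + A' * feed_const b * (s ^ 3 + s * remainder s \<psi>)"
proof -
  define h where "h \<omega> = (\<Sum>y\<in>I. u y (\<psi> + Z y \<omega>) - (4 * lh * ((\<psi> + Z y \<omega>) ^ 3 - 3 * G * (\<psi> + Z y \<omega>)) + 2 * r * (\<psi> + Z y \<omega>)))" for \<omega>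
  define q where "q \<omega> = (\<Sum>y\<in>I. remainder s (Z y \<omega>))" for \<omega>
  define c0 where "c0 = b * A * s ^ 3 + 5 / 4 * b * A' * remainder s \<psi>"
  have um: "(\<lambda>\<omega>. u y (\<psi> + Z y \<omega>)) \<in> borel_measurable M" if "y \<in> I" for y
    by (rule measurable_compose[OF _ u_meas[OF that]]) (use that in auto)
  have hm[measurable]: "h \<in> borel_measurable M"
    unfolding h_def by (intro borel_measurable_sum borel_measurable_diff um) auto
  have Um[measurable]: "U \<in> borel_measurable M" unfolding U_def by (intro borel_measurable_sum um)
  have hb: "\<bar>h \<omega>\<bar> \<le> c0 + A' * 26 ^ 5 * q \<omega>" for \<omega>
  proof -
    have "\<bar>h \<omega>\<bar> \<le> (\<Sum>y\<in>I. A * s ^ 3 + A' * (5 / 4 * remainder s \<psi> + 26 ^ 5 * remainder s (Z y \<omega>)))"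
      unfolding h_def
    proof (rule order_trans[OF sum_abs sum_mono])
      fix y assume y: "y \<in> I"
      have "A' * remainder s (\<psi> + Z y \<omega>) \<le> A' * (5 / 4 * remainder s \<psi> + 26 ^ 5 * remainder s (Z y \<omega>))"
        using s by (intro mult_left_mono A remainder_add) auto
      then show "\<bar>u y (\<psi> + Z y \<omega>) - (4 * lh * ((\<psi> + Z y \<omega>) ^ 3 - 3 * G * (\<psi> + Z y \<omega>)) + 2 * r * (\<psi> + Z y \<omega>))\<bar>
          \<le> A * s ^ 3 + A' * (5 / 4 * remainder s \<psi> + 26 ^ 5 * remainder s (Z y \<omega>))"
        using u_err[OF y, of "\<psi> + Z y \<omega>"] by linarith
    qed
    also have "\<dots> = c0 + A' * 26 ^ 5 * q \<omega>"
      by (simp add: sum.distrib sum_distrib_left[symmetric] q_def c0_def distrib_left mult.assoc)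
    finally show ?thesis .
  qed
  have iq: "integrable M (\<lambda>\<omega>. q \<omega> * exp (- X \<omega>))" using feed_int by (simp add: q_def)
  have ihb: "integrable M (\<lambda>\<omega>. (c0 + A' * 26 ^ 5 * q \<omega>) * exp (- X \<omega>))"
    using iq exp_X_int by (simp add: distrib_right mult.assoc)
  have ih: "integrable M (\<lambda>\<omega>. h \<omega> * exp (- X \<omega>))"
    by (rule Bochner_Integration.integrable_bound[OF ihb])
       (use hb in \<open>auto intro!: AE_I2 mult_right_mono order_trans[OF _ abs_ge_self] simp: abs_mult\<close>)
  have th: "\<bar>tilt h\<bar> \<le> c0 + A' * feed_const b * (s ^ 3 + s * remainder s \<psi>)"
  proof -
    have "\<bar>tilt h\<bar> \<le> tilt (\<lambda>\<omega>. \<bar>h \<omega>\<bar>)" by (rule tilt_abs)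
    also have "\<dots> \<le> tilt (\<lambda>\<omega>. c0 + A' * 26 ^ 5 * q \<omega>)"
      using integrable_abs[OF ih] hb by (intro tilt_mono ihb) (auto simp: abs_mult)
    also have "\<dots> = c0 + A' * 26 ^ 5 * tilt q"
      using tilt_add[of "\<lambda>_. c0" "\<lambda>\<omega>. A' * 26 ^ 5 * q \<omega>"] iq exp_X_int by (simp add: tilt_const tilt_cmult mult.assoc)
    also have "\<dots> \<le> c0 + A' * 26 ^ 5 * ((b * small_const b + large_const b) * (s ^ 3 + s * remainder s \<psi>))"
      using feed_down A by (intro add_left_mono mult_left_mono) (auto simp: q_def[abs_def])
    finally show ?thesis unfolding feed_const_def by (simp only: mult.assoc)
  qed
  have "tilt U = tilt (\<lambda>\<omega>. (4 * lh * b * (\<psi> ^ 3 - 3 * G * \<psi>) + 2 * r * b * \<psi> + (12 * lh * \<psi>) * Q 2 \<omega>) + ((4 * lh) * Q 3 \<omega> + h \<omega>))"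
  proof (rule tilt_cong)
    show "AE \<omega> in M. U \<omega> = (4 * lh * b * (\<psi> ^ 3 - 3 * G * \<psi>) + 2 * r * b * \<psi> + (12 * lh * \<psi>) * Q 2 \<omega>) + ((4 * lh) * Q 3 \<omega> + h \<omega>)"
      using Q1_AE
    proof eventually_elim
      case (elim \<omega>)
      have e: "4 * lh * ((\<psi> + z) ^ 3 - 3 * G * (\<psi> + z)) + 2 * r * (\<psi> + z)
         = (4 * lh * (\<psi> ^ 3 - 3 * G * \<psi>) + 2 * r * \<psi>) + (4 * lh * (3 * \<psi>\<^sup>2 - 3 * G) + 2 * r) * z ^ 1 + (12 * lh * \<psi>) * z ^ 2 + (4 * lh) * z ^ 3" for z
        by (simp add: eval_nat_numeral algebra_simps)
      have "U \<omega> - h \<omega> = (\<Sum>y\<in>I. 4 * lh * ((\<psi> + Z y \<omega>) ^ 3 - 3 * G * (\<psi> + Z y \<omega>)) + 2 * r * (\<psi> + Z y \<omega>))"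
        unfolding U_def h_def sum_subtractf by simp
      also have "\<dots> = b * (4 * lh * (\<psi> ^ 3 - 3 * G * \<psi>) + 2 * r * \<psi>) + (4 * lh * (3 * \<psi>\<^sup>2 - 3 * G) + 2 * r) * Q 1 \<omega> + (12 * lh * \<psi>) * Q 2 \<omega> + (4 * lh) * Q 3 \<omega>"
        unfolding e sum.distrib sum_distrib_left[symmetric] Q_def[symmetric] by (simp add: algebra_simps)
      finally show ?case using elim by (simp add: algebra_simps)
    qed
  qed measurable
  also have "\<dots> = 4 * lh * b * (\<psi> ^ 3 - 3 * G * \<psi>) + 2 * r * b * \<psi> + 12 * lh * \<psi> * tilt (Q 2) + (4 * lh * tilt (Q 3) + tilt h)"
  proof -
    define k where "k = 4 * lh * b * (\<psi> ^ 3 - 3 * G * \<psi>) + 2 * r * b * \<psi>"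
    have i2: "integrable M (\<lambda>\<omega>. ((12 * lh * \<psi>) * Q 2 \<omega>) * exp (- X \<omega>))" unfolding mult.assoc using tilt_ints by simp
    have i3: "integrable M (\<lambda>\<omega>. ((4 * lh) * Q 3 \<omega>) * exp (- X \<omega>))" unfolding mult.assoc using tilt_ints by simp
    have ik: "integrable M (\<lambda>\<omega>. k * exp (- X \<omega>))" using exp_X_int by simp
    have "tilt (\<lambda>\<omega>. (k + (12 * lh * \<psi>) * Q 2 \<omega>) + ((4 * lh) * Q 3 \<omega> + h \<omega>)) = (k + 12 * lh * \<psi> * tilt (Q 2)) + (4 * lh * tilt (Q 3) + tilt h)"
      by (subst tilt_add, simp only: distrib_right, intro Bochner_Integration.integrable_add ik i2,
          simp only: distrib_right, intro Bochner_Integration.integrable_add i3 ih,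
          subst tilt_add[OF ik i2], subst tilt_add[OF i3 ih], simp only: tilt_const tilt_cmult)
    then show ?thesis by (simp add: k_def)
  qed
  finally have "tilt U - (4 * lh * (b * (\<psi> ^ 3 - 3 * G * \<psi>) + 3 * b * \<gamma> * \<psi>) + 2 * r * b * \<psi> - 4 * lh * (3 * \<psi> * lead2 + lead3))
     = 4 * lh * (3 * \<psi> * (tilt (Q 2) - b * \<gamma> + lead2) + (tilt (Q 3) + lead3)) + tilt h"
    by (simp add: algebra_simps)
  moreover have "\<bar>4 * lh * (3 * \<psi> * (tilt (Q 2) - b * \<gamma> + lead2) + (tilt (Q 3) + lead3))\<bar> \<le> lead_const b * (s ^ 3 + remainder s \<psi>)"
    using leading_small leading_large by fastforce
  ultimately show ?thesis using th unfolding c0_def by linarith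
qed

end

section \<open>The quartic of the increments and the derivative of the block map\<close>

context gaussian_block begin

lemma F4_bound: "\<bar>F4 \<omega>\<bar> \<le> 10 * b * \<rho> \<omega> ^ 2"
proof -
  have nn: "0 \<le> Q 2 \<omega>" "0 \<le> Q 4 \<omega>" unfolding Q_def by (auto intro!: sum_nonneg)
  have "Q 4 \<omega> = (\<Sum>y\<in>I. (Z y \<omega>)\<^sup>2 * (Z y \<omega>)\<^sup>2)" by (simp add: Q_def power_add[symmetric])
  also have "\<dots> \<le> (\<Sum>y\<in>I. (Z y \<omega>)\<^sup>2 * Q 2 \<omega>)" by (intro sum_mono mult_left_mono Z_pow_bound) auto
  also have "\<dots> = Q 2 \<omega> * Q 2 \<omega>" by (simp add: Q_def sum_distrib_right)
  also have "\<dots> \<le> \<rho> \<omega> * \<rho> \<omega>" using nn by (intro mult_mono) (auto simp: \<rho>_def)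
  finally have 4: "Q 4 \<omega> \<le> \<rho> \<omega> ^ 2" by (simp add: power2_eq_square)
  have "\<rho> \<omega> ^ 1 \<le> \<rho> \<omega> ^ 2" using \<rho>_ge by (intro power_increasing) auto
  then have 2: "Q 2 \<omega> \<le> \<rho> \<omega> ^ 2" by (simp add: \<rho>_def)
  have g2: "\<gamma> * Q 2 \<omega> \<le> 1 * \<rho> \<omega> ^ 2" "0 \<le> \<gamma> * Q 2 \<omega>" using \<gamma>_bounds nn mult_mono[OF \<gamma>_bounds(2) 2] by auto
  have "b * \<gamma>\<^sup>2 \<le> b * \<rho> \<omega> ^ 2" using \<gamma>_bounds \<rho>_power_ge[of \<omega> 2] b_ge power_le_one[of \<gamma> 2] by (intro mult_left_mono) auto
  moreover have "0 \<le> b * \<gamma>\<^sup>2" by simp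
  moreover have "1 * \<rho> \<omega> ^ 2 \<le> b * \<rho> \<omega> ^ 2" using b_ge \<rho>_power_ge[of \<omega> 2] by (intro mult_right_mono) auto
  moreover have eq: "6 * \<gamma> * Q 2 \<omega> = 6 * (\<gamma> * Q 2 \<omega>)" "3 * b * \<gamma>\<^sup>2 = 3 * (b * \<gamma>\<^sup>2)" "10 * b * \<rho> \<omega> ^ 2 = 10 * (b * \<rho> \<omega> ^ 2)"
    by simp_all
  ultimately show ?thesis using 4 g2 nn unfolding F4_def eq by (intro abs_leI) linarith+
qed

lemma F4_meas[measurable]: "F4 \<in> borel_measurable M" unfolding F4_def[abs_def] by measurable

lemma F4_square_mean: "expectation (\<lambda>\<omega>. (F4 \<omega>)\<^sup>2) \<le> 100 * b\<^sup>2 * Mom 4" "integrable M (\<lambda>\<omega>. (F4 \<omega>)\<^sup>2)"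
proof -
  have le: "AE \<omega> in M. \<bar>(F4 \<omega>)\<^sup>2\<bar> \<le> (100 * b\<^sup>2) * \<rho> \<omega> ^ 4"
  proof (rule AE_I2)
    fix \<omega>
    have "\<bar>F4 \<omega>\<bar>\<^sup>2 \<le> (10 * b * \<rho> \<omega> ^ 2)\<^sup>2" by (intro power_mono F4_bound) auto
    then show "\<bar>(F4 \<omega>)\<^sup>2\<bar> \<le> (100 * b\<^sup>2) * \<rho> \<omega> ^ 4" by (simp add: power_mult_distrib power_mult[symmetric])
  qed
  have m: "(\<lambda>\<omega>. (F4 \<omega>)\<^sup>2) \<in> borel_measurable M" by measurable
  show "integrable M (\<lambda>\<omega>. (F4 \<omega>)\<^sup>2)" "expectation (\<lambda>\<omega>. (F4 \<omega>)\<^sup>2) \<le> 100 * b\<^sup>2 * Mom 4"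
    using \<rho>_bounded_int[OF m le] by auto
qed

end

context tilted_block begin

lemma tilt_F4:
  assumes small: "s * \<psi>\<^sup>2 \<le> 1"
  shows "\<bar>tilt F4 + 24 * lh * S4\<bar> \<le> 10 * b * small_const b * (s * (1 + \<psi>\<^sup>2))\<^sup>2"
    and "tilt (\<lambda>\<omega>. (F4 \<omega>)\<^sup>2) \<le> 100 * b\<^sup>2 * small_const b"
proof -
  have "\<bar>F4 \<omega>\<bar> \<le> (10 * b) * \<rho> \<omega> ^ 4" for \<omega>
    by (rule order_trans[OF F4_bound]) (use \<rho>_ge b_ge in \<open>auto intro!: mult_left_mono power_increasing\<close>)
  from small_field(1)[OF small F4_meas this F4_expect(1)]
  show "\<bar>tilt F4 + 24 * lh * S4\<bar> \<le> 10 * b * small_const b * (s * (1 + \<psi>\<^sup>2))\<^sup>2" unfolding cov_F4_X1 .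
  have "\<bar>(F4 \<omega>)\<^sup>2\<bar> \<le> (100 * b\<^sup>2) * \<rho> \<omega> ^ 4" for \<omega>
  proof -
    have "\<bar>F4 \<omega>\<bar>\<^sup>2 \<le> (10 * b * \<rho> \<omega> ^ 2)\<^sup>2" by (intro power_mono F4_bound) auto
    then show ?thesis by (simp add: power_mult_distrib power_mult[symmetric])
  qed
  from small_field(2)[OF small _ this]
  show "tilt (\<lambda>\<omega>. (F4 \<omega>)\<^sup>2) \<le> 100 * b\<^sup>2 * small_const b" by simp
qed

lemma tilt_prod: "tilt f = expectation (\<lambda>\<omega>. f \<omega> * (\<Prod>y\<in>I. g y (\<psi> + Z y \<omega>))) / expectation (\<lambda>\<omega>. \<Prod>y\<in>I. g y (\<psi> + Z y \<omega>))"
proof -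
  have p: "(\<Prod>y\<in>I. g y \<psi>) > 0" by (intro prod_pos g_pos) auto
  have "expectation (\<lambda>\<omega>. f \<omega> * (\<Prod>y\<in>I. g y (\<psi> + Z y \<omega>))) = expectation (\<lambda>\<omega>. (\<Prod>y\<in>I. g y \<psi>) * (f \<omega> * exp (- X \<omega>)))"
    by (simp only: exp_X mult_ac)
  moreover have "expectation (\<lambda>\<omega>. \<Prod>y\<in>I. g y (\<psi> + Z y \<omega>)) = (\<Prod>y\<in>I. g y \<psi>) * z0"
    by (simp add: exp_X z0_def)
  ultimately show ?thesis using p by (simp add: tilt_def)
qed

lemma expectation_prod_pos: "expectation (\<lambda>\<omega>. \<Prod>y\<in>I. g y (\<psi> + Z y \<omega>)) > 0"
proof -
  have p: "(\<Prod>y\<in>I. g y \<psi>) > 0" by (intro prod_pos g_pos) auto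
  have "expectation (\<lambda>\<omega>. \<Prod>y\<in>I. g y (\<psi> + Z y \<omega>)) = (\<Prod>y\<in>I. g y \<psi>) * z0"
    by (simp add: exp_X z0_def)
  then show ?thesis using p z0_pos by simp
qed

lemma uniform_bound:
  obtains K where "K \<ge> 1" "\<And>y x. y \<in> I \<Longrightarrow> g y x \<le> K" "\<And>y x. y \<in> I \<Longrightarrow> \<bar>u y x\<bar> * g y x \<le> K"
proof -
  have "\<forall>y\<in>I. \<exists>K. \<forall>x. 0 < g y x \<and> g y x \<le> K \<and> \<bar>u y x\<bar> * g y x \<le> K"
    using site_bounded(1)[OF good] by blast
  then obtain k where k: "\<And>y x. y \<in> I \<Longrightarrow> 0 < g y x \<and> g y x \<le> k y \<and> \<bar>u y x\<bar> * g y x \<le> k y" by metis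
  define K where "K = 1 + (\<Sum>y\<in>I. k y)"
  have k0: "0 \<le> k y" if "y \<in> I" for y using k[OF that, of 0] by linarith
  have le: "k y \<le> K" if "y \<in> I" for y
    using member_le_sum[of y I k] that finite_I k0 by (simp add: K_def)
  have K1: "K \<ge> 1" using k0 by (auto simp: K_def intro!: sum_nonneg)
  show ?thesis
  proof (rule that[OF K1])
    fix y x assume y: "y \<in> I"
    show "g y x \<le> K" "\<bar>u y x\<bar> * g y x \<le> K" using k[OF y, of x] le[OF y] by linarith+
  qed
qed

end

lemma (in gaussian_block) block_map_deriv:
  assumes prm: "rg_params A A' s lh r G" and good: "\<And>y. y \<in> I \<Longrightarrow> rg_good G lh r A A' s (g y) (u y)" and c: "0 < c" "c \<le> 1"
  shows "((\<lambda>x. expectation (\<lambda>\<omega>. \<Prod>y\<in>I. g y (c * x + Z y \<omega>))) has_real_derivative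
      expectation (\<lambda>\<omega>. - c * ((\<Sum>y\<in>I. u y (c * x + Z y \<omega>)) * (\<Prod>y\<in>I. g y (c * x + Z y \<omega>))))) (at x)"
proof -
  interpret rg_params A A' s lh r G by fact
  interpret T: tilted_block M I Z A A' s lh r G g u 0 by unfold_locales (rule good)
  obtain K where K: "K \<ge> 1" "\<And>y x. y \<in> I \<Longrightarrow> g y x \<le> K" "\<And>y x. y \<in> I \<Longrightarrow> \<bar>u y x\<bar> * g y x \<le> K"
    using T.uniform_bound by blast
  have gm: "(\<lambda>\<omega>. g y (c * x + Z y \<omega>)) \<in> borel_measurable M" and um: "(\<lambda>\<omega>. u y (c * x + Z y \<omega>)) \<in> borel_measurable M" if "y \<in> I" for y x
    using that by (auto intro!: measurable_compose[OF _ T.g_meas] measurable_compose[OF _ T.u_meas])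
  have pb: "(\<Prod>y\<in>J. g y (c * x + Z y \<omega>)) \<le> K ^ card I" "0 \<le> (\<Prod>y\<in>J. g y (c * x + Z y \<omega>))" if "J \<subseteq> I" for J x \<omega>
  proof -
    have "(\<Prod>y\<in>J. g y (c * x + Z y \<omega>)) \<le> (\<Prod>y\<in>J. K)"
      using that K T.g_pos by (intro prod_mono) (auto simp: less_imp_le subset_eq)
    also have "\<dots> = K ^ card J" by simp
    also have "\<dots> \<le> K ^ card I" using K finite_I that by (intro power_increasing card_mono) auto
    finally show "(\<Prod>y\<in>J. g y (c * x + Z y \<omega>)) \<le> K ^ card I" .
    show "0 \<le> (\<Prod>y\<in>J. g y (c * x + Z y \<omega>))" using that T.g_pos by (intro prod_nonneg) (auto simp: less_imp_le subset_eq)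
  qed
  define KK where "KK = K ^ card I + b * (K * K ^ card I)"
  have KK: "0 \<le> b * (K * K ^ card I)" "0 \<le> K ^ card I" using K by auto
  show ?thesis
  proof (rule has_derivative_expectation[of _ _ KK])
    fix x
    show "(\<lambda>\<omega>. \<Prod>y\<in>I. g y (c * x + Z y \<omega>)) \<in> borel_measurable M" by (intro borel_measurable_prod gm)
    show "(\<lambda>\<omega>. - c * ((\<Sum>y\<in>I. u y (c * x + Z y \<omega>)) * (\<Prod>y\<in>I. g y (c * x + Z y \<omega>)))) \<in> borel_measurable M"
      by (intro borel_measurable_times borel_measurable_const borel_measurable_prod borel_measurable_sum gm um)
    fix \<omega>
    have e: "(\<lambda>x. \<Prod>y\<in>I. g y (c * x + Z y \<omega>)) = (\<lambda>x. exp (\<Sum>y\<in>I. ln (g y (c * x + Z y \<omega>))))"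
      by (simp add: exp_sum finite_I T.g_pos)
    have d: "((\<lambda>x. ln (g y (c * x + Z y \<omega>))) has_real_derivative - c * u y (c * x + Z y \<omega>)) (at x)" if "y \<in> I" for y
    proof -
      have "((\<lambda>x. g y (c * x + Z y \<omega>)) has_real_derivative - (u y (c * x + Z y \<omega>) * g y (c * x + Z y \<omega>)) * c) (at x)"
        by (rule DERIV_chain2[OF T.g_deriv[OF that]]) (auto intro!: derivative_eq_intros)
      then show ?thesis
        using T.g_pos[OF that, of "c * x + Z y \<omega>"] by (auto intro!: derivative_eq_intros simp: field_simps)
    qed
    have "((\<lambda>x. exp (\<Sum>y\<in>I. ln (g y (c * x + Z y \<omega>)))) has_real_derivative
       exp (\<Sum>y\<in>I. ln (g y (c * x + Z y \<omega>))) * (\<Sum>y\<in>I. - c * u y (c * x + Z y \<omega>))) (at x)"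
      by (intro DERIV_fun_exp DERIV_sum d)
    also have "exp (\<Sum>y\<in>I. ln (g y (c * x + Z y \<omega>))) * (\<Sum>y\<in>I. - c * u y (c * x + Z y \<omega>))
        = - c * ((\<Sum>y\<in>I. u y (c * x + Z y \<omega>)) * (\<Prod>y\<in>I. g y (c * x + Z y \<omega>)))"
      unfolding fun_cong[OF e, of x, symmetric] sum_distrib_left[symmetric] by simp
    finally show "((\<lambda>x. \<Prod>y\<in>I. g y (c * x + Z y \<omega>)) has_real_derivative
        - c * ((\<Sum>y\<in>I. u y (c * x + Z y \<omega>)) * (\<Prod>y\<in>I. g y (c * x + Z y \<omega>)))) (at x)" unfolding e .
    show "\<bar>\<Prod>y\<in>I. g y (c * x + Z y \<omega>)\<bar> \<le> KK" using pb[of I x \<omega>] KK by (simp add: KK_def)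
    have "\<bar>(\<Sum>y\<in>I. u y (c * x + Z y \<omega>)) * (\<Prod>y\<in>I. g y (c * x + Z y \<omega>))\<bar>
       \<le> (\<Sum>y\<in>I. \<bar>u y (c * x + Z y \<omega>)\<bar> * (\<Prod>y\<in>I. g y (c * x + Z y \<omega>)))"
      unfolding sum_distrib_right by (rule order_trans[OF sum_abs]) (use pb(2)[of I x \<omega>] in \<open>auto simp: abs_mult\<close>)
    also have "\<dots> \<le> (\<Sum>y\<in>I. K * K ^ card I)"
    proof (rule sum_mono)
      fix y assume y: "y \<in> I"
      \<comment> \<open>The factor u, which need not be bounded, is paired with the weight of its
        own site; that product is bounded.\<close>
      have "\<bar>u y (c * x + Z y \<omega>)\<bar> * (\<Prod>y\<in>I. g y (c * x + Z y \<omega>))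
         = (\<bar>u y (c * x + Z y \<omega>)\<bar> * g y (c * x + Z y \<omega>)) * (\<Prod>y\<in>I - {y}. g y (c * x + Z y \<omega>))"
        using y finite_I by (simp add: prod.remove)
      also have "\<dots> \<le> K * K ^ card I"
        using K y pb[of "I - {y}" x \<omega>] by (intro mult_mono) auto
      finally show "\<bar>u y (c * x + Z y \<omega>)\<bar> * (\<Prod>y\<in>I. g y (c * x + Z y \<omega>)) \<le> K * K ^ card I" .
    qed
    finally have "c * \<bar>(\<Sum>y\<in>I. u y (c * x + Z y \<omega>)) * (\<Prod>y\<in>I. g y (c * x + Z y \<omega>))\<bar> \<le> 1 * (b * (K * K ^ card I))"
      using c by (intro mult_mono) auto
    then show "\<bar>- c * ((\<Sum>y\<in>I. u y (c * x + Z y \<omega>)) * (\<Prod>y\<in>I. g y (c * x + Z y \<omega>)))\<bar> \<le> KK"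
      using c KK by (simp add: KK_def abs_mult)
  qed
qed

section \<open>One renormalisation step and the flow of the couplings\<close>

definition flow_gamma :: "nat \<Rightarrow> real" where "flow_gamma L = 1 - 1 / real L ^ 3"

text \<open>The coefficient of \<open>lh\<^sup>2\<close> in the new mass as the block computation
  produces it: the first summand from the Wick ordering of \<open>Q 2\<close>, the second from the
  variance of \<open>Q 3\<close>. \<open>alpha3_eq\<close> identifies it with
  \<open>alpha3\<close>.\<close>

definition flow_alpha :: "nat \<Rightarrow> real \<Rightarrow> real" where
  "flow_alpha L G = - (144 * flow_gamma L * (G / real L) + 48 * (flow_gamma L ^ 3 - (real L ^ 3 - 1) / (real L ^ 3) ^ 3))"

text \<open>H is the variance of the rescaled coarse field and \<sigma> the row sum of the cubed
  covariance. Integrating out a layer moves the Wick constant from H + \<gamma> to H, because -3 (H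
  + \<gamma>) \<psi> + 3 \<gamma> \<psi> = -3 H \<psi>; the rest collects the cubic and linear terms
  into new couplings.\<close>

lemma flow_identity:
  fixes w H \<gamma> \<sigma> lh r \<psi> :: real
  shows "4 * (w\<^sup>2 * (lh - 36 * \<gamma> * lh\<^sup>2)) * ((w * \<psi>) ^ 3 - 3 * (w\<^sup>2 * H) * (w * \<psi>))
      + 2 * ((w\<^sup>2)\<^sup>2 * (r * (1 - 12 * \<gamma> * lh) + - (144 * \<gamma> * H + 48 * \<sigma>) * lh\<^sup>2)) * (w * \<psi>)
    = w ^ 5 * (4 * lh * (\<psi> ^ 3 - 3 * (H + \<gamma>) * \<psi> + 3 * \<gamma> * \<psi>) + 2 * r * \<psi>
        - 4 * lh * (3 * \<psi> * (12 * lh * \<gamma> * (\<psi>\<^sup>2 - H) + 2 * \<gamma> * r) + 24 * lh * \<psi> * \<sigma>))"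
  by (simp add: eval_nat_numeral algebra_simps)

text \<open>The logarithmic derivative of the block map at x is, up to sign, the tilted mean of
  \<open>U\<close> at x / w divided by w, with w = sqrt L. \<open>tilt_U\<close> gives its leading
  part and an error; the hypotheses on A, A' and s say that this error fits into the same form at
  coupling L s.\<close>

theorem rg_step:
  fixes M :: "'w measure" and I :: "'i set" and L :: nat
  assumes blk: "gaussian_block M I Z" and card: "card I = L ^ 3" and L: "L \<ge> 2"
    and prm: "rg_params A A' s lh r G" and Gfix: "G = G / real L + flow_gamma L"
    and A': "2 * lead_const (real L ^ 3) \<le> A'" and Afix: "lead_const (real L ^ 3) + A' * feed_const (real L ^ 3) \<le> A"
    and sfix: "4 * s * feed_const (real L ^ 3) \<le> 1"
    and good: "\<And>y. y \<in> I \<Longrightarrow> rg_good G lh r A A' s (g y) (u y)"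
  shows "\<exists>u'. rg_good G (real L * (lh - 36 * flow_gamma L * lh\<^sup>2)) (real L ^ 2 * (r * (1 - 12 * flow_gamma L * lh) + flow_alpha L G * lh\<^sup>2))
      A A' (real L * s) (\<lambda>x. \<integral>\<omega>. (\<Prod>y\<in>I. g y (x / sqrt (real L) + Z y \<omega>)) \<partial>M) u'"
proof -
  interpret gaussian_block M I Z by fact
  interpret rg_params A A' s lh r G by fact
  have bL: "b = real L ^ 3" using card by simp
  define w where "w = sqrt (real L)"
  have w2: "w\<^sup>2 = real L" by (simp add: w_def)
  have w14: "w \<ge> 1.4" unfolding w_def by (rule real_le_rsqrt) (use L in \<open>auto simp: power2_eq_square\<close>)
  have w6: "b = w ^ 6" unfolding bL w2[symmetric] by (simp add: power_mult[symmetric])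
  define c where "c = 1 / w"
  have c: "0 < c" "c \<le> 1" using w14 by (auto simp: c_def)
  have tb: "tilted_block M I Z A A' s lh r G g u"
    by unfold_locales (rule good)
  interpret T0: tilted_block M I Z A A' s lh r G g u 0 by (rule tb)
  define N where "N x = expectation (\<lambda>\<omega>. (\<Sum>y\<in>I. u y (c * x + Z y \<omega>)) * (\<Prod>y\<in>I. g y (c * x + Z y \<omega>)))" for x
  define R where "R x = expectation (\<lambda>\<omega>. \<Prod>y\<in>I. g y (c * x + Z y \<omega>))" for x
  define u' where "u' x = c * (N x / R x)" for x
  have Rpos: "R x > 0" for x
    using tilted_block.expectation_prod_pos[OF tb, of "c * x"] by (simp add: R_def)
  have gm: "(\<lambda>p. g y (c * fst p + Z y (snd p))) \<in> borel_measurable (borel \<Otimes>\<^sub>M M)" 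
    and um: "(\<lambda>p. u y (c * fst p + Z y (snd p))) \<in> borel_measurable (borel \<Otimes>\<^sub>M M)" if "y \<in> I" for y
    using that by (auto intro!: measurable_compose[OF _ T0.g_meas] measurable_compose[OF _ T0.u_meas])
  have Rm: "R \<in> borel_measurable borel"
    unfolding R_def[abs_def]
    by (rule borel_measurable_lebesgue_integral) (auto simp: split_beta' intro!: borel_measurable_prod gm)
  have Nm: "N \<in> borel_measurable borel"
    unfolding N_def[abs_def]
    by (rule borel_measurable_lebesgue_integral) (auto simp: split_beta' intro!: borel_measurable_times borel_measurable_sum borel_measurable_prod gm um)
  have um': "u' \<in> borel_measurable borel" unfolding u'_def[abs_def] using Rm Nm by measurable
  have d: "(R has_real_derivative - (u' x * R x)) (at x)" for x
  proof -
    have "(R has_real_derivative expectation (\<lambda>\<omega>. - c * ((\<Sum>y\<in>I. u y (c * x + Z y \<omega>)) * (\<Prod>y\<in>I. g y (c * x + Z y \<omega>))))) (at x)"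
      unfolding R_def[abs_def] by (rule block_map_deriv[OF prm good c])
    also have "expectation (\<lambda>\<omega>. - c * ((\<Sum>y\<in>I. u y (c * x + Z y \<omega>)) * (\<Prod>y\<in>I. g y (c * x + Z y \<omega>)))) = - (u' x * R x)"
      using Rpos[of x] by (simp add: u'_def N_def)
    finally show ?thesis .
  qed
  have e: "\<bar>u' x - (4 * (real L * (lh - 36 * flow_gamma L * lh\<^sup>2)) * (x ^ 3 - 3 * G * x) 
        + 2 * (real L ^ 2 * (r * (1 - 12 * flow_gamma L * lh) + flow_alpha L G * lh\<^sup>2)) * x)\<bar>
      \<le> A * (real L * s) ^ 3 + A' * remainder (real L * s) x" for x
  proof -
    interpret T: tilted_block M I Z A A' s lh r G g u "c * x" by (rule tb)
    define \<psi> where "\<psi> = c * x"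
    have x: "x = w * \<psi>" using w14 by (simp add: \<psi>_def c_def)
    define m where "m = remainder s \<psi>"
    define C3 where "C3 = lead_const b"
    define C4 where "C4 = feed_const b"
    define H where "H = G / real L"
    define \<sigma> where "\<sigma> = flow_gamma L ^ 3 - (real L ^ 3 - 1) / (real L ^ 3) ^ 3"
    have \<gamma>L: "flow_gamma L = \<gamma>" by (simp add: flow_gamma_def \<gamma>_def bL card)
    have GH: "G = w\<^sup>2 * H" using L by (simp add: H_def w2)
    have GH2: "G = H + \<gamma>" using Gfix by (simp add: H_def \<gamma>L)
    have S3: "S3 = w ^ 6 * \<sigma>" by (simp add: S3_def \<sigma>_def \<gamma>L w6[symmetric] bL)
    have al: "flow_alpha L G = - (144 * \<gamma> * H + 48 * \<sigma>)" by (simp add: flow_alpha_def H_def \<sigma>_def \<gamma>L)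
    have u'T: "u' x = c * T.tilt T.U"
      by (simp add: u'_def N_def R_def T.tilt_prod T.U_def[abs_def])
    define base where "base = 4 * lh * (b * (\<psi> ^ 3 - 3 * G * \<psi>) + 3 * b * \<gamma> * \<psi>) + 2 * r * b * \<psi> - 4 * lh * (3 * \<psi> * T.lead2 + T.lead3)"
    define E where "E = C3 * (s ^ 3 + m) + b * A * s ^ 3 + 5 / 4 * b * A' * m + A' * C4 * (s ^ 3 + s * m)"
    have tE: "\<bar>T.tilt T.U - base\<bar> \<le> E"
      using T.tilt_U by (simp only: base_def E_def m_def C3_def C4_def \<psi>_def)
    have eq: "4 * (real L * (lh - 36 * flow_gamma L * lh\<^sup>2)) * (x ^ 3 - 3 * G * x) 
        + 2 * (real L ^ 2 * (r * (1 - 12 * flow_gamma L * lh) + flow_alpha L G * lh\<^sup>2)) * x = c * base"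
    proof -
      have "c * base = w ^ 5 * (4 * lh * (\<psi> ^ 3 - 3 * (H + \<gamma>) * \<psi> + 3 * \<gamma> * \<psi>) + 2 * r * \<psi>
        - 4 * lh * (3 * \<psi> * (12 * lh * \<gamma> * (\<psi>\<^sup>2 - H) + 2 * \<gamma> * r) + 24 * lh * \<psi> * \<sigma>))"
      proof -
        have l2: "T.lead2 = w ^ 6 * (12 * lh * \<gamma> * (\<psi>\<^sup>2 - H) + 2 * \<gamma> * r)"
          unfolding T.lead2_def unfolding w6 \<psi>_def[symmetric] GH2 by (simp add: algebra_simps)
        have l3: "T.lead3 = w ^ 6 * (24 * lh * \<psi> * \<sigma>)"
          unfolding T.lead3_def unfolding S3 \<psi>_def[symmetric] by (simp add: algebra_simps)
        have "base = w ^ 6 * (4 * lh * (\<psi> ^ 3 - 3 * (H + \<gamma>) * \<psi> + 3 * \<gamma> * \<psi>) + 2 * r * \<psi>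
        - 4 * lh * (3 * \<psi> * (12 * lh * \<gamma> * (\<psi>\<^sup>2 - H) + 2 * \<gamma> * r) + 24 * lh * \<psi> * \<sigma>))"
          unfolding base_def l2 l3 unfolding w6 GH2 by (simp add: algebra_simps)
        moreover have "c * w ^ 6 = w ^ 5" using w14 by (simp add: c_def eval_nat_numeral)
        ultimately show ?thesis by (simp only: mult.assoc[symmetric])
      qed
      moreover have "4 * (real L * (lh - 36 * flow_gamma L * lh\<^sup>2)) * (x ^ 3 - 3 * G * x) 
        + 2 * (real L ^ 2 * (r * (1 - 12 * flow_gamma L * lh) + flow_alpha L G * lh\<^sup>2)) * x
        = 4 * (w\<^sup>2 * (lh - 36 * \<gamma> * lh\<^sup>2)) * ((w * \<psi>) ^ 3 - 3 * (w\<^sup>2 * H) * (w * \<psi>))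
      + 2 * ((w\<^sup>2)\<^sup>2 * (r * (1 - 12 * \<gamma> * lh) + - (144 * \<gamma> * H + 48 * \<sigma>) * lh\<^sup>2)) * (w * \<psi>)"
        unfolding al \<gamma>L by (simp only: x[symmetric] GH[unfolded w2, symmetric] w2)
      ultimately show ?thesis using flow_identity by simp
    qed
    have m0: "m \<ge> 0" "s ^ 3 \<ge> 0" using s rg_params_axioms remainder_nonneg by (auto simp: m_def rg_params_def)
    have A0: "0 \<le> A" "0 \<le> A'" using rg_params_axioms by (auto simp: rg_params_def)
    have s0: "s > 0" using rg_params_axioms by (auto simp: rg_params_def)
    have C30: "C3 \<ge> 0" "C4 \<ge> 0" using T.const_nonneg b_ge by (auto simp: C3_def C4_def lead_const_def feed_const_def)
    have w5: "w ^ 5 \<ge> 4"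
    proof -
      have "(1.4 :: real) ^ 5 \<le> w ^ 5" using w14 by (intro power_mono) auto
      then show ?thesis by (simp add: eval_nat_numeral)
    qed
    have "c * E \<le> (C3 + A' * C4 + w ^ 5 * A) * s ^ 3 + (C3 + 5 / 4 * w ^ 5 * A' + A' * (s * C4)) * m"
    proof -
      have cb: "c * b = w ^ 5" using w14 by (simp add: c_def w6 eval_nat_numeral)
      have "c * E = c * (C3 * (s ^ 3 + m) + A' * C4 * (s ^ 3 + s * m)) + (c * b) * (A * s ^ 3 + 5 / 4 * A' * m)"
        by (simp add: E_def algebra_simps)
      also have "\<dots> \<le> 1 * (C3 * (s ^ 3 + m) + A' * C4 * (s ^ 3 + s * m)) + w ^ 5 * (A * s ^ 3 + 5 / 4 * A' * m)"
        unfolding cb using c C30 A0 m0 s0 by (intro add_mono mult_right_mono) (auto intro!: add_nonneg_nonneg mult_nonneg_nonneg)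
      also have "\<dots> = (C3 + A' * C4 + w ^ 5 * A) * s ^ 3 + (C3 + 5 / 4 * w ^ 5 * A' + A' * (s * C4)) * m"
        by (simp add: algebra_simps)
      finally show ?thesis .
    qed
    also have "\<dots> \<le> (A * w ^ 6) * s ^ 3 + (A' * w ^ 7) * m"
    proof (intro add_mono mult_right_mono m0)
      \<comment> \<open>The fresh errors use up one A, so 1 + w^5 has to be at most w^6; w at least
        1.4 suffices.\<close>
      have "C3 + A' * C4 \<le> A" using Afix by (simp add: C3_def C4_def bL card)
      moreover have "A * (1 + w ^ 5) \<le> A * w ^ 6"
      proof (intro mult_left_mono A0)
        have "w ^ 5 * 1.4 \<le> w ^ 5 * w" using w14 by (intro mult_left_mono) auto
        then show "1 + w ^ 5 \<le> w ^ 6" using w5 by (simp add: eval_nat_numeral)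
      qed
      ultimately show "C3 + A' * C4 + w ^ 5 * A \<le> A * w ^ 6" by (simp add: algebra_simps)
      \<comment> \<open>Here the fresh errors use up 1/2 and 1/4 of A', and the inherited error 5/4
        w^5; the room is w^7, at least 2 w^5.\<close>
      have "C3 \<le> A' / 2" using A' by (simp add: C3_def bL card)
      moreover have "A' * (s * C4) \<le> A' * (1 / 4)" using sfix A0 by (intro mult_left_mono) (auto simp: C4_def bL card)
      moreover have "A' * (5 / 4 * w ^ 5 + 3 / 4) \<le> A' * w ^ 7"
      proof (intro mult_left_mono A0)
        have "2 * w ^ 5 \<le> w\<^sup>2 * w ^ 5" using L w14 by (intro mult_right_mono) (auto simp: w2)
        then show "5 / 4 * w ^ 5 + 3 / 4 \<le> w ^ 7" using w5 by (simp add: eval_nat_numeral)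
      qed
      ultimately show "C3 + 5 / 4 * w ^ 5 * A' + A' * (s * C4) \<le> A' * w ^ 7" by (simp add: algebra_simps)
    qed
    also have "\<dots> \<le> A * (real L * s) ^ 3 + A' * remainder (real L * s) x"
    proof -
      have "w ^ 7 * m \<le> remainder (real L * s) x"
        unfolding x m_def w2[symmetric] using w14 s0 by (intro remainder_rescale) auto
      then have "A' * (w ^ 7 * m) \<le> A' * remainder (real L * s) x" by (intro mult_left_mono A0)
      moreover have "(A * w ^ 6) * s ^ 3 = A * (real L * s) ^ 3"
        unfolding w2[symmetric] by (simp add: power_mult_distrib power_mult[symmetric])
      moreover have "(A' * w ^ 7) * m = A' * (w ^ 7 * m)" by simp
      ultimately show ?thesis by linarith
    qed
    finally have cE: "c * E \<le> A * (real L * s) ^ 3 + A' * remainder (real L * s) x" .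
    have "\<bar>u' x - c * base\<bar> = c * \<bar>T.tilt T.U - base\<bar>"
      unfolding u'T using c by (simp add: abs_mult right_diff_distrib[symmetric])
    also have "\<dots> \<le> c * E" using tE c by (intro mult_left_mono) auto
    finally show ?thesis unfolding eq using cE by linarith
  qed
  have Re: "(\<lambda>x. \<integral>\<omega>. (\<Prod>y\<in>I. g y (x / sqrt (real L) + Z y \<omega>)) \<partial>M) = R"
    by (simp add: R_def[abs_def] c_def w_def)
  show ?thesis
    unfolding rg_good_def Re by (intro exI[of _ u'] conjI um' allI Rpos d e)
qed

text \<open>s is the coupling obtained by pure scaling. The exponents are chosen so that the units
  outgrow the linear flow: s^2 grows by L^2 against L for the quartic coupling, s^(5/2) by L^(5/2)
  against L^2 for the mass. The half power beyond s^2 is what a logarithm of s costs in the source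
  terms.\<close>

definition flow_near :: "nat \<Rightarrow> real \<Rightarrow> real \<Rightarrow> real \<Rightarrow> real \<Rightarrow> bool" where
  "flow_near L K s lh r \<longleftrightarrow> \<bar>lh - s\<bar> \<le> 144 * s\<^sup>2 \<and> \<bar>r - mass_ct L s\<bar> \<le> K * (s\<^sup>2 * sqrt s)"

lemma G00_eq: "L \<ge> 2 \<Longrightarrow> G00 L = 1 + 1 / real L + 1 / real L ^ 2"
  by (simp add: G00_def field_simps eval_nat_numeral)

text \<open>Stationarity of the variance under one scale step; it permits the same Wick constant at
  every scale.\<close>

lemma G00_fixed: "L \<ge> 2 \<Longrightarrow> G00 L = G00 L / real L + flow_gamma L"
  by (simp add: G00_eq flow_gamma_def field_simps eval_nat_numeral)

lemma G00_bounds: assumes "L \<ge> 2" shows "0 \<le> G00 L" "G00 L \<le> 2"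
proof -
  have "1 / real L \<le> 1 / 2" using assms by (simp add: divide_simps)
  moreover have "1 / real L ^ 2 \<le> 1 / 2"
  proof -
    have "2 * 1 \<le> real L * real L" using assms by (intro mult_mono) auto
    then show ?thesis by (simp add: divide_simps power2_eq_square) 
  qed
  moreover have "0 \<le> 1 / real L" "0 \<le> 1 / real L ^ 2" by simp_all
  ultimately show "0 \<le> G00 L" "G00 L \<le> 2" unfolding G00_eq[OF assms] by linarith+
qed

lemma flow_gamma_bounds: "L \<ge> 2 \<Longrightarrow> 0 \<le> flow_gamma L" "L \<ge> 2 \<Longrightarrow> flow_gamma L \<le> 1"
  by (auto simp: flow_gamma_def divide_simps)

lemma Lam_image: "Lam L n = (\<lambda>f. \<chi> i. f i) ` (PiE (UNIV :: 3 set) (\<lambda>_. {0..<int (L ^ n)}))"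
proof (intro set_eqI iffI)
  fix x :: site assume "x \<in> Lam L n"
  then show "x \<in> (\<lambda>f. \<chi> i. f i) ` (PiE (UNIV :: 3 set) (\<lambda>_. {0..<int (L ^ n)}))"
    by (intro image_eqI[of _ _ "\<lambda>i. x $ i"]) (auto simp: Lam_def vec_eq_iff)
qed (auto simp: Lam_def PiE_iff)

lemma finite_Lam [simp]: "finite (Lam L n)"
  unfolding Lam_image by (intro finite_imageI finite_PiE) auto

lemma card_Lam: "card (Lam L n) = L ^ (3 * n)"
proof -
  have "inj_on (\<lambda>f. \<chi> i. f i) (PiE (UNIV :: 3 set) (\<lambda>_. {0..<int (L ^ n)}))"
    by (auto simp: inj_on_def vec_eq_iff fun_eq_iff)
  then show ?thesis unfolding Lam_image by (simp add: card_image card_PiE nat_power_eq power_mult[symmetric] mult.commute)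
qed

lemma ipart_Lam:
  assumes "L \<ge> 1" "x \<in> Lam L (Suc n)" shows "ipart x L \<in> Lam L n"
proof -
  have "0 \<le> x $ i div int L \<and> x $ i div int L < int (L ^ n)" for i
  proof -
    have x: "0 \<le> x $ i" "x $ i < int (L ^ n) * int L" using assms by (auto simp: Lam_def mult.commute)
    have "x $ i div int L < int (L ^ n)"
    proof (rule ccontr)
      assume "\<not> x $ i div int L < int (L ^ n)"
      then have "int (L ^ n) * int L \<le> (x $ i div int L) * int L" by (intro mult_right_mono) auto
      also have "\<dots> \<le> x $ i" using x assms by (metis div_mult_mod_eq le_add_same_cancel1 pos_mod_sign of_nat_0_less_iff less_eq_Suc_le One_nat_def)
      finally show False using x by simp
    qed
    then show ?thesis using x assms by (simp add: pos_imp_zdiv_nonneg_iff)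
  qed
  then show ?thesis by (simp add: Lam_def ipart_def)
qed

lemma card_block:
  assumes L: "L \<ge> 1" and x: "x \<in> Lam L n"
  shows "card {y \<in> Lam L (Suc n). ipart y L = x} = L ^ 3"
proof -
  define f where "f w = (\<chi> i. int L * x $ i + w $ i)" for w :: site
  have "{y \<in> Lam L (Suc n). ipart y L = x} = f ` Lam L 1"
  proof (intro set_eqI iffI)
    fix y assume y: "y \<in> {y \<in> Lam L (Suc n). ipart y L = x}"
    then have xi: "x $ i = y $ i div int L" for i by (auto simp: ipart_def vec_eq_iff)
    define w :: site where "w = (\<chi> i. y $ i mod int L)"
    have "w \<in> Lam L 1" using L by (auto simp: Lam_def w_def)
    moreover have "y = f w" by (simp add: f_def w_def vec_eq_iff xi)
    ultimately show "y \<in> f ` Lam L 1" by auto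
  next
    fix y assume "y \<in> f ` Lam L 1"
    then obtain w where w: "w \<in> Lam L 1" "y = f w" by auto
    have wi: "0 \<le> w $ i" "w $ i < int L" and xi: "0 \<le> x $ i" "x $ i < int (L ^ n)" for i
      using w x by (auto simp: Lam_def)
    have "y $ i < int (L ^ Suc n)" for i
    proof -
      have "y $ i < int L * x $ i + int L" using wi[of i] by (simp add: w f_def)
      also have "\<dots> = int L * (x $ i + 1)" by (simp add: algebra_simps)
      also have "\<dots> \<le> int L * int (L ^ n)" using xi[of i] by (intro mult_left_mono) auto
      finally show ?thesis by simp
    qed
    moreover have "0 \<le> y $ i" for i using wi[of i] xi[of i] by (simp add: w f_def)
    moreover have "ipart y L = x" using wi L by (auto simp: ipart_def w f_def vec_eq_iff div_pos_pos_trivial)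
    ultimately show "y \<in> {y \<in> Lam L (Suc n). ipart y L = x}" by (auto simp: Lam_def)
  qed
  moreover have "inj_on f (Lam L 1)" by (auto simp: inj_on_def f_def vec_eq_iff)
  ultimately show ?thesis by (simp add: card_image card_Lam del: One_nat_def)
qed

lemma phi_Suc:
  assumes "L \<ge> 1"
  shows "phi L (Suc n) x \<omega> = phi L n (ipart x L) \<omega> / sqrt (real L) + \<omega> (Suc n, x)"
proof -
  have a: "real L powr (- real (Suc m) / 2) = real L powr (- real m / 2) / sqrt (real L)" for m
  proof -
    have "real L powr (- real (Suc m) / 2) = real L powr (- real m / 2 + - (1 / 2))"
      by (rule arg_cong[where f = "\<lambda>t. real L powr t"]) (simp add: field_simps)
    also have "\<dots> = real L powr (- real m / 2) * real L powr - (1 / 2)" by (rule powr_add)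
    also have "real L powr - (1 / 2) = 1 / sqrt (real L)"
      unfolding powr_minus by (simp add: powr_half_sqrt inverse_eq_divide)
    finally show ?thesis by simp
  qed
  have b: "ipart x (L ^ Suc m) = ipart (ipart x L) (L ^ m)" for m
    by (simp add: ipart_def vec_eq_iff zdiv_zmult2_eq)
  have "ipart x 1 = x" by (simp add: ipart_def vec_eq_iff)
  then have "phi L (Suc n) x \<omega> = \<omega> (Suc n, x) + (\<Sum>m\<le>n. real L powr (- real (Suc m) / 2) * \<omega> (n - m, ipart x (L ^ Suc m)))"
    using assms unfolding phi_def sum.atMost_Suc_shift by simp
  also have "(\<Sum>m\<le>n. real L powr (- real (Suc m) / 2) * \<omega> (n - m, ipart x (L ^ Suc m))) = phi L n (ipart x L) \<omega> / sqrt (real L)"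
    unfolding phi_def sum_divide_distrib a b by simp
  finally show ?thesis by simp
qed

text \<open>Differentiating a polynomial in t times the generating exponential gives again such a
  product, so four derivatives are four polynomial computations.\<close>

lemma wick_2: "wick L 2 u = u\<^sup>2 - G00 L" and wick_4: "wick L 4 u = u ^ 4 - 6 * G00 L * u\<^sup>2 + 3 * (G00 L)\<^sup>2"
proof -
  define G where "G = G00 L"
  define e where "e t = exp (t * u - t\<^sup>2 / 2 * G)" for t
  have de: "(e has_real_derivative (u - t * G) * e t) (at t)" for t
    unfolding e_def[abs_def] by (auto intro!: derivative_eq_intros simp: e_def)
  have D: "deriv (\<lambda>t. p t * e t) = (\<lambda>t. (p' t + (u - t * G) * p t) * e t)"
    if "\<And>t. (p has_real_derivative p' t) (at t)" for p p' :: "real \<Rightarrow> real"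
    by (rule ext, rule DERIV_imp_deriv) (auto intro!: derivative_eq_intros that de simp: algebra_simps)
  have 1: "deriv e = (\<lambda>t. (u - t * G) * e t)" by (rule ext, rule DERIV_imp_deriv, rule de)
  have 2: "deriv (deriv e) = (\<lambda>t. (- G + (u - t * G) * (u - t * G)) * e t)"
    unfolding 1 by (rule D) (auto intro!: derivative_eq_intros)
  have 3: "deriv (deriv (deriv e)) = (\<lambda>t. (- 2 * G * (u - t * G) + (u - t * G) * (- G + (u - t * G) * (u - t * G))) * e t)"
    unfolding 2 by (rule D) (auto intro!: derivative_eq_intros simp: algebra_simps)
  have 4: "deriv (deriv (deriv (deriv e))) = (\<lambda>t. ((2 * G * G - G * (- G + (u - t * G) * (u - t * G)) + (u - t * G) * (- 2 * G * (u - t * G)))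
       + (u - t * G) * (- 2 * G * (u - t * G) + (u - t * G) * (- G + (u - t * G) * (u - t * G)))) * e t)"
    unfolding 3 by (rule D) (auto intro!: derivative_eq_intros simp: algebra_simps)
  have e0: "e 0 = 1" by (simp add: e_def)
  have "wick L 2 u = deriv (deriv e) 0" by (simp add: wick_def e_def[abs_def] G_def numeral_2_eq_2)
  then show "wick L 2 u = u\<^sup>2 - G00 L" unfolding 2 by (simp add: e0 G_def power2_eq_square)
  have "wick L 4 u = deriv (deriv (deriv (deriv e))) 0" by (simp add: wick_def e_def[abs_def] G_def eval_nat_numeral)
  then show "wick L 4 u = u ^ 4 - 6 * G00 L * u\<^sup>2 + 3 * (G00 L)\<^sup>2" unfolding 4 
    by (simp add: e0 G_def eval_nat_numeral algebra_simps)
qed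

text \<open>Behind the identity: with H = G00 / L and the layer covariance C, the sum over all y of
  (H + C)^3 is L^3 H^3 + 3 H \<gamma> + \<sigma>, and L^3 H^3 = G00^3 is precisely the term y = 0
  that \<open>alpha3\<close> omits. The off-diagonal entries all equal h + h^2 with h = 1 / L, so
  the check is one in a rational function of h.\<close>

lemma alpha3_eq:
  assumes L: "L \<ge> 2" shows "alpha3 L = flow_alpha L (G00 L)"
proof -
  define h where "h = 1 / real L"
  have h: "h > 0" "real L = 1 / h" using L by (auto simp: h_def)
  have z: "(0::site) \<in> Lam L 1" using L by (auto simp: Lam_def)
  have Gc: "Gcov L 0 y = h + h\<^sup>2" if "y \<in> Lam L 1 - {0}" for y
  proof -
    have "(0 = y) = False" using that by auto
    then show ?thesis unfolding Gcov_def G00_eq[OF L] h(2) using h(1) by (simp add: eval_nat_numeral field_simps)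
  qed
  have "(\<Sum>y\<in>Lam L 1 - {0}. Gcov L 0 y ^ 3) = (\<Sum>y\<in>Lam L 1 - {0}. (h + h\<^sup>2) ^ 3)"
    by (intro sum.cong refl) (simp add: Gc)
  also have "\<dots> = real (card (Lam L 1 - {0})) * (h + h\<^sup>2) ^ 3" by simp
  also have "real (card (Lam L 1 - {0})) = real L ^ 3 - 1"
    using z L by (simp add: card_Lam of_nat_diff)
  also have "(real L ^ 3 - 1) * (h + h\<^sup>2) ^ 3 = 3 * flow_gamma L * (G00 L / real L) + (flow_gamma L ^ 3 - (real L ^ 3 - 1) / (real L ^ 3) ^ 3)"
    unfolding flow_gamma_def G00_eq[OF L] h(2) using h(1) by (simp add: eval_nat_numeral field_simps)
  finally show ?thesis by (simp add: alpha3_def flow_alpha_def)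
qed

section \<open>The flow of the two couplings\<close>

lemma abs_log_le:
  assumes "L \<ge> 2" "0 < s" "s \<le> 1"
  shows "\<bar>log (real L) s\<bar> * sqrt s \<le> 2 / ln (real L)"
proof -
  have l: "ln (real L) > 0" using assms by simp
  have "ln (1 / sqrt s) \<le> 1 / sqrt s" using assms by (intro ln_bound) auto
  then have "- ln s \<le> 2 / sqrt s" using assms by (simp add: ln_div ln_sqrt)
  moreover have "ln s \<le> 0" using assms by simp
  ultimately have "\<bar>ln s\<bar> \<le> 2 / sqrt s" by simp
  then have "\<bar>ln s\<bar> * sqrt s \<le> 2" using assms by (simp add: field_simps)
  then show ?thesis using l by (simp add: log_def divide_right_mono)
qed

text \<open>Both deviations are multiplied by less than their units grow. K must dominate the
  sources: the product of mass and quartic coupling, and the replacement of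
  \<open>lh\<^sup>2\<close> by s^2 in front of \<open>alpha3\<close>.\<close>

lemma flow_step:
  assumes L: "L \<ge> 2" and K: "K \<ge> 0" "10 * (48 * \<bar>alpha3 L\<bar> / ln (real L) + 432 * \<bar>alpha3 L\<bar>) \<le> 3 * K"
    and s: "0 < s" "480 * s \<le> 1" "sqrt s * (2 * \<bar>alpha3 L\<bar> / ln (real L) + K) \<le> 1" and near: "flow_near L K s lh r"
  shows "s / 2 \<le> lh" "lh \<le> 2 * s" "\<bar>r\<bar> \<le> s"
    and "flow_near L K (real L * s) (real L * (lh - 36 * flow_gamma L * lh\<^sup>2))
           (real L ^ 2 * (r * (1 - 12 * flow_gamma L * lh) + alpha3 L * lh\<^sup>2))"
proof -
  define a where "a = \<bar>alpha3 L\<bar>"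
  define \<gamma> where "\<gamma> = flow_gamma L"
  define t where "t = s\<^sup>2 * sqrt s"
  have \<gamma>: "0 \<le> \<gamma>" "\<gamma> \<le> 1" using flow_gamma_bounds[OF L] by (auto simp: \<gamma>_def)
  have s1: "s \<le> 1" using s by simp
  have a0: "a \<ge> 0" by (simp add: a_def)
  have t0: "t \<ge> 0" using s by (simp add: t_def)
  have lh: "\<bar>lh - s\<bar> \<le> 144 * s\<^sup>2" and r: "\<bar>r - mass_ct L s\<bar> \<le> K * t"
    using near by (auto simp: flow_near_def t_def)
  have "144 * s * s \<le> (1 / 2) * s" using s by (intro mult_right_mono) auto
  then have "\<bar>lh - s\<bar> \<le> s / 2" using lh by (simp add: power2_eq_square)
  then show lhb: "s / 2 \<le> lh" "lh \<le> 2 * s" by linarith+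
  have m: "\<bar>mass_ct L s\<bar> * sqrt s \<le> a * s\<^sup>2 * (2 / ln (real L))"
  proof -
    have "\<bar>mass_ct L s\<bar> * sqrt s = a * s\<^sup>2 * (\<bar>log (real L) s\<bar> * sqrt s)"
      by (simp add: mass_ct_def a_def abs_mult)
    also have "\<dots> \<le> a * s\<^sup>2 * (2 / ln (real L))" using abs_log_le[OF L s(1) s1] a0 by (intro mult_left_mono) auto
    finally show ?thesis .
  qed
  have sq: "sqrt s * sqrt s = s" using s by simp
  have ms: "s * \<bar>mass_ct L s\<bar> \<le> (2 * a / ln (real L)) * t"
  proof -
    have "s * \<bar>mass_ct L s\<bar> = sqrt s * (\<bar>mass_ct L s\<bar> * sqrt s)" using sq by (metis mult.assoc mult.commute)
    also have "\<dots> \<le> sqrt s * (a * s\<^sup>2 * (2 / ln (real L)))" using m s by (intro mult_left_mono) auto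
    also have "\<dots> = (2 * a / ln (real L)) * t" by (simp add: t_def)
    finally show ?thesis .
  qed
  have rK: "\<bar>r\<bar> \<le> \<bar>mass_ct L s\<bar> + K * t" using r by linarith
  have "s * \<bar>r\<bar> \<le> s * (\<bar>mass_ct L s\<bar> + K * t)" using rK s by (intro mult_left_mono) auto
  also have "\<dots> \<le> (2 * a / ln (real L)) * t + s * (K * t)" using ms by (simp add: distrib_left)
  finally have sr: "s * \<bar>r\<bar> \<le> (2 * a / ln (real L)) * t + s * (K * t)" .
  also have "\<dots> \<le> (2 * a / ln (real L)) * t + 1 * (K * t)" using s1 K t0 by (intro add_left_mono mult_right_mono) auto
  also have "\<dots> = s\<^sup>2 * (sqrt s * (2 * a / ln (real L) + K))" by (simp add: t_def algebra_simps)
  also have "\<dots> \<le> s\<^sup>2 * 1" using s by (intro mult_left_mono) (auto simp: a_def)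
  finally show "\<bar>r\<bar> \<le> s" using s by (simp add: power2_eq_square)
  show "flow_near L K (real L * s) (real L * (lh - 36 * flow_gamma L * lh\<^sup>2))
           (real L ^ 2 * (r * (1 - 12 * flow_gamma L * lh) + alpha3 L * lh\<^sup>2))"
    unfolding flow_near_def
  proof
    have l2: "lh\<^sup>2 \<le> (2 * s)\<^sup>2" using lhb s by (intro power_mono) auto
    have "\<gamma> * lh\<^sup>2 \<le> 1 * (2 * s)\<^sup>2" using \<gamma> l2 by (intro mult_mono) auto
    moreover have "0 \<le> \<gamma> * lh\<^sup>2" using \<gamma> by simp
    moreover have "lh - 36 * \<gamma> * lh\<^sup>2 - s = (lh - s) - 36 * (\<gamma> * lh\<^sup>2)" by simp
    ultimately have "\<bar>lh - 36 * \<gamma> * lh\<^sup>2 - s\<bar> \<le> 144 * s\<^sup>2 + 36 * (2 * s)\<^sup>2" using lh by linarith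
    then have "real L * \<bar>lh - 36 * \<gamma> * lh\<^sup>2 - s\<bar> \<le> real L * (288 * s\<^sup>2)"
      by (intro mult_left_mono) (auto simp: power_mult_distrib)
    \<comment> \<open>144 is the constant with 144 + 36 * 4 = 2 * 144, and L is at least 2.\<close>
    also have "\<dots> \<le> 144 * (real L * s)\<^sup>2"
    proof -
      have "2 * (real L * s\<^sup>2) \<le> real L * (real L * s\<^sup>2)" using L by (intro mult_right_mono) auto
      then show ?thesis by (simp add: power_mult_distrib power2_eq_square mult_ac)
    qed
    finally show "\<bar>real L * (lh - 36 * flow_gamma L * lh\<^sup>2) - real L * s\<bar> \<le> 144 * (real L * s)\<^sup>2"
      by (simp add: \<gamma>_def[symmetric] right_diff_distrib[symmetric] abs_mult)
    have lg: "log (real L) (real L * s) = 1 + log (real L) s" using L s by (simp add: log_mult)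
    \<comment> \<open>The logarithm solves the second order recursion of the mass without error,
      since log increases by 1 from one scale to the next.\<close>
    have mc: "mass_ct L (real L * s) = (real L)\<^sup>2 * (mass_ct L s + alpha3 L * s\<^sup>2)"
      unfolding mass_ct_def lg by (simp add: power_mult_distrib algebra_simps)
    have "\<bar>(r - mass_ct L s) - 12 * \<gamma> * lh * r + alpha3 L * (lh\<^sup>2 - s\<^sup>2)\<bar> \<le> K * t + (48 * a / ln (real L) * t + 24 * s * (K * t)) + a * (432 * t)"
    proof -
      have "\<gamma> * lh * \<bar>r\<bar> \<le> 1 * (2 * s) * \<bar>r\<bar>" using \<gamma> lhb s by (intro mult_right_mono mult_mono) auto
      then have "12 * (\<gamma> * lh * \<bar>r\<bar>) \<le> 24 * (s * \<bar>r\<bar>)" by simp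
      also have "\<dots> \<le> 24 * ((2 * a / ln (real L)) * t + s * (K * t))" using sr by (intro mult_left_mono) auto
      also have "\<dots> = 48 * a / ln (real L) * t + 24 * s * (K * t)" by (simp add: algebra_simps)
      finally have 1: "\<bar>12 * \<gamma> * lh * r\<bar> \<le> 48 * a / ln (real L) * t + 24 * s * (K * t)"
        using \<gamma> lhb s by (simp add: abs_mult)
      have "\<bar>lh\<^sup>2 - s\<^sup>2\<bar> = \<bar>lh - s\<bar> * \<bar>lh + s\<bar>" by (simp add: abs_mult[symmetric] power2_eq_square algebra_simps)
      also have "\<dots> \<le> (144 * s\<^sup>2) * (3 * s)" using lh lhb s by (intro mult_mono) auto
      also have "\<dots> = 432 * (s\<^sup>2 * (sqrt s * sqrt s))" using sq by simp
      also have "\<dots> \<le> 432 * t"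
      proof -
        have "sqrt s * sqrt s \<le> 1 * sqrt s" using s1 s by (intro mult_right_mono) auto
        then show ?thesis unfolding t_def by (intro mult_left_mono) auto
      qed
      finally have "\<bar>alpha3 L * (lh\<^sup>2 - s\<^sup>2)\<bar> \<le> a * (432 * t)" unfolding abs_mult a_def by (intro mult_left_mono) auto
      then show ?thesis using 1 r by linarith
    qed
    \<comment> \<open>7/5 = 1 + 1/10 + 3/10: the old deviation, its coupling to \<open>lh\<close>,
      and the sources. It stays below sqrt 2.\<close>
    also have "\<dots> \<le> K * (7 / 5) * t"
    proof -
      have "24 * s * (K * t) \<le> 1 / 10 * (K * t)" using s K t0 by (intro mult_right_mono) auto
      moreover have "(48 * a / ln (real L) + 432 * a) * t \<le> (3 / 10 * K) * t" using K t0 by (intro mult_right_mono) (auto simp: a_def)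
      moreover have "K * t + (48 * a / ln (real L) * t + 24 * s * (K * t)) + a * (432 * t) = K * t + 24 * s * (K * t) + (48 * a / ln (real L) + 432 * a) * t"
        by (simp add: algebra_simps)
      moreover have "(3 / 10 * K) * t = 3 / 10 * (K * t)" "K * (7 / 5) * t = 7 / 5 * (K * t)" by simp_all
      ultimately show ?thesis by linarith
    qed
    also have "\<dots> \<le> K * sqrt (real L) * t"
    proof -
      have "7 / 5 \<le> sqrt (real L)" by (rule real_le_rsqrt) (use L in \<open>auto simp: power2_eq_square\<close>)
      then show ?thesis using K t0 by (intro mult_right_mono mult_left_mono) auto
    qed
    finally have "(real L)\<^sup>2 * \<bar>(r - mass_ct L s) - 12 * \<gamma> * lh * r + alpha3 L * (lh\<^sup>2 - s\<^sup>2)\<bar> \<le> (real L)\<^sup>2 * (K * sqrt (real L) * t)"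
      by (intro mult_left_mono) auto
    also have "\<dots> = K * ((real L * s)\<^sup>2 * sqrt (real L * s))" by (simp add: t_def power_mult_distrib real_sqrt_mult)
    finally have "\<bar>(real L)\<^sup>2 * ((r - mass_ct L s) - 12 * \<gamma> * lh * r + alpha3 L * (lh\<^sup>2 - s\<^sup>2))\<bar> \<le> K * ((real L * s)\<^sup>2 * sqrt (real L * s))"
      by (simp add: abs_mult)
    moreover have "real L ^ 2 * (r * (1 - 12 * flow_gamma L * lh) + alpha3 L * lh\<^sup>2) - mass_ct L (real L * s)
        = (real L)\<^sup>2 * ((r - mass_ct L s) - 12 * \<gamma> * lh * r + alpha3 L * (lh\<^sup>2 - s\<^sup>2))"
      unfolding mc \<gamma>_def by (simp add: algebra_simps)
    ultimately show "\<bar>real L ^ 2 * (r * (1 - 12 * flow_gamma L * lh) + alpha3 L * lh\<^sup>2) - mass_ct L (real L * s)\<bar> \<le> K * ((real L * s)\<^sup>2 * sqrt (real L * s))"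
      by simp
  qed
qed

text \<open>K depends on L alone and A, A' only on the block constants, so the range of s can be
  chosen last, uniformly in \<open>lh\<close> and \<open>r\<close>.\<close>

lemma rg_constants:
  assumes L: "L \<ge> 2"
  obtains A A' K s0 where "0 < s0" "s0 \<le> 1" "0 \<le> K"
    "2 * lead_const (real L ^ 3) \<le> A'" "lead_const (real L ^ 3) + A' * feed_const (real L ^ 3) \<le> A"
    "\<And>s lh r. 0 < s \<Longrightarrow> s \<le> s0 \<Longrightarrow> flow_near L K s lh r \<Longrightarrow>
       rg_params A A' s lh r (G00 L) \<and> 4 * s * feed_const (real L ^ 3) \<le> 1 \<and>
       flow_near L K (real L * s) (real L * (lh - 36 * flow_gamma L * lh\<^sup>2))
           (real L ^ 2 * (r * (1 - 12 * flow_gamma L * lh) + alpha3 L * lh\<^sup>2))"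
proof -
  define K where "K = 10 * (48 * \<bar>alpha3 L\<bar> / ln (real L) + 432 * \<bar>alpha3 L\<bar>)"
  define A' where "A' = 2 * \<bar>lead_const (real L ^ 3)\<bar>"
  define A where "A = \<bar>lead_const (real L ^ 3)\<bar> + A' * \<bar>feed_const (real L ^ 3)\<bar>"
  define q where "q = 2 * \<bar>alpha3 L\<bar> / ln (real L) + K"
  \<comment> \<open>Each summand bounds the inverse of s in one smallness condition, so s at most 1
    / T meets all of them.\<close>
  define T where "T = 480 + 64 * A + 256 * A' + A'\<^sup>2 + 4 * \<bar>feed_const (real L ^ 3)\<bar> + q\<^sup>2"
  have l: "ln (real L) > 0" using L by simp
  have K0: "K \<ge> 0" using l by (simp add: K_def)
  have A0: "A \<ge> 0" "A' \<ge> 0" by (auto simp: A_def A'_def)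
  have T: "T \<ge> 480" "T \<ge> 64 * A" "T \<ge> 256 * A'" "T \<ge> A'\<^sup>2" "T \<ge> 4 * \<bar>feed_const (real L ^ 3)\<bar>" "T \<ge> q\<^sup>2"
    using A0 by (auto simp: T_def)
  show ?thesis
  proof (rule that[of "1 / T" K A' A])
    show "0 < 1 / T" "1 / T \<le> 1" using T by auto
    show "0 \<le> K" by (rule K0)
    show "2 * lead_const (real L ^ 3) \<le> A'" by (simp add: A'_def)
    have "A' * feed_const (real L ^ 3) \<le> A' * \<bar>feed_const (real L ^ 3)\<bar>" using A0 by (intro mult_left_mono) auto
    then show "lead_const (real L ^ 3) + A' * feed_const (real L ^ 3) \<le> A" by (simp add: A_def)
    fix s lh r assume s: "0 < s" "s \<le> 1 / T" and near: "flow_near L K s lh r"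
    have le: "x * s \<le> 1" if "x \<le> T" for x
    proof -
      have "x * s \<le> T * s" using that s by (intro mult_right_mono) auto
      also have "\<dots> \<le> 1" using s T by (simp add: field_simps)
      finally show ?thesis .
    qed
    have "(sqrt s * q)\<^sup>2 \<le> 1" using le[OF T(6)] s by (simp add: power_mult_distrib mult.commute)
    then have sq: "sqrt s * q \<le> 1" using power2_le_imp_le[of "sqrt s * q" 1] by simp
    have K2: "10 * (48 * \<bar>alpha3 L\<bar> / ln (real L) + 432 * \<bar>alpha3 L\<bar>) \<le> 3 * K"
      using K0 by (simp only: K_def[symmetric])
    note F = flow_step[OF L K0 K2 s(1) le[OF T(1)] sq[unfolded q_def] near]
    have "rg_params A A' s lh r (G00 L)"
      by unfold_locales (use A0 s F le[OF T(1)] le[OF T(2)] le[OF T(3)] le[OF T(4)] G00_bounds[OF L] in auto)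
    moreover have "4 * s * feed_const (real L ^ 3) \<le> 1"
    proof -
      have "4 * s * feed_const (real L ^ 3) \<le> 4 * s * \<bar>feed_const (real L ^ 3)\<bar>" using s by (intro mult_left_mono) auto
      also have "\<dots> = 4 * \<bar>feed_const (real L ^ 3)\<bar> * s" by simp
      also have "\<dots> \<le> 1" by (rule le[OF T(5)])
      finally show ?thesis .
    qed
    ultimately show "rg_params A A' s lh r (G00 L) \<and> 4 * s * feed_const (real L ^ 3) \<le> 1 \<and>
       flow_near L K (real L * s) (real L * (lh - 36 * flow_gamma L * lh\<^sup>2))
           (real L ^ 2 * (r * (1 - 12 * flow_gamma L * lh) + alpha3 L * lh\<^sup>2))"
      using F(4) by blast
  qed
qed

section \<open>Blocks and layers of the hierarchical field\<close>

definition blk :: "nat \<Rightarrow> nat \<Rightarrow> site \<Rightarrow> site set" where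
  "blk L n x = {y \<in> Lam L (Suc n). ipart y L = x}"

definition blk_field :: "nat \<Rightarrow> nat \<Rightarrow> site \<Rightarrow> config \<Rightarrow> site \<Rightarrow> real" where
  "blk_field L n x \<omega> = (\<lambda>y\<in>blk L n x. \<omega> (Suc n, y))"

lemma finite_blk [simp]: "finite (blk L n x)"
  by (simp add: blk_def)

lemma centred_gaussian_family_mono:
  assumes "centred_gaussian_family M A X C" "B \<subseteq> A" "\<And>x y. x \<in> B \<Longrightarrow> y \<in> B \<Longrightarrow> C x y = C' x y"
  shows "centred_gaussian_family M B X C'"
  unfolding centred_gaussian_family_def
proof (intro conjI allI impI ballI)
  note G = assms(1)[unfolded centred_gaussian_family_def]
  show "X x \<in> borel_measurable M" if "x \<in> B" for x using G assms(2) that by blast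
  show "\<exists>\<sigma>. distr M borel (\<lambda>\<omega>. \<Sum>x\<in>D. c x * X x \<omega>) = distr std_normal_distribution borel (\<lambda>u. \<sigma> * u)"
    if "finite D" "D \<subseteq> B" for D c using G assms(2) that by (meson order_trans)
  show "(\<integral>\<omega>. X x \<omega> * X y \<omega> \<partial>M) = C' x y" if "x \<in> B" "y \<in> B" for x y
    using G assms(2) that by (simp add: assms(3)[symmetric] subset_iff)
qed

lemma ipart_power_Lam:
  assumes "L \<ge> 1" "x \<in> Lam L n" "m \<le> n" shows "ipart x (L ^ m) \<in> Lam L (n - m)"
  using assms
proof (induction m arbitrary: x n)
  case 0
  then show ?case by (simp add: ipart_def)
next
  case (Suc m)
  then obtain k where k: "n = Suc k" by (cases n) auto
  have "ipart x (L ^ Suc m) = ipart (ipart x L) (L ^ m)" by (simp add: ipart_def vec_eq_iff zdiv_zmult2_eq)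
  moreover have "ipart x L \<in> Lam L k" using Suc k ipart_Lam by auto
  ultimately show ?case using Suc.IH[of "ipart x L" k] Suc.prems k by simp
qed

lemma phi_restrict:
  assumes "L \<ge> 1" "x \<in> Lam L n" shows "phi L n x (restrict \<omega> (layers L n)) = phi L n x \<omega>"
  unfolding phi_def using ipart_power_Lam[OF assms] by (intro sum.cong refl) (auto simp: layers_def)

lemma phi_measurable:
  assumes "L \<ge> 1" "x \<in> Lam L n" shows "phi L n x \<in> borel_measurable (PiM (layers L n) (\<lambda>_. borel))"
  unfolding phi_def[abs_def] using ipart_power_Lam[OF assms]
  by (intro borel_measurable_sum borel_measurable_times borel_measurable_const measurable_component_singleton) (auto simp: layers_def)

lemma layers_Suc: "layers L (Suc n) = layers L n \<union> {Suc n} \<times> Lam L (Suc n)"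
  by (auto simp: layers_def le_Suc_eq)

section \<open>Independence of layers and of blocks under the free field\<close>

locale gff = prob_space P for P :: "config measure" +
  fixes L :: nat
  assumes L2: "L \<ge> 2" and GFF: "is_GFF L P"
begin

lemma L1: "L \<ge> 1" using L2 by simp

lemma sets_P: "sets P = sets (PiM (indices L) (\<lambda>_. borel))"
  using GFF by (simp add: is_GFF_def Omega_def)

lemma coord_meas: "x \<in> Lam L n \<Longrightarrow> (\<lambda>\<omega>. \<omega> (n, x)) \<in> borel_measurable P"
  unfolding measurable_cong_sets[OF sets_P refl] by (rule measurable_component_singleton) (simp add: indices_def)

lemma restrict_meas: "(\<lambda>\<omega>. restrict \<omega> (layers L n)) \<in> measurable P (PiM (layers L n) (\<lambda>_. borel))"
  by (rule measurable_restrict) (auto simp: layers_def coord_meas)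

lemma field_meas: "(\<lambda>\<omega>. restrict \<omega> ({Suc n} \<times> Lam L (Suc n))) \<in> measurable P (PiM ({Suc n} \<times> Lam L (Suc n)) (\<lambda>_. borel))"
  by (rule measurable_restrict) (auto simp: coord_meas)

lemma blk_field_meas: "blk_field L n x \<in> measurable P (PiM (blk L n x) (\<lambda>_. borel))"
  unfolding blk_field_def[abs_def] by (rule measurable_restrict) (auto simp: blk_def coord_meas)

lemma phi_meas: "x \<in> Lam L n \<Longrightarrow> phi L n x \<in> borel_measurable P"
  using measurable_compose[OF restrict_meas phi_measurable[OF L1]] by (simp add: phi_restrict[OF L1])

lemma gaussian_layer:
  "centred_gaussian_family P (Lam L (Suc n)) (\<lambda>x \<omega>. \<omega> (Suc n, x))
     (\<lambda>x y. of_bool (x = y) - of_bool (ipart x L = ipart y L) / real L ^ 3)"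
  using GFF unfolding is_GFF_def by auto

lemma gaussian_blk:
  assumes "x \<in> Lam L n" shows "gaussian_block P (blk L n x) (\<lambda>y \<omega>. \<omega> (Suc n, y))" and "card (blk L n x) = L ^ 3"
proof -
  show c: "card (blk L n x) = L ^ 3" unfolding blk_def by (rule card_block[OF L1 assms])
  have "2 ^ 3 \<le> L ^ 3" using L2 by (intro power_mono) auto
  then have "3 \<le> L ^ 3" by simp
  moreover have "centred_gaussian_family P (blk L n x) (\<lambda>y \<omega>. \<omega> (Suc n, y)) (\<lambda>x y. of_bool (x = y) - 1 / real (L ^ 3))"
    by (rule centred_gaussian_family_mono[OF gaussian_layer]) (auto simp: blk_def)
  ultimately show "gaussian_block P (blk L n x) (\<lambda>y \<omega>. \<omega> (Suc n, y))"
    by (intro gaussian_block.intro gaussian_block_axioms.intro prob_space_axioms)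
       (simp_all only: c finite_blk)
qed

lemma zero_Lam: "0 \<in> Lam L n" using L2 by (simp add: Lam_def)

lemma blocks_indep: "indep_vars (\<lambda>x. PiM (blk L n x) (\<lambda>_. borel)) (blk_field L n) (Lam L n)"
proof -
  have "indep_vars (\<lambda>x. PiM {y \<in> Lam L (Suc n). ipart y L = x} (\<lambda>_. borel))
      (\<lambda>x \<omega>. \<lambda>y\<in>{y \<in> Lam L (Suc n). ipart y L = x}. \<omega> (Suc n, y)) (Lam L n)"
    by (rule gaussian_blocks_indep[OF prob_space_axioms gaussian_layer])
       (use zero_Lam[of n] ipart_Lam[OF L1] in auto)
  then show ?thesis by (simp add: blk_def[abs_def] blk_field_def[abs_def])
qed

lemma blocks_product:
  fixes f :: "site \<Rightarrow> (site \<Rightarrow> real) \<Rightarrow> real"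
  assumes m: "\<And>x. x \<in> Lam L n \<Longrightarrow> f x \<in> borel_measurable (PiM (blk L n x) (\<lambda>_. borel))"
    and i: "\<And>x. x \<in> Lam L n \<Longrightarrow> integrable P (\<lambda>\<omega>. f x (blk_field L n x \<omega>))"
  shows "(\<integral>\<omega>. (\<Prod>x\<in>Lam L n. f x (blk_field L n x \<omega>)) \<partial>P) = (\<Prod>x\<in>Lam L n. \<integral>\<omega>. f x (blk_field L n x \<omega>) \<partial>P)"
  by (rule indep_vars_lebesgue_integral[OF finite_Lam indep_vars_compose2[OF blocks_indep] i]) (rule m)

lemma layers_indep:
  "indep_var (PiM (layers L n) (\<lambda>_. borel)) (\<lambda>\<omega>. restrict \<omega> (layers L n))
     (PiM ({Suc n} \<times> Lam L (Suc n)) (\<lambda>_. borel)) (\<lambda>\<omega>. restrict \<omega> ({Suc n} \<times> Lam L (Suc n)))"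
proof -
  define N where "N k = (PiM (Lam L k) (\<lambda>_. borel) :: (site \<Rightarrow> real) measure)" for k
  have ind: "indep_vars N (layer_field L) UNIV" using GFF by (auto simp: is_GFF_def N_def[abs_def])
  define Y1 where "Y1 \<xi> = (\<lambda>p\<in>layers L n. \<xi> (fst p) (snd p) :: real)" for \<xi> :: "nat \<Rightarrow> site \<Rightarrow> real"
  define T where "T = (PiM ({Suc n} \<times> Lam L (Suc n)) (\<lambda>_. borel) :: config measure)"
  define Y2 where "Y2 \<xi> = (\<lambda>p\<in>{Suc n} \<times> Lam L (Suc n). \<xi> (fst p) (snd p) :: real)" for \<xi> :: "nat \<Rightarrow> site \<Rightarrow> real"
  have Y1: "Y1 \<in> measurable (PiM {..n} N) (PiM (layers L n) (\<lambda>_. borel))"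
    unfolding Y1_def[abs_def]
  proof (rule measurable_restrict)
    fix p assume p: "p \<in> layers L n"
    have "(\<lambda>\<xi>. \<xi> (fst p)) \<in> measurable (PiM {..n} N) (N (fst p))"
      using p by (intro measurable_component_singleton) (auto simp: layers_def)
    moreover have "(\<lambda>\<eta>. \<eta> (snd p)) \<in> borel_measurable (N (fst p))"
      using p unfolding N_def by (intro measurable_component_singleton) (auto simp: layers_def)
    ultimately show "(\<lambda>\<xi>. \<xi> (fst p) (snd p)) \<in> borel_measurable (PiM {..n} N)" by (rule measurable_compose)
  qed
  have Y2: "Y2 \<in> measurable (PiM {Suc n} N) T"
    unfolding Y2_def[abs_def] T_def
  proof (rule measurable_restrict)
    fix p assume p: "p \<in> {Suc n} \<times> Lam L (Suc n)"
    have "(\<lambda>\<xi>. \<xi> (fst p)) \<in> measurable (PiM {Suc n} N) (N (fst p))"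
      using p by (intro measurable_component_singleton) auto
    moreover have "(\<lambda>\<eta>. \<eta> (snd p)) \<in> borel_measurable (N (fst p))"
      using p unfolding N_def by (intro measurable_component_singleton) auto
    ultimately show "(\<lambda>\<xi>. \<xi> (fst p) (snd p)) \<in> borel_measurable (PiM {Suc n} N)" by (rule measurable_compose)
  qed
  have "indep_var (PiM {..n} N) (\<lambda>\<omega>. \<lambda>i\<in>{..n}. layer_field L i \<omega>) (PiM {Suc n} N) (\<lambda>\<omega>. \<lambda>i\<in>{Suc n}. layer_field L i \<omega>)"
    by (rule indep_var_restrict[OF ind]) auto
  from indep_var_compose[OF this Y1 Y2]
  have "indep_var (PiM (layers L n) (\<lambda>_. borel)) (Y1 \<circ> (\<lambda>\<omega>. \<lambda>i\<in>{..n}. layer_field L i \<omega>)) T (Y2 \<circ> (\<lambda>\<omega>. \<lambda>i\<in>{Suc n}. layer_field L i \<omega>))" .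
  moreover have "Y1 \<circ> (\<lambda>\<omega>. \<lambda>i\<in>{..n}. layer_field L i \<omega>) = (\<lambda>\<omega>. restrict \<omega> (layers L n))"
    by (auto simp: Y1_def fun_eq_iff layers_def layer_field_def restrict_def)
  moreover have "Y2 \<circ> (\<lambda>\<omega>. \<lambda>i\<in>{Suc n}. layer_field L i \<omega>) = (\<lambda>\<omega>. restrict \<omega> ({Suc n} \<times> Lam L (Suc n)))"
    by (auto simp: Y2_def fun_eq_iff layer_field_def restrict_def)
  ultimately show ?thesis by (simp add: T_def)
qed

text \<open>Independence of the layer n + 1 from the coarser ones, written as an iterated integral
  over two copies of P: the fine layer is taken from the copy \<omega>'.\<close>

lemma layer_Fubini:
  fixes \<Psi> :: "config \<times> config \<Rightarrow> real"
  assumes m: "\<Psi> \<in> borel_measurable (PiM (layers L n) (\<lambda>_. borel) \<Otimes>\<^sub>M PiM ({Suc n} \<times> Lam L (Suc n)) (\<lambda>_. borel))"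
    and i: "integrable P (\<lambda>\<omega>. \<Psi> (restrict \<omega> (layers L n), restrict \<omega> ({Suc n} \<times> Lam L (Suc n))))"
  shows "(\<integral>\<omega>. \<Psi> (restrict \<omega> (layers L n), restrict \<omega> ({Suc n} \<times> Lam L (Suc n))) \<partial>P)
    = (\<integral>\<omega>. (\<integral>\<omega>'. \<Psi> (restrict \<omega> (layers L n), restrict \<omega>' ({Suc n} \<times> Lam L (Suc n))) \<partial>P) \<partial>P)"
proof -
  define S where "S = (PiM (layers L n) (\<lambda>_. borel) :: config measure)"
  define T where "T = (PiM ({Suc n} \<times> Lam L (Suc n)) (\<lambda>_. borel) :: config measure)"
  define X where "X \<omega> = restrict \<omega> (layers L n)" for \<omega> :: config
  define Y where "Y \<omega> = restrict \<omega> ({Suc n} \<times> Lam L (Suc n))" for \<omega> :: config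
  have ind: "indep_var S X T Y" using layers_indep by (simp add: S_def T_def X_def[abs_def] Y_def[abs_def])
  have X[measurable]: "X \<in> measurable P S" and Y[measurable]: "Y \<in> measurable P T"
    using restrict_meas field_meas[of n] by (auto simp: S_def T_def X_def[abs_def] Y_def[abs_def])
  have m[measurable]: "\<Psi> \<in> borel_measurable (S \<Otimes>\<^sub>M T)" using m by (simp add: S_def T_def)
  have eq: "distr P S X \<Otimes>\<^sub>M distr P T Y = distr P (S \<Otimes>\<^sub>M T) (\<lambda>x. (X x, Y x))"
    using ind unfolding indep_var_distribution_eq by simp
  interpret A: prob_space "distr P S X" by (rule prob_space_distr) simp
  interpret B: prob_space "distr P T Y" by (rule prob_space_distr) simp
  interpret AB: pair_prob_space "distr P S X" "distr P T Y" ..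
  have XY: "(\<lambda>x. (X x, Y x)) \<in> measurable P (S \<Otimes>\<^sub>M T)" by measurable
  have mAB: "\<Psi> \<in> borel_measurable (distr P S X \<Otimes>\<^sub>M distr P T Y)" unfolding eq by simp
  have i2: "integrable (distr P S X \<Otimes>\<^sub>M distr P T Y) \<Psi>"
    unfolding eq by (subst integrable_distr_eq[OF XY m]) (use i in \<open>simp add: X_def Y_def\<close>)
  have "(\<integral>\<omega>. \<Psi> (X \<omega>, Y \<omega>) \<partial>P) = (\<integral>p. \<Psi> p \<partial>(distr P S X \<Otimes>\<^sub>M distr P T Y))"
    unfolding eq by (subst integral_distr[OF XY m]) simp
  also have "\<dots> = (\<integral>a. (\<integral>b. \<Psi> (a, b) \<partial>distr P T Y) \<partial>distr P S X)"
    by (rule AB.integral_fst'[OF i2, symmetric])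
  also have "\<dots> = (\<integral>\<omega>. (\<integral>b. \<Psi> (X \<omega>, b) \<partial>distr P T Y) \<partial>P)"
    by (rule integral_distr[OF X], rule B.borel_measurable_lebesgue_integral)
       (use mAB in \<open>simp cong: measurable_cong_sets\<close>)
  also have "\<dots> = (\<integral>\<omega>. (\<integral>\<omega>'. \<Psi> (X \<omega>, Y \<omega>') \<partial>P) \<partial>P)"
  proof (rule Bochner_Integration.integral_cong[OF refl])
    fix \<omega> assume "\<omega> \<in> space P"
    then have "X \<omega> \<in> space S" using measurable_space[OF X] by auto
    then have "(\<lambda>b. \<Psi> (X \<omega>, b)) \<in> borel_measurable T" by measurable
    then show "(\<integral>b. \<Psi> (X \<omega>, b) \<partial>distr P T Y) = (\<integral>\<omega>'. \<Psi> (X \<omega>, Y \<omega>') \<partial>P)"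
      by (rule integral_distr[OF Y])
  qed
  finally show ?thesis by (simp add: X_def Y_def)
qed

text \<open>Conditional expectation given the coarse layers. Once these are frozen, the factors
  depend on different blocks of the fine layer, and blocks are independent. The factors see the
  coarse layers only through the field at their own site.\<close>

lemma integrate_out:
  fixes H :: "config \<Rightarrow> real" and F :: "site \<Rightarrow> real \<times> (site \<Rightarrow> real) \<Rightarrow> real"
  assumes H: "H \<in> borel_measurable (PiM (layers L n) (\<lambda>_. borel))"
    and F: "\<And>x. x \<in> Lam L n \<Longrightarrow> F x \<in> borel_measurable (borel \<Otimes>\<^sub>M PiM (blk L n x) (\<lambda>_. borel))"
    and i1: "\<And>x t. x \<in> Lam L n \<Longrightarrow> integrable P (\<lambda>\<omega>. F x (t, blk_field L n x \<omega>))"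
    and i2: "integrable P (\<lambda>\<omega>. H (restrict \<omega> (layers L n)) * (\<Prod>x\<in>Lam L n. F x (phi L n x \<omega>, blk_field L n x \<omega>)))"
  shows "(\<integral>\<omega>. H (restrict \<omega> (layers L n)) * (\<Prod>x\<in>Lam L n. F x (phi L n x \<omega>, blk_field L n x \<omega>)) \<partial>P)
    = (\<integral>\<omega>. H (restrict \<omega> (layers L n)) * (\<Prod>x\<in>Lam L n. (\<integral>\<omega>'. F x (phi L n x \<omega>, blk_field L n x \<omega>') \<partial>P)) \<partial>P)"
proof -
  define \<Psi> where "\<Psi> p = H (fst p) * (\<Prod>x\<in>Lam L n. F x (phi L n x (fst p), blk_field L n x (snd p)))" for p :: "config \<times> config"
  have r: "blk_field L n x (restrict \<omega> ({Suc n} \<times> Lam L (Suc n))) = blk_field L n x \<omega>" for \<omega> x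
    by (auto simp: blk_field_def blk_def fun_eq_iff)
  have e: "\<Psi> (restrict \<omega> (layers L n), restrict \<omega>' ({Suc n} \<times> Lam L (Suc n))) = H (restrict \<omega> (layers L n)) * (\<Prod>x\<in>Lam L n. F x (phi L n x \<omega>, blk_field L n x \<omega>'))" for \<omega> \<omega>'
    unfolding \<Psi>_def fst_conv snd_conv r by (simp add: phi_restrict[OF L1])
  have m: "\<Psi> \<in> borel_measurable (PiM (layers L n) (\<lambda>_. borel) \<Otimes>\<^sub>M PiM ({Suc n} \<times> Lam L (Suc n)) (\<lambda>_. borel))"
    unfolding \<Psi>_def
  proof (intro borel_measurable_times borel_measurable_prod)
    show "(\<lambda>p. H (fst p)) \<in> borel_measurable (PiM (layers L n) (\<lambda>_. borel) \<Otimes>\<^sub>M PiM ({Suc n} \<times> Lam L (Suc n)) (\<lambda>_. borel))"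
      by (rule measurable_compose[OF measurable_fst H])
    fix x assume x: "x \<in> Lam L n"
    have a: "(\<lambda>p. phi L n x (fst p)) \<in> borel_measurable (PiM (layers L n) (\<lambda>_. borel) \<Otimes>\<^sub>M PiM ({Suc n} \<times> Lam L (Suc n)) (\<lambda>_. borel))"
      by (rule measurable_compose[OF measurable_fst phi_measurable[OF L1 x]])
    have b: "(\<lambda>p. blk_field L n x (snd p)) \<in> measurable (PiM (layers L n) (\<lambda>_. borel) \<Otimes>\<^sub>M PiM ({Suc n} \<times> Lam L (Suc n)) (\<lambda>_. borel)) (PiM (blk L n x) (\<lambda>_. borel))"
    proof (rule measurable_compose[OF measurable_snd])
      show "blk_field L n x \<in> measurable (PiM ({Suc n} \<times> Lam L (Suc n)) (\<lambda>_. borel)) (PiM (blk L n x) (\<lambda>_. borel))"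
        unfolding blk_field_def[abs_def]
        by (intro measurable_restrict measurable_component_singleton) (auto simp: blk_def)
    qed
    show "(\<lambda>p. F x (phi L n x (fst p), blk_field L n x (snd p))) \<in> borel_measurable (PiM (layers L n) (\<lambda>_. borel) \<Otimes>\<^sub>M PiM ({Suc n} \<times> Lam L (Suc n)) (\<lambda>_. borel))"
      by (rule measurable_compose[OF measurable_Pair[OF a b] F[OF x]])
  qed
  have "(\<integral>\<omega>. H (restrict \<omega> (layers L n)) * (\<Prod>x\<in>Lam L n. F x (phi L n x \<omega>, blk_field L n x \<omega>)) \<partial>P)
     = (\<integral>\<omega>. (\<integral>\<omega>'. H (restrict \<omega> (layers L n)) * (\<Prod>x\<in>Lam L n. F x (phi L n x \<omega>, blk_field L n x \<omega>')) \<partial>P) \<partial>P)"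
    using layer_Fubini[OF m] i2 unfolding e by simp
  also have "\<dots> = (\<integral>\<omega>. H (restrict \<omega> (layers L n)) * (\<Prod>x\<in>Lam L n. (\<integral>\<omega>'. F x (phi L n x \<omega>, blk_field L n x \<omega>') \<partial>P)) \<partial>P)"
  proof (rule Bochner_Integration.integral_cong[OF refl])
    fix \<omega>
    have "(\<integral>\<omega>'. (\<Prod>x\<in>Lam L n. F x (phi L n x \<omega>, blk_field L n x \<omega>')) \<partial>P) = (\<Prod>x\<in>Lam L n. (\<integral>\<omega>'. F x (phi L n x \<omega>, blk_field L n x \<omega>') \<partial>P))"
      using F i1 by (intro blocks_product[where f = "\<lambda>x \<beta>. F x (phi L n x \<omega>, \<beta>)"]) (auto intro!: measurable_Pair2)
    then show "(\<integral>\<omega>'. H (restrict \<omega> (layers L n)) * (\<Prod>x\<in>Lam L n. F x (phi L n x \<omega>, blk_field L n x \<omega>')) \<partial>P)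
        = H (restrict \<omega> (layers L n)) * (\<Prod>x\<in>Lam L n. (\<integral>\<omega>'. F x (phi L n x \<omega>, blk_field L n x \<omega>') \<partial>P))" by simp
  qed
  finally show ?thesis .
qed

lemma prod_blocks: "(\<Prod>y\<in>Lam L (Suc n). f y) = (\<Prod>x\<in>Lam L n. \<Prod>y\<in>blk L n x. f y)" for f :: "site \<Rightarrow> real"
  unfolding blk_def by (rule prod.group[symmetric]) (use ipart_Lam[OF L1] in auto)

text \<open>Under the tilted law given the coarse layers, the terms of S are centred and
  independent, so that the mixed terms vanish and the second moment grows like the number of blocks.
  It is applied with weight 1 to the free field and with the block weights to the interacting
  measure. B is a majorant uniform in the coarse field, for integrability.\<close>

lemma second_moment_blocks:
  fixes a G :: "site \<Rightarrow> real \<times> (site \<Rightarrow> real) \<Rightarrow> real"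
  assumes am: "\<And>x. x \<in> Lam L n \<Longrightarrow> a x \<in> borel_measurable (borel \<Otimes>\<^sub>M PiM (blk L n x) (\<lambda>_. borel))"
    and Gm: "\<And>x. x \<in> Lam L n \<Longrightarrow> G x \<in> borel_measurable (borel \<Otimes>\<^sub>M PiM (blk L n x) (\<lambda>_. borel))"
    and G: "\<And>x t \<beta>. x \<in> Lam L n \<Longrightarrow> 0 \<le> G x (t, \<beta>) \<and> G x (t, \<beta>) \<le> K"
    and aB: "\<And>x t \<omega>. x \<in> Lam L n \<Longrightarrow> \<bar>a x (t, blk_field L n x \<omega>)\<bar> \<le> B x \<omega>"
    and Bi: "\<And>x. x \<in> Lam L n \<Longrightarrow> integrable P (\<lambda>\<omega>. (B x \<omega>)\<^sup>2)"
    and mean: "\<And>x t. x \<in> Lam L n \<Longrightarrow> (\<integral>\<omega>. a x (t, blk_field L n x \<omega>) * G x (t, blk_field L n x \<omega>) \<partial>P) = 0"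
    and var: "\<And>x t. x \<in> Lam L n \<Longrightarrow> (\<integral>\<omega>. (a x (t, blk_field L n x \<omega>))\<^sup>2 * G x (t, blk_field L n x \<omega>) \<partial>P) \<le> C * (\<integral>\<omega>. G x (t, blk_field L n x \<omega>) \<partial>P)"
  defines "S \<equiv> \<lambda>\<omega>. (\<Sum>x\<in>Lam L n. a x (phi L n x \<omega>, blk_field L n x \<omega>))" and "W \<equiv> \<lambda>\<omega>. (\<Prod>x\<in>Lam L n. G x (phi L n x \<omega>, blk_field L n x \<omega>))"
  shows "integrable P (\<lambda>\<omega>. (S \<omega>)\<^sup>2 * W \<omega>)" "integrable P W"
    and "(\<integral>\<omega>. (S \<omega>)\<^sup>2 * W \<omega> \<partial>P) \<le> real (card (Lam L n)) * C * (\<integral>\<omega>. W \<omega> \<partial>P)"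
proof -
  define A where "A x \<omega> = a x (phi L n x \<omega>, blk_field L n x \<omega>)" for x \<omega>
  have pm: "(\<lambda>\<omega>. (phi L n x \<omega>, blk_field L n x \<omega>)) \<in> measurable P (borel \<Otimes>\<^sub>M PiM (blk L n x) (\<lambda>_. borel))" if "x \<in> Lam L n" for x
    by (rule measurable_Pair[OF phi_meas[OF that] blk_field_meas])
  have tm: "(\<lambda>\<omega>. (t, blk_field L n x \<omega>)) \<in> measurable P (borel \<Otimes>\<^sub>M PiM (blk L n x) (\<lambda>_. borel))" for x t
    by (rule measurable_Pair[OF _ blk_field_meas]) simp
  have Am: "A x \<in> borel_measurable P" if "x \<in> Lam L n" for x
    unfolding A_def[abs_def] by (rule measurable_compose[OF pm am]) (rule that)+
  have Wm: "W \<in> borel_measurable P"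
    unfolding W_def by (intro borel_measurable_prod measurable_compose[OF pm Gm])
  have K0: "K \<ge> 0" using G[OF zero_Lam, of 0 undefined] by linarith
  have Wb: "0 \<le> W \<omega>" "W \<omega> \<le> K ^ card (Lam L n)" for \<omega>
  proof -
    show "0 \<le> W \<omega>" unfolding W_def using G by (intro prod_nonneg) auto
    have "W \<omega> \<le> (\<Prod>x\<in>Lam L n. K)" unfolding W_def using G by (intro prod_mono) auto
    then show "W \<omega> \<le> K ^ card (Lam L n)" by simp
  qed
  show iW: "integrable P W"
    by (rule integrable_const_bound[of _ "K ^ card (Lam L n)"]) (use Wm Wb in auto)
  have AB: "\<bar>A p \<omega> * A q \<omega>\<bar> \<le> (B p \<omega>)\<^sup>2 + (B q \<omega>)\<^sup>2" if "p \<in> Lam L n" "q \<in> Lam L n" for p q \<omega>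
  proof -
    have x: "\<bar>A p \<omega>\<bar> \<le> B p \<omega>" "\<bar>A q \<omega>\<bar> \<le> B q \<omega>" using aB that by (auto simp: A_def)
    have "\<bar>A p \<omega>\<bar> * \<bar>A q \<omega>\<bar> \<le> B p \<omega> * B q \<omega>" using x by (intro mult_mono) auto
    moreover have "2 * B p \<omega> * B q \<omega> \<le> (B p \<omega>)\<^sup>2 + (B q \<omega>)\<^sup>2" by (rule sum_squares_bound)
    moreover have "0 \<le> (B p \<omega>)\<^sup>2 + (B q \<omega>)\<^sup>2" by simp
    ultimately show ?thesis unfolding abs_mult by linarith
  qed
  have iA: "integrable P (\<lambda>\<omega>. A p \<omega> * A q \<omega> * W \<omega>)" if "p \<in> Lam L n" "q \<in> Lam L n" for p q
  proof (rule Bochner_Integration.integrable_bound[of _ "\<lambda>\<omega>. K ^ card (Lam L n) * ((B p \<omega>)\<^sup>2 + (B q \<omega>)\<^sup>2)"])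
    show "AE \<omega> in P. norm (A p \<omega> * A q \<omega> * W \<omega>) \<le> norm (K ^ card (Lam L n) * ((B p \<omega>)\<^sup>2 + (B q \<omega>)\<^sup>2))"
    proof (rule AE_I2)
      fix \<omega>
      have "\<bar>A p \<omega> * A q \<omega>\<bar> * W \<omega> \<le> ((B p \<omega>)\<^sup>2 + (B q \<omega>)\<^sup>2) * K ^ card (Lam L n)"
        using AB[OF that] Wb by (intro mult_mono) auto
      then show "norm (A p \<omega> * A q \<omega> * W \<omega>) \<le> norm (K ^ card (Lam L n) * ((B p \<omega>)\<^sup>2 + (B q \<omega>)\<^sup>2))"
        using Wb[of \<omega>] K0 by (simp add: abs_mult mult.commute)
    qed
  qed (use Bi that Am Wm in auto)
  have S2: "(S \<omega>)\<^sup>2 * W \<omega> = (\<Sum>p\<in>Lam L n. \<Sum>q\<in>Lam L n. A p \<omega> * A q \<omega> * W \<omega>)" for \<omega>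
    unfolding S_def A_def power2_eq_square sum_product by (simp only: sum_distrib_right)
  show "integrable P (\<lambda>\<omega>. (S \<omega>)\<^sup>2 * W \<omega>)" unfolding S2 using iA by auto
  have pair: "(\<integral>\<omega>. A p \<omega> * A q \<omega> * W \<omega> \<partial>P) \<le> (if p = q then C * (\<integral>\<omega>. W \<omega> \<partial>P) else 0)"
    if p: "p \<in> Lam L n" and q: "q \<in> Lam L n" for p q
  proof -
    \<comment> \<open>The factors \<open>a p\<close> and \<open>a q\<close> are absorbed into the
      weights of their blocks, so the product over blocks is kept.\<close>
    define F where "F x v = (if x = p then a x v else 1) * (if x = q then a x v else 1) * G x v" for x v
    have prodF: "(\<Prod>x\<in>Lam L n. F x (phi L n x \<omega>, blk_field L n x \<omega>)) = A p \<omega> * A q \<omega> * W \<omega>" for \<omega>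
      unfolding F_def prod.distrib W_def using p q by (simp add: prod.delta A_def)
    have Fm: "F x \<in> borel_measurable (borel \<Otimes>\<^sub>M PiM (blk L n x) (\<lambda>_. borel))" if "x \<in> Lam L n" for x
      unfolding F_def[abs_def] using am[OF that] Gm[OF that] by (cases "x = p"; cases "x = q") auto
    have Fi: "integrable P (\<lambda>\<omega>. F x (t, blk_field L n x \<omega>))" if x: "x \<in> Lam L n" for x t
    proof (rule Bochner_Integration.integrable_bound[of _ "\<lambda>\<omega>. (1 + (B x \<omega>)\<^sup>2) * K"])
      show "AE \<omega> in P. norm (F x (t, blk_field L n x \<omega>)) \<le> norm ((1 + (B x \<omega>)\<^sup>2) * K)"
      proof (rule AE_I2)
        fix \<omega>
        define y where "y = \<bar>a x (t, blk_field L n x \<omega>)\<bar>"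
        have y: "0 \<le> y" "y \<le> B x \<omega>" using aB[OF x] by (auto simp: y_def)
        have "y * y \<le> (B x \<omega>)\<^sup>2" unfolding power2_eq_square using y by (intro mult_mono) auto
        moreover have "y \<le> 1 + y * y" using zero_le_power2[of "y - 1"] y by (simp add: power2_eq_square algebra_simps)
        ultimately have "\<bar>(if x = p then a x (t, blk_field L n x \<omega>) else 1) * (if x = q then a x (t, blk_field L n x \<omega>) else 1)\<bar> \<le> 1 + (B x \<omega>)\<^sup>2"
          by (auto simp: abs_mult y_def)
        then have "\<bar>(if x = p then a x (t, blk_field L n x \<omega>) else 1) * (if x = q then a x (t, blk_field L n x \<omega>) else 1)\<bar> * G x (t, blk_field L n x \<omega>) \<le> (1 + (B x \<omega>)\<^sup>2) * K"
          using G[OF x, of t "blk_field L n x \<omega>"] by (intro mult_mono) auto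
        then show "norm (F x (t, blk_field L n x \<omega>)) \<le> norm ((1 + (B x \<omega>)\<^sup>2) * K)"
          using G[OF x, of t "blk_field L n x \<omega>"] K0 by (simp add: F_def abs_mult)
      qed
      show "integrable P (\<lambda>\<omega>. (1 + (B x \<omega>)\<^sup>2) * K)" using Bi[OF x] by (auto intro!: Bochner_Integration.integrable_add)
    qed (rule measurable_compose[OF tm Fm[OF x]])
    have int: "(\<integral>\<omega>. A p \<omega> * A q \<omega> * W \<omega> \<partial>P) = (\<integral>\<omega>. (\<Prod>x\<in>Lam L n. \<integral>\<omega>'. F x (phi L n x \<omega>, blk_field L n x \<omega>') \<partial>P) \<partial>P)"
      using integrate_out[of "\<lambda>_. 1" n F, OF _ Fm Fi] iA[OF p q] unfolding prodF by simp
    have intW: "(\<integral>\<omega>. W \<omega> \<partial>P) = (\<integral>\<omega>. (\<Prod>x\<in>Lam L n. \<integral>\<omega>'. G x (phi L n x \<omega>, blk_field L n x \<omega>') \<partial>P) \<partial>P)"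
    proof -
      have Gi: "integrable P (\<lambda>\<omega>. G x (t, blk_field L n x \<omega>))" if "x \<in> Lam L n" for x t
        by (rule integrable_const_bound[of _ K]) (use G[OF that] measurable_compose[OF tm Gm[OF that]] in auto)
      show ?thesis using integrate_out[of "\<lambda>_. 1" n G, OF _ Gm Gi] iW unfolding W_def by simp
    qed
    have G0: "0 \<le> (\<integral>\<omega>'. G x (t, blk_field L n x \<omega>') \<partial>P)" if "x \<in> Lam L n" for x t
      using G[OF that] by (intro Bochner_Integration.integral_nonneg) auto
    show ?thesis
    proof (cases "p = q")
      case False
      \<comment> \<open>Block p carries exactly one factor \<open>a p\<close>, which integrates to
        zero.\<close>
      have "(\<Prod>x\<in>Lam L n. \<integral>\<omega>'. F x (phi L n x \<omega>, blk_field L n x \<omega>') \<partial>P) = 0" for \<omega>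
        by (rule prod_zero[OF finite_Lam]) (use p False mean[OF p] in \<open>auto intro!: bexI[of _ p] simp: F_def\<close>)
      then show ?thesis using False unfolding int by (simp only: Bochner_Integration.integral_zero if_False order_refl)
    next
      case True
      have le: "(\<Prod>x\<in>Lam L n. \<integral>\<omega>'. F x (phi L n x \<omega>, blk_field L n x \<omega>') \<partial>P) \<le> C * (\<Prod>x\<in>Lam L n. \<integral>\<omega>'. G x (phi L n x \<omega>, blk_field L n x \<omega>') \<partial>P)" for \<omega>
      proof -
        have "(\<Prod>x\<in>Lam L n. \<integral>\<omega>'. F x (phi L n x \<omega>, blk_field L n x \<omega>') \<partial>P)
           = (\<integral>\<omega>'. F p (phi L n p \<omega>, blk_field L n p \<omega>') \<partial>P) * (\<Prod>x\<in>Lam L n - {p}. \<integral>\<omega>'. F x (phi L n x \<omega>, blk_field L n x \<omega>') \<partial>P)"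
          using p by (intro prod.remove) auto
        also have "(\<Prod>x\<in>Lam L n - {p}. \<integral>\<omega>'. F x (phi L n x \<omega>, blk_field L n x \<omega>') \<partial>P) = (\<Prod>x\<in>Lam L n - {p}. \<integral>\<omega>'. G x (phi L n x \<omega>, blk_field L n x \<omega>') \<partial>P)"
          using True by (intro prod.cong refl) (auto simp: F_def)
        also have "(\<integral>\<omega>'. F p (phi L n p \<omega>, blk_field L n p \<omega>') \<partial>P) * (\<Prod>x\<in>Lam L n - {p}. \<integral>\<omega>'. G x (phi L n x \<omega>, blk_field L n x \<omega>') \<partial>P)
          \<le> (C * (\<integral>\<omega>'. G p (phi L n p \<omega>, blk_field L n p \<omega>') \<partial>P)) * (\<Prod>x\<in>Lam L n - {p}. \<integral>\<omega>'. G x (phi L n x \<omega>, blk_field L n x \<omega>') \<partial>P)"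
          using var[OF p, of "phi L n p \<omega>"] True G0
          by (intro mult_right_mono prod_nonneg) (auto simp: F_def power2_eq_square)
        also have "\<dots> = C * (\<Prod>x\<in>Lam L n. \<integral>\<omega>'. G x (phi L n x \<omega>, blk_field L n x \<omega>') \<partial>P)"
          using p by (simp add: prod.remove)
        finally show ?thesis .
      qed
      have iG: "integrable P (\<lambda>\<omega>. (\<Prod>x\<in>Lam L n. \<integral>\<omega>'. G x (phi L n x \<omega>, blk_field L n x \<omega>') \<partial>P))"
      proof (rule integrable_const_bound[of _ "K ^ card (Lam L n)"])
        have gm: "(\<lambda>t. \<integral>\<omega>'. G x (t, blk_field L n x \<omega>') \<partial>P) \<in> borel_measurable borel" if "x \<in> Lam L n" for x
        proof (rule borel_measurable_lebesgue_integral)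
          have "(\<lambda>v. (fst v, blk_field L n x (snd v))) \<in> measurable (borel \<Otimes>\<^sub>M P) (borel \<Otimes>\<^sub>M PiM (blk L n x) (\<lambda>_. borel))"
            by (rule measurable_Pair[OF measurable_fst measurable_compose[OF measurable_snd blk_field_meas]])
          from measurable_compose[OF this Gm[OF that]]
          show "(\<lambda>(t, \<omega>'). G x (t, blk_field L n x \<omega>')) \<in> borel_measurable (borel \<Otimes>\<^sub>M P)" by (simp add: split_beta')
        qed
        show "(\<lambda>\<omega>. \<Prod>x\<in>Lam L n. \<integral>\<omega>'. G x (phi L n x \<omega>, blk_field L n x \<omega>') \<partial>P) \<in> borel_measurable P"
          by (intro borel_measurable_prod measurable_compose[OF phi_meas gm])
        show "AE \<omega> in P. norm (\<Prod>x\<in>Lam L n. \<integral>\<omega>'. G x (phi L n x \<omega>, blk_field L n x \<omega>') \<partial>P) \<le> K ^ card (Lam L n)"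
        proof (rule AE_I2)
          fix \<omega>
          have "(\<integral>\<omega>'. G x (t, blk_field L n x \<omega>') \<partial>P) \<le> K" if "x \<in> Lam L n" for x t
          proof -
            have "(\<integral>\<omega>'. G x (t, blk_field L n x \<omega>') \<partial>P) \<le> (\<integral>\<omega>'. K \<partial>P)"
              by (intro Bochner_Integration.integral_mono integrable_const_bound[of _ K])
                 (use G[OF that] K0 measurable_compose[OF tm Gm[OF that]] in auto)
            then show ?thesis by (simp add: prob_space)
          qed
          then have "(\<Prod>x\<in>Lam L n. \<integral>\<omega>'. G x (phi L n x \<omega>, blk_field L n x \<omega>') \<partial>P) \<le> (\<Prod>x\<in>Lam L n. K)"
            using G0 by (intro prod_mono) auto
          moreover have "0 \<le> (\<Prod>x\<in>Lam L n. \<integral>\<omega>'. G x (phi L n x \<omega>, blk_field L n x \<omega>') \<partial>P)" using G0 by (intro prod_nonneg) auto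
          ultimately show "norm (\<Prod>x\<in>Lam L n. \<integral>\<omega>'. G x (phi L n x \<omega>, blk_field L n x \<omega>') \<partial>P) \<le> K ^ card (Lam L n)" by simp
        qed
      qed
      have "(\<integral>\<omega>. A p \<omega> * A q \<omega> * W \<omega> \<partial>P) \<le> (\<integral>\<omega>. C * (\<Prod>x\<in>Lam L n. \<integral>\<omega>'. G x (phi L n x \<omega>, blk_field L n x \<omega>') \<partial>P) \<partial>P)"
        unfolding int by (rule integral_mono_AE'[OF integrable_mult_right[OF iG] AE_I2[OF le]])
          (rule AE_I2, rule order_trans[OF _ le], rule prod_nonneg,
           use True G in \<open>auto simp: F_def intro!: Bochner_Integration.integral_nonneg mult_nonneg_nonneg\<close>)
      also have "\<dots> = C * (\<integral>\<omega>. W \<omega> \<partial>P)" unfolding intW by simp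
      finally show ?thesis using True by simp
    qed
  qed
  have "(\<integral>\<omega>. (S \<omega>)\<^sup>2 * W \<omega> \<partial>P) = (\<Sum>p\<in>Lam L n. \<Sum>q\<in>Lam L n. \<integral>\<omega>. A p \<omega> * A q \<omega> * W \<omega> \<partial>P)"
    unfolding S2 using iA by (simp add: Bochner_Integration.integral_sum)
  also have "\<dots> \<le> (\<Sum>p\<in>Lam L n. \<Sum>q\<in>Lam L n. if p = q then C * (\<integral>\<omega>. W \<omega> \<partial>P) else 0)"
    by (intro sum_mono pair)
  also have "\<dots> = real (card (Lam L n)) * C * (\<integral>\<omega>. W \<omega> \<partial>P)" by (simp add: sum.delta)
  finally show "(\<integral>\<omega>. (S \<omega>)\<^sup>2 * W \<omega> \<partial>P) \<le> real (card (Lam L n)) * C * (\<integral>\<omega>. W \<omega> \<partial>P)" .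
qed

end

section \<open>Integrating out the layers of the interacting measure\<close>

context gff begin

lemma lam_scaled_Suc: "lam_scaled L lam n = real L * lam_scaled L lam (Suc n)" using L2 by (simp add: lam_scaled_def)

lemma lam_scaled_pos: "lam > 0 \<Longrightarrow> lam_scaled L lam n > 0" using L2 by (simp add: lam_scaled_def)

lemma lam_scaled_antimono: "lam > 0 \<Longrightarrow> n \<le> m \<Longrightarrow> lam_scaled L lam m \<le> lam_scaled L lam n"
  using L2 by (auto simp: lam_scaled_def intro!: divide_left_mono power_increasing mult_pos_pos)

text \<open>The product of site weights is a version of the unnormalised density of the cutoff
  measure on the layers up to n. Testing with bounded H makes the statement stable under integrating
  out layers, and H = 1 gives the partition function.\<close>

definition represents :: "real \<Rightarrow> nat \<Rightarrow> nat \<Rightarrow> (site \<Rightarrow> real \<Rightarrow> real) \<Rightarrow> bool" where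
  "represents lam N n g \<longleftrightarrow> (\<forall>H. H \<in> borel_measurable (PiM (layers L n) (\<lambda>_. borel)) \<longrightarrow> (\<exists>K. \<forall>\<alpha>. \<bar>H \<alpha>\<bar> \<le> K) \<longrightarrow>
     (\<integral>\<omega>. H (restrict \<omega> (layers L n)) * exp (- interaction L lam N \<omega>) \<partial>P)
     = (\<integral>\<omega>. H (restrict \<omega> (layers L n)) * (\<Prod>y\<in>Lam L n. g y (phi L n y \<omega>)) \<partial>P))"

definition block_weight :: "(site \<Rightarrow> real \<Rightarrow> real) \<Rightarrow> nat \<Rightarrow> site \<Rightarrow> real \<times> (site \<Rightarrow> real) \<Rightarrow> real" where
  "block_weight g n x v = (\<Prod>y\<in>blk L n x. g y (fst v / sqrt (real L) + snd v y))"

lemma block_weight_field: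
  "block_weight g n x (t, blk_field L n x \<omega>) = (\<Prod>y\<in>blk L n x. g y (t / sqrt (real L) + \<omega> (Suc n, y)))"
  by (simp add: block_weight_def blk_field_def)

lemma block_weight_prod:
  "(\<Prod>x\<in>Lam L n. block_weight g n x (phi L n x \<omega>, blk_field L n x \<omega>)) = (\<Prod>y\<in>Lam L (Suc n). g y (phi L (Suc n) y \<omega>))"
  unfolding prod_blocks block_weight_field by (intro prod.cong refl) (auto simp: blk_def phi_Suc[OF L1])

lemma rg_good_meas: "rg_good G lh r A A' s g u \<Longrightarrow> g \<in> borel_measurable borel"
  by (intro borel_measurable_continuous_onI continuous_at_imp_continuous_on ballI)
     (auto simp: rg_good_def dest: DERIV_isCont)

lemma block_weight_props:
  assumes prm: "rg_params A A' s lh r G" and good: "\<And>y. y \<in> Lam L (Suc n) \<Longrightarrow> rg_good G lh r A A' s (g y) (u y)"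
  shows "x \<in> Lam L n \<Longrightarrow> block_weight g n x \<in> borel_measurable (borel \<Otimes>\<^sub>M PiM (blk L n x) (\<lambda>_. borel))"
    and "\<exists>K. \<forall>x\<in>Lam L n. \<forall>v. 0 \<le> block_weight g n x v \<and> block_weight g n x v \<le> K"
    and "\<exists>K. \<forall>y\<in>Lam L (Suc n). \<forall>t. 0 < g y t \<and> g y t \<le> K"
proof -
  interpret rg_params A A' s lh r G by fact
  have "\<forall>y\<in>Lam L (Suc n). \<exists>K. \<forall>x. 0 < g y x \<and> g y x \<le> K"
    using site_bounded(1)[OF good] by blast
  then obtain k where k: "\<And>y x. y \<in> Lam L (Suc n) \<Longrightarrow> 0 < g y x \<and> g y x \<le> k y" by metis
  define K where "K = 1 + (\<Sum>y\<in>Lam L (Suc n). k y)"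
  have k0: "0 \<le> k y" if "y \<in> Lam L (Suc n)" for y using k[OF that, of 0] by linarith
  have K: "0 < g y t \<and> g y t \<le> K" if "y \<in> Lam L (Suc n)" for y t
    using member_le_sum[of y "Lam L (Suc n)" k] that k0 k[OF that, of t] by (simp add: K_def)
  then show "\<exists>K. \<forall>y\<in>Lam L (Suc n). \<forall>t. 0 < g y t \<and> g y t \<le> K" by blast
  have bl: "y \<in> Lam L (Suc n)" if "y \<in> blk L n x" for x y using that by (simp add: blk_def)
  show "\<exists>K. \<forall>x\<in>Lam L n. \<forall>v. 0 \<le> block_weight g n x v \<and> block_weight g n x v \<le> K"
  proof (intro exI[of _ "K ^ (L ^ 3)"] ballI allI conjI)
    fix x v assume x: "x \<in> Lam L n"
    show "0 \<le> block_weight g n x v" unfolding block_weight_def using K bl by (intro prod_nonneg) (auto simp: less_imp_le)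
    have "block_weight g n x v \<le> (\<Prod>y\<in>blk L n x. K)"
      unfolding block_weight_def using K bl by (intro prod_mono) (auto simp: less_imp_le)
    then show "block_weight g n x v \<le> K ^ (L ^ 3)" using gaussian_blk(2)[OF x] by simp
  qed
  show "block_weight g n x \<in> borel_measurable (borel \<Otimes>\<^sub>M PiM (blk L n x) (\<lambda>_. borel))" if "x \<in> Lam L n"
    unfolding block_weight_def[abs_def]
  proof (intro borel_measurable_prod)
    fix y assume y: "y \<in> blk L n x"
    have "(\<lambda>v. fst v / sqrt (real L) + snd v y) \<in> borel_measurable (borel \<Otimes>\<^sub>M PiM (blk L n x) (\<lambda>_. borel))"
      using y by (intro borel_measurable_add borel_measurable_divide measurable_compose[OF measurable_snd measurable_component_singleton]) auto
    then show "(\<lambda>v. g y (fst v / sqrt (real L) + snd v y)) \<in> borel_measurable (borel \<Otimes>\<^sub>M PiM (blk L n x) (\<lambda>_. borel))"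
      by (rule measurable_compose[OF _ rg_good_meas[OF good[OF bl[OF y]]]])
  qed
qed

definition block_map :: "(site \<Rightarrow> real \<Rightarrow> real) \<Rightarrow> nat \<Rightarrow> site \<Rightarrow> real \<Rightarrow> real" where
  "block_map g n x t = (\<integral>\<omega>. block_weight g n x (t, blk_field L n x \<omega>) \<partial>P)"

lemma field_pair_meas: "(\<lambda>\<omega>. (t, blk_field L n x \<omega>)) \<in> measurable P (borel \<Otimes>\<^sub>M PiM (blk L n x) (\<lambda>_. borel))"
  by (rule measurable_Pair[OF _ blk_field_meas]) simp

lemma phi_pair_meas: "x \<in> Lam L n \<Longrightarrow> (\<lambda>\<omega>. (phi L n x \<omega>, blk_field L n x \<omega>)) \<in> measurable P (borel \<Otimes>\<^sub>M PiM (blk L n x) (\<lambda>_. borel))"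
  by (rule measurable_Pair[OF phi_meas blk_field_meas])

text \<open>H is only assumed integrable, because later it is a sum of fourth powers of the coarse
  field.\<close>

lemma integrate_block_weight:
  assumes prm: "rg_params A A' s lh r G" and good: "\<And>y. y \<in> Lam L (Suc n) \<Longrightarrow> rg_good G lh r A A' s (g y) (u y)"
    and H: "H \<in> borel_measurable (PiM (layers L n) (\<lambda>_. borel))" and i: "integrable P (\<lambda>\<omega>. H (restrict \<omega> (layers L n)))"
  shows "integrable P (\<lambda>\<omega>. H (restrict \<omega> (layers L n)) * (\<Prod>y\<in>Lam L (Suc n). g y (phi L (Suc n) y \<omega>)))"
    and "(\<integral>\<omega>. H (restrict \<omega> (layers L n)) * (\<Prod>y\<in>Lam L (Suc n). g y (phi L (Suc n) y \<omega>)) \<partial>P)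
      = (\<integral>\<omega>. H (restrict \<omega> (layers L n)) * (\<Prod>x\<in>Lam L n. block_map g n x (phi L n x \<omega>)) \<partial>P)"
proof -
  have bw1: "block_weight g n x \<in> borel_measurable (borel \<Otimes>\<^sub>M PiM (blk L n x) (\<lambda>_. borel))" if "x \<in> Lam L n" for x
    by (rule block_weight_props(1)[OF prm good that])
  have bw2: "\<exists>K. \<forall>x\<in>Lam L n. \<forall>v. 0 \<le> block_weight g n x v \<and> block_weight g n x v \<le> K"
    by (rule block_weight_props(2)[OF prm good])
  obtain K where "\<forall>x\<in>Lam L n. \<forall>v. 0 \<le> block_weight g n x v \<and> block_weight g n x v \<le> K"
    using bw2 by (rule exE)
  then have K: "\<And>x v. x \<in> Lam L n \<Longrightarrow> 0 \<le> block_weight g n x v \<and> block_weight g n x v \<le> K" by blast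
  have W: "0 \<le> (\<Prod>x\<in>Lam L n. block_weight g n x (phi L n x \<omega>, blk_field L n x \<omega>))"
    "(\<Prod>x\<in>Lam L n. block_weight g n x (phi L n x \<omega>, blk_field L n x \<omega>)) \<le> K ^ card (Lam L n)" for \<omega>
  proof -
    show "0 \<le> (\<Prod>x\<in>Lam L n. block_weight g n x (phi L n x \<omega>, blk_field L n x \<omega>))" using K by (intro prod_nonneg) auto
    have "(\<Prod>x\<in>Lam L n. block_weight g n x (phi L n x \<omega>, blk_field L n x \<omega>)) \<le> (\<Prod>x\<in>Lam L n. K)" using K by (intro prod_mono) auto
    then show "(\<Prod>x\<in>Lam L n. block_weight g n x (phi L n x \<omega>, blk_field L n x \<omega>)) \<le> K ^ card (Lam L n)" by simp
  qed
  have int: "integrable P (\<lambda>\<omega>. H (restrict \<omega> (layers L n)) * (\<Prod>x\<in>Lam L n. block_weight g n x (phi L n x \<omega>, blk_field L n x \<omega>)))"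
  proof (rule Bochner_Integration.integrable_bound[OF integrable_mult_right[OF i, of "K ^ card (Lam L n)"]])
    show "(\<lambda>\<omega>. H (restrict \<omega> (layers L n)) * (\<Prod>x\<in>Lam L n. block_weight g n x (phi L n x \<omega>, blk_field L n x \<omega>))) \<in> borel_measurable P"
      by (intro borel_measurable_times borel_measurable_prod measurable_compose[OF restrict_meas H] measurable_compose[OF phi_pair_meas bw1]; assumption)
    show "AE \<omega> in P. norm (H (restrict \<omega> (layers L n)) * (\<Prod>x\<in>Lam L n. block_weight g n x (phi L n x \<omega>, blk_field L n x \<omega>)))
        \<le> norm (K ^ card (Lam L n) * H (restrict \<omega> (layers L n)))"
    proof (rule AE_I2)
      fix \<omega>
      have "\<bar>H (restrict \<omega> (layers L n))\<bar> * (\<Prod>x\<in>Lam L n. block_weight g n x (phi L n x \<omega>, blk_field L n x \<omega>))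
          \<le> \<bar>H (restrict \<omega> (layers L n))\<bar> * K ^ card (Lam L n)" by (intro mult_left_mono W) auto
      moreover have "0 \<le> K ^ card (Lam L n)" using W[of \<omega>] by linarith
      ultimately show "norm (H (restrict \<omega> (layers L n)) * (\<Prod>x\<in>Lam L n. block_weight g n x (phi L n x \<omega>, blk_field L n x \<omega>)))
        \<le> norm (K ^ card (Lam L n) * H (restrict \<omega> (layers L n)))" using W(1)[of \<omega>] by (simp add: abs_mult mult.commute)
    qed
  qed
  then show "integrable P (\<lambda>\<omega>. H (restrict \<omega> (layers L n)) * (\<Prod>y\<in>Lam L (Suc n). g y (phi L (Suc n) y \<omega>)))"
    unfolding block_weight_prod .
  have Gi: "integrable P (\<lambda>\<omega>. block_weight g n x (t, blk_field L n x \<omega>))" if "x \<in> Lam L n" for x t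
    by (rule integrable_const_bound[of _ K]) (use K[OF that] measurable_compose[OF field_pair_meas bw1[OF that]] in auto)
  show "(\<integral>\<omega>. H (restrict \<omega> (layers L n)) * (\<Prod>y\<in>Lam L (Suc n). g y (phi L (Suc n) y \<omega>)) \<partial>P)
      = (\<integral>\<omega>. H (restrict \<omega> (layers L n)) * (\<Prod>x\<in>Lam L n. block_map g n x (phi L n x \<omega>)) \<partial>P)"
    using integrate_out[OF H bw1 Gi int] unfolding block_weight_prod block_map_def .
qed

lemma block_map_eq: "block_map g n x = (\<lambda>t. \<integral>\<omega>. (\<Prod>y\<in>blk L n x. g y (t / sqrt (real L) + \<omega> (Suc n, y))) \<partial>P)"
  by (simp add: block_map_def block_weight_field fun_eq_iff)

lemma represents_step:
  assumes prm: "rg_params A A' s lh r G" and good: "\<And>y. y \<in> Lam L (Suc n) \<Longrightarrow> rg_good G lh r A A' s (g y) (u y)"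
    and rep: "represents lam N (Suc n) g"
  shows "represents lam N n (block_map g n)"
  unfolding represents_def
proof (intro allI impI)
  fix H :: "config \<Rightarrow> real" assume H: "H \<in> borel_measurable (PiM (layers L n) (\<lambda>_. borel))" and Hb: "\<exists>K. \<forall>\<alpha>. \<bar>H \<alpha>\<bar> \<le> K"
  define H' where "H' \<alpha> = H (restrict \<alpha> (layers L n))" for \<alpha>
  have sub: "layers L n \<subseteq> layers L (Suc n)" by (auto simp: layers_Suc)
  have H'm: "H' \<in> borel_measurable (PiM (layers L (Suc n)) (\<lambda>_. borel))"
    unfolding H'_def[abs_def] by (rule measurable_compose[OF measurable_restrict_subset[OF sub] H])
  have r: "H' (restrict \<omega> (layers L (Suc n))) = H (restrict \<omega> (layers L n))" for \<omega>
    using sub by (simp add: H'_def Int_absorb1)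
  have "\<exists>K. \<forall>\<alpha>. \<bar>H' \<alpha>\<bar> \<le> K" using Hb by (auto simp: H'_def)
  then have 1: "(\<integral>\<omega>. H (restrict \<omega> (layers L n)) * exp (- interaction L lam N \<omega>) \<partial>P)
      = (\<integral>\<omega>. H (restrict \<omega> (layers L n)) * (\<Prod>y\<in>Lam L (Suc n). g y (phi L (Suc n) y \<omega>)) \<partial>P)"
    using rep H'm unfolding represents_def r[symmetric] by blast
  obtain K where K: "\<And>\<alpha>. \<bar>H \<alpha>\<bar> \<le> K" using Hb by blast
  have i: "integrable P (\<lambda>\<omega>. H (restrict \<omega> (layers L n)))"
    by (rule integrable_const_bound[of _ K]) (use K measurable_compose[OF restrict_meas H] in auto)
  show "(\<integral>\<omega>. H (restrict \<omega> (layers L n)) * exp (- interaction L lam N \<omega>) \<partial>P)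
      = (\<integral>\<omega>. H (restrict \<omega> (layers L n)) * (\<Prod>x\<in>Lam L n. block_map g n x (phi L n x \<omega>)) \<partial>P)"
    unfolding 1 by (rule integrate_block_weight(2)[where g = g and n = n and u = u, OF prm good H i])
qed

lemma block_map_good:
  assumes prm: "rg_params A A' s lh r (G00 L)" and A': "2 * lead_const (real L ^ 3) \<le> A'"
    and A: "lead_const (real L ^ 3) + A' * feed_const (real L ^ 3) \<le> A" and fc: "4 * s * feed_const (real L ^ 3) \<le> 1"
    and good: "\<And>y. y \<in> Lam L (Suc n) \<Longrightarrow> rg_good (G00 L) lh r A A' s (g y) (u y)"
  shows "\<exists>u'. \<forall>x\<in>Lam L n. rg_good (G00 L) (real L * (lh - 36 * flow_gamma L * lh\<^sup>2))
    (real L ^ 2 * (r * (1 - 12 * flow_gamma L * lh) + alpha3 L * lh\<^sup>2)) A A' (real L * s) (block_map g n x) (u' x)"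
proof -
  have "\<exists>u'. rg_good (G00 L) (real L * (lh - 36 * flow_gamma L * lh\<^sup>2))
      (real L ^ 2 * (r * (1 - 12 * flow_gamma L * lh) + alpha3 L * lh\<^sup>2)) A A' (real L * s) (block_map g n x) u'" if x: "x \<in> Lam L n" for x
    unfolding block_map_eq alpha3_eq[OF L2]
    by (rule rg_step[OF gaussian_blk[OF x] L2 prm G00_fixed[OF L2] A' A fc good]) (simp add: blk_def)
  then show ?thesis by metis
qed

text \<open>Induction downwards from the cutoff N to n. The coupling s is largest at the coarsest
  scale, so the single condition at n keeps every step in the admissible range, and no constant
  involves N.\<close>

lemma rg_induction:
  assumes lam: "lam > 0" and s0: "lam_scaled L lam n \<le> s0" and nN: "n \<le> N"
    and A': "2 * lead_const (real L ^ 3) \<le> A'" and A: "lead_const (real L ^ 3) + A' * feed_const (real L ^ 3) \<le> A" and K: "K \<ge> 0"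
    and const: "\<And>s lh r. 0 < s \<Longrightarrow> s \<le> s0 \<Longrightarrow> flow_near L K s lh r \<Longrightarrow>
       rg_params A A' s lh r (G00 L) \<and> 4 * s * feed_const (real L ^ 3) \<le> 1 \<and>
       flow_near L K (real L * s) (real L * (lh - 36 * flow_gamma L * lh\<^sup>2))
           (real L ^ 2 * (r * (1 - 12 * flow_gamma L * lh) + alpha3 L * lh\<^sup>2))"
  shows "\<exists>lh r g u. flow_near L K (lam_scaled L lam n) lh r \<and> (\<forall>y\<in>Lam L n. rg_good (G00 L) lh r A A' (lam_scaled L lam n) (g y) (u y)) \<and> represents lam N n g"
  using nN
proof (induction rule: inc_induct)
  \<comment> \<open>At the cutoff the weight is the exact exponential of the Wick polynomials:
    \<open>lh\<close> is s, \<open>r\<close> is \<open>mass_ct\<close>, and the error of u is zero.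
    The constant in the fourth Wick power drops out of the logarithmic derivative.\<close>
  case base
  define s where "s = lam_scaled L lam N"
  define r where "r = mass_ct L s"
  define g where "g t = exp (- (s * wick L 4 t + r * wick L 2 t))" for t
  define u where "u t = 4 * s * (t ^ 3 - 3 * G00 L * t) + 2 * r * t" for t
  have s: "0 < s" "s \<le> s0" using lam_scaled_pos[OF lam] lam_scaled_antimono[OF lam nN] s0 by (auto simp: s_def)
  have near: "flow_near L K s s r" using K s by (simp add: flow_near_def r_def)
  interpret rg_params A A' s s r "G00 L" using const[OF s near] by blast
  have d: "(g has_real_derivative - (u t * g t)) (at t)" for t
    unfolding g_def[abs_def] wick_4 wick_2
    by (auto intro!: derivative_eq_intros simp: u_def algebra_simps eval_nat_numeral)
  have "rg_good (G00 L) s r A A' s g u"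
    unfolding rg_good_def
  proof (intro conjI allI d)
    show "u \<in> borel_measurable borel" unfolding u_def[abs_def] by measurable
    fix x show "0 < g x" by (simp add: g_def)
    have "0 \<le> A * s ^ 3 + A' * remainder s x" using rg_params_axioms remainder_nonneg[of s x] by (auto simp: rg_params_def)
    then show "\<bar>u x - (4 * s * (x ^ 3 - 3 * G00 L * x) + 2 * r * x)\<bar> \<le> A * s ^ 3 + A' * remainder s x" by (simp add: u_def)
  qed
  moreover have "represents lam N N (\<lambda>_. g)"
  proof -
    have "exp (- interaction L lam N \<omega>) = (\<Prod>y\<in>Lam L N. g (phi L N y \<omega>))" for \<omega>
      unfolding interaction_def g_def sum_negf[symmetric] exp_sum[OF finite_Lam]
      by (simp add: lam_scaled_def s_def r_def)
    then show ?thesis by (simp add: represents_def)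
  qed
  ultimately show ?case using near unfolding s_def[symmetric]
    by (intro exI[of _ s] exI[of _ r] exI[of _ "\<lambda>_. g"] exI[of _ "\<lambda>_. u"]) simp
next
  case (step m)
  then obtain lh r g u where near: "flow_near L K (lam_scaled L lam (Suc m)) lh r"
    and good: "\<And>y. y \<in> Lam L (Suc m) \<Longrightarrow> rg_good (G00 L) lh r A A' (lam_scaled L lam (Suc m)) (g y) (u y)" and rep: "represents lam N (Suc m) g"
    by blast
  have s: "0 < lam_scaled L lam (Suc m)" "lam_scaled L lam (Suc m) \<le> s0"
    using lam_scaled_pos[OF lam] lam_scaled_antimono[OF lam, of n "Suc m"] step.hyps s0 by (auto intro: order_trans)
  note c = const[OF s near]
  have prm: "rg_params A A' (lam_scaled L lam (Suc m)) lh r (G00 L)" and fc: "4 * lam_scaled L lam (Suc m) * feed_const (real L ^ 3) \<le> 1" using c by auto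
  define lh' where "lh' = real L * (lh - 36 * flow_gamma L * lh\<^sup>2)"
  define r' where "r' = real L ^ 2 * (r * (1 - 12 * flow_gamma L * lh) + alpha3 L * lh\<^sup>2)"
  obtain u' where u': "\<And>x. x \<in> Lam L m \<Longrightarrow> rg_good (G00 L) lh' r' A A' (lam_scaled L lam m) (block_map g m x) (u' x)"
    using block_map_good[where g = g and u = u and n = m, OF prm A' A fc good] unfolding lh'_def r'_def lam_scaled_Suc[of lam m] by blast
  have near': "flow_near L K (lam_scaled L lam m) lh' r'" using c unfolding lam_scaled_Suc[of lam m] lh'_def r'_def by blast
  show ?case
    by (rule exI[of _ lh'], rule exI[of _ r'], rule exI[of _ "block_map g m"], rule exI[of _ u'])
       (use near' u' represents_step[where g = g and u = u, OF prm good rep] in blast)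
qed

text \<open>The recursion of the field gives a fourth moment of at most half the previous one plus
  125 * 3; 750 is the fixed point of this bound.\<close>

lemma phi_fourth_moment:
  "x \<in> Lam L n \<Longrightarrow> integrable P (\<lambda>\<omega>. phi L n x \<omega> ^ 4)" "x \<in> Lam L n \<Longrightarrow> expectation (\<lambda>\<omega>. phi L n x \<omega> ^ 4) \<le> 750"
proof -
  have "x \<in> Lam L n \<longrightarrow> integrable P (\<lambda>\<omega>. phi L n x \<omega> ^ 4) \<and> expectation (\<lambda>\<omega>. phi L n x \<omega> ^ 4) \<le> 750"
  proof (induction n arbitrary: x)
    case 0
    show ?case
    proof
      assume "x \<in> Lam L 0"
      then have "0 \<le> x $ i \<and> x $ i < 1" for i by (simp add: Lam_def)
      then have "x $ i = 0" for i by (smt (verit))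
      then have x: "x = 0" by (simp add: vec_eq_iff)
      have D: "distributed P lborel (\<lambda>\<omega>. \<omega> (0, 0)) std_normal_density" using GFF by (simp add: is_GFF_def)
      have p: "phi L 0 x \<omega> = \<omega> (0, 0)" for \<omega> using L2 by (simp add: phi_def x ipart_def vec_eq_iff zero_vec_def)
      have dd: "distr P lborel (\<lambda>\<omega>. \<omega> (0, 0)) = density lborel std_normal_density"
        using D by (simp add: distributed_def)
      have dd: "distr P borel (\<lambda>\<omega>. \<omega> (0, 0)) = std_normal_distribution"
        unfolding dd[symmetric] by (rule distr_cong) auto
      have m: "(\<lambda>\<omega>. \<omega> (0, 0)) \<in> borel_measurable P" by (rule coord_meas[OF zero_Lam])
      have e: "distr P borel (\<lambda>\<omega>. \<omega> (0, 0)) = distr std_normal_distribution borel (\<lambda>u. 1 * u)"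
        unfolding dd by (simp add: distr_id2)
      have "(\<integral>u. u ^ 4 \<partial>std_normal_distribution) = 3"
        using std_normal_distribution_even_moments(1)[of 2] by (simp add: fact_numeral)
      then show "integrable P (\<lambda>\<omega>. phi L 0 x \<omega> ^ 4) \<and> expectation (\<lambda>\<omega>. phi L 0 x \<omega> ^ 4) \<le> 750"
        unfolding p using scaled_normal_moments(1,2)[OF m e, of 4] by simp
    qed
  next
    case (Suc n)
    show ?case
    proof
      assume x: "x \<in> Lam L (Suc n)"
      define x' where "x' = ipart x L"
      have x': "x' \<in> Lam L n" unfolding x'_def by (rule ipart_Lam[OF L1 x])
      have IH: "integrable P (\<lambda>\<omega>. phi L n x' \<omega> ^ 4)" "expectation (\<lambda>\<omega>. phi L n x' \<omega> ^ 4) \<le> 750" using Suc x' by auto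
      interpret B: gaussian_block P "blk L n x'" "\<lambda>y \<omega>. \<omega> (Suc n, y)" by (rule gaussian_blk[OF x'])
      have xb: "x \<in> blk L n x'" using x by (simp add: blk_def x'_def)
      have iz: "integrable P (\<lambda>\<omega>. \<omega> (Suc n, x) ^ 4)"
        using gaussian_integrable_mono[OF B.gauss' xb xb, of 4 0] by simp
      have ez: "expectation (\<lambda>\<omega>. \<omega> (Suc n, x) ^ 4) \<le> 3"
        using gaussian_moments(2)[OF B.gauss' xb xb] B.\<gamma>_bounds by (simp add: B.Cv_diag power_le_one)
      \<comment> \<open>Applied twice it puts 125/64 in front of the coarse part, which the factor 1
        / L^2, at most 1/4, brings below 1/2.\<close>
      have sq: "(p + q)\<^sup>2 \<le> 5 / 4 * p\<^sup>2 + 5 * q\<^sup>2" for p q :: real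
        using zero_le_power2[of "p / 2 - 2 * q"] by (simp add: power2_eq_square algebra_simps)
      have four: "(p + q) ^ 4 \<le> 125 / 64 * p ^ 4 + 125 * q ^ 4" for p q :: real
      proof -
        have "(p + q) ^ 4 = ((p + q)\<^sup>2)\<^sup>2" by (simp add: power_mult[symmetric])
        also have "\<dots> \<le> (5 / 4 * p\<^sup>2 + 5 * q\<^sup>2)\<^sup>2" by (intro power_mono sq) auto
        also have "\<dots> \<le> 5 / 4 * (5 / 4 * p\<^sup>2)\<^sup>2 + 5 * (5 * q\<^sup>2)\<^sup>2" by (rule sq)
        finally show ?thesis by (simp add: power_mult_distrib power_mult[symmetric] power_divide)
      qed
      have w4: "sqrt (real L) ^ 4 = real L ^ 2" using power_mult[of "sqrt (real L)" 2 2] by simp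
      have le: "phi L (Suc n) x \<omega> ^ 4 \<le> 1 / 2 * phi L n x' \<omega> ^ 4 + 125 * \<omega> (Suc n, x) ^ 4" for \<omega>
      proof -
        have "phi L (Suc n) x \<omega> ^ 4 \<le> 125 / 64 * (phi L n x' \<omega> / sqrt (real L)) ^ 4 + 125 * \<omega> (Suc n, x) ^ 4"
          unfolding phi_Suc[OF L1] x'_def[symmetric] by (rule four)
        also have "125 / 64 * (phi L n x' \<omega> / sqrt (real L)) ^ 4 \<le> 1 / 2 * phi L n x' \<omega> ^ 4"
        proof -
          have "2 * 2 \<le> real L * real L" using L2 by (intro mult_mono) auto
          then have "125 / 64 / real L ^ 2 \<le> 1 / 2" by (simp add: divide_le_eq power2_eq_square)
          then have "125 / 64 / real L ^ 2 * phi L n x' \<omega> ^ 4 \<le> 1 / 2 * phi L n x' \<omega> ^ 4" by (intro mult_right_mono) auto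
          then show ?thesis by (simp add: power_divide w4)
        qed
        finally show ?thesis by simp
      qed
      have ib: "integrable P (\<lambda>\<omega>. 1 / 2 * phi L n x' \<omega> ^ 4 + 125 * \<omega> (Suc n, x) ^ 4)" using IH iz by simp
      have i: "integrable P (\<lambda>\<omega>. phi L (Suc n) x \<omega> ^ 4)"
        by (rule Bochner_Integration.integrable_bound[OF ib]) (use phi_meas[OF x] le in \<open>auto intro!: AE_I2 order_trans[OF le abs_ge_self]\<close>)
      have "expectation (\<lambda>\<omega>. phi L (Suc n) x \<omega> ^ 4) \<le> expectation (\<lambda>\<omega>. 1 / 2 * phi L n x' \<omega> ^ 4 + 125 * \<omega> (Suc n, x) ^ 4)"
        by (intro Bochner_Integration.integral_mono i ib le)
      also have "\<dots> \<le> 750" using IH iz ez by simp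
      finally show "integrable P (\<lambda>\<omega>. phi L (Suc n) x \<omega> ^ 4) \<and> expectation (\<lambda>\<omega>. phi L (Suc n) x \<omega> ^ 4) \<le> 750" using i by simp
    qed
  qed
  then show "x \<in> Lam L n \<Longrightarrow> integrable P (\<lambda>\<omega>. phi L n x \<omega> ^ 4)" "x \<in> Lam L n \<Longrightarrow> expectation (\<lambda>\<omega>. phi L n x \<omega> ^ 4) \<le> 750" by auto
qed

text \<open>The association inequality once more, now globally: the tilted mean of X is at most its
  Gaussian mean O(s N), and X bounds s Y / 32 up to O(s N). The coupling cancels, so the bound is
  uniform in s. It controls how often the field leaves the perturbative region under the
  interaction.\<close>

lemma tilted_fourth_moment:
  assumes prm: "rg_params A A' s lh r G" and good: "\<And>y. y \<in> Lam L n \<Longrightarrow> rg_good G lh r A A' s (g y) (u y)"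
  defines "W \<equiv> \<lambda>\<omega>. (\<Prod>y\<in>Lam L n. g y (phi L n y \<omega>))"
  shows "expectation (\<lambda>\<omega>. (\<Sum>y\<in>Lam L n. phi L n y \<omega> ^ 4) * W \<omega>) \<le> 5000000 * real (card (Lam L n)) * expectation W"
    and "expectation W > 0" "integrable P (\<lambda>\<omega>. (\<Sum>y\<in>Lam L n. phi L n y \<omega> ^ 4) * W \<omega>)" "integrable P W"
proof -
  interpret rg_params A A' s lh r G by fact
  define N where "N = real (card (Lam L n))"
  define X where "X \<omega> = (\<Sum>y\<in>Lam L n. site_incr lh r G (g y) 0 (phi L n y \<omega>))" for \<omega>
  define Y where "Y \<omega> = (\<Sum>y\<in>Lam L n. phi L n y \<omega> ^ 4)" for \<omega>
  have gp: "g y t > 0" if "y \<in> Lam L n" for y t using good[OF that] by (simp add: rg_good_def)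
  have si: "site_incr lh r G (g y) 0 z = ln (g y 0) - ln (g y z)" for y z by (simp add: site_incr_def)
  have Xm: "X \<in> borel_measurable P" unfolding X_def si
    by (intro borel_measurable_sum borel_measurable_diff borel_measurable_const borel_measurable_ln measurable_compose[OF phi_meas rg_good_meas[OF good]])
  have Ym: "Y \<in> borel_measurable P" unfolding Y_def by (intro borel_measurable_sum borel_measurable_power phi_meas)
  have low: "X \<omega> \<ge> s / 32 * Y \<omega> - 6000 * s * N" for \<omega>
  proof -
    have "(\<Sum>y\<in>Lam L n. s / 32 * phi L n y \<omega> ^ 4 - 6000 * s) \<le> X \<omega>" unfolding X_def
      using site_lower[OF good, of _ 0] by (intro sum_mono) force
    moreover have "(\<Sum>y\<in>Lam L n. s / 32 * phi L n y \<omega> ^ 4 - 6000 * s) = s / 32 * Y \<omega> - 6000 * s * N"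
      unfolding sum_subtractf sum_distrib_left[symmetric] Y_def N_def by simp
    ultimately show ?thesis by simp
  qed
  have up: "\<bar>X \<omega>\<bar> \<le> 200 * s * (N + Y \<omega>)" for \<omega>
  proof -
    have "\<bar>X \<omega>\<bar> \<le> (\<Sum>y\<in>Lam L n. \<bar>site_incr lh r G (g y) 0 (phi L n y \<omega>)\<bar>)" unfolding X_def by (rule sum_abs)
    also have "\<dots> \<le> (\<Sum>y\<in>Lam L n. 200 * s * (1 + phi L n y \<omega> ^ 4))"
    proof (rule sum_mono)
      fix y assume y: "y \<in> Lam L n"
      have "(1 + (phi L n y \<omega>)\<^sup>2)\<^sup>2 \<le> 2 * (1 + phi L n y \<omega> ^ 4)"
        using zero_le_power2[of "(phi L n y \<omega>)\<^sup>2 - 1"] by (simp add: power2_sum power2_diff power_mult[symmetric])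
      then have "100 * s * (1 + (phi L n y \<omega>)\<^sup>2)\<^sup>2 \<le> 100 * s * (2 * (1 + phi L n y \<omega> ^ 4))" using rg_params_axioms
        by (intro mult_left_mono) (auto simp: rg_params_def)
      moreover have "\<bar>site_incr lh r G (g y) 0 (phi L n y \<omega>)\<bar> \<le> 100 * s * (1 + (phi L n y \<omega>)\<^sup>2)\<^sup>2"
        using site_abs[OF good[OF y], of 0 "phi L n y \<omega>"] by simp
      moreover have "100 * s * (2 * (1 + phi L n y \<omega> ^ 4)) = 200 * s * (1 + phi L n y \<omega> ^ 4)" by simp
      ultimately show "\<bar>site_incr lh r G (g y) 0 (phi L n y \<omega>)\<bar> \<le> 200 * s * (1 + phi L n y \<omega> ^ 4)" by linarith
    qed
    also have "\<dots> = 200 * s * (N + Y \<omega>)" by (simp add: sum_distrib_left[symmetric] sum.distrib Y_def N_def)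
    finally show ?thesis .
  qed
  have iY: "integrable P Y" unfolding Y_def using phi_fourth_moment(1) by auto
  have EY: "expectation Y \<le> 750 * N"
  proof -
    have "expectation Y = (\<Sum>y\<in>Lam L n. expectation (\<lambda>\<omega>. phi L n y \<omega> ^ 4))"
      unfolding Y_def using phi_fourth_moment(1) by (subst Bochner_Integration.integral_sum) auto
    also have "\<dots> \<le> (\<Sum>y\<in>Lam L n. 750)" by (intro sum_mono phi_fourth_moment(2))
    finally show ?thesis by (simp add: N_def)
  qed
  have Y0: "Y \<omega> \<ge> 0" for \<omega> unfolding Y_def by (intro sum_nonneg) auto
  have s0: "s > 0" using rg_params_axioms by (simp add: rg_params_def)
  have iB: "integrable P (\<lambda>\<omega>. 200 * s * (N + Y \<omega>))" using iY by simp
  have iX: "integrable P X"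
    by (rule Bochner_Integration.integrable_bound[OF iB Xm]) (use up in \<open>auto intro!: AE_I2 order_trans[OF up abs_ge_self]\<close>)
  have Xl: "AE \<omega> in P. X \<omega> \<ge> - (6000 * s * N)"
  proof (rule AE_I2)
    fix \<omega>
    have "0 \<le> s / 32 * Y \<omega>" using s0 Y0 by auto
    then show "X \<omega> \<ge> - (6000 * s * N)" using low[of \<omega>] by linarith
  qed
  note T = tilted_mean_le[OF iX Xl]
  define c where "c = (\<Prod>y\<in>Lam L n. g y 0)"
  have c: "c > 0" unfolding c_def using gp by (intro prod_pos) auto
  have We: "W \<omega> = c * exp (- X \<omega>)" for \<omega>
  proof -
    have "exp (- X \<omega>) = (\<Prod>y\<in>Lam L n. g y (phi L n y \<omega>) / g y 0)"
      unfolding X_def si sum_negf[symmetric] exp_sum[OF finite_Lam] by (intro prod.cong refl) (simp add: exp_diff gp)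
    then have "exp (- X \<omega>) = W \<omega> / c" by (simp add: W_def c_def prod_dividef)
    then show ?thesis using c by simp
  qed
  have EW: "expectation W = c * expectation (\<lambda>\<omega>. exp (- X \<omega>))" by (simp add: We[abs_def])
  show W0: "expectation W > 0" unfolding EW using c T(3) by (intro mult_pos_pos) (auto intro: less_le_trans[OF exp_gt_zero])
  show iW: "integrable P W" unfolding We[abs_def] using T(1) by simp
  have iXk: "integrable P (\<lambda>\<omega>. (X \<omega> + 6000 * s * N) * exp (- X \<omega>))" using T(1,2) by (simp add: distrib_right)
  have le: "s / 32 * (Y \<omega> * exp (- X \<omega>)) \<le> (X \<omega> + 6000 * s * N) * exp (- X \<omega>)" for \<omega>
    using mult_right_mono[of "s / 32 * Y \<omega>" "X \<omega> + 6000 * s * N" "exp (- X \<omega>)"] low[of \<omega>] by simp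
  have iYX: "integrable P (\<lambda>\<omega>. s / 32 * (Y \<omega> * exp (- X \<omega>)))"
  proof (rule Bochner_Integration.integrable_bound[OF iXk])
    show "AE \<omega> in P. norm (s / 32 * (Y \<omega> * exp (- X \<omega>))) \<le> norm ((X \<omega> + 6000 * s * N) * exp (- X \<omega>))"
    proof (rule AE_I2)
      fix \<omega>
      have "0 \<le> s / 32 * (Y \<omega> * exp (- X \<omega>))" using s0 Y0[of \<omega>] by simp
      then show "norm (s / 32 * (Y \<omega> * exp (- X \<omega>))) \<le> norm ((X \<omega> + 6000 * s * N) * exp (- X \<omega>))"
        using le[of \<omega>] by (simp only: real_norm_def abs_of_nonneg)
    qed
  qed (use Ym Xm in measurable)
  have iYX': "integrable P (\<lambda>\<omega>. Y \<omega> * exp (- X \<omega>))" using integrable_mult_right[OF iYX, of "32 / s"] s0 by simp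
  show "integrable P (\<lambda>\<omega>. (\<Sum>y\<in>Lam L n. phi L n y \<omega> ^ 4) * W \<omega>)"
    using integrable_mult_right[OF iYX', of c] by (simp add: We Y_def mult_ac)
  have EX: "expectation X \<le> 200 * s * (N + 750 * N)"
  proof -
    have "expectation X \<le> expectation (\<lambda>\<omega>. 200 * s * (N + Y \<omega>))"
      using up by (intro Bochner_Integration.integral_mono iX iB) (auto intro: order_trans[OF abs_ge_self])
    also have "\<dots> = 200 * s * (N + expectation Y)" using iY by (simp add: prob_space)
    also have "\<dots> \<le> 200 * s * (N + 750 * N)" using EY s0 by (intro mult_left_mono) auto
    finally show ?thesis .
  qed
  have "s / 32 * expectation (\<lambda>\<omega>. Y \<omega> * exp (- X \<omega>)) \<le> expectation (\<lambda>\<omega>. (X \<omega> + 6000 * s * N) * exp (- X \<omega>))"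
    using Bochner_Integration.integral_mono[OF iYX iXk le] by simp
  also have "\<dots> = expectation (\<lambda>\<omega>. X \<omega> * exp (- X \<omega>)) + 6000 * s * N * expectation (\<lambda>\<omega>. exp (- X \<omega>))"
    using T(1,2) by (simp add: distrib_right)
  also have "\<dots> \<le> (200 * s * (N + 750 * N)) * expectation (\<lambda>\<omega>. exp (- X \<omega>)) + 6000 * s * N * expectation (\<lambda>\<omega>. exp (- X \<omega>))"
    by (intro add_right_mono order_trans[OF T(4)] mult_right_mono EX) (auto intro!: Bochner_Integration.integral_nonneg)
  also have "\<dots> = s * (156200 * N * expectation (\<lambda>\<omega>. exp (- X \<omega>)))" by (simp add: algebra_simps)
  finally have "expectation (\<lambda>\<omega>. Y \<omega> * exp (- X \<omega>)) \<le> 32 * (156200 * N * expectation (\<lambda>\<omega>. exp (- X \<omega>)))" using s0 by simp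
  \<comment> \<open>32 * 156200 is slightly below 5000000; 156200 is 200 * 751 + 6000.\<close>
  also have "\<dots> \<le> 5000000 * N * expectation (\<lambda>\<omega>. exp (- X \<omega>))"
  proof -
    have "0 \<le> N * expectation (\<lambda>\<omega>. exp (- X \<omega>))" by (auto simp: N_def intro!: mult_nonneg_nonneg Bochner_Integration.integral_nonneg)
    then show ?thesis by simp
  qed
  finally have f: "c * expectation (\<lambda>\<omega>. Y \<omega> * exp (- X \<omega>)) \<le> c * (5000000 * N * expectation (\<lambda>\<omega>. exp (- X \<omega>)))"
    using c by (intro mult_left_mono) auto
  have "expectation (\<lambda>\<omega>. Y \<omega> * W \<omega>) = c * expectation (\<lambda>\<omega>. Y \<omega> * exp (- X \<omega>))" 
    unfolding We by (subst integral_mult_right_zero[symmetric]) (simp add: mult_ac)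
  then show "expectation (\<lambda>\<omega>. (\<Sum>y\<in>Lam L n. phi L n y \<omega> ^ 4) * W \<omega>) \<le> 5000000 * real (card (Lam L n)) * expectation W"
    using f unfolding EW by (simp add: Y_def N_def mult_ac)
qed

end

section \<open>The separating statistic\<close>

text \<open>Borel--Cantelli for functions instead of events: the sum of the f n has finite mean,
  hence is finite almost surely and its terms tend to zero.\<close>

lemma AE_tendsto_zero_of_summable:
  fixes f :: "nat \<Rightarrow> 'a \<Rightarrow> real"
  assumes M: "prob_space M" and [measurable]: "\<And>n. f n \<in> borel_measurable M"
    and f: "\<And>n x. 0 \<le> f n x \<and> f n x \<le> 1" and e: "\<And>n. (\<integral>x. f n x \<partial>M) \<le> e n" "summable e"
  shows "AE x in M. (\<lambda>n. f n x) \<longlonglongrightarrow> 0"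
proof -
  interpret prob_space M by fact
  have i: "integrable M (f n)" for n by (rule integrable_const_bound[of _ 1]) (use f in auto)
  have e0: "0 \<le> e n" for n using Bochner_Integration.integral_nonneg[of M "f n"] f e(1)[of n] by (meson order_trans)
  have "(\<integral>\<^sup>+x. (\<Sum>n. ennreal (f n x)) \<partial>M) = (\<Sum>n. \<integral>\<^sup>+x. ennreal (f n x) \<partial>M)"
    by (rule nn_integral_suminf) simp
  also have "\<dots> \<le> (\<Sum>n. ennreal (e n))"
    using f e(1) i by (intro suminf_le) (auto simp: nn_integral_eq_integral intro!: ennreal_leI)
  also have "\<dots> < \<top>" using e(2) e0 by (simp add: suminf_ennreal2)
  finally have "(\<integral>\<^sup>+x. (\<Sum>n. ennreal (f n x)) \<partial>M) \<noteq> \<infinity>" by simp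
  then have "AE x in M. (\<Sum>n. ennreal (f n x)) \<noteq> \<infinity>" by (intro nn_integral_PInf_AE) auto
  then show ?thesis
  proof eventually_elim
    case (elim x)
    then have "summable (\<lambda>n. f n x)" using f by (intro summable_suminf_not_top) auto
    then show ?case by (rule summable_LIMSEQ_zero)
  qed
qed

text \<open>Almost surely the tests tend to 0 under N and to 1 under M. The separating set is the
  complement of an N-null set containing all points where convergence to 0 fails.\<close>

lemma mutually_singular_of_tests:
  fixes h :: "nat \<Rightarrow> 'a \<Rightarrow> real"
  assumes "prob_space M" "prob_space N" and sets: "sets M = sets N"
    and hM: "\<And>n. h n \<in> borel_measurable M" and h: "\<And>n x. 0 \<le> h n x \<and> h n x \<le> 1"
    and N: "\<And>n. (\<integral>x. h n x \<partial>N) \<le> e n" and M: "\<And>n. 1 - e n \<le> (\<integral>x. h n x \<partial>M)" and e: "summable e"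
  shows "mutually_singular M N"
proof -
  interpret M: prob_space M by fact
  interpret N: prob_space N by fact
  have hN: "\<And>n. h n \<in> borel_measurable N" using hM measurable_cong_sets[OF sets refl] by blast
  have iM: "integrable M (h n)" for n by (rule M.integrable_const_bound[of _ 1]) (use h hM in auto)
  have "AE x in N. (\<lambda>n. h n x) \<longlonglongrightarrow> 0"
    by (rule AE_tendsto_zero_of_summable[OF N.prob_space_axioms hN h N e])
  then obtain B where B: "{x \<in> space N. \<not> (\<lambda>n. h n x) \<longlonglongrightarrow> 0} \<subseteq> B" "emeasure N B = 0" "B \<in> sets N" by (rule AE_E)
  have "AE x in M. (\<lambda>n. 1 - h n x) \<longlonglongrightarrow> 0"
    by (rule AE_tendsto_zero_of_summable[OF M.prob_space_axioms _ _ _ e])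
       (use hM h M iM in \<open>auto simp: M.prob_space algebra_simps\<close>)
  then have AM: "AE x in M. x \<notin> space N - B"
    using AE_space
  proof eventually_elim
    case (elim x)
    show ?case
    proof
      assume "x \<in> space N - B"
      then have "(\<lambda>n. h n x) \<longlonglongrightarrow> 0" using B(1) by auto
      from tendsto_add[OF this elim(1)] show False by (simp add: LIMSEQ_const_iff)
    qed
  qed
  have A: "space N - B \<in> sets M" using B sets by auto
  have "emeasure M (space N - B) = 0"
    using AE_iff_measurable[OF A, of "\<lambda>x. x \<notin> space N - B"] AM sets.sets_into_space[OF A] by auto
  moreover have "space N - (space N - B) = B" using sets.sets_into_space[OF B(3)] by auto
  ultimately show ?thesis unfolding mutually_singular_def using sets A B by metis
qed

definition quartic_const :: "nat \<Rightarrow> real" where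
  "quartic_const L = real L ^ 3 * (flow_gamma L ^ 4 + (real L ^ 3 - 1) / (real L ^ 3) ^ 4)"

text \<open>The centred quartic \<open>F4\<close> of a block, and in \<open>quartic_const\<close>
  the constant \<open>S4\<close>, written in the coordinates of one block and in L alone, so that
  the statistic does not refer to the probability measure.\<close>

definition quartic_stat :: "nat \<Rightarrow> nat \<Rightarrow> site \<Rightarrow> (site \<Rightarrow> real) \<Rightarrow> real" where
  "quartic_stat L n x \<beta> = (\<Sum>y\<in>blk L n x. \<beta> y ^ 4) - 6 * flow_gamma L * (\<Sum>y\<in>blk L n x. \<beta> y ^ 2) + 3 * real L ^ 3 * (flow_gamma L)\<^sup>2"

text \<open>
  First order perturbation theory for the tilted mean of the quartic needs \<open>s * t\<^sup>2 \<le> 1\<close>.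
\<close>

definition cutoff :: "real \<Rightarrow> real \<Rightarrow> real" where
  "cutoff s t = max 0 (1 - s * t\<^sup>2)"

definition stat :: "nat \<Rightarrow> real \<Rightarrow> nat \<Rightarrow> config \<Rightarrow> real" where
  "stat L s n \<omega> = (\<Sum>x\<in>Lam L n. cutoff s (phi L n x \<omega>) * quartic_stat L n x (blk_field L n x \<omega>))"

text \<open>A quarter of the guaranteed drift: the mean shift per block is - 24 \<open>lh\<close>
  \<open>quartic_const\<close> with \<open>lh\<close> at least s / 2, hence 12
  \<open>quartic_const\<close> s in absolute value. The test vanishes above minus one threshold and
  is 1 below minus two, which leaves two thresholds for fluctuations and errors.\<close>

definition threshold :: "nat \<Rightarrow> real \<Rightarrow> nat \<Rightarrow> real" where
  "threshold L s n = 3 * quartic_const L * s * real (card (Lam L n))"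

text \<open>
  Piecewise linear rather than an indicator, since only weak convergence of the cutoff measures is
  available.
\<close>

definition test_fun :: "nat \<Rightarrow> real \<Rightarrow> nat \<Rightarrow> config \<Rightarrow> real" where
  "test_fun L s n \<omega> = min 1 (max 0 (- stat L s n \<omega> / threshold L s n - 1))"

lemma test_fun_bounds: "0 \<le> test_fun L s n \<omega> \<and> test_fun L s n \<omega> \<le> 1"
  by (auto simp: test_fun_def)

lemma cutoff_bounds: "s \<ge> 0 \<Longrightarrow> 0 \<le> cutoff s t" "s \<ge> 0 \<Longrightarrow> cutoff s t \<le> 1"
  by (auto simp: cutoff_def)

lemma cutoff_nonzero: "cutoff s t \<noteq> 0 \<Longrightarrow> s * t\<^sup>2 \<le> 1"
  by (auto simp: cutoff_def max_def split: if_splits)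

section \<open>The statistic under the free field and under the interaction\<close>

context gff begin

lemma quartic_const_pos: "quartic_const L > 0"
proof -
  have "1 < real L ^ 3" using L2 by (intro one_less_power) auto
  moreover have "flow_gamma L > 0" using calculation by (simp add: flow_gamma_def divide_less_eq)
  ultimately show ?thesis unfolding quartic_const_def using L2
    by (intro mult_pos_pos add_pos_pos zero_less_power divide_pos_pos) auto
qed

lemma block_stat:
  assumes x: "x \<in> Lam L n"
  shows "gaussian_block.F4 (blk L n x) (\<lambda>y \<omega>. \<omega> (Suc n, y)) \<omega> = quartic_stat L n x (blk_field L n x \<omega>)"
    and "gaussian_block.S4 (blk L n x) = quartic_const L"
proof -
  interpret B: gaussian_block P "blk L n x" "\<lambda>y \<omega>. \<omega> (Suc n, y)" by (rule gaussian_blk[OF x])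
  have c: "real (card (blk L n x)) = real L ^ 3" using gaussian_blk(2)[OF x] by simp
  have g: "B.\<gamma> = flow_gamma L" by (simp add: B.\<gamma>_def flow_gamma_def gaussian_blk(2)[OF x])
  show "B.F4 \<omega> = quartic_stat L n x (blk_field L n x \<omega>)"
    unfolding B.F4_def quartic_stat_def B.Q_def g c by (simp add: blk_field_def)
  show "B.S4 = quartic_const L" unfolding B.S4_def quartic_const_def g c ..
qed

lemma quartic_stat_meas: "quartic_stat L n x \<in> borel_measurable (PiM (blk L n x) (\<lambda>_. borel))"
  unfolding quartic_stat_def[abs_def]
  by (intro borel_measurable_add borel_measurable_diff borel_measurable_times borel_measurable_const borel_measurable_sum borel_measurable_power measurable_component_singleton)

lemma cutoff_meas: "cutoff s \<in> borel_measurable borel"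
  unfolding cutoff_def[abs_def] by measurable

lemma cutoff_stat_meas:
  "(\<lambda>v. cutoff s (fst v) * quartic_stat L n x (snd v)) \<in> borel_measurable (borel \<Otimes>\<^sub>M PiM (blk L n x) (\<lambda>_. borel))"
  by (intro borel_measurable_times measurable_compose[OF measurable_fst cutoff_meas] measurable_compose[OF measurable_snd quartic_stat_meas])

lemma phi_restrict_le:
  assumes "n \<le> m" "x \<in> Lam L n" shows "phi L n x (restrict \<omega> (layers L m)) = phi L n x \<omega>"
  unfolding phi_def using ipart_power_Lam[OF L1 assms(2)] assms(1) by (intro sum.cong refl) (auto simp: layers_def)

lemma phi_measurable_le:
  assumes "n \<le> m" "x \<in> Lam L n" shows "phi L n x \<in> borel_measurable (PiM (layers L m) (\<lambda>_. borel))"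
  unfolding phi_def[abs_def] using ipart_power_Lam[OF L1 assms(2)] assms(1)
  by (intro borel_measurable_sum borel_measurable_times borel_measurable_const measurable_component_singleton) (auto simp: layers_def)

lemma blk_field_measurable: "blk_field L n x \<in> measurable (PiM (layers L (Suc n)) (\<lambda>_. borel)) (PiM (blk L n x) (\<lambda>_. borel))"
  unfolding blk_field_def[abs_def]
  by (intro measurable_restrict measurable_component_singleton) (auto simp: blk_def layers_def)

lemma stat_measurable: "stat L s n \<in> borel_measurable (PiM (layers L (Suc n)) (\<lambda>_. borel))"
  unfolding stat_def[abs_def]
proof (intro borel_measurable_sum borel_measurable_times)
  fix x assume x: "x \<in> Lam L n"
  show "(\<lambda>\<omega>. cutoff s (phi L n x \<omega>)) \<in> borel_measurable (PiM (layers L (Suc n)) (\<lambda>_. borel))"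
    by (rule measurable_compose[OF phi_measurable_le[OF _ x] cutoff_meas]) simp
  show "(\<lambda>\<omega>. quartic_stat L n x (blk_field L n x \<omega>)) \<in> borel_measurable (PiM (layers L (Suc n)) (\<lambda>_. borel))"
    by (rule measurable_compose[OF blk_field_measurable quartic_stat_meas])
qed

lemma test_fun_measurable: "test_fun L s n \<in> borel_measurable (PiM (layers L (Suc n)) (\<lambda>_. borel))"
  unfolding test_fun_def[abs_def] using stat_measurable by measurable

lemma test_fun_restrict: "test_fun L s n (restrict \<omega> (layers L (Suc n))) = test_fun L s n \<omega>"
proof -
  have "blk_field L n x (restrict \<omega> (layers L (Suc n))) = blk_field L n x \<omega>" for x
    by (auto simp: blk_field_def blk_def layers_def fun_eq_iff)
  then have "stat L s n (restrict \<omega> (layers L (Suc n))) = stat L s n \<omega>"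
    unfolding stat_def by (intro sum.cong refl) (simp add: phi_restrict_le)
  then show ?thesis by (simp add: test_fun_def)
qed

lemma test_fun_meas: "test_fun L s n \<in> borel_measurable P"
  using measurable_compose[OF restrict_meas test_fun_measurable, of s n] by (simp add: test_fun_restrict)

lemma test_fun_continuous:
  "continuous_map (product_topology (\<lambda>_. euclideanreal) (layers L (Suc n))) euclideanreal (test_fun L s n)"
proof -
  have co: "continuous_map (product_topology (\<lambda>_. euclideanreal) (layers L (Suc n))) euclideanreal (\<lambda>\<omega>. \<omega> p)" if "p \<in> layers L (Suc n)" for p
    using that by (rule continuous_map_product_projection)
  have ph: "continuous_map (product_topology (\<lambda>_. euclideanreal) (layers L (Suc n))) euclideanreal (phi L n x)" if x: "x \<in> Lam L n" for x
    unfolding phi_def[abs_def] using ipart_power_Lam[OF L1 x]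
    by (intro continuous_map_sum continuous_map_real_mult continuous_map_canonical_const co) (auto simp: layers_def)
  have bf: "continuous_map (product_topology (\<lambda>_. euclideanreal) (layers L (Suc n))) euclideanreal (\<lambda>\<omega>. blk_field L n x \<omega> y)"
    if "y \<in> blk L n x" for x y
    using co[of "(Suc n, y)"] that by (simp add: blk_field_def) (auto simp: blk_def layers_def)
  have st: "continuous_map (product_topology (\<lambda>_. euclideanreal) (layers L (Suc n))) euclideanreal (stat L s n)"
    unfolding stat_def[abs_def] cutoff_def quartic_stat_def
  proof (intro continuous_map_sum continuous_map_real_mult continuous_map_real_max continuous_map_canonical_const
      continuous_map_diff continuous_map_add continuous_map_real_pow ph bf finite_Lam finite_blk)
  qed auto
  have "continuous_map (product_topology (\<lambda>_. euclideanreal) (layers L (Suc n))) euclideanreal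
      (\<lambda>\<omega>. min 1 (max 0 (- stat L s n \<omega> * (1 / threshold L s n) - 1)))"
    by (intro continuous_map_real_min continuous_map_real_max continuous_map_diff continuous_map_real_mult continuous_map_minus continuous_map_canonical_const st)
  then show ?thesis by (simp add: test_fun_def[abs_def])
qed

lemma threshold_pos: "s > 0 \<Longrightarrow> threshold L s n > 0"
  using quartic_const_pos zero_Lam[of n] by (auto simp: threshold_def card_gt_0_iff intro!: mult_pos_pos)

text \<open>Chebyshev's inequality: under the free field the block quartics are centred and
  independent of the coarse field, and the cutoff, a function of the coarse field between 0 and 1,
  can only lower the second moment.\<close>

lemma test_fun_GFF:
  assumes s: "s > 0"
  shows "expectation (test_fun L s n) \<le> real (card (Lam L n)) * (100 * (real L ^ 3)\<^sup>2 * moment_bound (real L ^ 3) 4) / (threshold L s n)\<^sup>2"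
proof -
  define C where "C = 100 * (real L ^ 3)\<^sup>2 * moment_bound (real L ^ 3) 4"
  define k where "k = threshold L s n"
  define a where "a x v = cutoff s (fst v) * quartic_stat L n x (snd v)" for x v
  have k: "k > 0" using threshold_pos[OF s] by (simp add: k_def)
  define q where "q x \<omega> = quartic_stat L n x (blk_field L n x \<omega>)" for x \<omega>
  have q: "integrable P (q x)" "expectation (q x) = 0" "integrable P (\<lambda>\<omega>. (q x \<omega>)\<^sup>2)" "expectation (\<lambda>\<omega>. (q x \<omega>)\<^sup>2) \<le> C" if x: "x \<in> Lam L n" for x
  proof -
    interpret B: gaussian_block P "blk L n x" "\<lambda>y \<omega>. \<omega> (Suc n, y)" by (rule gaussian_blk[OF x])
    have e: "B.F4 = q x" by (simp add: fun_eq_iff block_stat(1)[OF x] q_def)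
    show "integrable P (q x)" "expectation (q x) = 0" "integrable P (\<lambda>\<omega>. (q x \<omega>)\<^sup>2)" "expectation (\<lambda>\<omega>. (q x \<omega>)\<^sup>2) \<le> C"
      using B.F4_expect B.F4_square_mean unfolding e by (auto simp: C_def gaussian_blk(2)[OF x])
  qed
  have ch: "0 \<le> cutoff s t" "cutoff s t \<le> 1" for t using cutoff_bounds s by auto
  have am: "a x \<in> borel_measurable (borel \<Otimes>\<^sub>M PiM (blk L n x) (\<lambda>_. borel))" for x
    unfolding a_def[abs_def] by (rule cutoff_stat_meas)
  have aB: "\<bar>a x (t, blk_field L n x \<omega>)\<bar> \<le> \<bar>q x \<omega>\<bar>" for x t \<omega>
    using ch[of t] by (simp add: a_def q_def abs_mult mult_left_le_one_le)
  have mean: "expectation (\<lambda>\<omega>. a x (t, blk_field L n x \<omega>) * 1) = 0" if "x \<in> Lam L n" for x t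
    using q[OF that] by (simp add: a_def q_def[symmetric])
  have var: "expectation (\<lambda>\<omega>. (a x (t, blk_field L n x \<omega>))\<^sup>2 * 1) \<le> C * expectation (\<lambda>\<omega>. 1)" if x: "x \<in> Lam L n" for x t
  proof -
    have "expectation (\<lambda>\<omega>. (a x (t, blk_field L n x \<omega>))\<^sup>2 * 1) = (cutoff s t)\<^sup>2 * expectation (\<lambda>\<omega>. (q x \<omega>)\<^sup>2)"
      by (simp add: a_def q_def[symmetric] power_mult_distrib)
    also have "\<dots> \<le> 1 * C" using q[OF x] ch[of t] by (intro mult_mono) (auto simp: power_le_one intro!: Bochner_Integration.integral_nonneg)
    finally show ?thesis by (simp add: prob_space)
  qed
  have Bi: "integrable P (\<lambda>\<omega>. \<bar>q x \<omega>\<bar>\<^sup>2)" if "x \<in> Lam L n" for x using q(3)[OF that] by simp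
  note S = second_moment_blocks[of n a "\<lambda>_ _. 1" 1 "\<lambda>x \<omega>. \<bar>q x \<omega>\<bar>", OF am _ _ aB Bi mean var]
  have st: "(\<Sum>x\<in>Lam L n. a x (phi L n x \<omega>, blk_field L n x \<omega>)) = stat L s n \<omega>" for \<omega>
    by (simp add: a_def stat_def)
  have S1: "integrable P (\<lambda>\<omega>. (stat L s n \<omega>)\<^sup>2)" and S2: "expectation (\<lambda>\<omega>. (stat L s n \<omega>)\<^sup>2) \<le> real (card (Lam L n)) * C"
    using S(1,3) unfolding st by (simp_all add: prob_space)
  have le: "test_fun L s n \<omega> \<le> (stat L s n \<omega>)\<^sup>2 / k\<^sup>2" for \<omega>
  proof (cases "stat L s n \<omega> < - k")
    case True
    have "k\<^sup>2 \<le> (- stat L s n \<omega>)\<^sup>2" using True k by (intro power_mono) auto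
    then have "1 \<le> (stat L s n \<omega>)\<^sup>2 / k\<^sup>2" using k by simp
    then show ?thesis using test_fun_bounds[of L s n \<omega>] by linarith
  next
    case False
    then have "- stat L s n \<omega> \<le> 1 * k" by simp
    then have "- stat L s n \<omega> / k \<le> 1" using k by (simp only: pos_divide_le_eq)
    then have "test_fun L s n \<omega> = 0" by (simp add: test_fun_def k_def[symmetric])
    then show ?thesis by simp
  qed
  have "expectation (test_fun L s n) \<le> expectation (\<lambda>\<omega>. (stat L s n \<omega>)\<^sup>2 / k\<^sup>2)"
    using S1 le test_fun_bounds test_fun_meas by (intro Bochner_Integration.integral_mono integrable_const_bound[of "test_fun L s n" 1]) auto
  also have "\<dots> \<le> real (card (Lam L n)) * C / k\<^sup>2" using S2 by (simp add: divide_right_mono)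
  finally show ?thesis by (simp add: C_def k_def)
qed

text \<open>The statistic is split into its conditional means given the coarse field and a
  conditionally centred rest. The rest is handled by second moments, the means by first order
  perturbation theory with an error s^2 (1 + \<phi>^4). Weights of two scales occur: those of layer
  n + 1 tilt the blocks, and their block maps control the fourth moments of the field at layer
  n.\<close>

lemma test_fun_tilted:
  assumes prm: "rg_params A A' s lh r (G00 L)" and good: "\<And>y. y \<in> Lam L (Suc n) \<Longrightarrow> rg_good (G00 L) lh r A A' s (g y) (u y)"
    and prm': "rg_params A A' s' lh' r' (G00 L)" and good': "\<And>x. x \<in> Lam L n \<Longrightarrow> rg_good (G00 L) lh' r' A A' s' (block_map g n x) (u' x)"
  defines "W \<equiv> \<lambda>\<omega>. (\<Prod>y\<in>Lam L (Suc n). g y (phi L (Suc n) y \<omega>))" and "b \<equiv> real L ^ 3" and "N \<equiv> real (card (Lam L n))"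
  shows "expectation (\<lambda>\<omega>. (1 - test_fun L s n \<omega>) * W \<omega>)
     \<le> (N * (100 * b\<^sup>2 * small_const b) / (threshold L s n)\<^sup>2 + (12 * quartic_const L + 20 * b * small_const b) * s\<^sup>2 * (5000001 * N) / threshold L s n) * expectation W"
    and "expectation W > 0"
proof -
  interpret rg_params A A' s lh r "G00 L" by fact
  have s0: "s > 0" and s1: "s \<le> 1" and lhb: "s / 2 \<le> lh" "lh \<le> 2 * s" using rg_params_axioms by (auto simp: rg_params_def)
  define k where "k = threshold L s n"
  have k: "k > 0" using threshold_pos[OF s0] by (simp add: k_def)
  define Q4 where "Q4 = quartic_const L"
  have Q4: "Q4 > 0" using quartic_const_pos by (simp add: Q4_def)
  define C where "C = 12 * Q4 + 20 * b * small_const b"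
  define q where "q x \<omega> = quartic_stat L n x (blk_field L n x \<omega>)" for x \<omega>
  define G where "G = block_weight g n"
  define R where "R x t = expectation (\<lambda>\<omega>. G x (t, blk_field L n x \<omega>))" for x t
  define T where "T x t = expectation (\<lambda>\<omega>. q x \<omega> * G x (t, blk_field L n x \<omega>))" for x t
  define m where "m x t = T x t / R x t" for x t
  \<comment> \<open>Subtracting the conditional mean m makes each block term centred under the
    tilted block law.\<close>
  define a where "a x v = cutoff s (fst v) * (quartic_stat L n x (snd v) - m x (fst v))" for x v
  have bl: "y \<in> Lam L (Suc n)" if "y \<in> blk L n x" for x y using that by (simp add: blk_def)
  have Gm: "G x \<in> borel_measurable (borel \<Otimes>\<^sub>M PiM (blk L n x) (\<lambda>_. borel))" if "x \<in> Lam L n" for x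
    unfolding G_def by (rule block_weight_props(1)[OF prm good that])
  obtain K where "\<forall>x\<in>Lam L n. \<forall>v. 0 \<le> G x v \<and> G x v \<le> K"
    unfolding G_def using block_weight_props(2)[OF prm good] by (rule exE)
  then have GK: "0 \<le> G x v \<and> G x v \<le> K" if "x \<in> Lam L n" for x v using that by blast
  have ch: "0 \<le> cutoff s t" "cutoff s t \<le> 1" for t using cutoff_bounds s0 by auto
  have block: "R x t > 0" "integrable P (q x)" "integrable P (\<lambda>\<omega>. (q x \<omega>)\<^sup>2)"
      "cutoff s t \<noteq> 0 \<Longrightarrow> \<bar>m x t + 24 * lh * Q4\<bar> \<le> 10 * b * small_const b * (s * (1 + t\<^sup>2))\<^sup>2"
      "cutoff s t \<noteq> 0 \<Longrightarrow> expectation (\<lambda>\<omega>. (q x \<omega>)\<^sup>2 * G x (t, blk_field L n x \<omega>)) \<le> 100 * b\<^sup>2 * small_const b * R x t"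
      "small_const b \<ge> 0"
    if x: "x \<in> Lam L n" for x t
  proof -
    have cb: "real (card (blk L n x)) = b" using gaussian_blk(2)[OF x] by (simp add: b_def)
    have "tilted_block P (blk L n x) (\<lambda>y \<omega>. \<omega> (Suc n, y)) A A' s lh r (G00 L) g u"
      by (intro tilted_block.intro tilted_block_axioms.intro gaussian_blk x prm good bl)
    then interpret B: tilted_block P "blk L n x" "\<lambda>y \<omega>. \<omega> (Suc n, y)" A A' s lh r "G00 L" g u "t / sqrt (real L)" .
    have F: "B.F4 = q x" by (simp add: fun_eq_iff block_stat(1)[OF x] q_def)
    have w: "G x (t, blk_field L n x \<omega>) = (\<Prod>y\<in>blk L n x. g y (t / sqrt (real L) + \<omega> (Suc n, y)))" for \<omega>
      unfolding G_def by (rule block_weight_field)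
    show R: "R x t > 0" using B.expectation_prod_pos by (simp add: R_def w)
    show "integrable P (q x)" "integrable P (\<lambda>\<omega>. (q x \<omega>)\<^sup>2)" using B.F4_expect B.F4_square_mean unfolding F by auto
    show "small_const b \<ge> 0" using B.const_nonneg unfolding cb by simp
    have mt: "B.tilt f = expectation (\<lambda>\<omega>. f \<omega> * G x (t, blk_field L n x \<omega>)) / R x t" for f
      unfolding B.tilt_prod R_def w ..
    assume "cutoff s t \<noteq> 0"
    then have st: "s * t\<^sup>2 \<le> 1" by (rule cutoff_nonzero)
    \<comment> \<open>The background in a block is the coarse field divided by sqrt L, hence small
      whenever the cutoff, taken at t itself, is nonzero.\<close>
    have psi: "(t / sqrt (real L))\<^sup>2 \<le> t\<^sup>2" using L2 by (simp add: power_divide divide_le_eq mult_le_cancel_left1)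
    have small: "s * (t / sqrt (real L))\<^sup>2 \<le> 1" using mult_left_mono[OF psi, of s] s0 st by linarith
    have "\<bar>m x t + 24 * lh * Q4\<bar> \<le> 10 * b * small_const b * (s * (1 + (t / sqrt (real L))\<^sup>2))\<^sup>2"
      using B.tilt_F4(1)[OF small] unfolding mt F cb block_stat(2)[OF x] m_def T_def Q4_def .
    also have "\<dots> \<le> 10 * b * small_const b * (s * (1 + t\<^sup>2))\<^sup>2"
      using psi s0 B.const_nonneg unfolding cb by (intro mult_left_mono power_mono) (auto simp: b_def)
    finally show "\<bar>m x t + 24 * lh * Q4\<bar> \<le> 10 * b * small_const b * (s * (1 + t\<^sup>2))\<^sup>2" .
    show "expectation (\<lambda>\<omega>. (q x \<omega>)\<^sup>2 * G x (t, blk_field L n x \<omega>)) \<le> 100 * b\<^sup>2 * small_const b * R x t"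
      using B.tilt_F4(2)[OF small] R unfolding mt F cb by (simp add: divide_le_eq)
  qed
  have sc0: "small_const b \<ge> 0" by (rule block(6)[OF zero_Lam])
  have C0: "C \<ge> 0" using sc0 Q4 by (simp add: C_def b_def)
  \<comment> \<open>A crude bound on the conditional mean within the cutoff, where s (1 + t^2) is at
    most 2; it enters only the integrable majorant B.\<close>
  define Cm where "Cm = 48 * Q4 + 40 * b * small_const b"
  have chm: "\<bar>cutoff s t * m x t\<bar> \<le> Cm" if x: "x \<in> Lam L n" for x t
  proof (cases "cutoff s t = 0")
    case True then show ?thesis using Q4 sc0 by (simp add: Cm_def b_def)
  next
    case False
    have "s * (1 + t\<^sup>2) \<le> 2" using cutoff_nonzero[OF False] s1 by (simp add: distrib_left)
    then have "(s * (1 + t\<^sup>2))\<^sup>2 \<le> 2\<^sup>2" using s0 by (intro power_mono) auto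
    then have "10 * b * small_const b * (s * (1 + t\<^sup>2))\<^sup>2 \<le> 10 * b * small_const b * 2\<^sup>2"
      using sc0 by (intro mult_left_mono) (auto simp: b_def)
    moreover have "10 * b * small_const b * 2\<^sup>2 = 40 * b * small_const b" by simp
    moreover have "24 * lh * Q4 \<le> 48 * Q4" "0 \<le> 24 * lh * Q4" using lhb s1 s0 Q4 by (auto intro!: mult_right_mono)
    ultimately have "\<bar>m x t\<bar> \<le> Cm" using block(4)[OF x False] unfolding Cm_def by linarith
    then have "cutoff s t * \<bar>m x t\<bar> \<le> 1 * Cm" using ch[of t] by (intro mult_mono) auto
    then show ?thesis using ch[of t] by (simp add: abs_mult)
  qed
  have gtm: "(\<lambda>v. G x (fst v, blk_field L n x (snd v))) \<in> borel_measurable (borel \<Otimes>\<^sub>M P)"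
    and qtm: "(\<lambda>v. q x (snd v)) \<in> borel_measurable (borel \<Otimes>\<^sub>M P)" if "x \<in> Lam L n" for x
  proof -
    have "(\<lambda>v. (fst v, blk_field L n x (snd v))) \<in> measurable (borel \<Otimes>\<^sub>M P) (borel \<Otimes>\<^sub>M PiM (blk L n x) (\<lambda>_. borel))"
      by (rule measurable_Pair[OF measurable_fst measurable_compose[OF measurable_snd blk_field_meas]])
    from measurable_compose[OF this Gm[OF that]]
    show "(\<lambda>v. G x (fst v, blk_field L n x (snd v))) \<in> borel_measurable (borel \<Otimes>\<^sub>M P)" .
    show "(\<lambda>v. q x (snd v)) \<in> borel_measurable (borel \<Otimes>\<^sub>M P)"
      unfolding q_def by (rule measurable_compose[OF measurable_compose[OF measurable_snd blk_field_meas] quartic_stat_meas])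
  qed
  have Rm: "R x \<in> borel_measurable borel" and Tm: "T x \<in> borel_measurable borel" if "x \<in> Lam L n" for x
    unfolding R_def[abs_def] T_def[abs_def] using gtm[OF that] qtm[OF that]
    by (auto intro!: borel_measurable_lebesgue_integral borel_measurable_times simp: split_beta')
  have mm: "m x \<in> borel_measurable borel" if "x \<in> Lam L n" for x
    unfolding m_def[abs_def] using Rm[OF that] Tm[OF that] by (intro borel_measurable_divide)
  have am: "a x \<in> borel_measurable (borel \<Otimes>\<^sub>M PiM (blk L n x) (\<lambda>_. borel))" if "x \<in> Lam L n" for x
    unfolding a_def[abs_def]
    by (intro borel_measurable_times borel_measurable_diff measurable_compose[OF measurable_fst cutoff_meas]
        measurable_compose[OF measurable_snd quartic_stat_meas] measurable_compose[OF measurable_fst mm[OF that]])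
  define B where "B x \<omega> = \<bar>q x \<omega>\<bar> + Cm" for x \<omega>
  have aB: "\<bar>a x (t, blk_field L n x \<omega>)\<bar> \<le> B x \<omega>" if x: "x \<in> Lam L n" for x t \<omega>
  proof -
    have "a x (t, blk_field L n x \<omega>) = cutoff s t * q x \<omega> - cutoff s t * m x t" by (simp add: a_def q_def right_diff_distrib)
    moreover have "\<bar>cutoff s t * q x \<omega>\<bar> \<le> \<bar>q x \<omega>\<bar>" using ch[of t] by (simp add: abs_mult mult_left_le_one_le)
    ultimately show ?thesis using chm[OF x, of t] unfolding B_def by linarith
  qed
  have Bi: "integrable P (\<lambda>\<omega>. (B x \<omega>)\<^sup>2)" if x: "x \<in> Lam L n" for x
  proof -
    have "(\<lambda>\<omega>. (B x \<omega>)\<^sup>2) = (\<lambda>\<omega>. (q x \<omega>)\<^sup>2 + 2 * Cm * \<bar>q x \<omega>\<bar> + Cm\<^sup>2)"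
      by (simp add: B_def power2_sum fun_eq_iff)
    then show ?thesis using block(2,3)[OF x] by simp
  qed
  have gi: "integrable P (\<lambda>\<omega>. f \<omega> * G x (t, blk_field L n x \<omega>))" if x: "x \<in> Lam L n" and f: "integrable P f" for x t f
  proof (rule Bochner_Integration.integrable_bound[OF integrable_mult_left[OF f, of K]])
    show "(\<lambda>\<omega>. f \<omega> * G x (t, blk_field L n x \<omega>)) \<in> borel_measurable P"
      using f by (intro borel_measurable_times measurable_compose[OF field_pair_meas Gm[OF x]]) auto
    show "AE \<omega> in P. norm (f \<omega> * G x (t, blk_field L n x \<omega>)) \<le> norm (f \<omega> * K)"
    proof (rule AE_I2)
      fix \<omega>
      have "\<bar>G x (t, blk_field L n x \<omega>)\<bar> \<le> \<bar>K\<bar>" using GK[OF x, of "(t, blk_field L n x \<omega>)"] by linarith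
      then show "norm (f \<omega> * G x (t, blk_field L n x \<omega>)) \<le> norm (f \<omega> * K)" by (simp add: abs_mult mult_left_mono)
    qed
  qed
  have c1: "integrable P (\<lambda>\<omega>. 1 :: real)" by simp
  have mean: "expectation (\<lambda>\<omega>. a x (t, blk_field L n x \<omega>) * G x (t, blk_field L n x \<omega>)) = 0" if x: "x \<in> Lam L n" for x t
  proof -
    have "expectation (\<lambda>\<omega>. a x (t, blk_field L n x \<omega>) * G x (t, blk_field L n x \<omega>))
       = expectation (\<lambda>\<omega>. cutoff s t * (q x \<omega> * G x (t, blk_field L n x \<omega>)) - cutoff s t * m x t * (1 * G x (t, blk_field L n x \<omega>)))"
      by (intro Bochner_Integration.integral_cong refl) (simp add: a_def q_def algebra_simps)
    also have "\<dots> = cutoff s t * T x t - cutoff s t * m x t * R x t"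
      using gi[OF x block(2)[OF x], of t] gi[OF x c1, of t] by (simp add: T_def R_def)
    also have "\<dots> = 0" using block(1)[OF x, of t] by (simp add: m_def)
    finally show ?thesis .
  qed
  have var: "expectation (\<lambda>\<omega>. (a x (t, blk_field L n x \<omega>))\<^sup>2 * G x (t, blk_field L n x \<omega>)) \<le> (100 * b\<^sup>2 * small_const b) * expectation (\<lambda>\<omega>. G x (t, blk_field L n x \<omega>))" if x: "x \<in> Lam L n" for x t
  proof -
    define V where "V = expectation (\<lambda>\<omega>. (q x \<omega>)\<^sup>2 * G x (t, blk_field L n x \<omega>))"
    have "expectation (\<lambda>\<omega>. (a x (t, blk_field L n x \<omega>))\<^sup>2 * G x (t, blk_field L n x \<omega>))
       = expectation (\<lambda>\<omega>. (cutoff s t)\<^sup>2 * ((q x \<omega>)\<^sup>2 * G x (t, blk_field L n x \<omega>)) - (cutoff s t)\<^sup>2 * (2 * m x t) * (q x \<omega> * G x (t, blk_field L n x \<omega>))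
           + (cutoff s t)\<^sup>2 * (m x t)\<^sup>2 * (1 * G x (t, blk_field L n x \<omega>)))"
      by (intro Bochner_Integration.integral_cong refl) (simp add: a_def q_def power2_eq_square algebra_simps)
    also have "\<dots> = (cutoff s t)\<^sup>2 * V - (cutoff s t)\<^sup>2 * (2 * m x t) * T x t + (cutoff s t)\<^sup>2 * (m x t)\<^sup>2 * R x t"
      using gi[OF x block(2)[OF x], of t] gi[OF x block(3)[OF x], of t] gi[OF x c1, of t] by (simp add: T_def R_def V_def)
    also have "\<dots> = (cutoff s t)\<^sup>2 * V - (cutoff s t)\<^sup>2 * ((m x t)\<^sup>2 * R x t)"
      using block(1)[OF x, of t] by (simp add: m_def power2_eq_square field_simps)
    also have "\<dots> \<le> (cutoff s t)\<^sup>2 * V" using block(1)[OF x, of t] by simp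
    also have "\<dots> \<le> 100 * b\<^sup>2 * small_const b * R x t"
    proof (cases "cutoff s t = 0")
      case True then show ?thesis using sc0 block(1)[OF x, of t] by simp
    next
      case False
      have V0: "V \<ge> 0" unfolding V_def using GK[OF x] by (intro Bochner_Integration.integral_nonneg) auto
      have "(cutoff s t)\<^sup>2 * V \<le> 1 * V" using ch[of t] V0 by (intro mult_right_mono) (auto simp: power_le_one)
      then show ?thesis using block(5)[OF x False] unfolding V_def by linarith
    qed
    finally show ?thesis by (simp add: R_def)
  qed
  define S where "S \<omega> = (\<Sum>x\<in>Lam L n. a x (phi L n x \<omega>, blk_field L n x \<omega>))" for \<omega>
  have W: "(\<Prod>x\<in>Lam L n. G x (phi L n x \<omega>, blk_field L n x \<omega>)) = W \<omega>" for \<omega>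
    unfolding G_def W_def by (rule block_weight_prod)
  have S1: "integrable P (\<lambda>\<omega>. (S \<omega>)\<^sup>2 * W \<omega>)" and iW: "integrable P W"
    and S3: "expectation (\<lambda>\<omega>. (S \<omega>)\<^sup>2 * W \<omega>) \<le> N * (100 * b\<^sup>2 * small_const b) * expectation W"
    using second_moment_blocks[of n a G K B, OF am Gm GK aB Bi mean var] unfolding W S_def[symmetric] N_def by auto
  have W0: "W \<omega> \<ge> 0" for \<omega> unfolding W[symmetric] using GK by (intro prod_nonneg) auto
  define Y where "Y \<omega> = (\<Sum>x\<in>Lam L n. phi L n x \<omega> ^ 4)" for \<omega>
  define H where "H \<alpha> = (\<Sum>x\<in>Lam L n. 1 + phi L n x \<alpha> ^ 4)" for \<alpha>
  have HY: "H \<omega> = N + Y \<omega>" for \<omega> by (simp add: H_def Y_def N_def sum.distrib)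
  have Hr: "H (restrict \<omega> (layers L n)) = H \<omega>" for \<omega> unfolding H_def by (intro sum.cong refl) (simp add: phi_restrict[OF L1])
  have Hm: "H \<in> borel_measurable (PiM (layers L n) (\<lambda>_. borel))"
    unfolding H_def[abs_def] by (intro borel_measurable_sum borel_measurable_add borel_measurable_const borel_measurable_power phi_measurable[OF L1])
  have Hi: "integrable P (\<lambda>\<omega>. H (restrict \<omega> (layers L n)))"
    unfolding Hr unfolding H_def using phi_fourth_moment(1) by auto
  define W' where "W' \<omega> = (\<Prod>x\<in>Lam L n. block_map g n x (phi L n x \<omega>))" for \<omega>
  note TF = tilted_fourth_moment[where g = "block_map g n" and n = n, OF prm' good', folded W'_def Y_def N_def, simplified]
  note IB = integrate_block_weight[where g = g and u = u and n = n, OF prm good]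
  have iHW: "integrable P (\<lambda>\<omega>. H \<omega> * W \<omega>)"
    unfolding W_def using IB(1)[OF _ Hm Hi, unfolded Hr] by blast
  have EHW: "expectation (\<lambda>\<omega>. H \<omega> * W \<omega>) = expectation (\<lambda>\<omega>. H \<omega> * W' \<omega>)"
    unfolding W_def W'_def using IB(2)[OF _ Hm Hi, unfolded Hr] by blast
  have EW: "expectation W = expectation W'"
    unfolding W_def[abs_def] W'_def[abs_def] using IB(2)[OF _ borel_measurable_const c1] by simp
  show EWpos: "expectation W > 0" unfolding EW by (rule TF(2))
  have HW: "expectation (\<lambda>\<omega>. H \<omega> * W \<omega>) \<le> 5000001 * N * expectation W"
  proof -
    have "expectation (\<lambda>\<omega>. H \<omega> * W' \<omega>) = N * expectation W' + expectation (\<lambda>\<omega>. Y \<omega> * W' \<omega>)"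
      unfolding HY distrib_right using TF(3,4) by simp
    also have "\<dots> \<le> N * expectation W' + 5000000 * N * expectation W'" using TF(1) by simp
    finally show ?thesis unfolding EHW EW by (simp add: algebra_simps)
  qed
  \<comment> \<open>Two losses against the drift - 12 s Q4: replacing the cutoff by 1 costs s t^2
    times the drift, and the first order error costs (s (1 + t^2))^2. Both are at most a multiple of
    s^2 (1 + t^4), with total constant C.\<close>
  have site: "cutoff s t * m x t \<le> - (12 * s * Q4) + C * s\<^sup>2 * (1 + t ^ 4)" if x: "x \<in> Lam L n" for x t
  proof -
    have t2: "t\<^sup>2 \<le> 1 + t ^ 4"
    proof -
      have "0 \<le> (t\<^sup>2 - 1)\<^sup>2" by simp
      then have "2 * t\<^sup>2 \<le> 1 + t ^ 4" by (simp add: power2_diff power_mult[symmetric])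
      moreover have "0 \<le> t\<^sup>2" by simp
      ultimately show ?thesis by linarith
    qed
    have cl: "1 - s * t\<^sup>2 \<le> cutoff s t" by (simp add: cutoff_def)
    have "12 * s * Q4 * (1 - s * t\<^sup>2) \<le> 12 * s * Q4 * cutoff s t" using cl s0 Q4 by (intro mult_left_mono) auto
    moreover have "12 * s * Q4 * (s * t\<^sup>2) \<le> 12 * s * Q4 * (s * (1 + t ^ 4))" using t2 s0 Q4 by (intro mult_left_mono) auto
    ultimately have 1: "- (12 * s * Q4 * cutoff s t) \<le> - (12 * s * Q4) + 12 * Q4 * s\<^sup>2 * (1 + t ^ 4)"
      by (simp add: power2_eq_square algebra_simps)
    have e0: "0 \<le> 20 * b * small_const b * s\<^sup>2 * (1 + t ^ 4)" using sc0 by (simp add: b_def)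
    have 2: "cutoff s t * m x t \<le> - (12 * s * Q4 * cutoff s t) + 20 * b * small_const b * s\<^sup>2 * (1 + t ^ 4)"
    proof (cases "cutoff s t = 0")
      case True then show ?thesis using e0 by simp
    next
      case False
      have "(s * (1 + t\<^sup>2))\<^sup>2 \<le> 2 * s\<^sup>2 * (1 + t ^ 4)"
      proof -
        have "(1 + t\<^sup>2)\<^sup>2 \<le> 2 * (1 + t ^ 4)" using zero_le_power2[of "t\<^sup>2 - 1"] by (simp add: power2_sum power2_diff power_mult[symmetric])
        then have "s\<^sup>2 * (1 + t\<^sup>2)\<^sup>2 \<le> s\<^sup>2 * (2 * (1 + t ^ 4))" by (intro mult_left_mono) auto
        then show ?thesis by (simp only: power_mult_distrib mult_ac)
      qed
      then have "10 * b * small_const b * (s * (1 + t\<^sup>2))\<^sup>2 \<le> 10 * b * small_const b * (2 * s\<^sup>2 * (1 + t ^ 4))"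
        using sc0 by (intro mult_left_mono) (auto simp: b_def)
      then have mu: "m x t \<le> - (24 * lh * Q4) + 20 * b * small_const b * s\<^sup>2 * (1 + t ^ 4)" using block(4)[OF x False] by linarith
      have "12 * s * Q4 \<le> 24 * lh * Q4" using lhb Q4 by (intro mult_right_mono) auto
      then have "m x t \<le> - (12 * s * Q4) + 20 * b * small_const b * s\<^sup>2 * (1 + t ^ 4)" using mu by linarith
      then have "cutoff s t * m x t \<le> cutoff s t * (- (12 * s * Q4) + 20 * b * small_const b * s\<^sup>2 * (1 + t ^ 4))"
        using ch[of t] by (intro mult_left_mono) auto
      also have "\<dots> = - (12 * s * Q4 * cutoff s t) + cutoff s t * (20 * b * small_const b * s\<^sup>2 * (1 + t ^ 4))" by (simp add: algebra_simps)
      also have "cutoff s t * (20 * b * small_const b * s\<^sup>2 * (1 + t ^ 4)) \<le> 1 * (20 * b * small_const b * s\<^sup>2 * (1 + t ^ 4))"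
        using ch[of t] e0 by (intro mult_right_mono) auto
      finally show ?thesis by simp
    qed
    have "C * s\<^sup>2 * (1 + t ^ 4) = 12 * Q4 * s\<^sup>2 * (1 + t ^ 4) + 20 * b * small_const b * s\<^sup>2 * (1 + t ^ 4)" by (simp add: C_def algebra_simps)
    then show ?thesis using 1 2 by linarith
  qed
  \<comment> \<open>The sum of the drifts is 12 s Q4 times the number of sites, that is 4 k.\<close>
  have stat_le: "stat L s n \<omega> \<le> S \<omega> - 4 * k + C * s\<^sup>2 * H \<omega>" for \<omega>
  proof -
    have "stat L s n \<omega> = S \<omega> + (\<Sum>x\<in>Lam L n. cutoff s (phi L n x \<omega>) * m x (phi L n x \<omega>))"
      unfolding stat_def S_def a_def sum.distrib[symmetric] by (intro sum.cong refl) (simp add: algebra_simps)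
    also have "(\<Sum>x\<in>Lam L n. cutoff s (phi L n x \<omega>) * m x (phi L n x \<omega>)) \<le> (\<Sum>x\<in>Lam L n. - (12 * s * Q4) + C * s\<^sup>2 * (1 + phi L n x \<omega> ^ 4))"
      by (intro sum_mono site)
    also have "\<dots> = - 4 * k + C * s\<^sup>2 * H \<omega>"
      by (simp add: sum.distrib sum_negf sum_subtractf H_def sum_distrib_left k_def threshold_def Q4_def N_def algebra_simps)
    finally show ?thesis by simp
  qed
  have H0: "H \<omega> \<ge> 0" for \<omega> unfolding H_def by (intro sum_nonneg) auto
  have pt: "1 - test_fun L s n \<omega> \<le> (S \<omega>)\<^sup>2 / k\<^sup>2 + C * s\<^sup>2 * H \<omega> / k" for \<omega>
  proof -
    have nn: "0 \<le> (S \<omega>)\<^sup>2 / k\<^sup>2" "0 \<le> C * s\<^sup>2 * H \<omega> / k" using k C0 H0[of \<omega>] by auto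
    \<comment> \<open>If the fluctuation S and the accumulated error are both below k, the statistic
      is below - 4 k + 2 k and the test equals 1.\<close>
    consider "S \<omega> \<ge> k" | "C * s\<^sup>2 * H \<omega> \<ge> k" | "stat L s n \<omega> \<le> - 2 * k" using stat_le[of \<omega>] by linarith
    then show ?thesis
    proof cases
      case 1
      then have "k\<^sup>2 \<le> (S \<omega>)\<^sup>2" using k by (intro power_mono) auto
      then have "1 \<le> (S \<omega>)\<^sup>2 / k\<^sup>2" using k by simp
      then show ?thesis using nn test_fun_bounds[of L s n \<omega>] by linarith
    next
      case 2
      then have "1 \<le> C * s\<^sup>2 * H \<omega> / k" using k by simp
      then show ?thesis using nn test_fun_bounds[of L s n \<omega>] by linarith
    next
      case 3
      then have "2 * k \<le> - stat L s n \<omega>" by simp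
      then have "2 \<le> - stat L s n \<omega> / k" using k by (simp only: pos_le_divide_eq)
      then have "test_fun L s n \<omega> = 1" by (simp add: test_fun_def k_def[symmetric])
      then show ?thesis using nn by simp
    qed
  qed
  have Wm: "W \<in> borel_measurable P" using iW by auto
  have i1: "integrable P (\<lambda>\<omega>. (1 - test_fun L s n \<omega>) * W \<omega>)"
  proof (rule Bochner_Integration.integrable_bound[OF iW])
    show "AE \<omega> in P. norm ((1 - test_fun L s n \<omega>) * W \<omega>) \<le> norm (W \<omega>)"
      using test_fun_bounds[of L s n] by (intro AE_I2) (auto simp: abs_mult intro!: mult_left_le_one_le)
  qed (use Wm test_fun_meas in auto)
  have i2: "integrable P (\<lambda>\<omega>. (S \<omega>)\<^sup>2 * W \<omega> / k\<^sup>2 + C * s\<^sup>2 / k * (H \<omega> * W \<omega>))"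
    using S1 iHW by simp
  have "expectation (\<lambda>\<omega>. (1 - test_fun L s n \<omega>) * W \<omega>) \<le> expectation (\<lambda>\<omega>. (S \<omega>)\<^sup>2 * W \<omega> / k\<^sup>2 + C * s\<^sup>2 / k * (H \<omega> * W \<omega>))"
  proof (intro Bochner_Integration.integral_mono i1 i2)
    fix \<omega>
    have "(1 - test_fun L s n \<omega>) * W \<omega> \<le> ((S \<omega>)\<^sup>2 / k\<^sup>2 + C * s\<^sup>2 * H \<omega> / k) * W \<omega>" using pt W0 by (intro mult_right_mono)
    then show "(1 - test_fun L s n \<omega>) * W \<omega> \<le> (S \<omega>)\<^sup>2 * W \<omega> / k\<^sup>2 + C * s\<^sup>2 / k * (H \<omega> * W \<omega>)" by (simp add: distrib_right)
  qed
  also have "\<dots> = expectation (\<lambda>\<omega>. (S \<omega>)\<^sup>2 * W \<omega>) / k\<^sup>2 + C * s\<^sup>2 / k * expectation (\<lambda>\<omega>. H \<omega> * W \<omega>)"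
    using S1 iHW by simp
  also have "\<dots> \<le> N * (100 * b\<^sup>2 * small_const b) * expectation W / k\<^sup>2 + C * s\<^sup>2 / k * (5000001 * N * expectation W)"
    using S3 HW k C0 by (intro add_mono divide_right_mono mult_left_mono) auto
  also have "\<dots> = (N * (100 * b\<^sup>2 * small_const b) / k\<^sup>2 + C * s\<^sup>2 * (5000001 * N) / k) * expectation W"
    by (simp add: distrib_right)
  finally show "expectation (\<lambda>\<omega>. (1 - test_fun L s n \<omega>) * W \<omega>)
     \<le> (N * (100 * b\<^sup>2 * small_const b) / (threshold L s n)\<^sup>2 + (12 * quartic_const L + 20 * b * small_const b) * s\<^sup>2 * (5000001 * N) / threshold L s n) * expectation W"
    by (simp add: C_def Q4_def k_def)
qed

text \<open>With p = L^n there are p^3 sites, s is of order 1 / p and the threshold of order p^2.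
  Thus the variance ratio p^3 / p^4 and the error ratio p^(-2) p^3 / p^2 are both of order 1 /
  p.\<close>

lemma threshold_lam_scaled:
  assumes "lam > 0"
  shows "real (card (Lam L n)) * c / (threshold L (lam_scaled L lam (Suc n)) n)\<^sup>2 = c * ((real L)\<^sup>2 / (9 * (quartic_const L)\<^sup>2 * lam\<^sup>2)) / real L ^ n"
    and "c * (lam_scaled L lam (Suc n))\<^sup>2 * (d * real (card (Lam L n))) / threshold L (lam_scaled L lam (Suc n)) n = c * (d * lam / (3 * quartic_const L * real L)) / real L ^ n"
proof -
  have Q: "quartic_const L > 0" by (rule quartic_const_pos)
  have l: "real L > 0" using L2 by simp
  define p where "p = real L ^ n"
  have p: "p > 0" using l by (simp add: p_def)
  have c: "real (card (Lam L n)) = p ^ 3" by (simp add: card_Lam p_def power_mult[symmetric] mult.commute)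
  have s: "lam_scaled L lam (Suc n) = lam / (real L * p)" by (simp add: lam_scaled_def p_def)
  show "real (card (Lam L n)) * c / (threshold L (lam_scaled L lam (Suc n)) n)\<^sup>2 = c * ((real L)\<^sup>2 / (9 * (quartic_const L)\<^sup>2 * lam\<^sup>2)) / real L ^ n"
    unfolding threshold_def c s p_def[symmetric] using Q l p assms by (simp add: power2_eq_square power3_eq_cube divide_simps)
  show "c * (lam_scaled L lam (Suc n))\<^sup>2 * (d * real (card (Lam L n))) / threshold L (lam_scaled L lam (Suc n)) n = c * (d * lam / (3 * quartic_const L * real L)) / real L ^ n" for c
    unfolding threshold_def \<open>real (card (Lam L n)) = p ^ 3\<close> s p_def[symmetric] using Q l p assms by (simp add: power2_eq_square power3_eq_cube divide_simps)
qed

lemma interaction_meas: "interaction L lam N \<in> borel_measurable P"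
proof -
  have "(\<lambda>\<omega>. wick L 4 (phi L N x \<omega>)) \<in> borel_measurable P" "(\<lambda>\<omega>. wick L 2 (phi L N x \<omega>)) \<in> borel_measurable P" if "x \<in> Lam L N" for x
    unfolding wick_4 wick_2 using phi_meas[OF that] by measurable
  then show ?thesis unfolding interaction_def[abs_def] by (intro borel_measurable_sum borel_measurable_add borel_measurable_times borel_measurable_const)
qed

lemma integral_Phi43_cutoff:
  assumes f: "f \<in> borel_measurable P" and Z: "partition_function L lam P N > 0"
  shows "(\<integral>\<omega>. f \<omega> \<partial>Phi43_cutoff L lam P N) = (\<integral>\<omega>. f \<omega> * exp (- interaction L lam N \<omega>) \<partial>P) / partition_function L lam P N"
proof -
  have "(\<integral>\<omega>. f \<omega> \<partial>Phi43_cutoff L lam P N) = (\<integral>\<omega>. (exp (- interaction L lam N \<omega>) / partition_function L lam P N) *\<^sub>R f \<omega> \<partial>P)"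
    unfolding Phi43_cutoff_def using interaction_meas Z by (intro integral_density f) auto
  also have "\<dots> = (\<integral>\<omega>. f \<omega> * exp (- interaction L lam N \<omega>) / partition_function L lam P N \<partial>P)" by (simp add: mult.commute)
  finally show ?thesis by simp
qed

text \<open>D is chosen before N enters, so the lower bound for the cutoff measures can pass to the
  limit. The start n0 only ensures that the coupling is in the perturbative range.\<close>

lemma test_fun_estimates:
  assumes lam: "lam > 0"
  obtains n0 D where
    "\<And>n. n \<ge> n0 \<Longrightarrow> expectation (test_fun L (lam_scaled L lam (Suc n)) n) \<le> D / real L ^ n"
    "\<And>n N. n \<ge> n0 \<Longrightarrow> Suc n \<le> N \<Longrightarrow> 1 - D / real L ^ n \<le> (\<integral>\<omega>. test_fun L (lam_scaled L lam (Suc n)) n \<omega> \<partial>Phi43_cutoff L lam P N)"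
proof -
  obtain A A' K s0 where s0: "0 < s0" "s0 \<le> 1" and K: "0 \<le> K" and A': "2 * lead_const (real L ^ 3) \<le> A'"
    and A: "lead_const (real L ^ 3) + A' * feed_const (real L ^ 3) \<le> A"
    and const: "\<And>s lh r. 0 < s \<Longrightarrow> s \<le> s0 \<Longrightarrow> flow_near L K s lh r \<Longrightarrow>
       rg_params A A' s lh r (G00 L) \<and> 4 * s * feed_const (real L ^ 3) \<le> 1 \<and>
       flow_near L K (real L * s) (real L * (lh - 36 * flow_gamma L * lh\<^sup>2))
           (real L ^ 2 * (r * (1 - 12 * flow_gamma L * lh) + alpha3 L * lh\<^sup>2))"
    by (rule rg_constants[OF L2]) (rule that)
  define k1 where "k1 = (real L)\<^sup>2 / (9 * (quartic_const L)\<^sup>2 * lam\<^sup>2)"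
  define k2 where "k2 = 5000001 * lam / (3 * quartic_const L * real L)"
  define C1 where "C1 = 100 * (real L ^ 3)\<^sup>2 * moment_bound (real L ^ 3) 4"
  define C2 where "C2 = 100 * (real L ^ 3)\<^sup>2 * small_const (real L ^ 3)"
  define C3 where "C3 = 12 * quartic_const L + 20 * real L ^ 3 * small_const (real L ^ 3)"
  define D where "D = max (C1 * k1) (C2 * k1 + C3 * k2)"
  have lp: "real L ^ n > 0" for n using L2 by simp
  obtain n0 where n0: "lam / s0 < real L ^ n0" using real_arch_pow[of "real L" "lam / s0"] L2 by auto
  have sc: "lam_scaled L lam n \<le> s0" if "n \<ge> n0" for n
  proof -
    have "lam_scaled L lam n0 \<le> s0" using n0 lp[of n0] s0 by (simp add: lam_scaled_def field_simps)
    then show ?thesis using lam_scaled_antimono[OF lam that] by linarith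
  qed
  show thesis
  proof (rule that[of n0 D])
    fix n
    show "expectation (test_fun L (lam_scaled L lam (Suc n)) n) \<le> D / real L ^ n"
    proof -
      have "expectation (test_fun L (lam_scaled L lam (Suc n)) n) \<le> C1 * k1 / real L ^ n"
        using test_fun_GFF[OF lam_scaled_pos[OF lam], of "Suc n" n] unfolding threshold_lam_scaled(1)[OF lam] k1_def C1_def .
      also have "\<dots> \<le> D / real L ^ n" using lp[of n] by (intro divide_right_mono) (auto simp: D_def)
      finally show ?thesis .
    qed
  next
    fix n N assume n: "n \<ge> n0" and N: "Suc n \<le> N"
    define s where "s = lam_scaled L lam (Suc n)"
    have s: "0 < s" "s \<le> s0" using lam_scaled_pos[OF lam] sc[of "Suc n"] n by (auto simp: s_def)
    have "lam_scaled L lam (Suc n) \<le> s0" using s unfolding s_def by simp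
    from rg_induction[OF lam this N A' A K const]
    obtain lh r g u where near: "flow_near L K s lh r"
      and good: "\<And>y. y \<in> Lam L (Suc n) \<Longrightarrow> rg_good (G00 L) lh r A A' s (g y) (u y)" and rep: "represents lam N (Suc n) g"
      unfolding s_def by blast
    define lh' where "lh' = real L * (lh - 36 * flow_gamma L * lh\<^sup>2)"
    define r' where "r' = real L ^ 2 * (r * (1 - 12 * flow_gamma L * lh) + alpha3 L * lh\<^sup>2)"
    have Ls: "real L * s = lam_scaled L lam n" by (simp add: s_def lam_scaled_Suc[of lam n])
    have prm: "rg_params A A' s lh r (G00 L)" and fc: "4 * s * feed_const (real L ^ 3) \<le> 1" and near': "flow_near L K (lam_scaled L lam n) lh' r'"
      using const[OF s near] by (simp_all add: Ls lh'_def r'_def)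
    \<comment> \<open>The field at layer n is estimated with the weights of scale n, so the coupling
      at n, which is L times that at n + 1, has to be admissible too.\<close>
    have prm': "rg_params A A' (lam_scaled L lam n) lh' r' (G00 L)" using const[OF lam_scaled_pos[OF lam] sc[OF n] near'] by blast
    obtain u' where good': "\<And>x. x \<in> Lam L n \<Longrightarrow> rg_good (G00 L) lh' r' A A' (lam_scaled L lam n) (block_map g n x) (u' x)"
      using block_map_good[where g = g and u = u and n = n, OF prm A' A fc good] unfolding Ls lh'_def r'_def by blast
    define W where "W \<omega> = (\<Prod>y\<in>Lam L (Suc n). g y (phi L (Suc n) y \<omega>))" for \<omega>
    define h where "h = test_fun L s n"
    have tilt: "expectation (\<lambda>\<omega>. (1 - h \<omega>) * W \<omega>) \<le> (C2 * k1 / real L ^ n + C3 * k2 / real L ^ n) * expectation W" and EW: "expectation W > 0"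
      using test_fun_tilted[where g = g and n = n and u = u and u' = u', OF prm good prm' good']
      unfolding s_def threshold_lam_scaled[OF lam] k1_def C2_def C3_def k2_def h_def W_def[abs_def] by auto
    have "C2 * k1 / real L ^ n + C3 * k2 / real L ^ n \<le> D / real L ^ n"
      unfolding add_divide_distrib[symmetric] using lp[of n] by (intro divide_right_mono) (auto simp: D_def)
    then have tilt': "expectation (\<lambda>\<omega>. (1 - h \<omega>) * W \<omega>) \<le> D / real L ^ n * expectation W"
      using tilt EW by (meson mult_right_mono order_trans less_imp_le)
    have hb: "0 \<le> h \<omega> \<and> h \<omega> \<le> 1" for \<omega> unfolding h_def by (rule test_fun_bounds)
    have hm: "h \<in> borel_measurable P" unfolding h_def by (rule test_fun_meas)
    \<comment> \<open>The integral of a non-integrable function is 0 by convention, so a positive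
      value implies integrability.\<close>
    have iW: "integrable P W" using EW not_integrable_integral_eq[of P W] by fastforce
    have ihW: "integrable P (\<lambda>\<omega>. h \<omega> * W \<omega>)"
    proof (rule Bochner_Integration.integrable_bound[OF iW])
      show "AE \<omega> in P. norm (h \<omega> * W \<omega>) \<le> norm (W \<omega>)"
        using hb by (intro AE_I2) (auto simp: abs_mult intro!: mult_left_le_one_le)
    qed (use iW hm in auto)
    have "expectation (\<lambda>\<omega>. (1 - h \<omega>) * W \<omega>) = expectation W - expectation (\<lambda>\<omega>. h \<omega> * W \<omega>)"
      unfolding left_diff_distrib using iW ihW by simp
    then have hW: "(1 - D / real L ^ n) * expectation W \<le> expectation (\<lambda>\<omega>. h \<omega> * W \<omega>)"
      using tilt' by (simp add: left_diff_distrib)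
    have Z: "partition_function L lam P N = expectation W"
      using rep[unfolded represents_def, rule_format, of "\<lambda>_. 1"] by (auto simp: partition_function_def W_def[abs_def])
    have hr: "h (restrict \<omega> (layers L (Suc n))) = h \<omega>" for \<omega> unfolding h_def by (rule test_fun_restrict)
    have "expectation (\<lambda>\<omega>. h \<omega> * exp (- interaction L lam N \<omega>)) = expectation (\<lambda>\<omega>. h \<omega> * W \<omega>)"
      using rep[unfolded represents_def, rule_format, of h, unfolded hr] hb test_fun_measurable[of s n]
      unfolding W_def h_def[symmetric] by (metis abs_of_nonneg)
    then have "(\<integral>\<omega>. h \<omega> \<partial>Phi43_cutoff L lam P N) = expectation (\<lambda>\<omega>. h \<omega> * W \<omega>) / expectation W"
      using integral_Phi43_cutoff[OF hm, of lam N] EW by (simp add: Z)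
    then show "1 - D / real L ^ n \<le> (\<integral>\<omega>. test_fun L (lam_scaled L lam (Suc n)) n \<omega> \<partial>Phi43_cutoff L lam P N)"
      using hW EW unfolding h_def[symmetric] s_def[symmetric] by (simp add: le_divide_eq)
  qed
qed

lemma integral_layer_law:
  assumes M: "sets M = sets P"
  shows "(\<integral>\<omega>. test_fun L s n \<omega> \<partial>layer_law L (Suc n) M) = (\<integral>\<omega>. test_fun L s n \<omega> \<partial>M)"
proof -
  have "(\<lambda>\<omega>. restrict \<omega> (layers L (Suc n))) \<in> measurable M (PiM (layers L (Suc n)) (\<lambda>_. borel))"
    using restrict_meas measurable_cong_sets[OF M refl] by blast
  then show ?thesis unfolding layer_law_def by (simp add: integral_distr test_fun_measurable test_fun_restrict)
qed

text \<open>For fixed n the test is a bounded continuous function of finitely many layers, so its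
  mean under the cutoff measures converges to its mean under Q and inherits the bound that is
  uniform in N. The geometric errors are summable in n.\<close>

lemma Phi43_singular:
  assumes lam: "lam > 0" and Q: "is_Phi43 L lam P Q"
  shows "mutually_singular Q P"
proof -
  have Qp: "prob_space Q" and sets: "sets Q = sets P" using Q sets_P by (auto simp: is_Phi43_def Omega_def)
  obtain n0 D where
    GFF: "\<And>n. n \<ge> n0 \<Longrightarrow> expectation (test_fun L (lam_scaled L lam (Suc n)) n) \<le> D / real L ^ n" and
    cut: "\<And>n N. n \<ge> n0 \<Longrightarrow> Suc n \<le> N \<Longrightarrow> 1 - D / real L ^ n \<le> (\<integral>\<omega>. test_fun L (lam_scaled L lam (Suc n)) n \<omega> \<partial>Phi43_cutoff L lam P N)"
    by (rule test_fun_estimates[OF lam]) (rule that)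
  define h where "h n = test_fun L (lam_scaled L lam (Suc (n0 + n))) (n0 + n)" for n
  have lim: "(\<lambda>N. \<integral>\<omega>. test_fun L s n \<omega> \<partial>Phi43_cutoff L lam P N) \<longlonglongrightarrow> (\<integral>\<omega>. test_fun L s n \<omega> \<partial>Q)" for s n
  proof -
    have "bounded (range (test_fun L s n))"
      unfolding bounded_iff using test_fun_bounds by (intro exI[of _ 1]) auto
    then have b: "bounded (test_fun L s n ` (\<Pi>\<^sub>E i\<in>layers L (Suc n). UNIV))" by (rule bounded_subset) auto
    have "(\<lambda>N. \<integral>\<omega>. test_fun L s n \<omega> \<partial>layer_law L (Suc n) (Phi43_cutoff L lam P N)) \<longlonglongrightarrow> (\<integral>\<omega>. test_fun L s n \<omega> \<partial>layer_law L (Suc n) Q)"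
      using Q test_fun_continuous b unfolding is_Phi43_def weak_conv_fin_def by blast
    moreover have "sets (Phi43_cutoff L lam P N) = sets P" for N by (simp add: Phi43_cutoff_def)
    ultimately show ?thesis by (simp add: integral_layer_law sets)
  qed
  show ?thesis
  proof (rule mutually_singular_of_tests[where h = h and e = "\<lambda>n. D / real L ^ (n0 + n)"])
    show "h n \<in> borel_measurable Q" for n
      using test_fun_meas measurable_cong_sets[OF sets refl] unfolding h_def by blast
    show "0 \<le> h n x \<and> h n x \<le> 1" for n x unfolding h_def by (rule test_fun_bounds)
    show "expectation (h n) \<le> D / real L ^ (n0 + n)" for n unfolding h_def by (rule GFF) simp
    show "1 - D / real L ^ (n0 + n) \<le> (\<integral>x. h n x \<partial>Q)" for n
      unfolding h_def by (rule LIMSEQ_le_const[OF lim]) (use cut in \<open>auto intro!: exI[of _ "Suc (n0 + n)"]\<close>)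
    have "summable (\<lambda>n. D / real L ^ n0 * (1 / real L) ^ n)" using L2 by (intro summable_mult summable_geometric) auto
    then show "summable (\<lambda>n. D / real L ^ (n0 + n))" by (simp add: power_add power_divide)
  qed (use Qp sets prob_space_axioms in auto)
qed

end

theorem theorem5p4:
  fixes L :: nat and lam :: real and P_GFF P_Phi43 :: "config measure"
  assumes "L \<ge> 2" and "lam > 0"
    and "is_GFF L P_GFF"
    and "is_Phi43 L lam P_GFF P_Phi43"
  shows "mutually_singular P_Phi43 P_GFF"
proof -
  interpret gff P_GFF L
    using assms(1,3) by (intro gff.intro gff_axioms.intro) (auto simp: is_GFF_def)
  show ?thesis by (rule Phi43_singular[OF assms(2,4)])
qed

end
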